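(* Let $p\ge 2$ be an integer, and let $(F_n)_{n\ge 0}$ and $(V_i)_{i\ge 1}$ be the generating functions of $p$-constellations defined in the context. Then, as formal power series in $t$ (with coefficients formal power series in $x_1,x_2,\ldots$), \[ \sum_{n \geq 0} F_n t^n = \cfrac{1}{1 - t \displaystyle \prod_{i_1=1}^{p-1} \cfrac{V_{i_1}}{ 1 - t \displaystyle \prod_{i_2=1}^{p-1} \cfrac{V_{i_1+i_2}}{ 1 - t \displaystyle \prod_{i_3=1}^{p-1} \cfrac{V_{i_1+i_2+i_3}}{\ddots}}}} \] Equivalently, writing $G(t;W_1,W_2,\ldots)$ for the unique formal power series in $t$ satisfying $G(t;W_1,W_2,\ldots)=1/\bigl(1-t\prod_{i=1}^{p-1}W_i\,G(t;W_{i+1},W_{i+2},\ldots)\bigr)$ for every sequence $(W_i)_{i\ge1}$, one has $\sum_{n\ge0}F_nt^n=G(t;V_1,V_2,\ldots)$.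
   Context: Fix an integer $p\ge 2$. A planar map is a proper embedding of a connected graph in the sphere, considered up to orientation-preserving homeomorphism; degrees of vertices and faces count incident edges with multiplicity. A $p$-constellation is a planar map whose faces are colored black or white so that adjacent faces have opposite colors, every black face has degree $p$, and every white face has degree a multiple of $p$. Each edge is oriented so that its incident white face lies on its right. A constellation is rooted if one edge (the root edge) is distinguished; the white root face is the white face incident to the root edge, and the root degree is its degree. A constellation is pointed if a vertex (the pointed vertex, not necessarily incident to the root edge) is distinguished. Let $(x_k)_{k\ge1}$ be formal variables; each white face of degree $kp$ receives weight $x_k$. For $n\ge1$, $F_n$ is the generating function of rooted $p$-constellations with root degree $np$, where the weight of a constellation is the product of the weights of its white faces other than the white root face; $F_0=1$. In a pointed constellation, a vertex $v$ is of type $j\in\mathbb N$ if $j$ is the minimal length of an oriented path from $v$ to the pointed vertex, and an edge is of type $j\to j'$ if its origin and endpoint have types $j$ and $j'$. For $i\ge1$, $V_i$ is $1$ plus the generating function (weight = product of the weights of all white faces) of pointed rooted $p$-constellations whose root edge is of type $j\to j-1$ for some $j\le i$. *)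

theory Defs
  imports "HOL-Library.Poly_Mapping" "HOL-Computational_Algebra.Formal_Power_Series"
          "HOL-Combinatorics.Permutations"
begin

section \<open>Coefficient ring: formal power series in x_1, x_2, ...\<close>

text \<open>Polynomials in the countably many variables x_1, x_2, ... (monomials are finitely
  supported exponent vectors).\<close>
type_synonym xpoly = "(nat \<Rightarrow>\<^sub>0 nat) \<Rightarrow>\<^sub>0 int"

text \<open>Formal power series in x_1, x_2, ... are represented as sequences of polynomials
  graded by weighted degree, where x_k has weight k: an element is a power series in an
  auxiliary grading variable u whose u^d-coefficient is the weighted-homogeneous part of
  degree d. The variable x_k is thus represented by u^k * x_k. (Each graded piece involves
  only finitely many monomials, so this is the full ring of formal power series.)\<close>
type_synonym xser = "xpoly fps"

definition xmon :: "nat \<Rightarrow> xpoly" where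
  "xmon k = Poly_Mapping.single (Poly_Mapping.single k 1) 1"

section \<open>Combinatorial maps (rotation systems)\<close>

text \<open>Darts are D; sigma rotates darts around vertices, alpha is the edge involution,
  phi = sigma o alpha is the face permutation (the face of a dart lies on its right).\<close>

definition orb :: "('a \<Rightarrow> 'a) \<Rightarrow> 'a \<Rightarrow> 'a set" where
  "orb f x = {(f ^^ k) x | k. True}"

definition is_planar_map :: "nat set \<Rightarrow> (nat \<Rightarrow> nat) \<Rightarrow> (nat \<Rightarrow> nat) \<Rightarrow> bool" where
  "is_planar_map D \<sigma> \<alpha> \<longleftrightarrow>
     finite D \<and> \<sigma> permutes D \<and> \<alpha> permutes D \<and>
     (\<forall>d\<in>D. \<alpha> d \<noteq> d \<and> \<alpha> (\<alpha> d) = d) \<and>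
     (\<forall>d\<in>D. \<forall>e\<in>D. (d, e) \<in> ({(x, \<sigma> x) | x. x \<in> D} \<union> {(x, \<alpha> x) | x. x \<in> D})\<^sup>*) \<and>
     card (orb \<sigma> ` D) + card (orb (\<sigma> \<circ> \<alpha>) ` D) = card D div 2 + 2"

text \<open>p-constellation: white d means the face containing dart d (on its right) is white.
  The white dart of each edge gives its orientation (white face on its right).\<close>
definition is_constellation ::
  "nat \<Rightarrow> nat set \<Rightarrow> (nat \<Rightarrow> nat) \<Rightarrow> (nat \<Rightarrow> nat) \<Rightarrow> (nat \<Rightarrow> bool) \<Rightarrow> bool" where
  "is_constellation p D \<sigma> \<alpha> w \<longleftrightarrow>
     is_planar_map D \<sigma> \<alpha> \<and>
     (\<forall>d. w d \<longrightarrow> d \<in> D) \<and>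
     (\<forall>d\<in>D. w ((\<sigma> \<circ> \<alpha>) d) = w d) \<and>
     (\<forall>d\<in>D. w (\<alpha> d) \<longleftrightarrow> \<not> w d) \<and>
     (\<forall>d\<in>D. \<not> w d \<longrightarrow> card (orb (\<sigma> \<circ> \<alpha>) d) = p) \<and>
     (\<forall>d\<in>D. w d \<longrightarrow> p dvd card (orb (\<sigma> \<circ> \<alpha>) d))"

definition white_faces :: "nat \<Rightarrow> (nat \<Rightarrow> nat) \<Rightarrow> (nat \<Rightarrow> nat) \<Rightarrow> (nat \<Rightarrow> bool) \<Rightarrow> nat set set" where
  "white_faces N \<sigma> \<alpha> w = {orb (\<sigma> \<circ> \<alpha>) d | d. d < N \<and> w d}"

section \<open>Rooted constellations and F_n\<close>

type_synonym rmap = "(nat \<Rightarrow> nat) \<times> (nat \<Rightarrow> nat) \<times> (nat \<Rightarrow> bool) \<times> nat"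

text \<open>Rooted p-constellations on dart set {0..<N} with root degree n*p.\<close>
definition rooted_constellations :: "nat \<Rightarrow> nat \<Rightarrow> nat \<Rightarrow> rmap set" where
  "rooted_constellations p n N = {(\<sigma>, \<alpha>, w, r).
     is_constellation p {0..<N} \<sigma> \<alpha> w \<and> r < N \<and> w r \<and>
     card (orb (\<sigma> \<circ> \<alpha>) r) = n * p}"

text \<open>Isomorphism = relabelling of darts (orientation-preserving homeomorphism).\<close>
definition rmap_iso :: "nat \<Rightarrow> rmap \<Rightarrow> rmap \<Rightarrow> bool" where
  "rmap_iso N s s' \<longleftrightarrow> (case s of (\<sigma>, \<alpha>, w, r) \<Rightarrow> case s' of (\<sigma>', \<alpha>', w', r') \<Rightarrow>
     (\<exists>\<pi>. \<pi> permutes {0..<N} \<and>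
        (\<forall>d<N. \<pi> (\<sigma> d) = \<sigma>' (\<pi> d) \<and> \<pi> (\<alpha> d) = \<alpha>' (\<pi> d) \<and> w' (\<pi> d) = w d) \<and>
        \<pi> r = r'))"

text \<open>x-monomial of a rooted constellation: product of x_{deg/p} over white faces other
  than the root face.\<close>
definition F_weight :: "nat \<Rightarrow> nat \<Rightarrow> rmap \<Rightarrow> xpoly" where
  "F_weight p N s = (case s of (\<sigma>, \<alpha>, w, r) \<Rightarrow>
     (\<Prod>f \<in> white_faces N \<sigma> \<alpha> w - {orb (\<sigma> \<circ> \<alpha>) r}. xmon (card f div p)))"

definition F_classes :: "nat \<Rightarrow> nat \<Rightarrow> nat \<Rightarrow> rmap set set" where
  "F_classes p n N = rooted_constellations p n N //
     ({(s, s'). rmap_iso N s s'} \<inter> rooted_constellations p n N \<times> rooted_constellations p n N)"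

text \<open>F_n for n \<ge> 1. The weighted degree of the x-monomial of a constellation with root
  degree np and N darts is N/(2p) - n, so the degree-d part collects N = 2p(n+d).\<close>
definition F_gf :: "nat \<Rightarrow> nat \<Rightarrow> xser" where
  "F_gf p n = (if n = 0 then 1 else
     Abs_fps (\<lambda>d. \<Sum>c \<in> F_classes p n (2 * p * (n + d)). the_elem (F_weight p (2 * p * (n + d)) ` c)))"

section \<open>Pointed rooted constellations and V_i\<close>

type_synonym pmap = "rmap \<times> nat set"

definition pointed_constellations :: "nat \<Rightarrow> nat \<Rightarrow> pmap set" where
  "pointed_constellations p N = {((\<sigma>, \<alpha>, w, r), P).
     is_constellation p {0..<N} \<sigma> \<alpha> w \<and> r < N \<and> w r \<and> P \<in> orb \<sigma> ` {0..<N}}"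

text \<open>Oriented edges between vertices (vertices = sigma-orbits): the white dart d goes from
  the vertex of d to the vertex of alpha d.\<close>
definition oriented_edges :: "nat \<Rightarrow> (nat \<Rightarrow> nat) \<Rightarrow> (nat \<Rightarrow> nat) \<Rightarrow> (nat \<Rightarrow> bool) \<Rightarrow> (nat set \<times> nat set) set" where
  "oriented_edges N \<sigma> \<alpha> w = {(orb \<sigma> d, orb \<sigma> (\<alpha> d)) | d. d < N \<and> w d}"

text \<open>Type of a vertex v: minimal length of an oriented path from v to the pointed vertex P.\<close>
definition vtype :: "nat \<Rightarrow> (nat \<Rightarrow> nat) \<Rightarrow> (nat \<Rightarrow> nat) \<Rightarrow> (nat \<Rightarrow> bool) \<Rightarrow> nat set \<Rightarrow> nat set \<Rightarrow> nat" where
  "vtype N \<sigma> \<alpha> w P v = (LEAST k. (v, P) \<in> oriented_edges N \<sigma> \<alpha> w ^^ k)"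

definition pmap_iso :: "nat \<Rightarrow> pmap \<Rightarrow> pmap \<Rightarrow> bool" where
  "pmap_iso N s s' \<longleftrightarrow> (case s of ((\<sigma>, \<alpha>, w, r), P) \<Rightarrow> case s' of ((\<sigma>', \<alpha>', w', r'), P') \<Rightarrow>
     (\<exists>\<pi>. \<pi> permutes {0..<N} \<and>
        (\<forall>d<N. \<pi> (\<sigma> d) = \<sigma>' (\<pi> d) \<and> \<pi> (\<alpha> d) = \<alpha>' (\<pi> d) \<and> w' (\<pi> d) = w d) \<and>
        \<pi> r = r' \<and> \<pi> ` P = P'))"

text \<open>Pointed rooted constellations whose root edge is of type j -> j-1 for some j \<le> i.\<close>
definition V_structs :: "nat \<Rightarrow> nat \<Rightarrow> nat \<Rightarrow> pmap set" where
  "V_structs p i N = {((\<sigma>, \<alpha>, w, r), P) \<in> pointed_constellations p N.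
     \<exists>j. 1 \<le> j \<and> j \<le> i \<and> vtype N \<sigma> \<alpha> w P (orb \<sigma> r) = j \<and>
         vtype N \<sigma> \<alpha> w P (orb \<sigma> (\<alpha> r)) = j - 1}"

definition V_weight :: "nat \<Rightarrow> nat \<Rightarrow> pmap \<Rightarrow> xpoly" where
  "V_weight p N s = (case s of ((\<sigma>, \<alpha>, w, r), P) \<Rightarrow>
     (\<Prod>f \<in> white_faces N \<sigma> \<alpha> w. xmon (card f div p)))"

definition V_classes :: "nat \<Rightarrow> nat \<Rightarrow> nat \<Rightarrow> pmap set set" where
  "V_classes p i N = V_structs p i N //
     ({(s, s'). pmap_iso N s s'} \<inter> V_structs p i N \<times> V_structs p i N)"

text \<open>V_i: 1 plus the generating function; a constellation with N darts has x-monomial of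
  weighted degree N/(2p).\<close>
definition V_gf :: "nat \<Rightarrow> nat \<Rightarrow> xser" where
  "V_gf p i = Abs_fps (\<lambda>d. (if d = 0 then 1 else 0) +
     (\<Sum>c \<in> V_classes p i (2 * p * d). the_elem (V_weight p (2 * p * d) ` c)))"

section \<open>The continued fraction G\<close>

text \<open>G(t; W_1, W_2, ...) = 1 / (1 - t * prod_{i=1}^{p-1} W_i G(t; W_{i+1}, W_{i+2}, ...)),
  for all sequences W (indexed from 1); the unique such function.\<close>
definition cfG :: "nat \<Rightarrow> (nat \<Rightarrow> 'a::comm_ring_1) \<Rightarrow> 'a fps" where
  "cfG p = (THE G. \<forall>W. G W * (1 - fps_X * (\<Prod>i = 1..p - 1. fps_const (W i) * G (\<lambda>j. W (i + j)))) = 1)"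

end

theory Submission
  imports Defs "HOL-Combinatorics.Multiset_Permutations"
begin

text \<open>
  Label each edge of a pointed constellation by the type of its origin. Around the white root face the
  labels form a cyclic word with steps \<open>-1\<close> and \<open>+(p - 1)\<close>, and if the pointed vertex is the origin of
  the root, the word is an excursion. The continued fraction is the generating function of such
  excursions with weight \<open>V\<^sub>j\<close> for each down-step starting at height \<open>j\<close>, so it suffices that the maps with a given
  word have this product as generating function.

  Consider the last up-step, which is followed by down-steps only. The first \<open>p - 1\<close> of these down-edges
  compete with the edges of the black face incident to the up-step. If one of them is not the next edge
  of that black face, then the leftmost geodesics starting at the two edges enclose a region up to the
  point where they merge. Swapping the black sides of the two geodesics level by level separates this
  region, because a connected result would have negative genus by Euler's formula; the region closes up
  to a pointed constellation whose root edge is of type \<open>j' \<rightarrow> j' - 1\<close> with \<open>j' \<le> j\<close>, and the same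
  swap glues it back. Hence a factor \<open>V\<^sub>j\<close>. Afterwards the black face touches the rest of the map along the root face
  only; deleting it removes the up-step and \<open>p - 1\<close> down-steps, and induction applies.

  All counting is done for maps with labelled edges, where sums over decompositions of the edge set
  are products of series and where rooted maps have trivial automorphism groups.
\<close>

section \<open>Orbits and the genus inequality\<close>

text \<open>A region has to be cut out of a map that consists of permutations only, so a count takes
  the place of a Jordan curve argument. The swap leaves \<open>fw\<close> alone and conjugates
  \<open>fb\<close>, hence both numbers of faces are kept. At a level strictly between the ends of
  the two geodesics it merges two vertices and splits the result again; at the top and at the bottom
  it splits the one vertex at which the geodesics meet. So there are two vertices more, too many for
  one component and just enough for two components of genus zero. If the geodesics start at level
  \<open>j\<close> and meet at level \<open>m\<close>, the region has root label
  \<open>j - m\<close>, and \<open>m\<close> ranges from \<open>0\<close> to \<open>j - 1\<close>: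
  this is why all types up to \<open>j\<close> are counted. The summand \<open>1\<close> of the
  factor is the case without a cut. The last up-step is taken because everything after it descends,
  so that a cut at one level cannot destroy the coincidences of root face and black face found at
  higher levels. That labels change by \<open>-1\<close> or \<open>p - 1\<close> only comes from a
  potential modulo \<open>p\<close>, obtained from the same genus inequality on a cyclic
  cover.\<close>

inductive_set reach :: "('a \<Rightarrow> 'a) set \<Rightarrow> 'a \<Rightarrow> 'a set" for F x where
  reach_refl [intro, simp]: "x \<in> reach F x"
| reach_step: "y \<in> reach F x \<Longrightarrow> f \<in> F \<Longrightarrow> f y \<in> reach F x"

definition bijs :: "('a \<Rightarrow> 'a) set \<Rightarrow> 'a set \<Rightarrow> bool" where
  "bijs F E \<longleftrightarrow> finite E \<and> (\<forall>f\<in>F. bij_betw f E E)"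

text \<open>For one permutation these are its cycles, for \<open>fw\<close> and \<open>fb\<close>
  together the components of a map; one notion serves for all terms of Euler's formula.\<close>

definition ncomp :: "('a \<Rightarrow> 'a) set \<Rightarrow> 'a set \<Rightarrow> nat" where
  "ncomp F E = card (reach F ` E)"

abbreviation cyc :: "('a \<Rightarrow> 'a) \<Rightarrow> 'a set \<Rightarrow> nat" where
  "cyc f E \<equiv> ncomp {f} E"

lemma orb_eq_reach: "orb f x = reach {f} x"
proof
  have "(f ^^ k) x \<in> reach {f} x" for k
    by (induction k) (auto intro: reach_step)
  then show "orb f x \<subseteq> reach {f} x" by (auto simp: orb_def)
next
  have "y \<in> orb f x" if "y \<in> reach {f} x" for y
    using that
  proof induction
    case reach_refl
    show ?case unfolding orb_def by (auto intro: exI[of _ 0])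
  next
    case (reach_step y g)
    then show ?case unfolding orb_def by (auto intro: exI[of _ "Suc _"])
  qed
  then show "reach {f} x \<subseteq> orb f x" by auto
qed

lemma reach_power: "f \<in> F \<Longrightarrow> (f ^^ k) x \<in> reach F x"
  by (induction k) (auto intro: reach_step)

lemma reach_single: "reach {f} x = {(f ^^ k) x | k. True}"
  using orb_eq_reach[of f x] by (simp add: orb_def)

lemma reach_powerE: assumes "y \<in> reach {f} x" obtains k where "y = (f ^^ k) x"
  using assms by (auto simp: reach_single)

lemma reach_least:
  assumes "x \<in> Z" "\<And>z f. z \<in> Z \<Longrightarrow> f \<in> F \<Longrightarrow> f z \<in> Z"
  shows "reach F x \<subseteq> Z"
proof
  fix y assume "y \<in> reach F x" then show "y \<in> Z" by induction (use assms in auto)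
qed

lemma reach_trans: "y \<in> reach F x \<Longrightarrow> z \<in> reach F y \<Longrightarrow> z \<in> reach F x"
  using reach_least[of y "reach F x" F] by (blast intro: reach_step)

lemma bijsD: "bijs F E \<Longrightarrow> f \<in> F \<Longrightarrow> x \<in> E \<Longrightarrow> f x \<in> E"
  by (auto simp: bijs_def bij_betw_def)

lemma reach_sub: "bijs F E \<Longrightarrow> x \<in> E \<Longrightarrow> reach F x \<subseteq> E"
  by (rule reach_least) (auto dest: bijsD)

text \<open>By finiteness \<open>f\<close> permutes \<open>Z\<close>, so every value in
  \<open>Z\<close> is already attained inside \<open>Z\<close>. This makes \<open>reach\<close>,
  which is defined by forward steps, symmetric.\<close>

lemma closed_back:
  assumes "finite E" "inj_on f E" "Z \<subseteq> E" "f ` Z \<subseteq> Z" "x \<in> E" "f x \<in> Z"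
  shows "x \<in> Z"
proof -
  have "finite Z" using assms finite_subset by blast
  then have "f ` Z = Z" using assms by (meson endo_inj_surj inj_on_subset)
  then obtain z where "z \<in> Z" "f z = f x" using assms(6) by (metis imageE)
  then show ?thesis using assms by (metis inj_onD subsetD)
qed

lemma reach_back:
  assumes "bijs F E" "f \<in> F" "x \<in> E" "y \<in> E" "f y \<in> reach F x"
  shows "y \<in> reach F x"
  by (rule closed_back[of E f]) (use assms reach_sub[of F E x] in \<open>auto simp: bijs_def bij_betw_def intro: reach_step\<close>)

lemma reach_sym:
  assumes "bijs F E" "x \<in> E" "y \<in> reach F x"
  shows "x \<in> reach F y"
  using assms(3)
proof induction
  case (reach_step y f)
  have yE: "y \<in> E" using reach_sub[OF assms(1,2)] reach_step by blast
  then have "f y \<in> E" using assms(1) reach_step bijsD by metis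
  then have "y \<in> reach F (f y)" using reach_back[OF assms(1) \<open>f \<in> F\<close> _ yE, of "f y"] by auto
  then show ?case using reach_step reach_trans by metis
qed auto

lemma reach_eq:
  assumes "bijs F E" "x \<in> E" "y \<in> reach F x"
  shows "reach F y = reach F x"
  using reach_sym[OF assms] assms(3) by (blast intro: reach_trans)

lemma reach_disj:
  assumes "bijs F E" "x \<in> E" "y \<in> E" "reach F x \<noteq> reach F y"
  shows "reach F x \<inter> reach F y = {}"
proof (rule ccontr)
  assume "reach F x \<inter> reach F y \<noteq> {}"
  then obtain z where "z \<in> reach F x" "z \<in> reach F y" by blast
  then show False using reach_eq[OF assms(1,2), of z] reach_eq[OF assms(1,3), of z] assms(4) by simp
qed

lemma reach_le:
  assumes "bijs F E" "x \<in> E" "\<And>y g. y \<in> E \<Longrightarrow> g \<in> G \<Longrightarrow> g y \<in> reach F y"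
  shows "reach G x \<subseteq> reach F x"
proof (rule reach_least)
  fix z f assume "z \<in> reach F x" "f \<in> G"
  then show "f z \<in> reach F x" using assms reach_sub[OF assms(1,2)] by (metis reach_trans subsetD)
qed auto

lemma reach_congF:
  assumes "x \<in> Z" "\<And>z. z \<in> Z \<Longrightarrow> f z \<in> Z \<and> f z = f' z \<and> g z \<in> Z \<and> g z = g' z"
  shows "reach {f,g} x = reach {f',g'} x"
proof -
  have "y \<in> reach {f',g'} x \<and> y \<in> Z" if "y \<in> reach {f,g} x" for y
    using that
  proof induction
    case (reach_step y h)
    then have "h y \<in> Z" using assms(2) by auto
    moreover have "h y = f' y \<or> h y = g' y" using assms(2) reach_step by auto
    ultimately show ?case using reach_step(3) reach.reach_step by fastforce
  qed (use assms in auto)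
  moreover have "y \<in> reach {f,g} x \<and> y \<in> Z" if "y \<in> reach {f',g'} x" for y
    using that
  proof induction
    case (reach_step y h)
    then have "h y \<in> Z" using assms(2) by (metis insert_iff singletonD)
    moreover have "h y = f y \<or> h y = g y" using assms(2) reach_step by (metis insert_iff singletonD)
    ultimately show ?case using reach_step(3) reach.reach_step by fastforce
  qed (use assms in auto)
  ultimately show ?thesis by blast
qed

lemma reach_cong1:
  assumes "x \<in> Z" "\<And>z. z \<in> Z \<Longrightarrow> f z \<in> Z \<and> f z = g z"
  shows "reach {f} x = reach {g} x"
proof -
  have "reach {f, f} x = reach {g, g} x"
    by (rule reach_congF[OF assms(1)]) (use assms(2) in blast)
  then show ?thesis by simp
qed

section \<open>Effect of a transposition on orbits and cycles\<close>

lemma ncomp_merge: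
  assumes F: "bijs F E" and G: "bijs (insert T F) E" and x: "x \<in> E" and y: "y \<in> E" and yx: "y \<notin> reach F x"
    and T: "T x = y" "T y = x" "\<And>z. z \<in> E \<Longrightarrow> z \<noteq> x \<Longrightarrow> z \<noteq> y \<Longrightarrow> T z = z"
  shows "ncomp (insert T F) E + 1 = ncomp F E"
proof -
  let ?X = "reach F x" and ?Y = "reach F y" and ?G = "insert T F"
  have XE: "?X \<subseteq> E" "?Y \<subseteq> E" using reach_sub[OF F] x y by auto
  have disj: "?X \<inter> ?Y = {}" using reach_disj[OF F x y] yx by auto
  have FG: "reach F z \<subseteq> reach ?G z" if "z \<in> E" for z
    by (rule reach_le[OF G that]) (auto intro: reach_step)
  have 1: "reach ?G x \<subseteq> ?X \<union> ?Y"
  proof (rule reach_least)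
    fix z f assume z: "z \<in> ?X \<union> ?Y" and f: "f \<in> ?G"
    show "f z \<in> ?X \<union> ?Y"
    proof (cases "f = T")
      case True
      then show ?thesis using z T XE by (cases "z = x"; cases "z = y") auto
    next
      case False then show ?thesis using z f by (auto intro: reach_step)
    qed
  qed auto
  have yG: "y \<in> reach ?G x" using reach_step[of x ?G x T] T by auto
  then have 2: "?X \<union> ?Y \<subseteq> reach ?G x"
    using FG[OF x] FG[OF y] reach_trans[OF yG] by auto
  have 3: "reach ?G z = ?X \<union> ?Y" if "z \<in> ?X \<union> ?Y" for z
    using reach_eq[OF G x, of z] that 1 2 by blast
  \<comment> \<open>An orbit that avoids \<open>x\<close> and \<open>y\<close> contains no point
    moved by \<open>T\<close>, so adding \<open>T\<close> leaves it alone.\<close>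
  have 4: "reach ?G z = reach F z" if "z \<in> E" "z \<notin> ?X \<union> ?Y" for z
  proof
    have n: "w \<notin> ?X \<union> ?Y" if "w \<in> reach F z" for w
    proof
      assume "w \<in> ?X \<union> ?Y"
      then have "z \<in> ?X \<union> ?Y" using reach_sym[OF F \<open>z \<in> E\<close> that] by (metis UnE UnI1 UnI2 reach_trans)
      then show False using \<open>z \<notin> ?X \<union> ?Y\<close> by blast
    qed
    show "reach ?G z \<subseteq> reach F z"
    proof (rule reach_least)
      fix w f assume w: "w \<in> reach F z" and f: "f \<in> ?G"
      then have "w \<in> E" using reach_sub[OF F that(1)] by auto
      show "f w \<in> reach F z"
      proof (cases "f = T")
        case True
        then have "f w = w" using T(3)[OF \<open>w \<in> E\<close>] n[OF w] by auto
        then show ?thesis using w by simp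
      next
        case False then show ?thesis using w f by (auto intro: reach_step)
      qed
    qed auto
  qed (use FG that in auto)
  let ?R = "reach F ` (E - ?X - ?Y)"
  have E: "E = (?X \<union> ?Y) \<union> (E - ?X - ?Y)" using XE by blast
  have finE: "finite E" using F by (simp add: bijs_def)
  have i1: "reach ?G ` (?X \<union> ?Y) = {?X \<union> ?Y}" using 3 by auto
  have i2: "reach ?G ` (E - ?X - ?Y) = ?R" using 4 by (intro image_cong) auto
  have i3: "reach F ` (?X \<union> ?Y) = {?X, ?Y}"
  proof -
    have "reach F ` reach F z = {reach F z}" if "z \<in> E" for z
      using image_cong[OF refl reach_eq[OF F that], of "reach F z" "\<lambda>w. w"] image_constant[OF reach_refl[of z F], of "reach F z"] by simp
    then show ?thesis using x y by (simp add: image_Un insert_commute)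
  qed
  have "reach ?G ` E = {?X \<union> ?Y} \<union> ?R" by (subst E, subst image_Un) (simp only: i1 i2)
  moreover have "reach F ` E = {?X, ?Y} \<union> ?R" by (subst E, subst image_Un) (simp only: i3)
  moreover have R: "z \<in> E \<Longrightarrow> x \<notin> reach F z \<or> z \<in> ?X" "z \<in> E \<Longrightarrow> y \<notin> reach F z \<or> z \<in> ?Y" for z
    using reach_sym[OF F] by blast+
  moreover have "?X \<union> ?Y \<notin> ?R" "?X \<notin> ?R" "?Y \<notin> ?R" using R by auto
  moreover have "?X \<noteq> ?Y" using yx by auto
  moreover have "finite ?R" using finE by auto
  ultimately show ?thesis unfolding ncomp_def by simp
qed

lemma bij_comp_transpose:
  assumes "bij_betw f E E" "x \<in> E" "y \<in> E"
  shows "bij_betw (\<lambda>z. f (transpose x y z)) E E"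
proof -
  have "bij_betw (transpose x y) E E" by (rule permutes_imp_bij[OF permutes_swap_id[OF assms(2,3)]])
  then show ?thesis using assms(1) bij_betw_trans[of "transpose x y" E E f E] by (simp add: o_def)
qed

lemma transpose_bij_on: "x \<in> E \<Longrightarrow> y \<in> E \<Longrightarrow> bij_betw (transpose x y) E E"
  by (rule permutes_imp_bij[OF permutes_swap_id])

text \<open>From \<open>x\<close> the map \<open>g\<close> jumps into the \<open>f\<close>-cycle of
  \<open>y\<close>, runs through it and leaves it at \<open>y\<close>. Hence the cycles of
  \<open>g\<close> are the orbits of \<open>f\<close> together with the transposition, and
  \<open>ncomp_merge\<close> counts them.\<close>

lemma cyc_transpose_merge:
  assumes fin: "finite E" and f: "bij_betw f E E" and x: "x \<in> E" and y: "y \<in> E"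
    and yx: "y \<notin> reach {f} x"
    and g: "\<And>z. z \<in> E \<Longrightarrow> g z = f (transpose x y z)"
  shows "y \<in> reach {g} x" "cyc g E + 1 = cyc f E"
    "\<And>z. z \<in> E \<Longrightarrow> reach {f} z \<subseteq> reach {g} z"
proof -
  let ?T = "transpose x y"
  have F: "bijs {f} E" using fin f by (simp add: bijs_def)
  have "bij_betw g E E" using bij_comp_transpose[OF f x y] bij_betw_cong[of E g "\<lambda>z. f (transpose x y z)" E] g by simp
  then have G: "bijs {g} E" using fin by (simp add: bijs_def)
  have TF: "bijs {?T, f} E" using F transpose_bij_on[OF x y] by (simp add: bijs_def)
  have "f y \<in> E" using F y bijsD by fastforce
  have "y \<in> reach {f} (f y)" using reach_sym[OF F y] reach_step[of y "{f}" y f] by auto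
  then obtain k where k: "(f ^^ k) (f y) = y" by (metis reach_powerE)
  then have "(f ^^ Suc k) y = y" by (simp add: funpow_swap1)
  then obtain n where n: "(f ^^ Suc n) y = y" "\<And>i. i < n \<Longrightarrow> (f ^^ Suc i) y \<noteq> y"
    using exists_least_iff[of "\<lambda>k. (f ^^ Suc k) y = y"] by blast
  have fi: "(f ^^ i) y \<in> E" for i using reach_power[of f "{f}" i y] reach_sub[OF F y] by auto
  have nx: "(f ^^ i) y \<noteq> x" for i
  proof
    assume "(f ^^ i) y = x"
    then have "x \<in> reach {f} y" using reach_power[of f "{f}" i y] by auto
    then show False using reach_sym[OF F y] yx by blast
  qed
  \<comment> \<open>\<open>g x = f y\<close>, and before the return to \<open>y\<close> this cycle
    contains neither \<open>x\<close> nor \<open>y\<close>, so \<open>g\<close> acts there as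
    \<open>f\<close>.\<close>
  have "(g ^^ Suc i) x = (f ^^ Suc i) y" if "i \<le> n" for i
    using that
  proof (induction i)
    case 0
    then show ?case using g x by simp
  next
    case (Suc i)
    have "(g ^^ Suc (Suc i)) x = g ((f ^^ Suc i) y)" using Suc by simp
    also have "\<dots> = f ((f ^^ Suc i) y)"
      using g[OF fi] nx[of "Suc i"] n(2)[of i] Suc by (metis Suc_le_lessD transpose_apply_other)
    finally show ?case by simp
  qed
  then have "(g ^^ Suc n) x = y" using n by simp
  then show 1: "y \<in> reach {g} x" using reach_power[of g "{g}" "Suc n" x] by auto
  have Tg: "?T z \<in> reach {g} z" if "z \<in> E" for z
    using 1 reach_sym[OF G x 1] by (auto simp: transpose_def)
  have fg: "f z \<in> reach {g} z" if "z \<in> E" for z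
  proof -
    have Tz: "?T z \<in> E" using that x y by (auto simp: transpose_def)
    have "f z = g (?T z)" using g[OF Tz] by simp
    then show ?thesis using Tg[OF that] reach_step by (metis singletonI)
  qed
  have "reach {?T, f} z \<subseteq> reach {g} z" if "z \<in> E" for z
    by (rule reach_le[OF G that]) (use Tg fg in auto)
  moreover have "reach {g} z \<subseteq> reach {?T, f} z" if "z \<in> E" for z
    by (rule reach_le[OF TF that]) (use g reach_step[of _ "{?T, f}"] in auto)
  ultimately have "reach {g} z = reach {?T, f} z" if "z \<in> E" for z using that by blast
  then have "cyc g E = ncomp {?T, f} E" unfolding ncomp_def by (simp cong: image_cong)
  then show "cyc g E + 1 = cyc f E"
    using ncomp_merge[OF F TF x y yx] by (simp add: transpose_def)
  show "reach {f} z \<subseteq> reach {g} z" if "z \<in> E" for z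
    by (rule reach_le[OF G that]) (use fg in auto)
qed

text \<open>The arc from \<open>f x\<close> to \<open>y\<close> is closed under \<open>g\<close>,
  because \<open>g y = f x\<close>, and it does not contain \<open>x\<close>. Once the two points
  are separated, \<open>f\<close> arises from \<open>g\<close> by the same transposition, so
  \<open>cyc_transpose_merge\<close> applies with the roles exchanged.\<close>

lemma cyc_transpose_split:
  assumes fin: "finite E" and f: "bij_betw f E E" and x: "x \<in> E" and y: "y \<in> E"
    and xy: "x \<noteq> y" and yx: "y \<in> reach {f} x"
    and g: "\<And>z. z \<in> E \<Longrightarrow> g z = f (transpose x y z)"
  shows "y \<notin> reach {g} x" "cyc g E = cyc f E + 1"
    "\<And>z. z \<in> E \<Longrightarrow> reach {g} z \<subseteq> reach {f} z"
proof -
  let ?T = "transpose x y"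
  have F: "bijs {f} E" using fin f by (simp add: bijs_def)
  have bg: "bij_betw g E E" using bij_comp_transpose[OF f x y] bij_betw_cong[of E g "\<lambda>z. f (transpose x y z)" E] g by simp
  then have G: "bijs {g} E" using fin by (simp add: bijs_def)
  obtain k where k: "(f ^^ k) x = y" "\<And>i. i < k \<Longrightarrow> (f ^^ i) x \<noteq> y"
    using reach_powerE[OF yx] exists_least_iff[of "\<lambda>k. (f ^^ k) x = y"] by metis
  have k0: "k > 0" using k xy by (cases k) auto
  have nx: "(f ^^ i) x \<noteq> x" if "0 < i" "i < k" for i
  proof
    assume "(f ^^ i) x = x"
    then have "(f ^^ (k - i)) x = (f ^^ (k - i)) ((f ^^ i) x)" by simp
    also have "\<dots> = (f ^^ k) x" using that by (simp add: funpow_add[symmetric, THEN fun_cong, unfolded o_def])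
    finally show False using k that by simp
  qed
  have fi: "(f ^^ i) x \<in> E" for i using reach_power[of f "{f}" i x] reach_sub[OF F x] by auto
  let ?Z = "{(f ^^ i) x | i. 1 \<le> i \<and> i \<le> k}"
  have "reach {g} y \<subseteq> ?Z"
  proof (rule reach_least)
    show "y \<in> ?Z" using k k0 by force
  next
    fix z h assume "z \<in> ?Z" "h \<in> {g}"
    then obtain i where i: "z = (f ^^ i) x" "1 \<le> i" "i \<le> k" "h = g" by auto
    show "h z \<in> ?Z"
    proof (cases "i = k")
      case True
      then have "g z = (f ^^ 1) x" using g[OF fi, of i] i k by simp
      then show ?thesis using k0 i by force
    next
      case False
      then have "g z = (f ^^ Suc i) x" using g[OF fi, of i] i k(2)[of i] nx[of i] by simp
      then show ?thesis using i False by (metis (mono_tags, lifting) le_SucI le_neq_implies_less less_eq_Suc_le mem_Collect_eq)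
    qed
  qed
  moreover have "x \<notin> ?Z"
  proof
    assume "x \<in> ?Z"
    then obtain i where i: "x = (f ^^ i) x" "1 \<le> i" "i \<le> k" by blast
    then show False using nx[of i] k(1) xy by (cases "i = k") auto
  qed
  ultimately have "x \<notin> reach {g} y" by (rule contra_subsetD)
  then show 1: "y \<notin> reach {g} x" using reach_sym[OF G x, of y] by auto
  have fT: "\<And>z. z \<in> E \<Longrightarrow> f z = g (?T z)"
    using g x y by (auto simp: transpose_def)
  show "cyc g E = cyc f E + 1" "\<And>z. z \<in> E \<Longrightarrow> reach {g} z \<subseteq> reach {f} z"
    using cyc_transpose_merge(2,3)[OF fin bg x y 1 fT] by auto
qed

lemma cyc_cong:
  assumes "bij_betw f E E" "\<And>z. z \<in> E \<Longrightarrow> f z = g z"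
  shows "cyc f E = cyc g E"
  unfolding ncomp_def using assms
  by (intro arg_cong[where f=card] image_cong reach_cong1[where Z=E]) (auto simp: bij_betw_def)

lemma reach_inverse:
  assumes "finite E" "bij_betw f E E" "bij_betw g E E" "\<And>z. z \<in> E \<Longrightarrow> f (g z) = z" "x \<in> E"
  shows "reach {f} x = reach {g} x"
proof
  have F: "bijs {f} E" "bijs {g} E" using assms by (auto simp: bijs_def)
  show "reach {g} x \<subseteq> reach {f} x"
  proof (rule reach_le[OF F(1) assms(5)])
    fix y h assume "y \<in> E" "h \<in> {g}"
    then show "h y \<in> reach {f} y" using reach_back[OF F(1), of f y "g y"] assms bijsD[OF F(2)] by auto
  qed
  show "reach {f} x \<subseteq> reach {g} x"
  proof (rule reach_le[OF F(2) assms(5)])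
    fix y h assume y: "y \<in> E" "h \<in> {f}"
    then obtain z where z: "z \<in> E" "g z = y" using assms by (metis bij_betw_def imageE)
    then show "h y \<in> reach {g} y" using y assms reach_sym[OF F(2) z(1), of y] reach_step[of z "{g}" z g] by auto
  qed
qed

lemma cyc_inverse:
  assumes "finite E" "bij_betw f E E" "bij_betw g E E" "\<And>z. z \<in> E \<Longrightarrow> f (g z) = z"
  shows "cyc f E = cyc g E"
  unfolding ncomp_def using reach_inverse[OF assms] by (simp cong: image_cong)

text \<open>The transposition stays inside the orbits of \<open>g\<close>, and \<open>g\<close> is a
  composite of the two new maps, so both families have the same orbits. The transposition is thereby
  isolated, and its effect on components is known from \<open>ncomp_merge\<close>.\<close>

lemma reach_swap_split:
  assumes fin: "finite E" and "bij_betw f E E" "bij_betw g E E" "x \<in> E" "y \<in> E" "y \<in> reach {g} x"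
    and z: "z \<in> E"
  shows "reach {f, g} z = reach (insert (transpose x y) {f, \<lambda>z. g (transpose x y z)}) z"
proof
  let ?T = "transpose x y" and ?g = "\<lambda>z. g (transpose x y z)"
  have b: "bij_betw ?T E E" using transpose_bij_on assms by metis
  have G: "bijs {g} E" using assms by (auto simp: bijs_def)
  have FG: "bijs {f,g} E" using assms by (auto simp: bijs_def)
  have TF: "bijs (insert ?T {f,?g}) E" using assms bij_comp_transpose[OF assms(3-5)] b by (auto simp: bijs_def)
  show "reach {f, g} z \<subseteq> reach (insert ?T {f,?g}) z"
  proof (rule reach_le[OF TF z])
    fix w h assume w: "w \<in> E" "h \<in> {f,g}"
    show "h w \<in> reach (insert ?T {f,?g}) w"
    proof (cases "h = f")
      case True then show ?thesis by (auto intro: reach_step)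
    next
      case False
      have "?T w \<in> reach (insert ?T {f,?g}) w" by (auto intro: reach_step)
      from reach_step[OF this, of ?g] show ?thesis using False w by auto
    qed
  qed
  have sg: "reach {g} w \<subseteq> reach {f,g} w" if "w \<in> E" for w
    by (rule reach_le[OF FG that]) (auto intro: reach_step)
  have Tw: "?T w \<in> reach {f,g} w" if "w \<in> E" for w
    using sg assms(4,5,6) reach_sym[OF G assms(4,6)] by (auto simp: transpose_def)
  show "reach (insert ?T {f,?g}) z \<subseteq> reach {f, g} z"
  proof (rule reach_le[OF FG z])
    fix w h assume w: "w \<in> E" "h \<in> insert ?T {f,?g}"
    have "g (?T w) \<in> reach {f,g} w" using reach_step[OF Tw[OF w(1)], of g] by auto
    then show "h w \<in> reach {f,g} w" using w Tw by (auto intro: reach_step)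
  qed
qed

text \<open>The genus of a triple of permutations is nonnegative. Induction on the number of points
  moved by \<open>g\<close>: splitting off a fixed point of \<open>g\<close> by a transposition changes the number of
  cycles of \<open>h\<close> by one, and if it disconnects the action then it splits a cycle of \<open>h\<close>.\<close>

lemma genus_nonneg:
  assumes "finite E" "bij_betw f E E" "bij_betw g E E" "bij_betw h E E" "\<And>z. z \<in> E \<Longrightarrow> f (h z) = g z"
  shows "cyc f E + cyc g E + cyc h E \<le> card E + 2 * ncomp {f, g} E"
  using assms
proof (induction "card {x \<in> E. g x \<noteq> x}" arbitrary: g h rule: less_induct)
  case less
  note fin = less.prems(1) and f = less.prems(2) and g = less.prems(3) and h = less.prems(4) and fh = less.prems(5)
  show ?case
  proof (cases "\<forall>x\<in>E. g x = x")
    \<comment> \<open>With \<open>g\<close> the identity, \<open>h\<close> is the inverse of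
      \<open>f\<close>, and the components are the cycles of \<open>f\<close>.\<close>
    case True
    have "reach {f,g} x = reach {f} x" if "x \<in> E" for x
    proof
      show "reach {f,g} x \<subseteq> reach {f} x"
        by (rule reach_le[of _ E]) (use that fin f True in \<open>auto simp: bijs_def intro: reach_step\<close>)
      show "reach {f} x \<subseteq> reach {f,g} x"
        by (rule reach_le[of _ E]) (use that fin f g in \<open>auto simp: bijs_def intro: reach_step\<close>)
    qed
    then have "ncomp {f,g} E = cyc f E" unfolding ncomp_def by (simp cong: image_cong)
    moreover have "cyc f E = cyc h E" by (rule cyc_inverse[OF fin f h]) (use fh True in auto)
    moreover have "cyc g E \<le> card E" unfolding ncomp_def by (rule card_image_le[OF fin])
    ultimately show ?thesis by simp
  next
    case False
    then obtain y where y: "y \<in> E" "g y \<noteq> y" by blast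
    \<comment> \<open>With this choice \<open>x\<close> becomes a fixed point of \<open>g'\<close>,
      so the induction measure drops.\<close>
    define x where "x = g y"
    have x: "x \<in> E" using g y x_def by (auto simp: bij_betw_def)
    have xy: "x \<noteq> y" using y x_def by auto
    let ?T = "transpose y x"
    define g' where "g' = (\<lambda>z. g (?T z))"
    define h' where "h' = (\<lambda>z. h (?T z))"
    have g': "bij_betw g' E E" unfolding g'_def by (rule bij_comp_transpose[OF g y(1) x])
    have h': "bij_betw h' E E" unfolding h'_def by (rule bij_comp_transpose[OF h y(1) x])
    have T: "?T z \<in> E" if "z \<in> E" for z using that x y by (auto simp: transpose_def)
    have fh': "\<And>z. z \<in> E \<Longrightarrow> f (h' z) = g' z" using fh T by (simp add: g'_def h'_def)
    have xg: "x \<in> reach {g} y" using reach_step[of y "{g}" y g] x_def by auto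
    have sub: "{z \<in> E. g' z \<noteq> z} \<subset> {z \<in> E. g z \<noteq> z}"
    proof
      show "{z \<in> E. g' z \<noteq> z} \<subseteq> {z \<in> E. g z \<noteq> z}"
      proof
        fix z assume z: "z \<in> {z \<in> E. g' z \<noteq> z}"
        have "g' x = x" by (simp add: g'_def x_def)
        then have "z \<noteq> x" using z by auto
        then show "z \<in> {z \<in> E. g z \<noteq> z}" using z y by (cases "z = y") (auto simp: g'_def)
      qed
      have "x \<in> {z \<in> E. g z \<noteq> z}" using g x y by (auto simp: bij_betw_def x_def inj_on_def)
      moreover have "x \<notin> {z \<in> E. g' z \<noteq> z}" by (simp add: g'_def x_def)
      ultimately show "{z \<in> E. g' z \<noteq> z} \<noteq> {z \<in> E. g z \<noteq> z}" by blast
    qed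
    have IH: "cyc f E + cyc g' E + cyc h' E \<le> card E + 2 * ncomp {f, g'} E"
      using less.hyps[OF psubset_card_mono[OF _ sub] fin f g' h' fh'] fin by auto
    have cg: "cyc g' E = cyc g E + 1"
      by (rule cyc_transpose_split(2)[OF fin g y(1) x _ xg]) (use xy in \<open>auto simp: g'_def\<close>)
    have FG: "bijs {f,g'} E" "bijs {h'} E" using fin f g' h' by (auto simp: bijs_def)
    have TFG: "bijs (insert ?T {f,g'}) E" using FG transpose_bij_on[OF y(1) x] by (auto simp: bijs_def)
    have "reach {f,g} z = reach (insert ?T {f,g'}) z" if "z \<in> E" for z
      unfolding g'_def by (rule reach_swap_split[OF fin f g y(1) x xg that])
    then have nc: "ncomp {f,g} E = ncomp (insert ?T {f,g'}) E" unfolding ncomp_def by (simp cong: image_cong)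
    have hT: "\<And>z. z \<in> E \<Longrightarrow> h z = h' (?T z)" by (simp add: h'_def)
    have ch: "cyc h E \<le> cyc h' E + 1"
    proof (cases "x \<in> reach {h'} y")
      case True
      then show ?thesis using cyc_transpose_split(2)[OF fin h' y(1) x _ True hT] xy by auto
    next
      case False
      then show ?thesis using cyc_transpose_merge(2)[OF fin h' y(1) x False hT] by auto
    qed
    show ?thesis
    proof (cases "x \<in> reach {f,g'} y")
      case True
      have "reach (insert ?T {f,g'}) z = reach {f,g'} z" if "z \<in> E" for z
      proof
        have tt: "?T w \<in> reach {f,g'} w" for w
          using True reach_sym[OF FG(1) y(1) True] by (auto simp: transpose_def)
        show "reach (insert ?T {f,g'}) z \<subseteq> reach {f,g'} z"
          by (rule reach_le[OF FG(1) that]) (use tt in \<open>auto intro: reach_step\<close>)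
        show "reach {f,g'} z \<subseteq> reach (insert ?T {f,g'}) z"
          by (rule reach_le[OF TFG that]) (auto intro: reach_step)
      qed
      then have "ncomp {f,g} E = ncomp {f,g'} E" unfolding nc by (simp add: ncomp_def cong: image_cong)
      then show ?thesis using IH cg ch by simp
    next
      case False
      \<comment> \<open>The bound for \<open>g'\<close> is larger by two here; one more cycle of
        \<open>g'\<close> and one more cycle of \<open>h'\<close> make up for it.\<close>
      have n: "ncomp {f,g} E + 1 = ncomp {f,g'} E" unfolding nc
        by (rule ncomp_merge[OF FG(1) TFG y(1) x False]) auto
      have gh: "h' z \<in> reach {f,g'} z" if "z \<in> E" for z
      proof -
        have "f (h' z) \<in> reach {f,g'} z" using fh'[OF that] by (auto intro: reach_step)
        then show ?thesis using reach_back[OF FG(1), of f z "h' z"] that bijsD[OF FG(2)] by auto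
      qed
      have "reach {h'} y \<subseteq> reach {f,g'} y"
        by (rule reach_le[OF FG(1) y(1)]) (use gh in auto)
      then have "x \<notin> reach {h'} y" using False by blast
      then have "cyc h E + 1 = cyc h' E" using cyc_transpose_merge(2)[OF fin h' y(1) x _ hT] by auto
      then show ?thesis using IH cg n by simp
    qed
  qed
qed

section \<open>Additivity and conjugation invariance of orbit counts\<close>

lemma ncomp_UN:
  assumes "finite I" "\<And>i. i \<in> I \<Longrightarrow> bijs F (A i)" "\<And>i j. i \<in> I \<Longrightarrow> j \<in> I \<Longrightarrow> i \<noteq> j \<Longrightarrow> A i \<inter> A j = {}"
  shows "ncomp F (\<Union>i\<in>I. A i) = (\<Sum>i\<in>I. ncomp F (A i))"
  unfolding ncomp_def image_UN
proof (rule card_UN_disjoint[OF assms(1)])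
  show "\<forall>i\<in>I. finite (reach F ` A i)" using assms(2) by (auto simp: bijs_def)
  show "\<forall>i\<in>I. \<forall>j\<in>I. i \<noteq> j \<longrightarrow> reach F ` A i \<inter> reach F ` A j = {}"
  proof (intro ballI impI)
    fix i j assume ij: "i \<in> I" "j \<in> I" "i \<noteq> j"
    show "reach F ` A i \<inter> reach F ` A j = {}"
    proof (rule ccontr)
      assume "reach F ` A i \<inter> reach F ` A j \<noteq> {}"
      then obtain x y where "x \<in> A i" "y \<in> A j" "reach F x = reach F y" by auto
      then have "x \<in> A j" using reach_sub[OF assms(2)[OF ij(2)]] reach_refl[of x F] by auto
      then show False using assms(3)[OF ij] \<open>x \<in> A i\<close> by auto
    qed
  qed
qed

lemma ncomp_Un:
  assumes "bijs F A" "bijs F B" "A \<inter> B = {}"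
  shows "ncomp F (A \<union> B) = ncomp F A + ncomp F B"
proof -
  have "ncomp F (\<Union>i\<in>{0, 1 :: nat}. if i = 0 then A else B) = (\<Sum>i\<in>{0, 1 :: nat}. ncomp F (if i = 0 then A else B))"
    by (rule ncomp_UN) (use assms in \<open>auto split: if_splits\<close>)
  then show ?thesis by (simp add: Un_commute)
qed

text \<open>Applied with \<open>h\<close> the label of the endpoint, so that vertices can be counted
  level by level.\<close>

lemma ncomp_levels:
  assumes "finite E" "bij_betw f E E" "\<And>x. x \<in> E \<Longrightarrow> h (f x) = h x" "finite L" "h ` E \<subseteq> L"
  shows "cyc f E = (\<Sum>l\<in>L. cyc f {x \<in> E. h x = l})"
proof -
  have "bijs {f} {x \<in> E. h x = l}" for l
  proof -
    have i: "inj_on f {x \<in> E. h x = l}" using assms(2) by (auto simp: bij_betw_def inj_on_def)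
    have "f ` {x \<in> E. h x = l} \<subseteq> {x \<in> E. h x = l}" using assms(2,3) by (auto simp: bij_betw_def)
    then have "f ` {x \<in> E. h x = l} = {x \<in> E. h x = l}" using assms(1) i by (intro endo_inj_surj) auto
    then show ?thesis using i assms(1) by (auto simp: bijs_def bij_betw_def)
  qed
  then have "cyc f (\<Union>l\<in>L. {x \<in> E. h x = l}) = (\<Sum>l\<in>L. cyc f {x \<in> E. h x = l})"
    by (intro ncomp_UN) (use assms in auto)
  moreover have "(\<Union>l\<in>L. {x \<in> E. h x = l}) = E" using assms(5) by auto
  ultimately show ?thesis by simp
qed

lemma reach_conj:
  assumes "bij g"
  shows "reach ((\<lambda>f. g \<circ> f \<circ> inv g) ` F) (g x) = g ` reach F x"
proof
  have gi: "inv g (g z) = z" for z using assms by (simp add: bij_is_inj)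
  show "reach ((\<lambda>f. g \<circ> f \<circ> inv g) ` F) (g x) \<subseteq> g ` reach F x"
  proof (rule reach_least)
    fix z f assume "z \<in> g ` reach F x" "f \<in> (\<lambda>f. g \<circ> f \<circ> inv g) ` F"
    then show "f z \<in> g ` reach F x" by (auto simp: gi intro!: imageI intro: reach_step)
  qed auto
  have "g y \<in> reach ((\<lambda>f. g \<circ> f \<circ> inv g) ` F) (g x)" if "y \<in> reach F x" for y
    using that
  proof induction
    case (reach_step y f)
    have "(g \<circ> f \<circ> inv g) (g y) \<in> reach ((\<lambda>f. g \<circ> f \<circ> inv g) ` F) (g x)"
      by (rule reach.reach_step[OF reach_step(3)]) (use reach_step(2) in blast)
    moreover have "(g \<circ> f \<circ> inv g) (g y) = g (f y)" using gi by simp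
    ultimately show ?case by metis
  qed auto
  then show "g ` reach F x \<subseteq> reach ((\<lambda>f. g \<circ> f \<circ> inv g) ` F) (g x)" by auto
qed

lemma ncomp_conj:
  assumes "bij g"
  shows "ncomp ((\<lambda>f. g \<circ> f \<circ> inv g) ` F) (g ` E) = ncomp F E"
proof -
  have "reach ((\<lambda>f. g \<circ> f \<circ> inv g) ` F) ` g ` E = (`) g ` (reach F ` E)"
    by (simp add: image_image reach_conj[OF assms])
  moreover have "inj_on ((`) g) (reach F ` E)"
    by (rule inj_onI) (simp add: inj_image_eq_iff[OF bij_is_inj[OF assms]])
  ultimately show ?thesis unfolding ncomp_def by (simp add: card_image)
qed

lemma cyc_conj: "bij g \<Longrightarrow> cyc (g \<circ> f \<circ> inv g) (g ` E) = cyc f E"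
  using ncomp_conj[of g "{f}" E] by simp

section \<open>Edge permutations and labels\<close>

text \<open>Encoding: the points are the edges, \<open>fw x\<close> and \<open>fb x\<close> are the edges following \<open>x\<close>
  around its white and its black face, and the orbits of \<open>sig fw fb\<close> are the sets of edges with a
  common endpoint. A label \<open>t x\<close> is the type of the origin of \<open>x\<close>, hence \<open>t (fw x)\<close> is the type of its
  endpoint.\<close>

definition sig :: "('a \<Rightarrow> 'a) \<Rightarrow> ('a \<Rightarrow> 'a) \<Rightarrow> 'a \<Rightarrow> 'a" where
  "sig fw fb = inv fw \<circ> fb"

definition dn :: "('a \<Rightarrow> 'a) \<Rightarrow> ('a \<Rightarrow> nat) \<Rightarrow> 'a \<Rightarrow> bool" where
  "dn fw t x \<longleftrightarrow> t (fw x) + 1 = t x"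

text \<open>\<open>nxt\<close> is one step of the leftmost geodesic: turn around the endpoint of \<open>x\<close> up to the first
  outgoing edge that decreases the label.\<close>

definition nxt :: "('a \<Rightarrow> 'a) \<Rightarrow> ('a \<Rightarrow> 'a) \<Rightarrow> ('a \<Rightarrow> nat) \<Rightarrow> 'a \<Rightarrow> 'a \<Rightarrow> bool" where
  "nxt fw fb t x y \<longleftrightarrow> (\<exists>j. y = fb ((sig fw fb ^^ j) x) \<and> dn fw t y \<and>
     (\<forall>i<j. \<not> dn fw t (fb ((sig fw fb ^^ i) x))))"

lemma nxt_unique: "nxt fw fb t x y \<Longrightarrow> nxt fw fb t x z \<Longrightarrow> y = z"
  unfolding nxt_def by (metis nat_neq_iff)

lemma nxt_exists:
  assumes "y \<in> reach {sig fw fb} x" "dn fw t (fb y)"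
  shows "\<exists>z. nxt fw fb t x z"
proof -
  obtain k where "y = (sig fw fb ^^ k) x" by (rule reach_powerE[OF assms(1)])
  then have "\<exists>j. dn fw t (fb ((sig fw fb ^^ j) x))" using assms(2) by auto
  then obtain j where "dn fw t (fb ((sig fw fb ^^ j) x))" "\<forall>i<j. \<not> dn fw t (fb ((sig fw fb ^^ i) x))"
    using exists_least_iff[of "\<lambda>j. dn fw t (fb ((sig fw fb ^^ j) x))"] by auto
  then show ?thesis unfolding nxt_def by blast
qed

text \<open>The level is read off from the label of \<open>x\<close>, since each of the two
  geodesics has exactly one edge for each level from \<open>m + 1\<close> to \<open>i\<close>. Off
  the two paths it is the identity.\<close>

definition tau :: "('a \<Rightarrow> nat) \<Rightarrow> (nat \<Rightarrow> 'a) \<Rightarrow> (nat \<Rightarrow> 'a) \<Rightarrow> nat \<Rightarrow> nat \<Rightarrow> 'a \<Rightarrow> 'a" where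
  "tau t a b m i x = (if m < t x \<and> t x \<le> i then (if x = a (t x) then b (t x) else
      if x = b (t x) then a (t x) else x) else x)"

text \<open>For an involution \<open>T\<close> this is conjugation, so the black faces keep their
  number and their degrees.\<close>

definition swp :: "('a \<Rightarrow> 'a) \<Rightarrow> ('a \<Rightarrow> 'a) \<Rightarrow> 'a \<Rightarrow> 'a" where
  "swp T f = T \<circ> f \<circ> T"

lemma swp_apply [simp]: "swp T f x = T (f (T x))" by (simp add: swp_def)

text \<open>\<open>lab\<close> makes the labels a function on vertices: \<open>fw x\<close> and
  \<open>fb x\<close> both start at the endpoint of \<open>x\<close>.\<close>

locale labelled =
  fixes E :: "'a set" and fw fb :: "'a \<Rightarrow> 'a" and t :: "'a \<Rightarrow> nat"
  assumes fin: "finite E" and fw: "fw permutes E" and fb: "fb permutes E"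
    and lab: "\<And>x. x \<in> E \<Longrightarrow> t (fb x) = t (fw x)"
begin

abbreviation "s \<equiv> sig fw fb"

lemma fw_s: "fw (s x) = fb x"
  using permutes_inverses[OF fw] by (simp add: sig_def)

lemma s_perm: "s permutes E"
  unfolding sig_def by (rule permutes_compose[OF fb permutes_inv[OF fw]])

lemma s_bij: "bij_betw s E E" by (rule permutes_imp_bij[OF s_perm])

lemma bijs_s: "bijs {s} E" using fin s_bij by (simp add: bijs_def)

lemma bijs_wb: "bijs {fw, fb} E"
  using fin permutes_imp_bij[OF fw] permutes_imp_bij[OF fb] by (simp add: bijs_def)

lemma bijs_w: "bijs {fw} E"
  using fin permutes_imp_bij[OF fw] by (simp add: bijs_def)

lemma inE [simp]: "fw x \<in> E \<longleftrightarrow> x \<in> E" "fb x \<in> E \<longleftrightarrow> x \<in> E" "s x \<in> E \<longleftrightarrow> x \<in> E"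
   "inv fb x \<in> E \<longleftrightarrow> x \<in> E" "inv fw x \<in> E \<longleftrightarrow> x \<in> E"
  using permutes_in_image[OF fw] permutes_in_image[OF fb] permutes_in_image[OF s_perm]
    permutes_in_image[OF permutes_inv[OF fb]] permutes_in_image[OF permutes_inv[OF fw]] by auto

lemma sE: "(s ^^ k) x \<in> E \<longleftrightarrow> x \<in> E" by (induction k) auto

lemma head_s: "x \<in> E \<Longrightarrow> t (fw (s x)) = t (fw x)"
  by (simp add: fw_s lab)

lemma head_sk: "x \<in> E \<Longrightarrow> t (fw ((s ^^ k) x)) = t (fw x)"
  by (induction k) (simp_all add: head_s sE)

lemma head_reach: "x \<in> E \<Longrightarrow> y \<in> reach {s} x \<Longrightarrow> t (fw y) = t (fw x)"
  by (erule reach_powerE) (simp add: head_sk)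

lemma inv_inv [simp]: "fb (inv fb x) = x" "inv fb (fb x) = x" "fw (inv fw x) = x" "inv fw (fw x) = x"
  using permutes_inverses[OF fb] permutes_inverses[OF fw] by auto

lemma nxt_lab: assumes "nxt fw fb t x y" "x \<in> E" shows "y \<in> E" "t y = t (fw x)" "dn fw t y" "inv fb y \<in> reach {s} x"
proof -
  obtain j where j: "y = fb ((s ^^ j) x)" using assms by (auto simp: nxt_def)
  then show "y \<in> E" "t y = t (fw x)" using assms by (auto simp: sE lab head_sk)
  show "dn fw t y" using assms by (auto simp: nxt_def)
  show "inv fb y \<in> reach {s} x" using j reach_power[of s "{s}"] by simp
qed

lemma s_closed_wb: "x \<in> E \<Longrightarrow> s x \<in> reach {fw, fb} x"
proof -
  assume x: "x \<in> E"
  have "fw (s x) \<in> reach {fw, fb} x" by (auto simp: fw_s intro: reach_step)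
  then show ?thesis using reach_back[OF bijs_wb, of fw x "s x"] x by auto
qed

lemma reach_s_wb: "x \<in> E \<Longrightarrow> reach {s} x \<subseteq> reach {fw, fb} x"
  by (rule reach_le[OF bijs_wb]) (auto intro: s_closed_wb)

lemma nxt_reach: assumes "nxt fw fb t x y" "x \<in> E" shows "y \<in> reach {fw, fb} x"
proof -
  have "inv fb y \<in> reach {fw, fb} x" using nxt_lab(4)[OF assms] reach_s_wb[OF assms(2)] by blast
  from reach_step[OF this, of fb] show ?thesis by simp
qed

abbreviation "lev l \<equiv> {x \<in> E. t (fw x) = l}"

lemma lev_bij: "bij_betw s (lev l) (lev l)"
proof -
  have i: "inj_on s (lev l)" using s_bij by (auto simp: bij_betw_def inj_on_def)
  have "s ` lev l \<subseteq> lev l" by (auto simp: head_s)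
  then have "s ` lev l = lev l" using fin i by (intro endo_inj_surj) auto
  then show ?thesis using i by (auto simp: bij_betw_def)
qed

lemma bijs_lev: "bijs {s} (lev l)" using lev_bij fin by (simp add: bijs_def)

end

text \<open>\<open>a\<close> and \<open>b\<close> list two geodesics by the type of the origin, from level \<open>i\<close> down to level \<open>m + 1\<close>,
  whose vertices differ at the levels between. Exchanging the black sides of \<open>a k\<close> and \<open>b k\<close> at every
  level cuts along both paths and reglues the four sides crosswise.\<close>

locale zip = labelled +
  fixes a b :: "nat \<Rightarrow> 'a" and m i :: nat
  assumes mi: "m < i"
    and ab: "\<And>k. m < k \<Longrightarrow> k \<le> i \<Longrightarrow> a k \<in> E \<and> b k \<in> E \<and> t (a k) = k \<and> t (b k) = k \<and>
        dn fw t (a k) \<and> dn fw t (b k) \<and> a k \<noteq> b k"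
    and patha: "\<And>k. m < k \<Longrightarrow> k < i \<Longrightarrow> nxt fw fb t (a (Suc k)) (a k)"
    and pathb: "\<And>k. m < k \<Longrightarrow> k < i \<Longrightarrow> nxt fw fb t (b (Suc k)) (b k)"
    and apart: "\<And>k. Suc m < k \<Longrightarrow> k \<le> i \<Longrightarrow> b k \<notin> reach {s} (a k)"
begin

abbreviation "T \<equiv> tau t a b m i"
abbreviation "fb' \<equiv> swp T fb"

lemma tau_swap_args: "tau t b a m i = T"
  using ab by (auto simp: tau_def fun_eq_iff)

lemma zip_sym: "zip E fw fb t b a m i"
proof unfold_locales
  fix k assume k: "Suc m < k" "k \<le> i"
  show "a k \<notin> reach {s} (b k)"
    using apart[OF k] reach_sym[OF bijs_s, of "b k" "a k"] ab[of k] k by auto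
next
  fix k assume "m < k" "k \<le> i"
  then show "b k \<in> E \<and> a k \<in> E \<and> t (b k) = k \<and> t (a k) = k \<and> dn fw t (b k) \<and> dn fw t (a k) \<and> b k \<noteq> a k"
    using ab[of k] by auto
qed (use mi patha pathb in auto)

lemma T_T [simp]: "T (T x) = x"
  using ab[of "t x"] by (auto simp: tau_def)

lemma T_t [simp]: "t (T x) = t x"
  using ab[of "t x"] by (auto simp: tau_def)

lemma T_E [simp]: "T x \<in> E \<longleftrightarrow> x \<in> E"
  using ab[of "t x"] by (auto simp: tau_def)

lemma T_a [simp]: "m < k \<Longrightarrow> k \<le> i \<Longrightarrow> T (a k) = b k" and T_b [simp]: "m < k \<Longrightarrow> k \<le> i \<Longrightarrow> T (b k) = a k"
  using ab[of k] by (auto simp: tau_def)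

lemma T_moved: "T x \<noteq> x \<Longrightarrow> m < t x \<and> t x \<le> i \<and> (x = a (t x) \<or> x = b (t x)) \<and> dn fw t x \<and> x \<in> E"
  using ab[of "t x"] by (auto simp: tau_def split: if_splits)

lemma T_ndn: "\<not> dn fw t x \<Longrightarrow> T x = x" using T_moved by blast

text \<open>A moved edge and its image are both down-edges that start at the same level, so they
  also end at the same level.\<close>

lemma T_head [simp]: "t (fw (T x)) = t (fw x)"
proof (cases "T x = x")
  case False
  then have "dn fw t x" "dn fw t (T x)" using T_moved[of x] T_moved[of "T x"] by auto
  then show ?thesis using T_t[of x] unfolding dn_def by linarith
qed simp

lemma T_dn [simp]: "dn fw t (T x) = dn fw t x" by (simp add: dn_def)

lemma T_bij: "bij T" by (rule o_bij[of T]) (auto simp: fun_eq_iff)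

lemma T_inv: "inv T = T" by (rule inv_equality) auto

lemma T_perm: "T permutes E"
  by (rule bij_imp_permutes[OF bij_betw_byWitness[where f'=T]]) (use T_moved in \<open>auto\<close>)

lemma fb'_perm: "fb' permutes E" unfolding swp_def by (intro permutes_compose T_perm fb)

lemma labelled': "labelled E fw fb' t"
  by unfold_locales (use fin fw fb'_perm lab in auto)

sublocale L': labelled E fw fb' t by (rule labelled')

lemma fb'_back: "swp T fb' = fb" by (auto simp: fun_eq_iff)

abbreviation "s' \<equiv> sig fw fb'"

lemma s'_eq: "s' x = inv fw (T (fb (T x)))" by (simp add: sig_def)

lemma T_lev: "x \<in> E \<Longrightarrow> t (fw x) = l \<Longrightarrow> T x = (if m \<le> l \<and> l < i then transpose (a (Suc l)) (b (Suc l)) x else x)"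
proof -
  assume x: "x \<in> E" "t (fw x) = l"
  show ?thesis
  proof (cases "T x = x")
    case True
    then have "x \<noteq> a (Suc l) \<and> x \<noteq> b (Suc l)" if "m \<le> l" "l < i"
      using that ab[of "Suc l"] by auto
    then show ?thesis using True by auto
  next
    case False
    then have m: "m < t x \<and> t x \<le> i \<and> (x = a (t x) \<or> x = b (t x)) \<and> dn fw t x" using T_moved by blast
    then have tx: "t x = Suc l" using x by (auto simp: dn_def)
    then show ?thesis using m ab[of "Suc l"] by (auto simp: tx)
  qed
qed

lemma T_fb: "x \<in> E \<Longrightarrow> t (fw x) = l \<Longrightarrow>
   T (fb x) = (if m < l \<and> l \<le> i then fb (transpose (inv fb (a l)) (inv fb (b l)) x) else fb x)"
proof -
  assume x: "x \<in> E" "t (fw x) = l"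
  have inj: "fb x = y \<longleftrightarrow> x = inv fb y" for y by auto
  have tl: "t (fb x) = l" using x lab by auto
  show ?thesis
  proof (cases "m < l \<and> l \<le> i")
    case True
    then show ?thesis unfolding tau_def tl
      by (cases "fb x = a l"; cases "fb x = b l") (auto simp: inj transpose_def)
  next
    case False then show ?thesis by (auto simp: tau_def tl)
  qed
qed

abbreviation "xa l \<equiv> inv fb (a l)"
abbreviation "xb l \<equiv> inv fb (b l)"

lemma xab: assumes "m < l" "l \<le> i" shows "xa l \<in> lev l" "xb l \<in> lev l" "xa l \<noteq> xb l"
proof -
  have *: "y \<in> E \<Longrightarrow> t y = l \<Longrightarrow> inv fb y \<in> lev l" for y using lab[of "inv fb y"] by simp
  show "xa l \<in> lev l" "xb l \<in> lev l" using * ab[OF assms] by blast+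
  show "xa l \<noteq> xb l" using ab[OF assms] inv_inv by metis
qed

lemma ab_lev: assumes "m \<le> l" "l < i" shows "a (Suc l) \<in> lev l" "b (Suc l) \<in> lev l"
  using ab[of "Suc l"] assms by (auto simp: dn_def)

text \<open>The inner \<open>T\<close> in \<open>fb'\<close> exchanges the two path edges arriving
  at level \<open>l\<close>, the outer one those leaving it. Both act strictly between
  \<open>m\<close> and \<open>i\<close>, only the first at the bottom level \<open>m\<close>, only
  the second at the top level \<open>i\<close>. So on each level the rotation changes by at most two
  transpositions.\<close>

lemma s'_lev:
  assumes "x \<in> lev l"
  shows "s' x = (let y = (if m \<le> l \<and> l < i then transpose (a (Suc l)) (b (Suc l)) x else x)
     in s (if m < l \<and> l \<le> i then transpose (xa l) (xb l) y else y))"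
proof -
  have "T x \<in> E" "t (fw (T x)) = l" using assms by auto
  note T_fb[OF this]
  moreover have "s y = inv fw (fb y)" for y by (simp add: sig_def)
  ultimately show ?thesis unfolding s'_eq Let_def using T_lev[of x l] assms by auto
qed

text \<open>The transposition belonging to the leaving edges merges the vertices of the two paths,
  which are distinct by \<open>apart\<close>; the one belonging to the arriving edges splits the
  result again.\<close>

lemma lev_mid:
  assumes "m < l" "l < i"
  shows "cyc s' (lev l) = cyc s (lev l)" "b (Suc l) \<notin> reach {s'} (a (Suc l))"
proof -
  let ?c = "\<lambda>z. s (transpose (xa l) (xb l) z)"
  have finl: "finite (lev l)" using fin by simp
  have x: "xa l \<in> lev l" "xb l \<in> lev l" using xab assms by auto
  have al: "a (Suc l) \<in> lev l" "b (Suc l) \<in> lev l" using ab_lev[of l] assms by auto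
  have ra: "xa l \<in> reach {s} (a (Suc l))" using nxt_lab(4)[OF patha[OF assms]] ab[of "Suc l"] assms by auto
  have rb: "xb l \<in> reach {s} (b (Suc l))" using nxt_lab(4)[OF pathb[OF assms]] ab[of "Suc l"] assms by auto
  have ea: "reach {s} (xa l) = reach {s} (a (Suc l))" by (rule reach_eq[OF bijs_lev al(1) ra])
  have eb: "reach {s} (xb l) = reach {s} (b (Suc l))" by (rule reach_eq[OF bijs_lev al(2) rb])
  have "b (Suc l) \<notin> reach {s} (a (Suc l))" using apart[of "Suc l"] assms by auto
  then have n: "xb l \<notin> reach {s} (xa l)"
    using reach_eq[OF bijs_lev al(1), of "xb l"] ea eb reach_refl by metis
  note M = cyc_transpose_merge[OF finl lev_bij x n, of ?c, OF refl]
  have cb: "bij_betw ?c (lev l) (lev l)" by (rule bij_comp_transpose[OF lev_bij x])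
  have C: "bijs {?c} (lev l)" using cb finl by (simp add: bijs_def)
  have ca: "xa l \<in> reach {?c} (a (Suc l))" by (rule subsetD[OF M(3)[OF al(1)] ra])
  have cb': "xb l \<in> reach {?c} (b (Suc l))" by (rule subsetD[OF M(3)[OF al(2)] rb])
  have "b (Suc l) \<in> reach {?c} (a (Suc l))"
    by (rule reach_trans[OF reach_trans[OF ca M(1)] reach_sym[OF C al(2) cb']])
  then have S: "b (Suc l) \<notin> reach {s'} (a (Suc l))" "cyc s' (lev l) = cyc ?c (lev l) + 1"
    using cyc_transpose_split(1,2)[OF finl cb al, of s'] s'_lev[of _ l] assms ab[of "Suc l"] by auto
  show "b (Suc l) \<notin> reach {s'} (a (Suc l))" by (fact S(1))
  show "cyc s' (lev l) = cyc s (lev l)" using S(2) M(2) by simp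
qed

lemma lev_other: assumes "l < m \<or> i < l" shows "cyc s' (lev l) = cyc s (lev l)"
  using cyc_cong[OF lev_bij, of l s'] s'_lev[of _ l] assms by auto

text \<open>Only one of the two transpositions acts at the top, and it splits the vertex that both
  paths leave. The bottom level behaves likewise with the arriving edges.\<close>

lemma lev_top_split:
  assumes "xb i \<in> reach {s} (xa i)"
  shows "cyc s' (lev i) = cyc s (lev i) + 1"
  by (rule cyc_transpose_split(2)[OF _ lev_bij xab(1,2,3)[of i] assms]) (use fin mi s'_lev[of _ i] in auto)

lemma lev_bot_split:
  assumes "b (Suc m) \<in> reach {s} (a (Suc m))"
  shows "cyc s' (lev m) = cyc s (lev m) + 1" "b (Suc m) \<notin> reach {s'} (a (Suc m))"
  using cyc_transpose_split(1,2)[OF _ lev_bij ab_lev[of m] _ assms, of s'] fin mi s'_lev[of _ m] ab[of "Suc m"] by auto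

lemma lev_top_merge:
  assumes "xb i \<notin> reach {s} (xa i)"
  shows "xb i \<in> reach {s'} (xa i)"
  by (rule cyc_transpose_merge(1)[OF _ lev_bij xab(1,2)[of i] assms]) (use fin mi s'_lev[of _ i] in auto)

lemma lev_bot_merge:
  assumes "b (Suc m) \<notin> reach {s} (a (Suc m))"
  shows "b (Suc m) \<in> reach {s'} (a (Suc m))"
    "\<And>z. z \<in> lev m \<Longrightarrow> reach {s} z \<subseteq> reach {s'} z"
  using cyc_transpose_merge(1,3)[OF _ lev_bij ab_lev[of m] assms, of s'] fin mi s'_lev[of _ m] by auto

text \<open>The middle levels contribute nothing, the top and the bottom one vertex each. This
  surplus of two is what the genus inequality turns into a separation.\<close>

lemma cyc_s'_split:
  assumes "xb i \<in> reach {s} (xa i)" "b (Suc m) \<in> reach {s} (a (Suc m))"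
  shows "cyc s' E = cyc s E + 2"
proof -
  let ?h = "\<lambda>x. t (fw x)"
  let ?L = "?h ` E \<union> {m, i}"
  have L: "finite ?L" "?h ` E \<subseteq> ?L" using fin by auto
  have "cyc s' (lev l) = cyc s (lev l) + ((if l = i then 1 else 0) + (if l = m then 1 else 0))" for l
    using lev_top_split[OF assms(1)] lev_bot_split(1)[OF assms(2)] lev_mid(1)[of l] lev_other[of l] mi
    by (cases "l < m"; cases "l = m"; cases "l < i"; cases "l = i") auto
  moreover have "cyc s' E = (\<Sum>l\<in>?L. cyc s' (lev l))"
    by (rule ncomp_levels[OF fin L'.s_bij L'.head_s L])
  moreover have "cyc s E = (\<Sum>l\<in>?L. cyc s (lev l))"
    by (rule ncomp_levels[OF fin s_bij head_s L])
  ultimately show ?thesis using L(1) mi by (simp add: sum.distrib)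
qed

text \<open>Turning around the endpoint of \<open>a (Suc k)\<close> in the new map is, up to
  \<open>T\<close>, turning around that of \<open>b (Suc k)\<close> in the old one: \<open>T\<close>
  replaces the first edge, fixes everything before the next down-edge, and turns the final
  \<open>b k\<close> into \<open>a k\<close>.\<close>

lemma path'_a: assumes k: "m < k" "k < i" shows "nxt fw fb' t (a (Suc k)) (a k)"
proof -
  have bE: "b (Suc k) \<in> E" "a (Suc k) \<in> E" using ab[of "Suc k"] k by auto
  obtain j where j: "b k = fb ((s ^^ j) (b (Suc k)))" "dn fw t (b k)"
     "\<And>n. n < j \<Longrightarrow> \<not> dn fw t (fb ((s ^^ n) (b (Suc k))))"
    using pathb[OF k] unfolding nxt_def by blast
  have *: "n \<le> j \<Longrightarrow> T ((s' ^^ n) (a (Suc k))) = (s ^^ n) (b (Suc k))" for n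
  proof (induction n)
    case 0 then show ?case using k by simp
  next
    case (Suc n)
    let ?y = "(s ^^ Suc n) (b (Suc k))"
    have IH: "T ((s' ^^ n) (a (Suc k))) = (s ^^ n) (b (Suc k))"
      by (rule Suc.IH[OF Suc_leD[OF Suc.prems]])
    have "(s' ^^ Suc n) (a (Suc k)) = inv fw (T (fb ((s ^^ n) (b (Suc k)))))"
      by (simp only: funpow.simps o_apply[of s' "s' ^^ n"] s'_eq IH)
    also have "\<dots> = ?y" using j(3)[of n] Suc T_ndn by (simp add: sig_def)
    finally have e: "(s' ^^ Suc n) (a (Suc k)) = ?y" .
    have yl: "?y \<in> lev k" using bE head_sk[of "b (Suc k)" "Suc n"] ab_lev(2)[of k] k sE[of "Suc n" "b (Suc k)"] by auto
    have "?y \<noteq> a (Suc k)" using apart[of "Suc k"] k reach_power[of s "{s}" "Suc n" "b (Suc k)"]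
        reach_sym[OF bijs_s bE(1), of "a (Suc k)"] by auto
    \<comment> \<open>A return to the start within \<open>j\<close> steps would meet the down-edge
      \<open>b k\<close> before step \<open>j\<close>.\<close>
    moreover have "?y \<noteq> b (Suc k)"
    proof
      assume y: "?y = b (Suc k)"
      have "(s ^^ j) (b (Suc k)) = (s ^^ (j - Suc n)) ((s ^^ Suc n) (b (Suc k)))"
        using Suc.prems funpow_add[of "j - Suc n" "Suc n" s] by (metis comp_apply le_add_diff_inverse2)
      then have "fb ((s ^^ (j - Suc n)) (b (Suc k))) = b k" using y j(1) by simp
      then show False using j(3)[of "j - Suc n"] j(2) Suc.prems by auto
    qed
    ultimately have "T ?y = ?y" using T_lev[of ?y k] yl k by auto
    then show ?case by (simp only: e)
  qed
  have nd: "\<not> dn fw t (fb' ((s' ^^ n) (a (Suc k))))" if "n < j" for n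
    using *[of n] j(3)[OF that] that by simp
  have "fb' ((s' ^^ j) (a (Suc k))) = a k" using *[of j] j(1)[symmetric] k by simp
  then show ?thesis unfolding nxt_def using nd ab[of k] k by (metis less_imp_le)
qed

lemma path'_b: assumes k: "m < k" "k < i" shows "nxt fw fb' t (b (Suc k)) (b k)"
proof -
  interpret Z: zip E fw fb t b a m i by (rule zip_sym)
  show ?thesis using Z.path'_a[OF assms] by (simp add: tau_swap_args)
qed

lemma xa': "inv fb' (a i) = xb i" and xb': "inv fb' (b i) = xa i"
proof -
  have "T (xb i) = xb i" "T (xa i) = xa i"
    using T_lev[of "xa i" i] T_lev[of "xb i" i] xab[of i] mi by auto
  then have "fb' (xb i) = a i" "fb' (xa i) = b i" using mi by auto
  then show "inv fb' (a i) = xb i" "inv fb' (b i) = xa i" using L'.inv_inv(2) by metis+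
qed

text \<open>The swap is an involution, so that cutting and gluing are the same operation.\<close>

lemma zip': shows "zip E fw fb' t a b m i"
proof unfold_locales
  fix k assume k: "Suc m < k" "k \<le> i"
  then obtain l where "k = Suc l" "m < l" "l < i" by (cases k) auto
  then show "b k \<notin> reach {s'} (a k)" using lev_mid(2) by blast
qed (use mi ab path'_a path'_b in auto)

end

section \<open>Distance labellings\<close>

text \<open>Planar constellations labelled by the distance to a pointed vertex. The labels need not be
  compared with actual paths: \<open>step\<close> makes them lower bounds, \<open>down\<close> produces a geodesic, and \<open>uniq\<close> says
  that only the pointed vertex has label \<open>0\<close>.\<close>

locale lconst = labelled +
  fixes p :: nat
  assumes p2: "2 \<le> p"
    and order: "\<And>x. x \<in> E \<Longrightarrow> (fb ^^ p) x = x"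
    and step: "\<And>x. x \<in> E \<Longrightarrow> t (fw x) + 1 = t x \<or> t (fw x) + 1 = t x + p"
    and conn: "\<And>x y. x \<in> E \<Longrightarrow> y \<in> E \<Longrightarrow> y \<in> reach {fw, fb} x"
    and euler: "cyc fw E + cyc fb E + cyc (sig fw fb) E = card E + 2"
    and down: "\<And>x. x \<in> E \<Longrightarrow> 0 < t (fw x) \<Longrightarrow> \<exists>y\<in>reach {sig fw fb} x. dn fw t (fb y)"
    and pt: "\<exists>z\<in>E. t (fw z) = 0"
    and uniq: "\<And>x y. x \<in> E \<Longrightarrow> y \<in> E \<Longrightarrow> t (fw x) = 0 \<Longrightarrow> t (fw y) = 0 \<Longrightarrow> y \<in> reach {sig fw fb} x"
    and out: "\<And>x. x \<notin> E \<Longrightarrow> t x = 0"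

text \<open>Iterates \<open>nxt\<close>, which \<open>down\<close> keeps defined until the endpoint
  has label \<open>0\<close>. Indexing the edges by the label of their origin allows two paths to be
  compared level by level.\<close>

lemma (in lconst) path_exists:
  assumes "x \<in> E" "dn fw t x"
  shows "\<exists>a. a (t x) = x \<and> (\<forall>k. 0 < k \<and> k \<le> t x \<longrightarrow> a k \<in> E \<and> t (a k) = k \<and> dn fw t (a k)) \<and>
     (\<forall>k. 0 < k \<and> k < t x \<longrightarrow> nxt fw fb t (a (Suc k)) (a k))"
  using assms
proof (induction "t x" arbitrary: x)
  case 0
  then show ?case by (auto simp: dn_def)
next
  case (Suc l)
  show ?case
  proof (cases "l = 0")
    case True
    then show ?thesis using Suc by (intro exI[of _ "\<lambda>_. x"]) auto
  next
    case False
    have tx: "t x = Suc l" using Suc by simp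
    then have hx: "t (fw x) = l" using Suc.prems by (auto simp: dn_def)
    obtain y where y: "nxt fw fb t x y"
      using down[of x] hx False Suc.prems nxt_exists[of _ fw fb x t] by auto
    have y': "y \<in> E" "t y = l" "dn fw t y" using nxt_lab[OF y] hx Suc.prems by auto
    obtain a where a: "a l = y" "\<And>k. 0 < k \<Longrightarrow> k \<le> l \<Longrightarrow> a k \<in> E \<and> t (a k) = k \<and> dn fw t (a k)"
       "\<And>k. 0 < k \<Longrightarrow> k < l \<Longrightarrow> nxt fw fb t (a (Suc k)) (a k)"
      using Suc(1)[of y] y' by auto
    let ?a = "a(Suc l := x)"
    have "nxt fw fb t (?a (Suc k)) (?a k)" if "0 < k" "k < Suc l" for k
      using a y that by (cases "k = l") auto
    moreover have "?a k \<in> E \<and> t (?a k) = k \<and> dn fw t (?a k)" if "0 < k" "k \<le> Suc l" for k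
      using a(2)[of k] that Suc.prems tx by (cases "k = Suc l") auto
    ultimately show ?thesis unfolding tx by (intro exI[of _ ?a]) auto
  qed
qed

lemma swp_pow: "(\<And>x. T (T x) = x) \<Longrightarrow> (swp T f ^^ n) x = T ((f ^^ n) (T x))"
  by (induction n) auto

context zip
begin

lemma T_top: "x \<in> E \<Longrightarrow> t (fw x) = i \<Longrightarrow> T x = x"
  using T_lev[of x i] by auto

lemma cyc_fb': "cyc fb' E = cyc fb E"
proof -
  have "cyc (T \<circ> fb \<circ> T) (T ` E) = cyc fb E" using cyc_conj[OF T_bij, of fb E] by (simp only: T_inv)
  then show ?thesis unfolding swp_def permutes_image[OF T_perm] .
qed

text \<open>The path is still a path of \<open>nxt\<close> after the swap, so its edges cannot fall
  into different components.\<close>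

lemma reach'_a: "m < k \<Longrightarrow> k \<le> i \<Longrightarrow> a k \<in> reach {fw, fb'} (a i)"
proof (induction "i - k" arbitrary: k)
  case (Suc n)
  have k: "k < i" using Suc by auto
  have n: "nxt fw fb' t (a (Suc k)) (a k)" by (rule path'_a[OF Suc(3) k])
  have r: "a (Suc k) \<in> reach {fw, fb'} (a i)"
    by (rule Suc(1)) (use Suc k in auto)
  have "a (Suc k) \<in> E" using ab[of "Suc k"] Suc k by auto
  then show ?case by (rule reach_trans[OF r L'.nxt_reach[OF n]])
qed auto

lemma reach'_b: "m < k \<Longrightarrow> k \<le> i \<Longrightarrow> b k \<in> reach {fw, fb'} (b i)"
proof -
  assume k: "m < k" "k \<le> i"
  interpret Z: zip E fw fb t b a m i by (rule zip_sym)
  show ?thesis using Z.reach'_a[OF k] by (simp add: tau_swap_args)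
qed

lemma lev_reach_other:
  assumes "l < m \<or> i < l" "x \<in> lev l"
  shows "reach {s'} x = reach {s} x"
  by (rule reach_cong1[of x "lev l", symmetric]) (use assms s'_lev[of _ l] head_s in auto)

text \<open>At level \<open>m\<close> the rotation \<open>s\<close> is \<open>s'\<close> preceded by
  the transposition of the two arriving edges, so the union of their \<open>s'\<close>-orbits is
  closed under \<open>s\<close>.\<close>

lemma bot_closed:
  assumes "z \<in> reach {s} (a (Suc m)) \<or> z \<in> reach {s} (b (Suc m))"
  shows "z \<in> reach {s'} (a (Suc m)) \<union> reach {s'} (b (Suc m))"
proof -
  let ?U = "reach {s'} (a (Suc m)) \<union> reach {s'} (b (Suc m))"
  have UE: "z \<in> ?U \<Longrightarrow> z \<in> lev m" for z
    using reach_sub[OF L'.bijs_lev, of "a (Suc m)" m] reach_sub[OF L'.bijs_lev, of "b (Suc m)" m]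
      ab_lev[of m] mi by blast
  have cl: "s z \<in> ?U" if z: "z \<in> ?U" for z
  proof -
    have tz: "transpose (a (Suc m)) (b (Suc m)) z \<in> ?U" using z by (auto simp: transpose_def)
    have "s' (transpose (a (Suc m)) (b (Suc m)) z) = s z"
      using s'_lev[OF UE[OF tz]] mi by auto
    then show ?thesis using tz reach_step[of _ "{s'}" _ s'] by (metis UnCI UnE singletonI)
  qed
  have "reach {s} (a (Suc m)) \<subseteq> ?U" "reach {s} (b (Suc m)) \<subseteq> ?U"
    by (rule reach_least; use cl in auto)+
  then show ?thesis using assms by blast
qed

text \<open>If the vertex had no down-edge after the swap, then \<open>T\<close> would move no edge
  arriving at it, because the next path edge would leave from there, and no edge leaving it. So it
  would be an unchanged vertex, which has a down-edge. Only the bottom of the paths, where no next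
  path edge exists, has to be excluded.\<close>

lemma down_transfer:
  assumes x: "x \<in> E" and d: "\<exists>y\<in>reach {s} x. dn fw t (fb y)"
    and mm: "t (fw x) = m \<Longrightarrow> a (Suc m) \<notin> reach {s'} x \<and> b (Suc m) \<notin> reach {s'} x"
  shows "\<exists>y\<in>reach {s'} x. dn fw t (fb' y)"
proof (rule ccontr)
  assume no: "\<not> ?thesis"
  define l where "l = t (fw x)"
  have 1: "T y = y \<and> fb' y = fb y" if y: "y \<in> reach {s'} x" for y
  proof -
    have yl: "y \<in> E" "t (fw y) = l" using y L'.head_reach[OF x y] reach_sub[OF L'.bijs_s x] l_def by auto
    have Ty: "T y = y"
    proof (rule ccontr)
      assume "T y \<noteq> y"
      then have c: "m \<le> l" "l < i" "y = a (Suc l) \<or> y = b (Suc l)"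
        using T_lev[OF yl] by (auto simp: transpose_def split: if_splits)
      have ml: "m < l" using c mm y l_def by (cases "l = m") auto
      have "inv fb' (a l) \<in> reach {s'} (a (Suc l))" "inv fb' (b l) \<in> reach {s'} (b (Suc l))"
        using L'.nxt_lab(4)[OF path'_a[OF ml c(2)]] L'.nxt_lab(4)[OF path'_b[OF ml c(2)]] ab[of "Suc l"] c by auto
      then have "inv fb' (a l) \<in> reach {s'} x \<or> inv fb' (b l) \<in> reach {s'} x"
        using c(3) reach_trans[OF y] by blast
      moreover have "dn fw t (fb' (inv fb' (a l)))" "dn fw t (fb' (inv fb' (b l)))"
        using ab[of l] ml c(2) by (simp_all only: L'.inv_inv)
      ultimately show False using no by blast
    qed
    have "fb' y = T (fb y)" using Ty by simp
    moreover have "T (fb y) = fb y"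
    proof (rule ccontr)
      assume "T (fb y) \<noteq> fb y"
      then have "dn fw t (T (fb y))" using T_moved by auto
      then show False using no y Ty by auto
    qed
    ultimately show ?thesis using Ty by simp
  qed
  have "reach {s'} x = reach {s} x"
  proof (rule reach_cong1[of x "reach {s'} x"])
    fix z assume z: "z \<in> reach {s'} x"
    then show "s' z \<in> reach {s'} x \<and> s' z = s z"
      using reach_step[OF z, of s'] 1[OF z] by (auto simp: sig_def)
  qed simp
  then show False using d no 1 by auto
qed

end

section \<open>Restriction to a closed set of edges\<close>

definition res :: "'a set \<Rightarrow> ('a \<Rightarrow> 'a) \<Rightarrow> 'a \<Rightarrow> 'a" where
  "res C f x = (if x \<in> C then f x else x)"

text \<open>The shift gives a region that was cut off its own pointed vertex, at the former level
  \<open>d\<close>. The value \<open>0\<close> outside \<open>C\<close> matches \<open>out\<close>,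
  so that a labelling is determined as a function by its values on \<open>C\<close>.\<close>

definition lres :: "'a set \<Rightarrow> nat \<Rightarrow> ('a \<Rightarrow> nat) \<Rightarrow> 'a \<Rightarrow> nat" where
  "lres C d t x = (if x \<in> C then t x - d else 0)"

locale sublab = labelled +
  fixes C :: "'a set" and d :: nat
  assumes CE: "C \<subseteq> E" and Cw: "\<And>x. x \<in> C \<Longrightarrow> fw x \<in> C" and Cb: "\<And>x. x \<in> C \<Longrightarrow> fb x \<in> C"
    and dt: "\<And>x. x \<in> C \<Longrightarrow> d \<le> t x"
begin

abbreviation "fwC \<equiv> res C fw"
abbreviation "fbC \<equiv> res C fb"
abbreviation "tC \<equiv> lres C d t"

lemma res_perm: assumes "f permutes E" "\<And>x. x \<in> C \<Longrightarrow> f x \<in> C" shows "res C f permutes C"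
proof (rule bij_imp_permutes)
  have i: "inj_on f C" using permutes_inj[OF assms(1)] by (auto simp: inj_on_def)
  have "f ` C = C" using fin CE assms(2) by (intro endo_inj_surj i) (auto intro: finite_subset)
  then have "bij_betw f C C" using i by (auto simp: bij_betw_def)
  then show "bij_betw (res C f) C C" by (subst bij_betw_cong[of C _ f]) (auto simp: res_def)
qed (auto simp: res_def)

lemma labelledC: "labelled C fwC fbC tC"
proof unfold_locales
  show "finite C" using fin CE finite_subset by blast
  show "fwC permutes C" "fbC permutes C" using res_perm fw fb Cw Cb by auto
  show "tC (fbC x) = tC (fwC x)" if "x \<in> C" for x
    using that Cw Cb lab CE by (auto simp: res_def lres_def)
qed

sublocale C: labelled C fwC fbC tC by (rule labelledC)

lemma sC: "x \<in> C \<Longrightarrow> C.s x = s x"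
proof -
  assume x: "x \<in> C"
  have "C.s x \<in> C" using x by simp
  have "fw (C.s x) = fwC (C.s x)" using \<open>C.s x \<in> C\<close> by (simp add: res_def)
  also have "\<dots> = fb x" unfolding C.fw_s using x by (simp add: res_def)
  finally show "C.s x = s x" by (metis inv_inv(4) fw_s)
qed

lemma sC_in: "x \<in> C \<Longrightarrow> s x \<in> C" using sC C.inE(3) by metis

lemma reachC_s: "x \<in> C \<Longrightarrow> reach {C.s} x = reach {s} x"
  by (rule reach_cong1[of x C]) (auto simp: sC sC_in)

lemma reachC_w: "x \<in> C \<Longrightarrow> reach {fwC} x = reach {fw} x"
  by (rule reach_cong1[of x C]) (auto simp: res_def Cw)

lemma reachC_wb: "x \<in> C \<Longrightarrow> reach {fwC, fbC} x = reach {fw, fb} x"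
  by (rule reach_congF[of x C]) (auto simp: res_def Cw Cb)

lemma cycC: "cyc fwC C = cyc fw C" "cyc fbC C = cyc fb C" "cyc C.s C = cyc s C"
  by (rule cyc_cong; use permutes_imp_bij[OF C.fw] permutes_imp_bij[OF C.fb] C.s_bij sC in \<open>auto simp: res_def\<close>)+

lemma tC: "x \<in> C \<Longrightarrow> tC x + d = t x" using dt by (simp add: lres_def)

lemma tC_head: "x \<in> C \<Longrightarrow> tC (fwC x) + d = t (fw x)" using tC[OF Cw] by (simp add: res_def)

lemma dnC: "x \<in> C \<Longrightarrow> dn fwC tC x = dn fw t x"
  using tC[of x] tC_head[of x] by (auto simp: dn_def)

lemma sC_pow: "x \<in> C \<Longrightarrow> (C.s ^^ k) x = (s ^^ k) x \<and> (s ^^ k) x \<in> C"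
  by (induction k) (auto simp: sC sC_in)

lemma nxtC: "x \<in> C \<Longrightarrow> nxt fwC fbC tC x y = nxt fw fb t x y"
proof -
  assume x: "x \<in> C"
  have "fbC ((C.s ^^ k) x) = fb ((s ^^ k) x)" for k using sC_pow[OF x, of k] by (simp add: res_def)
  moreover have "fb ((s ^^ k) x) \<in> C" for k using sC_pow[OF x, of k] Cb by simp
  ultimately show ?thesis unfolding nxt_def using dnC by metis
qed

end

section \<open>Cutting and gluing\<close>

text \<open>\<open>fb e\<close> and \<open>fw e\<close> are the two candidates for the next edge,
  and the geodesics \<open>a\<close> and \<open>b\<close> start with them. \<open>bot\<close> makes
  the geodesics end at a common vertex of level \<open>m\<close>. \<open>root\<close> puts an edge
  leaving the pointed vertex on the white face of \<open>e\<close>, which decides the side on which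
  this vertex stays.\<close>

locale cut = lconst E fw fb t p + zip E fw fb t a b m i
  for E :: "'a set" and fw fb t p a b m i +
  fixes e
  assumes eE: "e \<in> E" and ea: "fb e = a i" and eb: "fw e = b i"
    and bot: "b (Suc m) \<in> reach {sig fw fb} (a (Suc m))"
    and root: "\<exists>r\<in>reach {fw} e. t r = 0"
begin

abbreviation "A \<equiv> reach {fw, fb'} (b i)"
abbreviation "B \<equiv> reach {fw, fb'} (a i)"

lemma ai: "a i \<in> E" "b i \<in> E" using ab mi by auto

lemma Te: "T e = e" by (rule T_top[OF eE]) (use eb ab mi in auto)

lemma fb'e: "fb' e = fw e" using Te ea eb mi by simp

text \<open>Both paths leave from the endpoint of \<open>e\<close>.\<close>

lemma top: "xb i \<in> reach {s} (xa i)"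
proof -
  have "xa i = e" using ea inv_inv by metis
  moreover have "s (xb i) = e" using eb inv_inv(4)[of e] by (simp add: sig_def)
  then have "e \<in> reach {s} (xb i)" using reach_step[of "xb i" "{s}" "xb i" s] by auto
  then have "xb i \<in> reach {s} e" by (rule reach_sym[OF bijs_s, rotated]) (use ai in auto)
  ultimately show ?thesis by simp
qed

lemma AE: "A \<subseteq> E" "B \<subseteq> E" using reach_sub[OF L'.bijs_wb] ai by auto

text \<open>The two components contain both paths and are therefore together closed under
  \<open>T\<close>, hence under \<open>fb\<close>, which is \<open>fb'\<close> conjugated by
  \<open>T\<close>; and the old map is connected.\<close>

lemma AB: "A \<union> B = E"
proof
  show "E \<subseteq> A \<union> B"
  proof
    fix x assume "x \<in> E"
    then have x: "x \<in> reach {fw, fb} (a i)" using conn ai by blast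
    have Tc: "T z \<in> A \<union> B" if "z \<in> A \<union> B" for z
    proof (cases "T z = z")
      case False
      then have "m < t z" "t z \<le> i" "z = a (t z) \<or> z = b (t z)" using T_moved by blast+
      then show ?thesis using reach'_a[of "t z"] reach'_b[of "t z"] T_a[of "t z"] T_b[of "t z"] by (metis UnCI)
    qed (use that in auto)
    have "reach {fw, fb} (a i) \<subseteq> A \<union> B"
    proof (rule reach_least)
      fix z f assume z: "z \<in> A \<union> B" and f: "f \<in> {fw, fb}"
      show "f z \<in> A \<union> B"
      proof (cases "f = fw")
        case True then show ?thesis using z by (auto intro: reach_step)
      next
        case False
        have "fb' (T z) \<in> A \<union> B" using Tc[OF z] reach_step[of "T z" "{fw, fb'}" _ fb'] by auto
        then have "T (fb' (T z)) \<in> A \<union> B" by (rule Tc)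
        then show ?thesis using f False by simp
      qed
    qed auto
    then show "x \<in> A \<union> B" using x by blast
  qed
qed (use AE in auto)

lemma total': "cyc fw E + cyc fb' E + cyc s' E = card E + 4"
  using cyc_s'_split[OF top bot] cyc_fb' euler by simp

lemma genus': "C \<subseteq> E \<Longrightarrow> bijs {fw, fb'} C \<Longrightarrow> bijs {s'} C \<Longrightarrow> cyc fw C + cyc fb' C + cyc s' C \<le> card C + 2 * ncomp {fw, fb'} C"
  by (rule genus_nonneg) (auto simp: bijs_def L'.fw_s)

text \<open>A single component would give \<open>card E + 4 \<le> card E + 2\<close> by the genus
  inequality.\<close>

lemma disj: "A \<inter> B = {}"
proof (rule ccontr)
  assume "A \<inter> B \<noteq> {}"
  then have "A = B" using reach_disj[OF L'.bijs_wb ai(2,1)] by metis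
  then have EA: "A = E" using AB by (metis Un_absorb)
  have "reach {fw, fb'} x = A" if "x \<in> E" for x
    by (rule reach_eq[OF L'.bijs_wb ai(2)]) (use that EA in \<open>simp only:\<close>)
  then have "reach {fw, fb'} ` E \<subseteq> {A}" by (intro image_subsetI) (simp only: singleton_iff)
  then have "ncomp {fw, fb'} E \<le> 1" unfolding ncomp_def by (metis card_mono card.empty card.insert finite.emptyI finite.insertI empty_iff One_nat_def)
  moreover have "card E + 4 \<le> card E + 2 * ncomp {fw, fb'} E"
    using genus'[OF subset_refl L'.bijs_wb L'.bijs_s] total' by simp
  ultimately show False by simp
qed

lemma comp_props:
  assumes "z \<in> E"
  defines "C \<equiv> reach {fw, fb'} z"
  shows "\<And>x. x \<in> C \<Longrightarrow> fw x \<in> C" "\<And>x. x \<in> C \<Longrightarrow> fb' x \<in> C" "\<And>x. x \<in> C \<Longrightarrow> s' x \<in> C" "C \<subseteq> E"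
    "bijs {fw, fb'} C" "bijs {s'} C" "ncomp {fw, fb'} C = 1"
proof -
  show CE: "C \<subseteq> E" unfolding C_def by (rule reach_sub[OF L'.bijs_wb assms(1)])
  show w: "fw x \<in> C" "fb' x \<in> C" if "x \<in> C" for x using that unfolding C_def by (auto intro: reach_step simp del: swp_apply)
  show ss: "s' x \<in> C" if "x \<in> C" for x
    using L'.s_closed_wb[of x] that CE reach_trans unfolding C_def by fast
  have b: "bij_betw f C C" if "f permutes E" "\<And>x. x \<in> C \<Longrightarrow> f x \<in> C" for f
  proof -
    have i: "inj_on f C" using permutes_inj[OF that(1)] by (auto simp: inj_on_def)
    have "f ` C = C" using fin CE that(2) by (intro endo_inj_surj i) (auto intro: finite_subset)
    then show ?thesis using i by (auto simp: bij_betw_def)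
  qed
  have "finite C" using fin CE finite_subset by blast
  then show "bijs {fw, fb'} C" "bijs {s'} C" using b[OF fw w(1)] b[OF L'.fb w(2)] b[OF L'.s_perm ss] by (auto simp: bijs_def simp del: swp_apply)
  have "reach {fw, fb'} x = C" if "x \<in> C" for x
    unfolding C_def by (rule reach_eq[OF L'.bijs_wb assms(1)]) (use that in \<open>simp only: C_def\<close>)
  then have "reach {fw, fb'} ` C = (\<lambda>_. C) ` C" by (rule image_cong[OF refl])
  also have "\<dots> = {C}" by (rule image_constant[of z]) (simp add: C_def)
  finally have "reach {fw, fb'} ` C = {C}" .
  then show "ncomp {fw, fb'} C = 1" by (simp add: ncomp_def del: swp_apply)
qed

text \<open>Each component is bounded by its number of edges plus two, and together they attain
  \<open>card E + 4\<close>; so neither bound can be strict.\<close>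

lemma euler_AB: "cyc fw A + cyc fb' A + cyc s' A = card A + 2" "cyc fw B + cyc fb' B + cyc s' B = card B + 2"
proof -
  note PA = comp_props[OF ai(2)] and PB = comp_props[OF ai(1)]
  have "cyc fw A + cyc fb' A + cyc s' A \<le> card A + 2" "cyc fw B + cyc fb' B + cyc s' B \<le> card B + 2"
    using genus'[OF PA(4,5,6)] genus'[OF PB(4,5,6)] PA(7) PB(7) by auto
  moreover have "card E = card A + card B"
    using card_Un_disjoint[OF _ _ disj] AB AE fin finite_subset by metis
  moreover have "cyc f E = cyc f A + cyc f B" if "bijs {f} A" "bijs {f} B" for f
    using ncomp_Un[OF that disj] AB by simp
  then have "cyc fw E = cyc fw A + cyc fw B" "cyc fb' E = cyc fb' A + cyc fb' B" "cyc s' E = cyc s' A + cyc s' B"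
    using PA PB unfolding bijs_def by blast+
  ultimately show "cyc fw A + cyc fb' A + cyc s' A = card A + 2" "cyc fw B + cyc fb' B + cyc s' B = card B + 2"
    using total' by linarith+
qed

lemma s'_comp: "z \<in> E \<Longrightarrow> x \<in> reach {fw, fb'} z \<Longrightarrow> reach {s'} x \<subseteq> reach {fw, fb'} z"
  by (rule reach_least) (use comp_props(3) in auto)

lemma abm: "a (Suc m) \<in> B" "b (Suc m) \<in> A"
  using reach'_a[of "Suc m"] reach'_b[of "Suc m"] mi by auto

lemma abmE: "a (Suc m) \<in> E" "b (Suc m) \<in> E" "t (fw (a (Suc m))) = m" "t (fw (b (Suc m))) = m"
  using ab_lev[of m] mi by auto

lemma eA: "e \<in> A"
proof -
  have "fw e \<in> A" using eb by simp
  then show ?thesis using reach_back[OF L'.bijs_wb, of fw "b i" e] eE ai by auto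
qed

text \<open>The swap does not touch \<open>fw\<close>, so the whole white face of \<open>e\<close>
  stays in \<open>A\<close>, and with it an edge that leaves the pointed vertex.\<close>

lemma root_A: obtains g where "g \<in> A" "t (fw g) = 0"
proof -
  obtain r where r: "r \<in> reach {fw} e" "t r = 0" using root by blast
  have "reach {fw} e \<subseteq> A" by (rule reach_least) (use eA in \<open>auto intro: reach_step\<close>)
  then have rA: "r \<in> A" using r by blast
  then have "inv fw r \<in> A" using reach_back[OF L'.bijs_wb, of fw "b i" "inv fw r"] AE ai by auto
  then show thesis using that[of "inv fw r"] r by simp
qed

text \<open>For positive \<open>m\<close> the pointed vertex lies below the swapped levels and is
  unchanged. For \<open>m = 0\<close> it is the bottom vertex itself, and its edges are shared out
  between the two sides.\<close>

lemma head0: "x \<in> E \<Longrightarrow> t (fw x) = 0 \<Longrightarrow> (m > 0 \<and> x \<in> A) \<or> (m = 0 \<and> x \<in> reach {s'} (a (Suc m)) \<union> reach {s'} (b (Suc m)))"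
proof (cases "m = 0")
  case True
  assume x: "x \<in> E" "t (fw x) = 0"
  then have "x \<in> reach {s} (a (Suc m))" using uniq[of "a (Suc m)" x] abmE True by auto
  then show ?thesis using bot_closed True by auto
next
  case False
  assume x: "x \<in> E" "t (fw x) = 0"
  obtain g where g: "g \<in> A" "t (fw g) = 0" by (rule root_A)
  then have "x \<in> reach {s} g" using uniq[of g x] x AE by auto
  then have "x \<in> reach {s'} g" using lev_reach_other[of 0 g] False g AE by auto
  then show ?thesis using s'_comp[OF ai(2) g(1)] False by auto
qed

text \<open>Induction on the label: another vertex of \<open>B\<close> at or below level
  \<open>m\<close> would have a down-edge inside \<open>B\<close> and so lead to an exception of
  smaller label; at label \<open>0\<close> there is none by \<open>head0\<close>.\<close>

lemma B_low: "x \<in> B \<Longrightarrow> t (fw x) \<le> m \<Longrightarrow> t (fw x) = m \<and> x \<in> reach {s'} (a (Suc m))"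
proof (induction "t (fw x)" arbitrary: x rule: less_induct)
  case less
  have xE: "x \<in> E" using less AE by auto
  show ?case
  proof (rule ccontr)
    assume n: "\<not> ?case"
    show False
    proof (cases "t (fw x) = 0")
      case True
      then show False using head0[OF xE True] n less disj s'_comp[OF ai(2) abm(2)] by auto
    next
      case False
      have "\<exists>y\<in>reach {s'} x. dn fw t (fb' y)"
      proof (rule down_transfer[OF xE])
        show "\<exists>y\<in>reach {s} x. dn fw t (fb y)" using down xE False by auto
        assume "t (fw x) = m"
        then have "x \<notin> reach {s'} (a (Suc m))" using n by auto
        moreover have "b (Suc m) \<notin> reach {s'} x" using s'_comp[OF ai(1) less(2)] abm disj by auto
        ultimately show "a (Suc m) \<notin> reach {s'} x \<and> b (Suc m) \<notin> reach {s'} x"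
          using reach_sym[OF L'.bijs_s xE, of "a (Suc m)"] by auto
      qed
      then obtain y where y: "y \<in> reach {s'} x" "dn fw t (fb' y)" by blast
      have yB: "y \<in> B" "fb' y \<in> B" using s'_comp[OF ai(1) less(2)] y comp_props(2)[OF ai(1)] by auto
      have "t (fb' y) = t (fw x)" using L'.lab[of y] yB AE L'.head_reach[OF xE y(1)] by auto
      then have "t (fw (fb' y)) < t (fw x)" using y(2) unfolding dn_def by simp
      then show False using less(1)[OF _ yB(2)] less(3) by auto
    qed
  qed
qed

text \<open>Such an edge would end below level \<open>m\<close> inside \<open>B\<close>. All
  continuations below the bottom vertex are thus on the side of \<open>A\<close>.\<close>

lemma B_no_down: "y \<in> reach {s'} (a (Suc m)) \<Longrightarrow> \<not> dn fw t (fb' y)"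
proof
  assume y: "y \<in> reach {s'} (a (Suc m))" and d: "dn fw t (fb' y)"
  have yB: "y \<in> B" using s'_comp[OF ai(1) abm(1)] y by auto
  then have "fb' y \<in> B" by (rule comp_props(2)[OF ai(1)])
  moreover have "t (fb' y) = m" using L'.lab[of y] yB AE L'.head_reach[OF abmE(1) y] abmE by auto
  ultimately show False using B_low[of "fb' y"] d unfolding dn_def by auto
qed

lemma subA: "sublab E fw fb' t A 0"
  by unfold_locales (use comp_props[OF ai(2)] in auto)

lemma B_ge: "x \<in> B \<Longrightarrow> m \<le> t x"
proof -
  assume x: "x \<in> B"
  then have "inv fw x \<in> B" using reach_back[OF L'.bijs_wb, of fw "a i" "inv fw x"] AE ai by auto
  then show ?thesis using B_low[of "inv fw x"] by force
qed

lemma subB: "sublab E fw fb' t B m"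
  by unfold_locales (use comp_props[OF ai(1)] B_ge in auto)

lemma order': "x \<in> E \<Longrightarrow> (fb' ^^ p) x = x"
  using order[of "T x"] by (simp add: swp_pow)

text \<open>For the half of the bottom vertex in \<open>A\<close>: the old vertex had a down-edge,
  after the swap it belongs to one of the two halves, and \<open>B_no_down\<close> rules out the
  other one. Elsewhere \<open>down_transfer\<close> suffices.\<close>

lemma down_A: "x \<in> A \<Longrightarrow> 0 < t (fw x) \<Longrightarrow> \<exists>y\<in>reach {s'} x. dn fw t (fb' y)"
proof -
  assume x: "x \<in> A" "0 < t (fw x)"
  then have xE: "x \<in> E" using AE by auto
  show ?thesis
  proof (cases "t (fw x) = m \<and> b (Suc m) \<in> reach {s'} x")
    case True
    then have r: "reach {s'} (b (Suc m)) = reach {s'} x" by (intro reach_eq[OF L'.bijs_s xE]) auto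
    obtain y where y: "y \<in> reach {s} (a (Suc m))" "dn fw t (fb y)" using down[of "a (Suc m)"] abmE True x by auto
    have "y \<in> lev m" using head_reach[OF abmE(1) y(1)] reach_sub[OF bijs_s abmE(1)] y abmE by auto
    then have "T y \<in> reach {s'} (a (Suc m)) \<union> reach {s'} (b (Suc m))"
      using T_lev[of y m] mi bot_closed[of y] y by (auto simp: transpose_def)
    moreover have "dn fw t (fb' (T y))" using y by simp
    ultimately have "T y \<in> reach {s'} (b (Suc m))" using B_no_down by blast
    then show ?thesis using \<open>dn fw t (fb' (T y))\<close> r by blast
  next
    case False
    show ?thesis
      by (rule down_transfer[OF xE]) (use False down x xE s'_comp[OF ai(2) x(1)] abm disj in auto)
  qed
qed

lemma lconst_A: "lconst A (res A fw) (res A fb') (lres A 0 t) p"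
proof -
  interpret S: sublab E fw fb' t A 0 by (rule subA)
  show ?thesis
  proof unfold_locales
    fix x assume x: "x \<in> A"
    then have xE: "x \<in> E" using AE by auto
    have "(S.fbC ^^ k) x = (fb' ^^ k) x \<and> (fb' ^^ k) x \<in> A" for k
      by (induction k) (use x S.Cb in \<open>auto simp: res_def simp del: swp_apply\<close>)
    then show "(S.fbC ^^ p) x = x" using order'[OF xE] by simp
    show "S.tC (S.fwC x) + 1 = S.tC x \<or> S.tC (S.fwC x) + 1 = S.tC x + p"
      using S.tC[OF x] S.tC_head[OF x] step[OF xE] by auto
    show "y \<in> reach {S.fwC, S.fbC} x" if "y \<in> A" for y
      using S.reachC_wb[OF x] reach_eq[OF L'.bijs_wb ai(2) x] that by auto
    show "0 < S.tC (S.fwC x) \<Longrightarrow> \<exists>y\<in>reach {sig S.fwC S.fbC} x. dn S.fwC S.tC (S.fbC y)"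
    proof -
      assume "0 < S.tC (S.fwC x)"
      then obtain y where y: "y \<in> reach {s'} x" "dn fw t (fb' y)" using down_A[OF x] S.tC_head[OF x] by auto
      have "y \<in> A" using s'_comp[OF ai(2) x] y by auto
      then have "dn S.fwC S.tC (S.fbC y)" using S.dnC[OF S.Cb] y by (simp add: res_def del: swp_apply)
      then show ?thesis using y S.reachC_s[OF x] by auto
    qed
    show "y \<in> reach {sig S.fwC S.fbC} x" if y: "y \<in> A" and h: "S.tC (S.fwC x) = 0" "S.tC (S.fwC y) = 0" for y
    proof -
      have yE: "y \<in> E" using y AE by auto
      have h': "t (fw x) = 0" "t (fw y) = 0" using h S.tC_head x y by auto
      have "y \<in> reach {s'} x"
      proof (cases "m = 0")
        case True
        have "z \<in> reach {s'} (b (Suc m))" if "z \<in> A" "t (fw z) = 0" for z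
          using head0[of z] that True AE s'_comp[OF ai(1) abm(1)] disj by auto
        then show ?thesis using x y h' reach_eq[OF L'.bijs_s abmE(2), of x] by auto
      next
        case False
        then show ?thesis using uniq[OF xE yE h'] lev_reach_other[of 0 x] h' xE by auto
      qed
      then show ?thesis using S.reachC_s[OF x] by auto
    qed
  next
    show "2 \<le> p" by (rule p2)
    show "cyc S.fwC A + cyc S.fbC A + cyc (sig S.fwC S.fbC) A = card A + 2"
      using S.cycC euler_AB by simp
    obtain g where "g \<in> A" "t (fw g) = 0" by (rule root_A)
    then show "\<exists>z\<in>A. S.tC (S.fwC z) = 0" using S.tC_head by force
  qed (auto simp: lres_def)
qed

text \<open>The bottom vertex becomes the pointed vertex of \<open>B\<close>, hence the shift of the
  labels by \<open>m\<close>.\<close>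

lemma lconst_B: "lconst B (res B fw) (res B fb') (lres B m t) p"
proof -
  interpret S: sublab E fw fb' t B m by (rule subB)
  show ?thesis
  proof unfold_locales
    fix x assume x: "x \<in> B"
    then have xE: "x \<in> E" using AE by auto
    have "(S.fbC ^^ k) x = (fb' ^^ k) x \<and> (fb' ^^ k) x \<in> B" for k
      by (induction k) (use x S.Cb in \<open>auto simp: res_def simp del: swp_apply\<close>)
    then show "(S.fbC ^^ p) x = x" using order'[OF xE] by simp
    show "S.tC (S.fwC x) + 1 = S.tC x \<or> S.tC (S.fwC x) + 1 = S.tC x + p"
      using S.tC[OF x] S.tC_head[OF x] step[OF xE] by auto
    show "y \<in> reach {S.fwC, S.fbC} x" if "y \<in> B" for y
      using S.reachC_wb[OF x] reach_eq[OF L'.bijs_wb ai(1) x] that by auto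
    show "0 < S.tC (S.fwC x) \<Longrightarrow> \<exists>y\<in>reach {sig S.fwC S.fbC} x. dn S.fwC S.tC (S.fbC y)"
    proof -
      assume "0 < S.tC (S.fwC x)"
      then have gt: "m < t (fw x)" using S.tC_head[OF x] by auto
      then obtain y where y: "y \<in> reach {s'} x" "dn fw t (fb' y)" 
        using down_transfer[OF xE down[OF xE]] by auto
      have "y \<in> B" using s'_comp[OF ai(1) x] y by auto
      then have "dn S.fwC S.tC (S.fbC y)" using S.dnC[OF S.Cb] y by (simp add: res_def del: swp_apply)
      then show ?thesis using y S.reachC_s[OF x] by auto
    qed
    show "y \<in> reach {sig S.fwC S.fbC} x" if y: "y \<in> B" and h: "S.tC (S.fwC x) = 0" "S.tC (S.fwC y) = 0" for y
    proof -
      have h': "t (fw x) = m" "t (fw y) = m" using h S.tC_head x y by force+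
      then have "x \<in> reach {s'} (a (Suc m))" "y \<in> reach {s'} (a (Suc m))" using B_low x y by auto
      then have "y \<in> reach {s'} x" using reach_eq[OF L'.bijs_s abmE(1), of x] by auto
      then show ?thesis using S.reachC_s[OF x] by auto
    qed
  next
    show "2 \<le> p" by (rule p2)
    show "cyc S.fwC B + cyc S.fbC B + cyc (sig S.fwC S.fbC) B = card B + 2"
      using S.cycC euler_AB by simp
    show "\<exists>z\<in>B. S.tC (S.fwC z) = 0" using S.tC_head[OF abm(1)] abmE abm by force
  qed (auto simp: lres_def)
qed

end

section \<open>Gluing a region into a map\<close>

lemma sublab_cong_res:
  assumes "f permutes A" "A \<inter> B = {}"
  shows "res A (\<lambda>x. if x \<in> B then g x else f x) = f"
  using assms permutes_not_in[OF assms(1)] by (auto simp: res_def fun_eq_iff)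

lemma permutes_disjoint_union:
  assumes "f permutes A" "g permutes B" "A \<inter> B = {}"
  shows "(\<lambda>x. if x \<in> B then g x else f x) permutes A \<union> B"
proof -
  have "x \<notin> A" if "x \<in> B" for x using that assms(3) by auto
  then have "(\<lambda>x. if x \<in> B then g x else f x) = f \<circ> g"
    using permutes_not_in[OF assms(1)] permutes_not_in[OF assms(2)] permutes_in_image[OF assms(2)]
    by (auto simp: fun_eq_iff)
  moreover have "f \<circ> g permutes A \<union> B"
    using permutes_subset[OF assms(1), of "A \<union> B"] permutes_subset[OF assms(2), of "A \<union> B"]
    by (intro permutes_compose) auto
  ultimately show ?thesis by simp
qed

text \<open>The converse of \<open>cut\<close>: \<open>fb\<close> is now the disjoint union of two
  maps, and the swap joins them. That \<open>e\<close> has the same successor around its black and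
  its white face marks the place in \<open>A\<close> where the seam opens for
  \<open>B\<close>.\<close>

locale gluez = zip E fw fb t a b m i for E :: "'a set" and fw fb t a b m i +
  fixes A B :: "'a set" and p e
  assumes AB: "E = A \<union> B" and disj: "A \<inter> B = {}"
    and LA: "lconst A (res A fw) (res A fb) (lres A 0 t) p"
    and LB: "lconst B (res B fw) (res B fb) (lres B m t) p"
    and subA: "sublab E fw fb t A 0" and subB: "sublab E fw fb t B m"
    and eA: "e \<in> A" and fbe: "fb e = b i" and fwe: "fw e = b i"
    and aB: "\<And>k. m < k \<Longrightarrow> k \<le> i \<Longrightarrow> a k \<in> B" and bA: "\<And>k. m < k \<Longrightarrow> k \<le> i \<Longrightarrow> b k \<in> A"
    and outE: "\<And>x. x \<notin> E \<Longrightarrow> t x = 0"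
begin

sublocale SA: sublab E fw fb t A 0 by (rule subA)
sublocale SB: sublab E fw fb t B m by (rule subB)
sublocale LA: lconst A "res A fw" "res A fb" "lres A 0 t" p by (rule LA)
sublocale LB: lconst B "res B fw" "res B fb" "lres B m t" p by (rule LB)

lemma eE: "e \<in> E" using eA AB by auto

lemma Te: "T e = e" by (rule T_top[OF eE]) (use fwe ab mi in auto)

lemma fb'e: "fb' e = a i" using Te fbe mi by simp

lemma abm: "a (Suc m) \<in> B" "b (Suc m) \<in> A" "a (Suc m) \<in> E" "b (Suc m) \<in> E"
   "t (fw (a (Suc m))) = m" "t (fw (b (Suc m))) = m"
  using ab_lev[of m] mi aB[of "Suc m"] bA[of "Suc m"] by auto

lemma reach_AB: "x \<in> A \<Longrightarrow> reach {s} x \<subseteq> A" "x \<in> B \<Longrightarrow> reach {s} x \<subseteq> B"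
  by (rule reach_least; use SA.sC_in SB.sC_in in auto)+

lemma bot: "b (Suc m) \<in> reach {s'} (a (Suc m))"
  by (rule lev_bot_merge(1)) (use reach_AB(2)[OF abm(1)] abm disj in auto)

lemma xaB: "xa i \<in> B"
proof -
  have f: "finite B" "B \<subseteq> E" using fin AB by auto
  have "a i \<in> B" using aB mi by auto
  then show ?thesis
    using closed_back[of E fb B "xa i"] f fin permutes_inj[OF fb] SB.Cb ab[of i] mi
    by (auto simp: inj_on_def)
qed

lemma xbA: "xb i = e"
  using fbe inv_inv(2)[of e] by simp

lemma topm: "xb i \<in> reach {s'} (xa i)"
  by (rule lev_top_merge) (use reach_AB(2)[OF xaB] xbA eA disj in auto)

text \<open>Seen from the glued map, swapping back splits the top and the bottom vertex, so the
  disjoint union has two vertices more. Its own total is \<open>card E + 4\<close>, from two maps of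
  genus zero.\<close>

lemma euler': "cyc fw E + cyc fb' E + cyc s' E = card E + 2"
proof -
  interpret Z: zip E fw fb' t a b m i by (rule zip')
  have "xa i \<in> reach {s'} (xb i)"
    by (rule reach_sym[OF L'.bijs_s _ topm]) (use xab[of i] mi in auto)
  then have "cyc (sig fw (swp T fb')) E = cyc s' E + 2"
    by (intro Z.cyc_s'_split[unfolded xa' xb'] bot)
  then have c: "cyc s E = cyc s' E + 2" by (simp only: fb'_back)
  have fAB: "finite A" "finite B" using fin AB by auto
  have *: "cyc f E = cyc f A + cyc f B" if "f \<in> {fw, fb, s}" for f
  proof -
    have "f permutes E" using that fw fb s_perm by auto
    then have i: "inj_on f Z" for Z using permutes_inj by (auto simp: inj_on_def)
    have "f ` A \<subseteq> A" "f ` B \<subseteq> B"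
      using that SA.Cw SA.Cb SA.sC_in SB.Cw SB.Cb SB.sC_in by auto
    then have "f ` A = A" "f ` B = B" using endo_inj_surj[OF fAB(1) _ i] endo_inj_surj[OF fAB(2) _ i] by auto
    then have "bijs {f} A" "bijs {f} B" using i fAB by (auto simp: bijs_def bij_betw_def)
    then show ?thesis unfolding AB by (rule ncomp_Un[OF _ _ disj])
  qed
  have "card E = card A + card B" using fAB disj AB card_Un_disjoint by auto
  then have "cyc fw E + cyc fb E + cyc s E = card E + 4"
    using *[of fw] *[of fb] *[of s] LA.euler LB.euler SA.cycC SB.cycC by simp
  then show ?thesis using c cyc_fb' by simp
qed

text \<open>\<open>fw e\<close> starts the path \<open>b\<close> and \<open>fb' e\<close> starts the
  path \<open>a\<close>, so the set reached from \<open>e\<close> contains both paths. It is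
  therefore closed under \<open>T\<close>, hence under the old \<open>fb\<close>.\<close>

lemma conn': "x \<in> E \<Longrightarrow> x \<in> reach {fw, fb'} e"
proof -
  let ?R = "reach {fw, fb'} e"
  have ai: "a i \<in> ?R" using reach_step[of e "{fw,fb'}" e fb'] fb'e by auto
  have bi: "b i \<in> ?R" using reach_step[of e "{fw,fb'}" e fw] fwe by auto
  have Tc: "T z \<in> ?R" if "z \<in> ?R" for z
  proof (cases "T z = z")
    case False
    then have k: "m < t z" "t z \<le> i" "z = a (t z) \<or> z = b (t z)" using T_moved by blast+
    have "a (t z) \<in> ?R" "b (t z) \<in> ?R"
      using reach_trans[OF ai reach'_a[OF k(1,2)]] reach_trans[OF bi reach'_b[OF k(1,2)]] by auto
    then show ?thesis using k T_a[of "t z"] T_b[of "t z"] by metis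
  qed (use that in auto)
  have wc: "fw z \<in> ?R" if "z \<in> ?R" for z using that by (auto intro: reach_step)
  have bc: "fb z \<in> ?R" if "z \<in> ?R" for z
  proof -
    have "fb' (T z) \<in> ?R" using reach_step[OF Tc[OF that], of fb'] by auto
    then have "T (fb' (T z)) \<in> ?R" by (rule Tc)
    then show ?thesis by simp
  qed
  have cl: "reach {fw, fb} z \<subseteq> ?R" if "z \<in> ?R" for z
    by (rule reach_least) (use that wc bc in auto)
  assume "x \<in> E"
  then consider "x \<in> A" | "x \<in> B" using AB by auto
  then show "x \<in> ?R"
  proof cases
    case 1
    then have "x \<in> reach {fw, fb} e" using LA.conn[OF eA 1] SA.reachC_wb[OF eA] by auto
    then show ?thesis using cl[of e] by auto
  next
    case 2
    have aiB: "a i \<in> B" using aB mi by auto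
    have "x \<in> reach {fw, fb} (a i)" using LB.conn[OF aiB 2] SB.reachC_wb[OF aiB] by auto
    then show ?thesis using cl[OF ai] by auto
  qed
qed

text \<open>The merged bottom vertex inherits its down-edge from \<open>A\<close>, because the side
  of \<open>B\<close> has label \<open>0\<close> there.\<close>

lemma down_b: "0 < m \<Longrightarrow> \<exists>y\<in>reach {s'} (b (Suc m)). dn fw t (fb' y)"
proof -
  assume "0 < m"
  then have "0 < SA.tC (SA.fwC (b (Suc m)))" using SA.tC_head[of "b (Suc m)"] abm by auto
  then obtain y where y: "y \<in> reach {SA.C.s} (b (Suc m))" "dn SA.fwC SA.tC (SA.fbC y)"
    using LA.down[OF abm(2)] by auto
  have y1: "y \<in> reach {s} (b (Suc m))" using y SA.reachC_s[OF abm(2)] by auto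
  then have yA: "y \<in> A" using reach_AB(1)[OF abm(2)] by auto
  have d: "dn fw t (fb y)" using y(2) SA.dnC[OF SA.Cb[OF yA]] yA by (simp add: res_def)
  have y2: "y \<in> reach {s'} (b (Suc m))" using lev_bot_merge(2)[of "b (Suc m)"] y1 abm
      reach_AB(2)[OF abm(1)] disj by auto
  have y3: "t (fw y) = m" "y \<in> E" using head_reach[OF abm(4) y1] abm yA AB by auto
  have "a (Suc m) \<in> reach {s'} (b (Suc m))" using reach_sym[OF L'.bijs_s abm(3) bot] .
  then have "T y \<in> reach {s'} (b (Suc m))" using T_lev[OF y3(2,1)] y2 by (auto simp: transpose_def)
  moreover have "dn fw t (fb' (T y))" using d by simp
  ultimately show ?thesis by blast
qed

lemma head_B: "x \<in> B \<Longrightarrow> m \<le> t (fw x)" using SB.tC_head[of x] by auto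

lemma B_bot: "x \<in> B \<Longrightarrow> t (fw x) = m \<Longrightarrow> x \<in> reach {s} (a (Suc m))"
  using LB.uniq[OF abm(1), of x] SB.reachC_s[OF abm(1)] SB.tC_head[of x] SB.tC_head[OF abm(1)] abm by auto

lemma merged: "z \<in> reach {s} (a (Suc m)) \<or> z \<in> reach {s} (b (Suc m)) \<Longrightarrow> z \<in> reach {s'} (b (Suc m))"
  using bot_closed[of z] reach_eq[OF L'.bijs_s abm(3) bot] by auto

lemma down': "x \<in> E \<Longrightarrow> 0 < t (fw x) \<Longrightarrow> \<exists>y\<in>reach {s'} x. dn fw t (fb' y)"
proof -
  assume x: "x \<in> E" "0 < t (fw x)"
  show ?thesis
  proof (cases "t (fw x) = m \<and> (a (Suc m) \<in> reach {s'} x \<or> b (Suc m) \<in> reach {s'} x)")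
    case True
    then have "b (Suc m) \<in> reach {s'} x" using bot reach_trans by metis
    then show ?thesis using down_b True x reach_trans by metis
  next
    case False
    have "\<exists>y\<in>reach {s} x. dn fw t (fb y)"
    proof (cases "x \<in> A")
      case True
      then have "0 < SA.tC (SA.fwC x)" using SA.tC_head x by auto
      then obtain y where y: "y \<in> reach {SA.C.s} x" "dn SA.fwC SA.tC (SA.fbC y)" using LA.down[OF True] by auto
      have y1: "y \<in> reach {s} x" using y SA.reachC_s[OF True] by auto
      then have yA: "y \<in> A" using reach_AB(1)[OF True] by auto
      show ?thesis using y(2) SA.dnC[OF SA.Cb[OF yA]] yA y1 by (auto simp: res_def)
    next
      case nA: False
      then have xB: "x \<in> B" using x AB by auto
      have "t (fw x) \<noteq> m"
      proof
        assume tm: "t (fw x) = m"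
        have "x \<in> reach {s'} (b (Suc m))" using merged B_bot[OF xB tm] by auto
        then have "b (Suc m) \<in> reach {s'} x" using reach_sym[OF L'.bijs_s abm(4)] by auto
        then show False using False tm by auto
      qed
      then have "0 < SB.tC (SB.fwC x)" using SB.tC_head[OF xB] head_B[OF xB] by auto
      then obtain y where y: "y \<in> reach {SB.C.s} x" "dn SB.fwC SB.tC (SB.fbC y)" using LB.down[OF xB] by auto
      have y1: "y \<in> reach {s} x" using y SB.reachC_s[OF xB] by auto
      then have yB: "y \<in> B" using reach_AB(2)[OF xB] by auto
      show ?thesis using y(2) SB.dnC[OF SB.Cb[OF yB]] yB y1 by (auto simp: res_def)
    qed
    then show ?thesis by (rule down_transfer[OF x(1)]) (use False in auto)
  qed
qed

lemma order': "x \<in> E \<Longrightarrow> (fb' ^^ p) x = x"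
proof -
  assume "x \<in> E"
  have "(fb ^^ p) z = z" if "z \<in> E" for z
  proof (cases "z \<in> A")
    case True
    have "(SA.fbC ^^ k) z = (fb ^^ k) z \<and> (fb ^^ k) z \<in> A" for k
      by (induction k) (use True SA.Cb in \<open>auto simp: res_def\<close>)
    then show ?thesis using LA.order[OF True] by simp
  next
    case False
    then have z: "z \<in> B" using that AB by auto
    have "(SB.fbC ^^ k) z = (fb ^^ k) z \<and> (fb ^^ k) z \<in> B" for k
      by (induction k) (use z SB.Cb in \<open>auto simp: res_def\<close>)
    then show ?thesis using LB.order[OF z] by simp
  qed
  from this[of "T x"] show ?thesis using \<open>x \<in> E\<close> by (simp add: swp_pow)
qed

lemma lconst': "lconst E fw fb' t p"
proof unfold_locales
  show "2 \<le> p" by (rule LA.p2)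
  show "(fb' ^^ p) x = x" if "x \<in> E" for x by (rule order'[OF that])
  show "t (fw x) + 1 = t x \<or> t (fw x) + 1 = t x + p" if "x \<in> E" for x
  proof (cases "x \<in> A")
    case True
    then show ?thesis using LA.step[OF True] SA.tC[OF True] SA.tC_head[OF True] by auto
  next
    case False
    then have x: "x \<in> B" using that AB by auto
    then show ?thesis using LB.step[OF x] SB.tC[OF x] SB.tC_head[OF x] by auto
  qed
  show "y \<in> reach {fw, fb'} x" if "x \<in> E" "y \<in> E" for x y
    using conn'[OF that(1)] conn'[OF that(2)] reach_sym[OF L'.bijs_wb eE, of x] reach_trans by metis
  show "cyc fw E + cyc fb' E + cyc s' E = card E + 2" by (rule euler')
  show "\<exists>y\<in>reach {s'} x. dn fw t (fb' y)" if "x \<in> E" "0 < t (fw x)" for x by (rule down'[OF that])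
  obtain z where "z \<in> A" "SA.tC (SA.fwC z) = 0" using LA.pt by auto
  then show "\<exists>z\<in>E. t (fw z) = 0" using SA.tC_head[of z] AB by force
  show "t x = 0" if "x \<notin> E" for x by (rule outE[OF that])
  show "y \<in> reach {s'} x" if xy: "x \<in> E" "y \<in> E" "t (fw x) = 0" "t (fw y) = 0" for x y
  proof (cases "m = 0")
    case True
    have "z \<in> reach {s'} (b (Suc m))" if z: "z \<in> E" "t (fw z) = 0" for z
    proof (cases "z \<in> A")
      case zA: True
      then have "z \<in> reach {s} (b (Suc m))"
        using LA.uniq[OF abm(2) zA] SA.tC_head[OF zA] SA.tC_head[OF abm(2)] abm True z SA.reachC_s[OF abm(2)] by auto
      then show ?thesis using merged by auto
    next
      case False
      then show ?thesis using merged B_bot[of z] z AB True by auto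
    qed
    then show ?thesis using xy reach_sym[OF L'.bijs_s abm(4), of x] reach_trans by metis
  next
    case False
    have "x \<in> A" "y \<in> A" using xy head_B[of x] head_B[of y] False AB by auto
    then have "y \<in> reach {s} x"
      using LA.uniq[of x y] SA.tC_head[of x] SA.tC_head[of y] xy SA.reachC_s[of x] by auto
    then show ?thesis using lev_reach_other[of 0 x] False xy by auto
  qed
qed

end

section \<open>Cutting and gluing as a bijection\<close>

definition cutdata where
  "cutdata E fw fb t e a b m \<longleftrightarrow> zip E fw fb t a b m (t (fw e)) \<and> e \<in> E \<and> fb e = a (t (fw e)) \<and>
     fw e = b (t (fw e)) \<and> b (Suc m) \<in> reach {sig fw fb} (a (Suc m))"

text \<open>A relation, since both directions are obtained by existence proofs:
  \<open>cut_thm\<close> and \<open>glue_thm\<close> provide partners, and uniqueness on both sides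
  makes it a bijection. The conditions on \<open>fw e\<close> and on the labels allow
  \<open>t\<close> and \<open>m\<close> to be recovered from the two parts.\<close>

definition cutrel where
  "cutrel E e fw fb t B fwA fbA tA fwB fbB tB \<rho> \<longleftrightarrow> (\<exists>a b m fb'. cutdata E fw fb t e a b m \<and>
     fb' = swp (tau t a b m (t (fw e))) fb \<and> \<rho> = fb e \<and> B = reach {fw, fb'} \<rho> \<and> e \<notin> B \<and> fw e \<notin> B \<and>
     (\<forall>x\<in>B. m \<le> t x) \<and> (\<forall>x. x \<notin> E \<longrightarrow> t x = 0) \<and>
     fwA = res (E - B) fw \<and> fbA = res (E - B) fb' \<and> tA = lres (E - B) 0 t \<and>
     fwB = res B fw \<and> fbB = res B fb' \<and> tB = lres B m t)"

text \<open>\<open>m\<close> is the highest level at which the two geodesics end in a common vertex.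
  Level \<open>0\<close> qualifies, because only the pointed vertex has label
  \<open>0\<close>.\<close>

lemma cutdata_exists:
  assumes "lconst E fw fb t p" "e \<in> E" "dn fw t (fb e)" "dn fw t (fw e)" "fb e \<noteq> fw e"
  shows "\<exists>a b m. cutdata E fw fb t e a b m"
proof -
  interpret lconst E fw fb t p by fact
  define i where "i = t (fw e)"
  have ti: "t (fb e) = i" "t (fw e) = i" using lab assms i_def by auto
  obtain a where a: "a i = fb e" "\<And>k. 0 < k \<Longrightarrow> k \<le> i \<Longrightarrow> a k \<in> E \<and> t (a k) = k \<and> dn fw t (a k)"
     "\<And>k. 0 < k \<Longrightarrow> k < i \<Longrightarrow> nxt fw fb t (a (Suc k)) (a k)"
    using path_exists[of "fb e"] assms ti by auto
  obtain b where b: "b i = fw e" "\<And>k. 0 < k \<Longrightarrow> k \<le> i \<Longrightarrow> b k \<in> E \<and> t (b k) = k \<and> dn fw t (b k)"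
     "\<And>k. 0 < k \<Longrightarrow> k < i \<Longrightarrow> nxt fw fb t (b (Suc k)) (b k)"
    using path_exists[of "fw e"] assms ti by auto
  have i0: "0 < i" using assms(4) i_def by (auto simp: dn_def)
  define M where "M = {m. m < i \<and> b (Suc m) \<in> reach {s} (a (Suc m))}"
  have "0 \<in> M" unfolding M_def
  proof (intro CollectI conjI i0)
    show "b (Suc 0) \<in> reach {s} (a (Suc 0))"
      by (rule uniq) (use a(2)[of "Suc 0"] b(2)[of "Suc 0"] i0 in \<open>auto simp: dn_def\<close>)
  qed
  moreover have "finite M" unfolding M_def by auto
  ultimately have m: "Max M \<in> M" "\<And>k. k \<in> M \<Longrightarrow> k \<le> Max M" by (auto intro: Max_in)
  define m where "m = Max M"
  have mi: "m < i" "b (Suc m) \<in> reach {s} (a (Suc m))" using m(1) by (auto simp: m_def M_def)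
  have ap: "b k \<notin> reach {s} (a k)" if "Suc m < k" "k \<le> i" for k
  proof
    assume "b k \<in> reach {s} (a k)"
    then have "k - 1 \<in> M" using that by (cases k) (auto simp: M_def)
    then have "k - 1 \<le> m" using m(2) m_def by simp
    then show False using that by simp
  qed
  \<comment> \<open>Equal edges at a level \<open>k < i\<close> would force the preceding edges to
    end in the same vertex of level \<open>k\<close>, against the maximality of
    \<open>m\<close>.\<close>
  have ne: "a k \<noteq> b k" if "m < k" "k \<le> i" for k
  proof (cases "k = i")
    case True then show ?thesis using a b assms by auto
  next
    case False
    then have k: "k < i" "0 < k" using that by auto
    have "inv fb (a k) \<in> reach {s} (a (Suc k))" "inv fb (b k) \<in> reach {s} (b (Suc k))"
      using nxt_lab(4)[OF a(3)] nxt_lab(4)[OF b(3)] a(2)[of "Suc k"] b(2)[of "Suc k"] k by auto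
    moreover have "b (Suc k) \<in> E" using b(2)[of "Suc k"] k by auto
    ultimately show ?thesis using ap[of "Suc k"] that k reach_sym[OF bijs_s, of "b (Suc k)"] reach_trans by (metis Suc_leI Suc_less_eq)
  qed
  have "zip E fw fb t a b m i"
    by unfold_locales (use mi ap ne a b in auto)
  then have "cutdata E fw fb t e a b m"
    unfolding cutdata_def using assms(2) a(1) b(1) mi(2) i_def by auto
  then show ?thesis by blast
qed

text \<open>With \<open>i = t (fw e)\<close> the root of \<open>B\<close> has label
  \<open>i - m\<close>, some number from \<open>1\<close> to \<open>i\<close>. This is the condition
  on the root in \<open>vmaps p B i\<close>.\<close>

lemma cut_thm:
  assumes L: "lconst E fw fb t p" and e: "e \<in> E" "dn fw t (fb e)" "dn fw t (fw e)" "fb e \<noteq> fw e"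
    and root: "\<exists>r\<in>reach {fw} e. t r = 0"
  obtains B fwA fbA tA fwB fbB tB where "cutrel E e fw fb t B fwA fbA tA fwB fbB tB (fb e)"
    "B \<subseteq> E" "reach {fw} e \<subseteq> E - B" "lconst (E - B) fwA fbA tA p" "lconst B fwB fbB tB p"
    "fbA e = fwA e" "fb e \<in> B" "dn fwB tB (fb e)" "tB (fb e) \<le> t (fw e)"
proof -
  obtain a b m where C: "cutdata E fw fb t e a b m" using cutdata_exists[OF L e] by blast
  interpret L: lconst E fw fb t p by fact
  interpret Z: zip E fw fb t a b m "t (fw e)" using C by (simp add: cutdata_def)
  interpret cut E fw fb t p a b m "t (fw e)" e
    by unfold_locales (use C root in \<open>auto simp: cutdata_def\<close>)
  interpret SB: sublab E fw Z.fb' t B m using subB by simp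
  have EB: "E - B = A" using AB disj by auto
  have fwe: "fw e \<in> A" using eb by simp
  have aiB: "fb e \<in> B" using ea by simp
  have "cutrel E e fw fb t B (res A fw) (res A Z.fb') (lres A 0 t) (res B fw) (res B Z.fb') (lres B m t) (fb e)"
    unfolding cutrel_def EB[symmetric]
    by (rule exI[of _ a], rule exI[of _ b], rule exI[of _ m], rule exI[of _ Z.fb'])
      (use C eA fwe disj B_ge L.out ea in auto)
  moreover have "reach {fw} e \<subseteq> A" by (rule reach_least) (use eA in \<open>auto intro: reach_step\<close>)
  moreover have "res A Z.fb' e = res A fw e" using fb'e by (simp add: res_def)
  moreover have "dn SB.fwC SB.tC (fb e)" using SB.dnC[OF aiB] e by simp
  moreover have "lres B m t (fb e) \<le> t (fw e)" using L.lab[OF e(1)] by (simp add: lres_def)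
  ultimately show thesis using that EB lconst_A lconst_B AE aiB by metis
qed

text \<open>The swap moves only down-edges that start at or below the level of \<open>fw e\<close>.
  By the two label conditions neither \<open>x\<close> nor its black successor is such an edge, so
  coincidences established before \<open>e\<close> on the root face survive the cut.\<close>

lemma cutrel_protect:
  assumes "cutrel E e fw fb t B fwA fbA tA fwB fbB tB \<rho>" "x \<in> E - B" "\<not> dn fw t x \<or> t (fw e) < t x" "t (fw e) < t (fw x)"
  shows "fb x = fw x \<longleftrightarrow> fbA x = fwA x"
proof -
  obtain a b m where C: "zip E fw fb t a b m (t (fw e))" "fwA = res (E - B) fw"
      "fbA = res (E - B) (swp (tau t a b m (t (fw e))) fb)"
    using assms(1) by (auto simp: cutrel_def cutdata_def)
  interpret Z: zip E fw fb t a b m "t (fw e)" by fact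
  have "Z.T x = x" using Z.T_moved[of x] assms(3) by (cases "Z.T x = x") auto
  moreover have "Z.T (fb x) = fb x" using Z.T_moved[of "fb x"] Z.lab[of x] assms(2,4) by (cases "Z.T (fb x) = fb x") auto
  ultimately show ?thesis using assms(2) C by (simp add: res_def)
qed

text \<open>\<open>nxt\<close> is deterministic, so paths with the same first edges agree as long as
  both last.\<close>

lemma zip_path_unique:
  assumes "zip E fw fb t a b m i" "zip E fw fb t a2 b2 m2 i" "a i = a2 i" "b i = b2 i"
    "m < k" "m2 < k" "k \<le> i"
  shows "a k = a2 k \<and> b k = b2 k"
  using assms(5-7)
proof (induction "i - k" arbitrary: k)
  case 0
  then show ?case using assms by auto
next
  case (Suc n)
  have IH: "a (Suc k) = a2 (Suc k) \<and> b (Suc k) = b2 (Suc k)" by (rule Suc(1)) (use Suc in auto)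
  have k: "k < i" using Suc by auto
  show ?case using nxt_unique[of fw fb t] zip.patha[OF assms(1), of k] zip.patha[OF assms(2), of k]
    zip.pathb[OF assms(1), of k] zip.pathb[OF assms(2), of k] IH k Suc.prems by metis
qed

lemma tau_cong: "(\<And>k. m < k \<Longrightarrow> k \<le> i \<Longrightarrow> a k = a2 k \<and> b k = b2 k) \<Longrightarrow> tau t a b m i = tau t a2 b2 m i"
  by (auto simp: tau_def fun_eq_iff)

text \<open>The geodesics are determined by their first edges \<open>fb e\<close> and
  \<open>fw e\<close>. Then \<open>m\<close> is the first level from above at which they meet, by
  \<open>apart\<close> and the last condition of \<open>cutdata\<close>.\<close>

lemma cutrel_right_unique:
  assumes "cutrel E e fw fb t B fwA fbA tA fwB fbB tB \<rho>" "cutrel E e fw fb t B2 fwA2 fbA2 tA2 fwB2 fbB2 tB2 \<rho>2"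
  shows "(B, fwA, fbA, tA, fwB, fbB, tB, \<rho>) = (B2, fwA2, fbA2, tA2, fwB2, fbB2, tB2, \<rho>2)"
proof -
  let ?i = "t (fw e)"
  obtain a b m where C: "cutdata E fw fb t e a b m" "\<rho> = fb e" "B = reach {fw, swp (tau t a b m ?i) fb} \<rho>"
      "fwA = res (E - B) fw" "fbA = res (E - B) (swp (tau t a b m ?i) fb)" "tA = lres (E - B) 0 t"
      "fwB = res B fw" "fbB = res B (swp (tau t a b m ?i) fb)" "tB = lres B m t"
    using assms(1) unfolding cutrel_def by blast
  obtain a2 b2 m2 where C2: "cutdata E fw fb t e a2 b2 m2" "\<rho>2 = fb e" "B2 = reach {fw, swp (tau t a2 b2 m2 ?i) fb} \<rho>2"
      "fwA2 = res (E - B2) fw" "fbA2 = res (E - B2) (swp (tau t a2 b2 m2 ?i) fb)" "tA2 = lres (E - B2) 0 t"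
      "fwB2 = res B2 fw" "fbB2 = res B2 (swp (tau t a2 b2 m2 ?i) fb)" "tB2 = lres B2 m2 t"
    using assms(2) unfolding cutrel_def by blast
  have z: "zip E fw fb t a b m ?i" "zip E fw fb t a2 b2 m2 ?i" "a ?i = a2 ?i" "b ?i = b2 ?i"
    using C(1) C2(1) by (auto simp: cutdata_def)
  have mm: "\<not> m < m2"
  proof
    assume l: "m < m2"
    then have "a (Suc m2) = a2 (Suc m2) \<and> b (Suc m2) = b2 (Suc m2)"
      using zip_path_unique[OF z, of "Suc m2"] zip.mi[OF z(2)] by auto
    then show False using zip.apart[OF z(1), of "Suc m2"] l zip.mi[OF z(2)] C2(1) by (auto simp: cutdata_def)
  qed
  have mm2: "\<not> m2 < m"
  proof
    assume l: "m2 < m"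
    then have "a (Suc m) = a2 (Suc m) \<and> b (Suc m) = b2 (Suc m)"
      using zip_path_unique[OF z, of "Suc m"] zip.mi[OF z(1)] by auto
    then show False using zip.apart[OF z(2), of "Suc m"] l zip.mi[OF z(1)] C(1) by (auto simp: cutdata_def)
  qed
  then have meq: "m = m2" using mm by auto
  then have "tau t a b m ?i = tau t a2 b2 m2 ?i"
    using tau_cong[of m ?i a a2 b b2 t] zip_path_unique[OF z] by auto
  then show ?thesis using C C2 meq by simp
qed

text \<open>The parts determine \<open>fw\<close> and the swapped \<open>fb'\<close>; the level
  \<open>i\<close> is read off at \<open>fw e\<close>, and the label of \<rho> then gives
  \<open>m\<close>. By \<open>zip'\<close> the paths are geodesics for \<open>fb'\<close> as well,
  so they are determined together with \<open>T\<close>, and swapping back yields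
  \<open>fb\<close>.\<close>

lemma cutrel_left_unique:
  assumes "cutrel E e fw fb t B fwA fbA tA fwB fbB tB \<rho>" "cutrel E e fw2 fb2 t2 B fwA fbA tA fwB fbB tB \<rho>"
  shows "(fw, fb, t) = (fw2, fb2, t2)"
proof -
  let ?i = "t (fw e)" and ?i2 = "t2 (fw2 e)"
  obtain a b m fb' where C: "cutdata E fw fb t e a b m" "fb' = swp (tau t a b m ?i) fb" "\<rho> = fb e" "B = reach {fw, fb'} \<rho>"
      "e \<notin> B" "fw e \<notin> B" "\<forall>x\<in>B. m \<le> t x" "\<forall>x. x \<notin> E \<longrightarrow> t x = 0"
      "fwA = res (E - B) fw" "fbA = res (E - B) fb'" "tA = lres (E - B) 0 t"
      "fwB = res B fw" "fbB = res B fb'" "tB = lres B m t"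
    using assms(1) unfolding cutrel_def by blast
  obtain a2 b2 m2 fb2' where C2: "cutdata E fw2 fb2 t2 e a2 b2 m2" "fb2' = swp (tau t2 a2 b2 m2 ?i2) fb2" "\<rho> = fb2 e" "B = reach {fw2, fb2'} \<rho>"
      "e \<notin> B" "fw2 e \<notin> B" "\<forall>x\<in>B. m2 \<le> t2 x" "\<forall>x. x \<notin> E \<longrightarrow> t2 x = 0"
      "fwA = res (E - B) fw2" "fbA = res (E - B) fb2'" "tA = lres (E - B) 0 t2"
      "fwB = res B fw2" "fbB = res B fb2'" "tB = lres B m2 t2"
    using assms(2) unfolding cutrel_def by blast
  interpret Z: zip E fw fb t a b m ?i using C(1) by (simp add: cutdata_def)
  interpret Z2: zip E fw2 fb2 t2 a2 b2 m2 ?i2 using C2(1) by (simp add: cutdata_def)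
  have eE: "e \<in> E" "a ?i = \<rho>" "b ?i = fw e" "a2 ?i2 = \<rho>" "b2 ?i2 = fw2 e" using C C2 by (auto simp: cutdata_def)
  have \<rho>B: "\<rho> \<in> B" "\<rho> \<in> E" using C(4) Z.ab[of ?i] Z.mi eE by auto
  have weq: "f = g" if "f permutes E" "g permutes E" "res (E - B) f = res (E - B) g" "res B f = res B g" for f g
  proof
    fix x
    show "f x = g x" using fun_cong[OF that(3), of x] fun_cong[OF that(4), of x]
        permutes_not_in[OF that(1), of x] permutes_not_in[OF that(2), of x]
      by (cases "x \<in> E"; cases "x \<in> B") (auto simp: res_def)
  qed
  have fweq: "fw = fw2" by (rule weq) (use Z.fw Z2.fw C C2 in auto)
  have fb'eq: "fb' = fb2'" by (rule weq) (use Z.fb'_perm Z2.fb'_perm C(2,10,13) C2(2,10,13) in auto)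
  have fwe: "fw e \<in> E - B" using C(6) eE by simp
  have "tA (fw e) = ?i" unfolding C(11) lres_def using fwe by simp
  moreover have "tA (fw e) = ?i2" unfolding C2(11) lres_def using fwe fweq by simp
  ultimately have ieq: "?i = ?i2" by simp
  have "t \<rho> = ?i" "t2 \<rho> = ?i2" using Z.ab[of ?i] Z.mi Z2.ab[of ?i2] Z2.mi eE by auto
  moreover have "t \<rho> - m = t2 \<rho> - m2" using C(14) C2(14) \<rho>B by (metis lres_def)
  ultimately have meq: "m = m2" using ieq Z.mi Z2.mi by linarith
  have teq: "t = t2"
  proof
    fix x
    show "t x = t2 x"
    proof (cases "x \<in> B")
      case True
      then have "t x - m = t2 x - m" using C(14) C2(14) meq by (metis lres_def)
      then show ?thesis using C(7) C2(7) True meq by (metis eq_diff_iff)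
    next
      case False
      then show ?thesis using C(8,11) C2(8,11) by (metis DiffI diff_zero lres_def)
    qed
  qed
  have z: "zip E fw fb' t a b m ?i" "zip E fw fb' t a2 b2 m ?i"
    using Z.zip' Z2.zip' C(2) C2(2) fb'eq meq teq fweq by auto
  have ab: "a ?i = a2 ?i" "b ?i = b2 ?i" using eE ieq fweq by auto
  have "tau t a b m ?i = tau t a2 b2 m ?i"
    by (rule tau_cong) (use zip_path_unique[OF z ab] in auto)
  then have "fb = fb2" using Z.fb'_back Z2.fb'_back C(2) C2(2) fb'eq ieq meq teq by metis
  then show ?thesis using fweq teq by simp
qed

lemma glue_thm:
  assumes LA: "lconst A fwA fbA tA p" and LB: "lconst B fwB fbB tB p" and disj: "A \<inter> B = {}"
    and e: "e \<in> A" "fbA e = fwA e" "dn fwA tA (fwA e)"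
    and \<rho>: "\<rho> \<in> B" "dn fwB tB \<rho>" "tB \<rho> \<le> tA (fwA e)"
  obtains fw fb t where "cutrel (A \<union> B) e fw fb t B fwA fbA tA fwB fbB tB \<rho>" "lconst (A \<union> B) fw fb t p"
    "dn fw t (fb e)" "fb e \<noteq> fw e"
proof -
  interpret A: lconst A fwA fbA tA p by fact
  interpret B: lconst B fwB fbB tB p by fact
  let ?E = "A \<union> B"
  define fw where "fw = (\<lambda>x. if x \<in> B then fwB x else fwA x)"
  define fb0 where "fb0 = (\<lambda>x. if x \<in> B then fbB x else fbA x)"
  define i where "i = tA (fwA e)"
  \<comment> \<open>Raising the labels of \<open>B\<close> by this amount makes \<rho> start at the
    level of \<open>fwA e\<close>, where the other path starts.\<close>
  define m where "m = i - tB \<rho>"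
  define t where "t = (\<lambda>x. if x \<in> B then tB x + m else tA x)"
  have nA: "x \<in> A \<Longrightarrow> x \<notin> B" and nB: "x \<in> B \<Longrightarrow> x \<notin> A" for x using disj by auto
  have BA: "B \<inter> A = {}" using disj by auto
  have rA: "res A fw = fwA" "res A fb0 = fbA"
    unfolding fw_def fb0_def by (rule sublab_cong_res[OF A.fw disj], rule sublab_cong_res[OF A.fb disj])
  have rB: "res B fw = fwB" "res B fb0 = fbB"
    unfolding fw_def fb0_def using permutes_not_in[OF B.fw] permutes_not_in[OF B.fb] by (auto simp: res_def fun_eq_iff)
  have lA: "lres A 0 t = tA" unfolding t_def lres_def using nA A.out by (auto simp: fun_eq_iff)
  have lB: "lres B m t = tB" unfolding t_def lres_def using B.out by (auto simp: fun_eq_iff)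
  have lab0: "labelled ?E fw fb0 t"
  proof unfold_locales
    show "finite ?E" using A.fin B.fin by simp
    show "fw permutes ?E" unfolding fw_def by (rule permutes_disjoint_union[OF A.fw B.fw disj])
    show "fb0 permutes ?E" unfolding fb0_def by (rule permutes_disjoint_union[OF A.fb B.fb disj])
    show "t (fb0 x) = t (fw x)" if "x \<in> ?E" for x
      using that A.lab B.lab nA by (auto simp: t_def fb0_def fw_def)
  qed
  interpret L0: labelled ?E fw fb0 t by (rule lab0)
  interpret SA: sublab ?E fw fb0 t A 0
    by unfold_locales (use nA in \<open>auto simp: fw_def fb0_def\<close>)
  interpret SB: sublab ?E fw fb0 t B m
    by unfold_locales (auto simp: fw_def fb0_def t_def)
  note dA = SA.dnC[unfolded rA lA] and nxA = SA.nxtC[unfolded rA lA]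
  note dB = SB.dnC[unfolded rB lB] and nxB = SB.nxtC[unfolded rB lB]
  have t\<rho>: "0 < tB \<rho>" "tB \<rho> \<le> i" using \<rho> by (auto simp: dn_def i_def)
  obtain b where b: "b i = fwA e" "\<And>k. 0 < k \<Longrightarrow> k \<le> i \<Longrightarrow> b k \<in> A \<and> tA (b k) = k \<and> dn fwA tA (b k)"
     "\<And>k. 0 < k \<Longrightarrow> k < i \<Longrightarrow> nxt fwA fbA tA (b (Suc k)) (b k)"
    using A.path_exists[of "fwA e"] e i_def by auto
  obtain a0 where a0: "a0 (tB \<rho>) = \<rho>" "\<And>k. 0 < k \<Longrightarrow> k \<le> tB \<rho> \<Longrightarrow> a0 k \<in> B \<and> tB (a0 k) = k \<and> dn fwB tB (a0 k)"
     "\<And>k. 0 < k \<Longrightarrow> k < tB \<rho> \<Longrightarrow> nxt fwB fbB tB (a0 (Suc k)) (a0 k)"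
    using B.path_exists[of \<rho>] \<rho> by auto
  define a where "a = (\<lambda>k. a0 (k - m))"
  have im: "m < i" "i - m = tB \<rho>" using t\<rho> m_def by auto
  have aB: "a k \<in> B \<and> t (a k) = k \<and> dn fw t (a k)" if "m < k" "k \<le> i" for k
    using a0(2)[of "k - m"] that im dB[of "a k"] by (auto simp: a_def t_def)
  have bA: "b k \<in> A \<and> t (b k) = k \<and> dn fw t (b k)" if "m < k" "k \<le> i" for k
    using b(2)[of k] that dA[of "b k"] nA[of "b k"] by (auto simp: t_def)
  interpret zip ?E fw fb0 t a b m i
  proof unfold_locales
    show "m < i" by (rule im)
    show "a k \<in> ?E \<and> b k \<in> ?E \<and> t (a k) = k \<and> t (b k) = k \<and> dn fw t (a k) \<and> dn fw t (b k) \<and> a k \<noteq> b k"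
      if "m < k" "k \<le> i" for k using aB[OF that] bA[OF that] disj by auto
    show "nxt fw fb0 t (a (Suc k)) (a k)" if "m < k" "k < i" for k
    proof -
      have "a (Suc k) \<in> B" using aB[of "Suc k"] that by auto
      moreover have "Suc k - m = Suc (k - m)" using that by auto
      then have "nxt fwB fbB tB (a (Suc k)) (a k)" using a0(3)[of "k - m"] that im by (auto simp: a_def)
      ultimately show ?thesis using nxB by auto
    qed
    show "nxt fw fb0 t (b (Suc k)) (b k)" if "m < k" "k < i" for k
      using b(3)[of k] nxA[of "b (Suc k)"] b(2)[of "Suc k"] that by auto
    \<comment> \<open>The two paths lie in different components, so they share no vertex at any
      level.\<close>
    show "b k \<notin> reach {sig fw fb0} (a k)" if "Suc m < k" "k \<le> i" for k
    proof -
      have "reach {sig fw fb0} (a k) \<subseteq> B"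
        by (rule reach_least) (use aB[of k] that SB.sC_in in auto)
      then show ?thesis using bA[of k] that disj by auto
    qed
  qed
  have fwe: "fw e = b i" "fb0 e = b i" using b(1) e nA by (auto simp: fw_def fb0_def)
  interpret G: gluez ?E fw fb0 t a b m i A B p e
  proof unfold_locales
    show "?E = A \<union> B" "A \<inter> B = {}" "e \<in> A" "fb0 e = b i" "fw e = b i" using disj e fwe by auto
    show "a k \<in> B" if "m < k" "k \<le> i" for k using aB[OF that] by auto
    show "b k \<in> A" if "m < k" "k \<le> i" for k using bA[OF that] by auto
    show "t x = 0" if "x \<notin> ?E" for x using that A.out by (auto simp: t_def)
  qed (use LA LB SA.sublab_axioms SB.sublab_axioms in \<open>simp_all add: rA rB lA lB lconst_def lconst_axioms_def sublab_def sublab_axioms_def labelled_def\<close>)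
  have ai: "a i = \<rho>" using a0(1) im by (simp add: a_def)
  have ti: "t (fw e) = i" using ab[of i] mi fwe by auto
  have "zip ?E fw fb' t a b m i" by (rule zip')
  then have C: "cutdata ?E fw fb' t e a b m"
    unfolding cutdata_def ti using e G.fb'e fwe G.bot by auto
  have EB: "?E - B = A" using disj by auto
  have cl: "reach {fw, fb0} \<rho> = B"
  proof
    show "reach {fw, fb0} \<rho> \<subseteq> B" by (rule reach_least) (use \<rho> SB.Cw SB.Cb in auto)
    show "B \<subseteq> reach {fw, fb0} \<rho>" using B.conn[OF \<rho>(1)] SB.reachC_wb[OF \<rho>(1), unfolded rB] by auto
  qed
  have "cutrel ?E e fw fb' t B fwA fbA tA fwB fbB tB \<rho>"
    unfolding cutrel_def ti
  proof (rule exI[of _ a], rule exI[of _ b], rule exI[of _ m], rule exI[of _ fb0], intro conjI)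
    show "cutdata ?E fw fb' t e a b m" by (rule C)
    show "fb0 = swp T fb'" by (rule fb'_back[symmetric])
    show "\<rho> = fb' e" using G.fb'e ai by simp
    show "B = reach {fw, fb0} \<rho>" using cl by simp
    show "e \<notin> B" using e disj by auto
    show "fw e \<notin> B" using fwe bA[of i] mi disj by auto
    show "\<forall>x\<in>B. m \<le> t x" by (auto simp: t_def)
    show "\<forall>x. x \<notin> ?E \<longrightarrow> t x = 0" using G.outE by auto
  qed (use EB rA rB lA lB in auto)
  moreover have "dn fw t (fb' e)" "fb' e \<noteq> fw e" using G.fb'e fwe ab[of i] mi by auto
  ultimately show thesis using that G.lconst' by blast
qed

section \<open>Orbit lengths, black faces and bounds on labels\<close>

lemma orbit_period:
  assumes "finite E" "bij_betw f E E" "x \<in> E"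
  defines "N \<equiv> card (reach {f} x)"
  shows "(f ^^ N) x = x" "inj_on (\<lambda>k. (f ^^ k) x) {..<N}" "reach {f} x = (\<lambda>k. (f ^^ k) x) ` {..<N}" "0 < N"
proof -
  have F: "bijs {f} E" using assms by (simp add: bijs_def)
  have "x \<in> reach {f} (f x)" by (rule reach_sym[OF F assms(3)]) (auto intro: reach_step)
  then obtain k where "x = (f ^^ k) (f x)" by (rule reach_powerE)
  then have "(f ^^ Suc k) x = x" by (simp add: funpow_swap1)
  then obtain M where M: "(f ^^ Suc M) x = x" "\<And>k. k < M \<Longrightarrow> (f ^^ Suc k) x \<noteq> x"
    using exists_least_iff[of "\<lambda>k. (f ^^ Suc k) x = x"] by blast
  have inj: "inj_on (\<lambda>k. (f ^^ k) x) {..<Suc M}"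
  proof (rule linorder_inj_onI)
    fix i j assume ij: "i < j" "i \<in> {..<Suc M}" "j \<in> {..<Suc M}"
    show "(f ^^ i) x \<noteq> (f ^^ j) x"
    proof
      assume e: "(f ^^ i) x = (f ^^ j) x"
      have "(f ^^ (Suc M - j + i)) x = (f ^^ (Suc M - j)) ((f ^^ j) x)" using e by (simp add: funpow_add)
      also have "\<dots> = (f ^^ (Suc M - j + j)) x" by (simp only: funpow_add o_apply)
      also have "\<dots> = x" using M(1) ij by simp
      finally have "(f ^^ (Suc M - j + i)) x = x" .
      moreover have "Suc M - j + i = Suc (M - j + i)" "M - j + i < M" using ij by auto
      ultimately show False using M(2)[of "M - j + i"] by simp
    qed
  qed auto
  have "reach {f} x \<subseteq> (\<lambda>k. (f ^^ k) x) ` {..<Suc M}"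
  proof (rule reach_least)
    show "x \<in> (\<lambda>k. (f ^^ k) x) ` {..<Suc M}" by (rule image_eqI[of _ _ 0]) auto
    fix z g assume "z \<in> (\<lambda>k. (f ^^ k) x) ` {..<Suc M}" "g \<in> {f}"
    then obtain k where k: "k < Suc M" "g z = (f ^^ Suc k) x" by auto
    show "g z \<in> (\<lambda>k. (f ^^ k) x) ` {..<Suc M}"
    proof (cases "k = M")
      case True
      then have "g z = (f ^^ 0) x" using M(1) k(2) by simp
      then show ?thesis by blast
    next
      case False
      then show ?thesis using k by (intro image_eqI[of _ _ "Suc k"]) auto
    qed
  qed
  then have R: "reach {f} x = (\<lambda>k. (f ^^ k) x) ` {..<Suc M}" by (auto intro: reach_power)
  then have "N = Suc M" unfolding N_def using card_image[OF inj] by simp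
  then show "(f ^^ N) x = x" "inj_on (\<lambda>k. (f ^^ k) x) {..<N}" "reach {f} x = (\<lambda>k. (f ^^ k) x) ` {..<N}" "0 < N"
    using M(1) inj R by auto
qed

lemma orbit_periodI:
  assumes "(f ^^ N) x = x" "inj_on (\<lambda>k. (f ^^ k) x) {..<N}" "0 < N"
  shows "card (reach {f} x) = N" "reach {f} x = (\<lambda>k. (f ^^ k) x) ` {..<N}"
proof -
  have "reach {f} x \<subseteq> (\<lambda>k. (f ^^ k) x) ` {..<N}"
  proof (rule reach_least)
    show "x \<in> (\<lambda>k. (f ^^ k) x) ` {..<N}" by (rule image_eqI[of _ _ 0]) (use assms in auto)
    fix z g assume "z \<in> (\<lambda>k. (f ^^ k) x) ` {..<N}" "g \<in> {f}"
    then obtain k where k: "k < N" "g z = (f ^^ Suc k) x" by auto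
    show "g z \<in> (\<lambda>k. (f ^^ k) x) ` {..<N}"
    proof (cases "Suc k = N")
      case True
      then have "g z = (f ^^ 0) x" using assms(1) k(2) by simp
      then show ?thesis using assms(3) by blast
    next
      case False
      then show ?thesis using k by (intro image_eqI[of _ _ "Suc k"]) auto
    qed
  qed
  then show R: "reach {f} x = (\<lambda>k. (f ^^ k) x) ` {..<N}" by (auto intro: reach_power)
  show "card (reach {f} x) = N" unfolding R using card_image[OF assms(2)] by simp
qed

text \<open>For bijections that are given as relations, total and unique on both sides, such as
  \<open>cutrel\<close>.\<close>

lemma sum_bij_rel:
  assumes "\<And>x. x \<in> X \<Longrightarrow> \<exists>y\<in>Y. R x y" "\<And>y. y \<in> Y \<Longrightarrow> \<exists>x\<in>X. R x y"
    "\<And>x y z. x \<in> X \<Longrightarrow> y \<in> Y \<Longrightarrow> z \<in> Y \<Longrightarrow> R x y \<Longrightarrow> R x z \<Longrightarrow> y = z"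
    "\<And>x y z. x \<in> X \<Longrightarrow> z \<in> X \<Longrightarrow> y \<in> Y \<Longrightarrow> R x y \<Longrightarrow> R z y \<Longrightarrow> x = z"
    "\<And>x y. x \<in> X \<Longrightarrow> y \<in> Y \<Longrightarrow> R x y \<Longrightarrow> f x = g y"
  shows "sum f X = sum g Y"
proof -
  define F where "F = (\<lambda>x. SOME y. y \<in> Y \<and> R x y)"
  have F: "F x \<in> Y \<and> R x (F x)" if "x \<in> X" for x
    unfolding F_def by (rule someI_ex) (use assms(1)[OF that] in blast)
  have "bij_betw F X Y"
  proof (rule bij_betwI')
    fix x y assume "x \<in> X" "y \<in> X" then show "(F x = F y) = (x = y)" using F assms(4) by metis
  next
    fix y assume "y \<in> Y" then show "\<exists>x\<in>X. y = F x" using assms(2,3) F by metis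
  qed (use F in auto)
  then have "sum g Y = (\<Sum>x\<in>X. g (F x))" by (simp add: sum.reindex_bij_betw)
  also have "\<dots> = sum f X" by (rule sum.cong[OF refl], rule assms(5)[symmetric]) (use F in auto)
  finally show ?thesis by simp
qed

context lconst
begin

lemma fbk: "x \<in> E \<Longrightarrow> (fb ^^ k) x \<in> E"
  by (induction k) auto

lemma fb_lower: "x \<in> E \<Longrightarrow> t x \<le> t ((fb ^^ k) x) + k"
proof (induction k)
  case (Suc k)
  have "(fb ^^ k) x \<in> E" using fbk[OF Suc(2)] .
  then show ?case using Suc step[of "(fb ^^ k) x"] lab[of "(fb ^^ k) x"] p2 by auto
qed auto

text \<open>Labels fall by at most one per edge, so two rises by \<open>p - 1\<close> among the
  \<open>p\<close> edges of a face could not be compensated by the at most \<open>p - 2\<close>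
  falls.\<close>

lemma black_face:
  assumes x: "x \<in> E" "\<not> dn fw t x" and l: "0 < l" "l < p"
  shows "dn fw t ((fb ^^ l) x)"
proof (rule ccontr)
  assume n: "\<not> ?thesis"
  let ?y = "(fb ^^ l) x"
  have yE: "?y \<in> E" "fb x \<in> E" "fb ?y \<in> E" using fbk x by auto
  have 1: "t (fb x) + 1 = t x + p" "t (fb ?y) + 1 = t ?y + p"
    using step[OF x(1)] step[OF yE(1)] x n lab x yE by (auto simp: dn_def)
  have "(fb ^^ (l - 1)) (fb x) = ?y" using l by (cases l) (auto simp: funpow_swap1)
  then have 2: "t (fb x) \<le> t ?y + (l - 1)" using fb_lower[OF yE(2), of "l - 1"] by simp
  have "(fb ^^ (p - l - 1)) (fb ?y) = (fb ^^ (p - l - 1 + Suc l)) x" by (simp only: funpow_add o_apply funpow.simps)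
  also have "p - l - 1 + Suc l = p" using l by simp
  finally have "(fb ^^ (p - l - 1)) (fb ?y) = x" using order[OF x(1)] by simp
  then have "t (fb ?y) \<le> t x + (p - l - 1)" using fb_lower[OF yE(3), of "p - l - 1"] by simp
  then show False using 1 2 l by linarith
qed

text \<open>Descending from an edge meets every smaller label. The bound makes the sets of labelled
  maps on \<open>E\<close> finite.\<close>

lemma label_bound: "x \<in> E \<Longrightarrow> t x \<le> card E"
proof -
  have head: "{..t (fw y)} \<subseteq> (\<lambda>y. t (fw y)) ` E" if "y \<in> E" for y
    using that
  proof (induction "t (fw y)" arbitrary: y)
    case 0 then show ?case by (auto simp: image_iff intro!: bexI[of _ y])
  next
    case (Suc l)
    obtain z where z: "z \<in> reach {s} y" "dn fw t (fb z)" using down[of y] Suc by auto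
    have zE: "z \<in> E" using reach_sub[OF bijs_s Suc(3)] z by auto
    have "t (fb z) = Suc l" using lab[OF zE] head_reach[OF Suc(3) z(1)] Suc by simp
    then have "t (fw (fb z)) = l" using z by (simp add: dn_def)
    then have "{..l} \<subseteq> (\<lambda>y. t (fw y)) ` E" using Suc(1)[of "fb z"] zE by auto
    moreover have "{..Suc l} = insert (Suc l) {..l}" by auto
    ultimately show ?case using Suc by auto
  qed
  assume x: "x \<in> E"
  have "card {..t (fw (inv fw x))} \<le> card ((\<lambda>y. t (fw y)) ` E)"
    by (rule card_mono[OF _ head]) (use fin x in auto)
  also have "\<dots> \<le> card E" by (rule card_image_le[OF fin])
  finally show ?thesis by simp
qed

end

section \<open>Labelled counting\<close>

type_synonym lmap = "(nat \<Rightarrow> nat) \<times> (nat \<Rightarrow> nat) \<times> (nat \<Rightarrow> nat) \<times> nat"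

definition lmaps :: "nat \<Rightarrow> nat set \<Rightarrow> lmap set" where
  "lmaps p E = {(fw, fb, t, r). lconst E fw fb t p \<and> r \<in> E}"

lemma finite_lmaps: assumes "finite E" shows "finite (lmaps p E)"
proof -
  let ?T = "{t. \<forall>x. (x \<in> E \<longrightarrow> t x \<in> {..card E}) \<and> (x \<notin> E \<longrightarrow> t x = (0::nat))}"
  have "lmaps p E \<subseteq> {f. f permutes E} \<times> {f. f permutes E} \<times> ?T \<times> E"
  proof
    fix x assume x: "x \<in> lmaps p E"
    obtain fw fb t r where e: "x = (fw, fb, t, r)" by (cases x)
    then interpret lconst E fw fb t p using x by (simp add: lmaps_def)
    show "x \<in> {f. f permutes E} \<times> {f. f permutes E} \<times> ?T \<times> E"
      using x e fw fb label_bound out by (auto simp: lmaps_def)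
  qed
  moreover have "finite ?T" by (rule finite_set_of_finite_funs[OF assms]) auto
  ultimately show ?thesis using finite_permutations[OF assms] assms by (meson finite_SigmaI finite_subset)
qed

definition wtV :: "(nat \<Rightarrow> 'c::comm_ring_1) \<Rightarrow> nat set \<Rightarrow> (nat \<Rightarrow> nat) \<Rightarrow> 'c" where
  "wtV wg E fw = (\<Prod>f\<in>reach {fw} ` E. wg (card f))"

definition wtF :: "(nat \<Rightarrow> 'c::comm_ring_1) \<Rightarrow> nat set \<Rightarrow> (nat \<Rightarrow> nat) \<Rightarrow> nat \<Rightarrow> 'c" where
  "wtF wg E fw r = (\<Prod>f\<in>reach {fw} ` E - {reach {fw} r}. wg (card f))"

lemma wtF_split:
  assumes "finite E" "bij_betw fw E E" "B \<subseteq> E" "\<And>x. x \<in> E - B \<Longrightarrow> fw x \<in> E - B" "\<And>x. x \<in> B \<Longrightarrow> fw x \<in> B" "r \<in> E - B"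
  shows "wtF wg E fw r = wtF wg (E - B) (res (E - B) fw) r * wtV wg B (res B fw)"
proof -
  let ?A = "E - B"
  have rA: "reach {res ?A fw} x = reach {fw} x" if "x \<in> ?A" for x
    using that by (intro reach_cong1[of x ?A]) (use assms(4) in \<open>auto simp: res_def\<close>)
  have rB: "reach {res B fw} x = reach {fw} x" if "x \<in> B" for x
    using that by (intro reach_cong1[of x B]) (use assms(5) in \<open>auto simp: res_def\<close>)
  have subA: "reach {fw} x \<subseteq> ?A" if "x \<in> ?A" for x by (rule reach_least) (use that assms(4) in auto)
  have subB: "reach {fw} x \<subseteq> B" if "x \<in> B" for x by (rule reach_least) (use that assms(5) in auto)
  have n: "reach {fw} x \<noteq> reach {fw} y" if "x \<in> ?A" "y \<in> B" for x y
    using subA[OF that(1)] subB[OF that(2)] reach_refl[of y "{fw}"] by auto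
  have "E = ?A \<union> B" using assms(3) by auto
  then have "reach {fw} ` E - {reach {fw} r} = (reach {fw} ` ?A - {reach {fw} r}) \<union> reach {fw} ` B"
    using n[OF assms(6)] by auto
  moreover have "(reach {fw} ` ?A - {reach {fw} r}) \<inter> reach {fw} ` B = {}" using n by auto
  moreover have "finite (reach {fw} ` ?A - {reach {fw} r})" "finite (reach {fw} ` B)"
    using assms(1,3) finite_subset by auto
  ultimately have "wtF wg E fw r = (\<Prod>f\<in>reach {fw} ` ?A - {reach {fw} r}. wg (card f)) * (\<Prod>f\<in>reach {fw} ` B. wg (card f))"
    unfolding wtF_def by (metis (no_types, lifting) prod.union_disjoint)
  moreover have "reach {res ?A fw} ` ?A = reach {fw} ` ?A" "reach {res B fw} ` B = reach {fw} ` B"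
    using rA rB by (auto intro: image_cong)
  ultimately show ?thesis unfolding wtF_def wtV_def using rA[OF assms(6)] by simp
qed

text \<open>A word records the label steps around the white root face: \<open>True\<close> is a step up by \<open>p - 1\<close>,
  \<open>False\<close> a step down by one (truncated at \<open>0\<close>, which \<open>wok\<close> below excludes).\<close>

fun wend :: "nat \<Rightarrow> nat \<Rightarrow> bool list \<Rightarrow> nat" where
  "wend p h [] = h"
| "wend p h (True # w) = wend p (h + (p - 1)) w"
| "wend p h (False # w) = wend p (h - 1) w"

lemma wend_append: "wend p h (u @ v) = wend p (wend p h u) v"
  by (induction p h u rule: wend.induct) auto

lemma wend_replicate: "wend p h (replicate n False) = h - n"
  by (induction n arbitrary: h) auto

definition wht :: "nat \<Rightarrow> bool list \<Rightarrow> nat \<Rightarrow> nat" where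
  "wht p w k = wend p 0 (take k w)"

text \<open>A word that returns to height \<open>0\<close> is determined by what precedes its last
  up-step: from height \<open>J\<close> before this step it must go up to \<open>J + p - 1\<close>
  and then straight down.\<close>

definition lastup :: "nat \<Rightarrow> bool list \<Rightarrow> bool list" where
  "lastup p pre = pre @ True # replicate (wend p 0 pre + (p - 1)) False"

lemma lastup_length: "length (lastup p pre) = length pre + p + wend p 0 pre" if "2 \<le> p"
  using that by (simp add: lastup_def)

lemma wht_lastup_pre: "k \<le> length pre \<Longrightarrow> wht p (lastup p pre) k = wht p pre k"
  by (simp add: wht_def lastup_def)

lemma wht_lastup: "l \<le> wend p 0 pre + (p - 1) \<Longrightarrow>
   wht p (lastup p pre) (length pre + 1 + l) = wend p 0 pre + (p - 1) - l"
  by (simp add: wht_def lastup_def wend_append wend_replicate)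

definition rmaps :: "nat \<Rightarrow> nat set \<Rightarrow> bool list \<Rightarrow> lmap set" where
  "rmaps p E w = {(fw, fb, t, r). lconst E fw fb t p \<and> r \<in> E \<and> card (reach {fw} r) = length w \<and>
     (\<forall>k\<le>length w. t ((fw ^^ k) r) = wht p w k)}"

text \<open>After the last up-step, the edges \<open>q, ..., q + j\<close> of the root face also follow each other
  around a black face; \<open>j = p - 1\<close> means that this whole black face hangs on the root face.\<close>

definition tmaps :: "nat \<Rightarrow> nat set \<Rightarrow> bool list \<Rightarrow> nat \<Rightarrow> nat \<Rightarrow> lmap set" where
  "tmaps p E w q j = {(fw, fb, t, r) \<in> rmaps p E w.
     \<forall>l<j. fb ((fw ^^ (q + l)) r) = (fw ^^ (q + l + 1)) r}"

definition vmaps :: "nat \<Rightarrow> nat set \<Rightarrow> nat \<Rightarrow> lmap set" where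
  "vmaps p E i = {(fw, fb, t, r). lconst E fw fb t p \<and> r \<in> E \<and> dn fw t r \<and> t r \<le> i}"

lemma maps_finite: "finite E \<Longrightarrow> finite (rmaps p E w)" "finite E \<Longrightarrow> finite (tmaps p E w q j)" "finite E \<Longrightarrow> finite (vmaps p E i)"
  by (rule finite_subset[OF _ finite_lmaps[of E p]]; auto simp: lmaps_def rmaps_def tmaps_def vmaps_def)+

definition wF :: "(nat \<Rightarrow> 'c::comm_ring_1) \<Rightarrow> nat set \<Rightarrow> lmap \<Rightarrow> 'c" where
  "wF wg E = (\<lambda>(fw, fb, t, r). wtF wg E fw r)"

definition wV :: "(nat \<Rightarrow> 'c::comm_ring_1) \<Rightarrow> nat set \<Rightarrow> lmap \<Rightarrow> 'c" where
  "wV wg E = (\<lambda>(fw, fb, t, r). wtV wg E fw)"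

lemma pow_res:
  assumes "\<And>x. x \<in> A \<Longrightarrow> fw x \<in> A" "r \<in> A"
  shows "(res A fw ^^ k) r = (fw ^^ k) r \<and> (fw ^^ k) r \<in> A"
  by (induction k) (use assms in \<open>auto simp: res_def\<close>)

text \<open>Either the next edge also follows around the black face, or the two candidates for the next
  edge start a bigon to be cut off; this is the factor \<open>V = 1 + (V - 1)\<close>.\<close>

lemma cut_sum:
  fixes wg :: "nat \<Rightarrow> 'c::comm_ring_1" and pre :: "bool list"
  assumes E: "finite E" and p: "2 \<le> p" and j: "j < p - 1"
  defines "w \<equiv> lastup p pre" and "q \<equiv> length pre" and "J \<equiv> wend p 0 pre"
  shows "(\<Sum>x\<in>tmaps p E w q j. wF wg E x) = (\<Sum>x\<in>tmaps p E w q (Suc j). wF wg E x) +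
     (\<Sum>B\<in>Pow E. (\<Sum>x\<in>tmaps p (E - B) w q (Suc j). wF wg (E - B) x) * (\<Sum>x\<in>vmaps p B (J + (p - 1) - j). wV wg B x))"
proof -
  let ?i = "J + (p - 1) - j"
  let ?X = "tmaps p E w q j - tmaps p E w q (Suc j)"
  let ?Y = "Sigma (Pow E) (\<lambda>B. tmaps p (E - B) w q (Suc j) \<times> vmaps p B ?i)"
  define R where "R = (\<lambda>(fw, fb, t, r :: nat) (B, (fwA, fbA, tA, r'), (fwB, fbB, tB, \<rho>)).
     r' = r \<and> cutrel E ((fw ^^ (q + j)) r) fw fb t B fwA fbA tA fwB fbB tB \<rho>)"
  have len: "length w = q + p + J" using lastup_length[OF p] by (simp add: w_def q_def J_def)
  have whtq: "wht p w (q + 1 + l) = J + (p - 1) - l" if "l \<le> J + (p - 1)" for l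
    using wht_lastup[of l p pre] that by (simp add: w_def q_def J_def)
  have whtq0: "wht p w q = J" unfolding w_def q_def J_def using wht_lastup_pre[of "length pre" pre p] by (simp add: wht_def)
  have labs: "t ((fw ^^ q) r) = J" "\<And>l. l \<le> p \<Longrightarrow> 0 < l \<Longrightarrow> t ((fw ^^ (q + l)) r) = J + p - l"
    if "(fw, fb, t, r) \<in> rmaps p E' w" for fw fb t r E'
  proof -
    have *: "k \<le> length w \<Longrightarrow> t ((fw ^^ k) r) = wht p w k" for k using that by (auto simp: rmaps_def)
    show "t ((fw ^^ q) r) = J" using *[of q] whtq0 len by simp
    show "t ((fw ^^ (q + l)) r) = J + p - l" if "l \<le> p" "0 < l" for l
      using *[of "q + l"] whtq[of "l - 1"] len that by auto
  qed
  have ppos: "0 < p" using p by simp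
  \<comment> \<open>The edges at the positions from \<open>q\<close> to \<open>q + j - 1\<close> end
    above the level of the cut. The first of them is the up-step, which \<open>T\<close> never
    moves, and the others also start above that level.\<close>
  have protect: "fb ((fw ^^ (q + l)) r) = (fw ^^ (q + l + 1)) r \<longleftrightarrow> fbA ((fwA ^^ (q + l)) r) = (fwA ^^ (q + l + 1)) r"
    if "l < j" and c: "cutrel E ((fw ^^ (q + j)) r) fw fb t B fwA fbA tA fwB fbB tB \<rho>"
      and L: "t ((fw ^^ q) r) = J" "\<And>l. l \<le> p \<Longrightarrow> 0 < l \<Longrightarrow> t ((fw ^^ (q + l)) r) = J + p - l"
      and res: "\<And>k. (fwA ^^ k) r = (fw ^^ k) r" "\<And>k. (fw ^^ k) r \<in> E - B" for l fw fb t r B fwA fbA tA fwB fbB tB \<rho>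
  proof -
    let ?x = "(fw ^^ (q + l)) r" and ?e = "(fw ^^ (q + j)) r"
    have lt: "t (fw ?x) = J + p - Suc l" "t (fw ?e) = J + p - Suc j"
      using L(2)[of "Suc l"] L(2)[of "Suc j"] that(1) \<open>j < p - 1\<close> by auto
    have "fb ?x = fw ?x \<longleftrightarrow> fbA ?x = fwA ?x"
    proof (rule cutrel_protect[OF c])
      show "?x \<in> E - B" by (rule res(2))
      show "t (fw ?e) < t (fw ?x)" using lt that(1) \<open>j < p - 1\<close> by linarith
      show "\<not> dn fw t ?x \<or> t (fw ?e) < t ?x"
      proof (cases "l = 0")
        case True
        have "t ?x = J" using True L(1) by simp
        moreover have "t (fw ?x) = J + p - 1" using lt True by simp
        ultimately show ?thesis using p unfolding dn_def by linarith
      next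
        case False
        then have "t ?x = J + p - l" using L(2)[of l] that(1) \<open>j < p - 1\<close> by auto
        then show ?thesis using lt that(1) \<open>j < p - 1\<close> by linarith
      qed
    qed
    then show ?thesis using res(1)[of "q + l"] res(1)[of "Suc (q + l)"] by simp
  qed
  have "(\<Sum>x\<in>?X. wF wg E x) = (\<Sum>(B, y, z)\<in>?Y. wF wg (E - B) y * wV wg B z)"
  proof (rule sum_bij_rel[where R=R])
    fix x assume x: "x \<in> ?X"
    obtain fw fb t r where xe: "x = (fw, fb, t, r)" by (cases x)
    have xr: "(fw, fb, t, r) \<in> rmaps p E w" and xl: "\<And>l. l < j \<Longrightarrow> fb ((fw ^^ (q + l)) r) = (fw ^^ (q + l + 1)) r"
      using x xe by (auto simp: tmaps_def)
    have xn: "fb ((fw ^^ (q + j)) r) \<noteq> (fw ^^ (q + j + 1)) r"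
      using x xe less_Suc_eq by (auto simp: tmaps_def)
    interpret lconst E fw fb t p using xr by (simp add: rmaps_def)
    have rE: "r \<in> E" using xr by (simp add: rmaps_def)
    have kE: "(fw ^^ k) r \<in> E" for k by (induction k) (use rE in auto)
    note L = labs[OF xr]
    let ?e = "(fw ^^ (q + j)) r"
    have eq: "(fb ^^ l) ((fw ^^ q) r) = (fw ^^ (q + l)) r" if "l \<le> j" for l
      using that by (induction l) (use xl in auto)
    \<comment> \<open>As the edge at position \<open>q\<close> rises, \<open>black_face\<close>
      makes all other edges of its black face down-edges, among them the black successor of the edge
      at position \<open>q + j\<close>.\<close>
    have up: "\<not> dn fw t ((fw ^^ q) r)" using L(1) L(2)[of 1] p by (auto simp: dn_def)
    have "dn fw t ((fb ^^ Suc j) ((fw ^^ q) r))" by (rule black_face[OF kE up]) (use j in auto)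
    then have d1: "dn fw t (fb ?e)" using eq[of j] by simp
    have tfe: "t (fw ?e) = ?i" using L(2)[of "Suc j"] j by simp
    have d2: "dn fw t (fw ?e)" unfolding dn_def using tfe L(2)[of "Suc (Suc j)"] j by simp
    have rre: "?e \<in> reach {fw} r" by (rule reach_power) simp
    have "r \<in> reach {fw} ?e" by (rule reach_sym[OF bijs_w rE rre])
    moreover have "t r = 0" using xr by (auto simp: rmaps_def wht_def dest!: spec[of _ 0])
    ultimately have root: "\<exists>r\<in>reach {fw} ?e. t r = 0" by blast
    have ne: "fb ?e \<noteq> fw ?e" using xn by simp
    obtain B fwA fbA tA fwB fbB tB where C: "cutrel E ?e fw fb t B fwA fbA tA fwB fbB tB (fb ?e)"
      "B \<subseteq> E" "reach {fw} ?e \<subseteq> E - B" "lconst (E - B) fwA fbA tA p" "lconst B fwB fbB tB p"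
      "fbA ?e = fwA ?e" "fb ?e \<in> B" "dn fwB tB (fb ?e)" "tB (fb ?e) \<le> t (fw ?e)"
      by (rule cut_thm[OF lconst_axioms kE d1 d2 ne root]) 
    have rA: "reach {fw} r \<subseteq> E - B" using C(3) reach_eq[OF bijs_w rE rre] by simp
    have fwA: "fwA = res (E - B) fw" "tA = lres (E - B) 0 t" using C(1) by (auto simp: cutrel_def)
    have kA: "(fw ^^ k) r \<in> E - B" for k using rA reach_power[of fw "{fw}" k r] by auto
    have pw: "(fwA ^^ k) r = (fw ^^ k) r" for k
      by (induction k) (use kA in \<open>auto simp: fwA res_def\<close>)
    have rch: "reach {fwA} r = reach {fw} r"
      unfolding reach_single pw by simp
    have "(fwA, fbA, tA, r) \<in> tmaps p (E - B) w q (Suc j)"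
      unfolding tmaps_def rmaps_def
    proof (safe)
      show "lconst (E - B) fwA fbA tA p" by (rule C(4))
      show "r \<in> E" by (rule rE)
      show "r \<in> B \<Longrightarrow> False" using kA[of 0] by auto
      show "card (reach {fwA} r) = length w" using xr rch by (simp add: rmaps_def)
      show "tA ((fwA ^^ k) r) = wht p w k" if "k \<le> length w" for k
      proof -
        have "tA ((fwA ^^ k) r) = t ((fw ^^ k) r)" unfolding pw using kA[of k] by (simp add: fwA(2) lres_def)
        then show ?thesis using xr that by (simp add: rmaps_def)
      qed
      show "fbA ((fwA ^^ (q + l)) r) = (fwA ^^ (q + l + 1)) r" if "l < Suc j" for l
      proof (cases "l = j")
        case True
        then show ?thesis using C(6) pw[of "q + j"] by simp
      next
        case False
        then have "l < j" using that by simp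
        from protect[OF this C(1) L pw kA] show ?thesis using xl[OF \<open>l < j\<close>] by blast
      qed
    qed
    moreover have "(fwB, fbB, tB, fb ?e) \<in> vmaps p B ?i" using C tfe by (auto simp: vmaps_def)
    ultimately show "\<exists>y\<in>?Y. R x y"
      using C(1,2) by (intro bexI[of _ "(B, (fwA, fbA, tA, r), (fwB, fbB, tB, fb ?e))"]) (auto simp: R_def xe)
  next
    fix y assume y: "y \<in> ?Y"
    obtain B fwA fbA tA r fwB fbB tB \<rho> where ye: "y = (B, (fwA, fbA, tA, r), (fwB, fbB, tB, \<rho>))" by (metis prod_cases4 prod.exhaust)
    have yA: "(fwA, fbA, tA, r) \<in> rmaps p (E - B) w" and yl: "\<And>l. l < Suc j \<Longrightarrow> fbA ((fwA ^^ (q + l)) r) = (fwA ^^ (q + l + 1)) r"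
      and yB: "(fwB, fbB, tB, \<rho>) \<in> vmaps p B ?i" and BE: "B \<subseteq> E" using y ye by (auto simp: tmaps_def)
    interpret A: lconst "E - B" fwA fbA tA p using yA by (simp add: rmaps_def)
    have LB: "lconst B fwB fbB tB p" using yB by (simp add: vmaps_def)
    have rA: "r \<in> E - B" using yA by (simp add: rmaps_def)
    have kA: "(fwA ^^ k) r \<in> E - B" for k
    proof (induction k)
      case (Suc k) then show ?case using A.inE(1)[of "(fwA ^^ k) r"] by simp
    qed (use rA in simp)
    note L = labs[OF yA]
    let ?e = "(fwA ^^ (q + j)) r"
    have tfe: "tA (fwA ?e) = ?i" using L(2)[of "Suc j"] j by simp
    have d2: "dn fwA tA (fwA ?e)" unfolding dn_def using tfe L(2)[of "Suc (Suc j)"] j by simp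
    have pe: "fbA ?e = fwA ?e" using yl[of j] by simp
    have EB: "E - B \<union> B = E" using BE by auto
    have \<rho>: "\<rho> \<in> B" "dn fwB tB \<rho>" "tB \<rho> \<le> tA (fwA ?e)" using yB tfe by (auto simp: vmaps_def)
    obtain fw fb t where C: "cutrel E ?e fw fb t B fwA fbA tA fwB fbB tB \<rho>" "lconst E fw fb t p"
      "dn fw t (fb ?e)" "fb ?e \<noteq> fw ?e"
      using glue_thm[OF A.lconst_axioms LB _ kA pe d2 \<rho>] EB by auto
    interpret lconst E fw fb t p by (rule C(2))
    have fwA: "fwA = res (E - B) fw" "tA = lres (E - B) 0 t" using C(1) by (auto simp: cutrel_def)
    have pw: "(fwA ^^ k) r = (fw ^^ k) r" for k
    proof (induction k)
      case (Suc k)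
      have "(fwA ^^ Suc k) r = fwA ((fwA ^^ k) r)" by simp
      also have "\<dots> = fw ((fwA ^^ k) r)" using kA[of k] by (simp add: fwA(1) res_def)
      finally show ?case using Suc by simp
    qed simp
    have kA': "(fw ^^ k) r \<in> E - B" for k using kA[of k] pw by simp
    have rch: "reach {fwA} r = reach {fw} r" unfolding reach_single pw by simp
    have tt: "t ((fw ^^ k) r) = tA ((fwA ^^ k) r)" for k unfolding pw using kA'[of k] fwA(2) by (simp add: lres_def)
    have L': "t ((fw ^^ q) r) = J" "\<And>l. l \<le> p \<Longrightarrow> 0 < l \<Longrightarrow> t ((fw ^^ (q + l)) r) = J + p - l"
      using L unfolding tt by auto
    have C': "cutrel E ((fw ^^ (q + j)) r) fw fb t B fwA fbA tA fwB fbB tB \<rho>" using C(1) pw by simp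
    have rm: "(fw, fb, t, r) \<in> rmaps p E w"
      using yA C(2) rch tt by (auto simp: rmaps_def)
    have ps: "fb ((fw ^^ (q + l)) r) = (fw ^^ (q + l + 1)) r" if "l < j" for l
      using protect[OF that C' L' pw kA'] yl[of l] that by simp
    have "(fw, fb, t, r) \<in> ?X"
    proof
      show "(fw, fb, t, r) \<in> tmaps p E w q j" using rm ps by (auto simp: tmaps_def)
      show "(fw, fb, t, r) \<notin> tmaps p E w q (Suc j)"
        using C(4) pw by (auto simp: tmaps_def dest!: spec[of _ j])
    qed
    moreover have "R (fw, fb, t, r) y" using C' by (simp add: R_def ye)
    ultimately show "\<exists>x\<in>?X. R x y" by blast
  next
    fix x y z assume R: "R x y" "R x z"
    obtain fw fb t r where xe: "x = (fw, fb, t, r)" by (cases x)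
    obtain B fwA fbA tA r1 fwB fbB tB \<rho> where ye: "y = (B, (fwA, fbA, tA, r1), (fwB, fbB, tB, \<rho>))" by (metis prod_cases4 prod.exhaust)
    obtain B2 fwA2 fbA2 tA2 r2 fwB2 fbB2 tB2 \<rho>2 where ze: "z = (B2, (fwA2, fbA2, tA2, r2), (fwB2, fbB2, tB2, \<rho>2))" by (metis prod_cases4 prod.exhaust)
    have c: "cutrel E ((fw ^^ (q + j)) r) fw fb t B fwA fbA tA fwB fbB tB \<rho>"
      "cutrel E ((fw ^^ (q + j)) r) fw fb t B2 fwA2 fbA2 tA2 fwB2 fbB2 tB2 \<rho>2" "r1 = r" "r2 = r"
      using R by (simp_all add: R_def xe ye ze)
    show "y = z" using cutrel_right_unique[OF c(1,2)] c(3,4) by (simp add: ye ze)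
  next
    fix x z y assume xz: "x \<in> ?X" "z \<in> ?X" and y: "y \<in> ?Y" and R: "R x y" "R z y"
    obtain B fwA fbA tA r fwB fbB tB \<rho> where ye: "y = (B, (fwA, fbA, tA, r), (fwB, fbB, tB, \<rho>))" by (metis prod_cases4 prod.exhaust)
    obtain fw fb t where xe: "x = (fw, fb, t, r)" using R(1) by (cases x) (auto simp: R_def ye)
    obtain fw2 fb2 t2 where ze: "z = (fw2, fb2, t2, r)" using R(2) by (cases z) (auto simp: R_def ye)
    have yA: "(fwA, fbA, tA, r) \<in> rmaps p (E - B) w" using y ye by (auto simp: tmaps_def)
    interpret A: lconst "E - B" fwA fbA tA p using yA by (simp add: rmaps_def)
    have rA: "r \<in> E - B" using yA by (simp add: rmaps_def)
    have pw: "(f ^^ k) r = (fwA ^^ k) r \<and> (fwA ^^ k) r \<in> E - B" if "fwA = res (E - B) f" for f k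
    proof (induction k)
      case (Suc k)
      then have 1: "(fwA ^^ k) r \<in> E - B" by simp
      have "(fwA ^^ Suc k) r = fwA ((fwA ^^ k) r)" by simp
      moreover have "fwA ((fwA ^^ k) r) = f ((fwA ^^ k) r)" using 1 by (simp add: that res_def)
      moreover have "fwA ((fwA ^^ k) r) \<in> E - B" using A.inE(1)[of "(fwA ^^ k) r"] 1 by simp
      ultimately show ?case using Suc by simp
    qed (use rA in simp)
    have c1: "cutrel E ((fw ^^ (q + j)) r) fw fb t B fwA fbA tA fwB fbB tB \<rho>"
      and c2: "cutrel E ((fw2 ^^ (q + j)) r) fw2 fb2 t2 B fwA fbA tA fwB fbB tB \<rho>"
      using R by (auto simp: R_def ye xe ze)
    then have "fwA = res (E - B) fw" "fwA = res (E - B) fw2" unfolding cutrel_def by blast+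
    \<comment> \<open>The cut edge is defined through the large map, but it lies on the root face,
      whose contour is already that of \<open>fwA\<close>.\<close>
    then have e: "(fw2 ^^ (q + j)) r = (fw ^^ (q + j)) r" using pw by metis
    show "x = z" using cutrel_left_unique[OF c1 c2[unfolded e]] by (simp add: xe ze)
  next
    fix x y assume x: "x \<in> ?X" and y: "y \<in> ?Y" and R: "R x y"
    obtain B fwA fbA tA r fwB fbB tB \<rho> where ye: "y = (B, (fwA, fbA, tA, r), (fwB, fbB, tB, \<rho>))" by (metis prod_cases4 prod.exhaust)
    obtain fw fb t where xe: "x = (fw, fb, t, r)" using R by (cases x) (auto simp: R_def ye)
    have yA: "(fwA, fbA, tA, r) \<in> rmaps p (E - B) w" and yB: "(fwB, fbB, tB, \<rho>) \<in> vmaps p B ?i"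
      and BE: "B \<subseteq> E" using y ye by (auto simp: tmaps_def)
    interpret A: lconst "E - B" fwA fbA tA p using yA by (simp add: rmaps_def)
    interpret B: lconst B fwB fbB tB p using yB by (simp add: vmaps_def)
    interpret lconst E fw fb t p using x xe by (simp add: tmaps_def rmaps_def)
    have "cutrel E ((fw ^^ (q + j)) r) fw fb t B fwA fbA tA fwB fbB tB \<rho>" using R by (simp add: R_def ye xe)
    then have f: "fwA = res (E - B) fw" "fwB = res B fw" unfolding cutrel_def by blast+
    have cA: "fw z \<in> E - B" if "z \<in> E - B" for z
      using A.inE(1)[of z] that by (simp add: f(1) res_def)
    have cB: "fw z \<in> B" if "z \<in> B" for z
      using B.inE(1)[of z] that by (simp add: f(2) res_def)
    have rA: "r \<in> E - B" using yA by (simp add: rmaps_def)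
    show "wF wg E x = (case y of (B, y, z) \<Rightarrow> wF wg (E - B) y * wV wg B z)"
      using wtF_split[OF fin permutes_imp_bij[OF fw] BE cA cB rA, of wg]
      by (simp add: wF_def wV_def xe ye f[symmetric])
  qed
  also have "\<dots> = (\<Sum>B\<in>Pow E. \<Sum>(y, z)\<in>tmaps p (E - B) w q (Suc j) \<times> vmaps p B ?i. wF wg (E - B) y * wV wg B z)"
    by (subst sum.Sigma) (use E in \<open>auto intro!: maps_finite intro: finite_subset\<close>)
  also have "\<dots> = (\<Sum>B\<in>Pow E. (\<Sum>x\<in>tmaps p (E - B) w q (Suc j). wF wg (E - B) x) * (\<Sum>x\<in>vmaps p B ?i. wV wg B x))"
    by (intro sum.cong refl) (simp add: sum_product sum.cartesian_product)
  finally have S: "(\<Sum>x\<in>?X. wF wg E x) = \<dots>" .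
  have sub: "tmaps p E w q (Suc j) \<subseteq> tmaps p E w q j" by (auto simp: tmaps_def)
  show ?thesis using sum.subset_diff[OF sub maps_finite(2)[OF E], of "wF wg E"] S by simp
qed

section \<open>Polygons given by lists\<close>

definition idx :: "'a list \<Rightarrow> 'a \<Rightarrow> nat" where
  "idx z x = (SOME k. k < length z \<and> z ! k = x)"

definition cz :: "'a list \<Rightarrow> 'a \<Rightarrow> 'a" where
  "cz z x = (if x \<in> set z then z ! (Suc (idx z x) mod length z) else x)"

text \<open>Labels of the origins along a black face: the up-step \<open>z ! 0\<close> leaves level
  \<open>J\<close>, and the other edges come down from \<open>J + p - 1\<close> to
  \<open>J\<close>.\<close>

definition lz :: "nat \<Rightarrow> nat \<Rightarrow> 'a list \<Rightarrow> 'a \<Rightarrow> nat" where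
  "lz J p z x = (if x \<in> set z then (if idx z x = 0 then J else J + p - idx z x) else 0)"

lemma idx_nth: "distinct z \<Longrightarrow> k < length z \<Longrightarrow> idx z (z ! k) = k"
  unfolding idx_def by (rule some_equality) (auto simp: nth_eq_iff_index_eq)

lemma cz_nth: "distinct z \<Longrightarrow> k < length z \<Longrightarrow> cz z (z ! k) = z ! (Suc k mod length z)"
  by (simp add: cz_def idx_nth)

lemma cz_pow: "distinct z \<Longrightarrow> k < length z \<Longrightarrow> (cz z ^^ n) (z ! k) = z ! ((k + n) mod length z)"
proof (induction n)
  case (Suc n)
  have "(k + n) mod length z < length z" using Suc by (intro mod_less_divisor) auto
  then show ?case using Suc cz_nth[of z "(k + n) mod length z"] by (simp add: mod_Suc_eq)
qed auto

lemma lz_nth: "distinct z \<Longrightarrow> k < length z \<Longrightarrow> lz J p z (z ! k) = (if k = 0 then J else J + p - k)"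
  by (simp add: lz_def idx_nth)

lemma cz_in: "x \<in> set z \<Longrightarrow> cz z x \<in> set z"
  unfolding cz_def by (auto intro!: nth_mem mod_less_divisor dest: length_pos_if_in_set)

lemma cz_permutes: assumes "distinct z" shows "cz z permutes set z"
proof (rule bij_imp_permutes)
  have s: "set z \<subseteq> cz z ` set z"
  proof
    fix x assume "x \<in> set z"
    then obtain k where k: "x = z ! k" "k < length z" by (metis in_set_conv_nth)
    have l: "Suc (length z - 1) = length z" using k by simp
    have "(cz z ^^ Suc (length z - 1)) x = x"
      unfolding l using cz_pow[OF assms k(2), of "length z"] k by simp
    then have "x = cz z ((cz z ^^ (length z - 1)) x)" by (metis funpow.simps(2) o_apply)
    moreover have "(cz z ^^ n) x \<in> set z" for n by (induction n) (use \<open>x \<in> set z\<close> cz_in in auto)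
    ultimately show "x \<in> cz z ` set z" by blast
  qed
  then have e: "cz z ` set z = set z" using cz_in by auto
  then have "inj_on (cz z) (set z)" by (intro eq_card_imp_inj_on) auto
  then show "bij_betw (cz z) (set z) (set z)" using e by (simp add: bij_betw_def)
qed (auto simp: cz_def)

lemma nth_cycle_reach:
  assumes "\<And>k. k < length z \<Longrightarrow> f (z ! k) = z ! (Suc k mod length z)" "k < length z"
  shows "reach {f} (z ! k) = set z"
proof
  show "reach {f} (z ! k) \<subseteq> set z"
  proof (rule reach_least)
    fix y g assume "y \<in> set z" "g \<in> {f}"
    then show "g y \<in> set z" using assms(1) by (metis in_set_conv_nth mod_less_divisor nth_mem singletonD length_pos_if_in_set)
  qed (use assms in auto)
  have *: "(f ^^ n) (z ! k) = z ! ((k + n) mod length z)" for n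
  proof (induction n)
    case (Suc n)
    have "(k + n) mod length z < length z" using assms(2) by (intro mod_less_divisor) auto
    then show ?case using Suc assms(1) by (simp add: mod_Suc_eq)
  qed (use assms in auto)
  have "z ! l \<in> reach {f} (z ! k)" if l: "l < length z" for l
  proof -
    have "(f ^^ (l + length z - k)) (z ! k) = z ! ((l + length z) mod length z)" using *[of "l + length z - k"] assms(2) by simp
    then show ?thesis using l reach_power[of f "{f}" "l + length z - k" "z ! k"] by simp
  qed
  then show "set z \<subseteq> reach {f} (z ! k)" by (metis in_set_conv_nth subsetI)
qed

lemma nth_cycle_cyc:
  assumes "\<And>k. k < length z \<Longrightarrow> f (z ! k) = z ! (Suc k mod length z)" "z \<noteq> []"
  shows "cyc f (set z) = 1"
proof -
  have "reach {f} x = set z" if "x \<in> set z" for x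
    using nth_cycle_reach[OF assms(1)] that by (metis in_set_conv_nth)
  then have "reach {f} ` set z = (\<lambda>_. set z) ` set z" by (rule image_cong[OF refl])
  also have "\<dots> = {set z}" using assms(2) by (simp add: image_constant_conv)
  finally show ?thesis by (simp add: ncomp_def)
qed

lemma id_cyc: assumes "\<And>x. x \<in> U \<Longrightarrow> f x = x" shows "cyc f U = card U"
proof -
  have "reach {f} x = {x}" if "x \<in> U" for x
  proof
    show "reach {f} x \<subseteq> {x}" by (rule reach_least) (use that assms in auto)
  qed auto
  then have "reach {f} ` U = (\<lambda>x. {x}) ` U" by (rule image_cong[OF refl])
  then show ?thesis by (simp add: ncomp_def card_image)
qed

section \<open>Removing the last black face\<close>

text \<open>A black face whose \<open>p\<close> edges \<open>z\<close> are also consecutive on the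
  white root face, with \<open>c\<close> the edge before them. It shares only the endpoint of
  \<open>c\<close> with the rest of the map.\<close>

locale leaf = labelled E fw fb t for E :: "'a set" and fw fb t +
  fixes z :: "'a list" and c :: 'a and J p :: nat
  assumes dz: "distinct z" and lz: "length z = p" and p2: "2 \<le> p" and zE: "set z \<subseteq> E"
    and cE: "c \<in> E" and cU: "c \<notin> set z"
    and fbz: "\<And>k. k < p \<Longrightarrow> fb (z ! k) = z ! (Suc k mod p)"
    and fwz: "\<And>k. Suc k < p \<Longrightarrow> fw (z ! k) = z ! Suc k"
    and fwc: "fw c = z ! 0"
    and tz0: "t (z ! 0) = J" and tz: "\<And>k. 0 < k \<Longrightarrow> k < p \<Longrightarrow> t (z ! k) = J + p - k"
    and td: "t (fw (z ! (p - 1))) = J"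
    and out: "\<And>x. x \<notin> E \<Longrightarrow> t x = 0"
begin

abbreviation "d \<equiv> z ! (p - 1)"
abbreviation "U \<equiv> set z"
abbreviation "A \<equiv> E - set z"
text \<open>Bypasses the black face: \<open>c\<close> is followed by the former successor of the
  last edge \<open>d\<close>, and \<open>z\<close> closes up to a white cycle of its own.\<close>

definition "fw1 = (\<lambda>x. fw (transpose c d x))"

lemma zU: "k < p \<Longrightarrow> z ! k \<in> U" using lz by auto
lemma UE: "x \<in> U \<Longrightarrow> \<exists>k<p. x = z ! k" using lz by (metis in_set_conv_nth)
lemma dU: "d \<in> U" using zU p2 by auto
lemma cd: "c \<noteq> d" using dU cU by auto
lemma dE: "d \<in> E" using dU zE by auto

lemma fw1_simps: "fw1 c = fw d" "fw1 d = z ! 0" "x \<noteq> c \<Longrightarrow> x \<noteq> d \<Longrightarrow> fw1 x = fw x"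
  by (auto simp: fw1_def fwc)

lemma fw1_perm: "fw1 permutes E"
  using permutes_compose[OF permutes_swap_id[OF cE dE] fw] by (simp add: fw1_def o_def)

lemma fw1z: "k < p \<Longrightarrow> fw1 (z ! k) = z ! (Suc k mod p)"
proof -
  assume k: "k < p"
  show ?thesis
  proof (cases "Suc k = p")
    case True
    then have "z ! k = d" by auto
    then show ?thesis using fw1_simps(2) True by simp
  next
    case False
    have "z ! k \<noteq> d" using dz lz k False by (auto simp: nth_eq_iff_index_eq)
    moreover have "z ! k \<noteq> c" using zU[OF k] cU by auto
    ultimately show ?thesis using fw1_simps(3) fwz[of k] k False by simp
  qed
qed

lemma head_cd: "t (fw c) = J" "t (fw d) = J" using fwc tz0 td by auto

lemma head1: "t (fw1 x) = t (fw x)"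
  using fw1_simps(1,2) fw1_simps(3)[of x] head_cd tz0 by (cases "x = c"; cases "x = d") auto

lemma dn1: "dn fw1 t x = dn fw t x" by (simp add: dn_def head1)

lemma labelled1: "labelled E fw1 fb t"
  by unfold_locales (use fin fw1_perm fb lab head1 in auto)

sublocale L1: labelled E fw1 fb t by (rule labelled1)

lemma closed_U: "x \<in> U \<Longrightarrow> fw1 x \<in> U" "x \<in> U \<Longrightarrow> fb x \<in> U"
  using UE[of x] fw1z fbz zU p2 by (auto intro!: zU)

lemma closed_A: "x \<in> A \<Longrightarrow> fw1 x \<in> A" "x \<in> A \<Longrightarrow> fb x \<in> A"
proof -
  have i: "inj_on fw1 E" "inj_on fb E" by (rule permutes_inj_on[OF fw1_perm], rule permutes_inj_on[OF fb])
  show "x \<in> A \<Longrightarrow> fw1 x \<in> A"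
    using closed_back[OF fin i(1) zE, of x] closed_U by auto
  show "x \<in> A \<Longrightarrow> fb x \<in> A"
    using closed_back[OF fin i(2) zE, of x] closed_U by auto
qed

lemma sublabA: "sublab E fw1 fb t A 0"
  by unfold_locales (use closed_A in auto)

sublocale S: sublab E fw1 fb t A 0 by (rule sublabA)

abbreviation "s1 \<equiv> sig fw1 fb"

lemma s_s1: "s x = transpose c d (s1 x)"
proof -
  have "fw (transpose c d (s1 x)) = fw (s x)" using L1.fw_s[of x] fw_s[of x] by (simp add: fw1_def)
  then show ?thesis by (metis inv_inv(4))
qed

text \<open>On the detached polygon white and black successors coincide, so each of its vertices has
  a single arriving edge.\<close>

lemma s1z: "x \<in> U \<Longrightarrow> s1 x = x"
proof -
  assume "x \<in> U"
  then obtain k where k: "k < p" "x = z ! k" using UE by blast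
  have "fw1 (s1 x) = fw1 x" using L1.fw_s fw1z fbz k by simp
  then show ?thesis by (metis L1.inv_inv(4))
qed

lemma sd: "s d = c" using s_s1[of d] s1z[OF dU] by simp

lemma s1A: "x \<in> A \<Longrightarrow> s1 x \<in> A" by (rule S.sC_in)

text \<open>The two rotations differ only at the shared vertex, where \<open>d\<close> is inserted
  directly before \<open>c\<close>.\<close>

lemma sA: "x \<in> A \<Longrightarrow> s x = (if s1 x = c then d else s1 x)"
proof -
  assume "x \<in> A"
  then have "s1 x \<noteq> d" using s1A[of x] dU by (metis DiffD2)
  then show ?thesis using s_s1[of x] by auto
qed

lemma reach_s1_s: "x \<in> A \<Longrightarrow> reach {s1} x \<subseteq> reach {s} x"
proof -
  assume x: "x \<in> A"
  have "reach {s1} x \<subseteq> reach {s} x \<inter> A"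
  proof (rule reach_least)
    fix y f assume y: "y \<in> reach {s} x \<inter> A" "f \<in> {s1}"
    have sy: "s y \<in> reach {s} x" using y by (auto intro: reach_step)
    have "s1 y \<in> reach {s} x"
    proof (cases "s1 y = c")
      case True
      then have "s y = d" using sA y by auto
      then have "s (s y) = c" using sd by simp
      then show ?thesis using True reach_step[OF sy, of s] by auto
    next
      case False then show ?thesis using sy sA y by auto
    qed
    then show "f y \<in> reach {s} x \<inter> A" using y s1A by auto
  qed (use x in auto)
  then show ?thesis by auto
qed

lemma reach_s_s1: "x \<in> A \<Longrightarrow> y \<in> reach {s} x \<Longrightarrow> y \<noteq> d \<Longrightarrow> y \<in> reach {s1} x"
proof -
  assume x: "x \<in> A" and y: "y \<in> reach {s} x" "y \<noteq> d"
  let ?Z = "reach {s1} x \<union> (if c \<in> reach {s1} x then {d} else {})"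
  have rA: "reach {s1} x \<subseteq> A" by (rule reach_least) (use x s1A in auto)
  have "reach {s} x \<subseteq> ?Z"
  proof (rule reach_least)
    fix y f assume y: "y \<in> ?Z" and f: "f \<in> {s}"
    show "f y \<in> ?Z"
    proof (cases "y \<in> reach {s1} x")
      case True
      have "s1 y \<in> reach {s1} x" using True by (auto intro: reach_step)
      moreover have "y \<in> A" using True rA by blast
      ultimately show ?thesis using f sA[of y] by auto
    next
      case False
      then show ?thesis using y f sd by (auto split: if_splits)
    qed
  qed auto
  then show ?thesis using y by (auto split: if_splits)
qed

lemma cyc_fw1: "cyc fw1 E = cyc fw E + 1"
proof (rule cyc_transpose_split(2)[OF fin permutes_imp_bij[OF fw] cE dE cd])
  have "k < p \<Longrightarrow> z ! k \<in> reach {fw} c" for k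
  proof (induction k)
    case 0 then show ?case using fwc reach_step[of c "{fw}" c fw] by auto
  next
    case (Suc k) then show ?case using fwz[of k] reach_step[of "z ! k" "{fw}" c fw] by auto
  qed
  then show "d \<in> reach {fw} c" using p2 by auto
qed (simp add: fw1_def)

lemma cyc_s1: "cyc s1 E = cyc s E + 1"
\<comment> \<open>\<open>s1\<close> is \<open>s\<close> followed by the transposition of
  \<open>c\<close> and \<open>d\<close>. Carried to the other side of \<open>s\<close>, it exchanges
  their preimages \<open>d\<close> and \<open>inv s d\<close>.\<close>
proof (rule cyc_transpose_split(2)[OF fin s_bij, of d "inv s d"])
  have si: "s (inv s d) = d" using permutes_inverses[OF s_perm] by auto
  show "d \<in> E" by (rule dE)
  then show i: "inv s d \<in> E" using permutes_in_image[OF permutes_inv[OF s_perm]] by auto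
  show "d \<noteq> inv s d" using si sd cd by metis
  have "d \<in> reach {s} (inv s d)" using si reach_step[of "inv s d" "{s}" _ s] by auto
  then show "inv s d \<in> reach {s} d" by (rule reach_sym[OF bijs_s i])
  show "s1 x = s (transpose d (inv s d) x)" for x
  proof -
    have 1: "s1 x = transpose c d (s x)" using s_s1[of x] by simp
    have inj: "s u = y \<longleftrightarrow> u = inv s y" for u y using permutes_inverses[OF s_perm] by metis
    have "inv s c = d" using sd inj[of d c] by simp
    then show ?thesis unfolding 1 using sd si inj[of x c] inj[of x d] by (auto simp: transpose_def)
  qed
qed

lemma finU: "finite U" "finite A" using fin by auto

lemma bijU: "bijs {fw1} U" "bijs {fb} U" "bijs {s1} U" "bijs {fw1} A" "bijs {fb} A" "bijs {s1} A"
proof -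
  have i: "inj_on fw1 Z" "inj_on fb Z" "inj_on s1 Z" for Z
    by (rule permutes_inj_on[OF fw1_perm], rule permutes_inj_on[OF fb], rule permutes_inj_on[OF L1.s_perm])
  have "f ` Z = Z" if "finite Z" "f ` Z \<subseteq> Z" "inj_on f Z" for f :: "'a \<Rightarrow> 'a" and Z by (rule endo_inj_surj[OF that])
  then have *: "bijs {f} Z" if "finite Z" "f ` Z \<subseteq> Z" "inj_on f Z" for f :: "'a \<Rightarrow> 'a" and Z
    using that by (auto simp: bijs_def bij_betw_def)
  show "bijs {fw1} U" "bijs {fb} U" "bijs {s1} U" "bijs {fw1} A" "bijs {fb} A" "bijs {s1} A"
    by (rule *[OF finU(1) image_subsetI i(1)], erule closed_U, rule *[OF finU(1) image_subsetI i(2)], erule closed_U,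
      rule *[OF finU(1) image_subsetI i(3)], simp only: s1z,
      rule *[OF finU(2) image_subsetI i(1)], erule closed_A, rule *[OF finU(2) image_subsetI i(2)], erule closed_A,
      rule *[OF finU(2) image_subsetI i(3)], erule s1A)
qed

text \<open>Detaching the polygon adds one white face and one vertex, and the polygon alone, with
  two faces, \<open>p\<close> vertices and \<open>p\<close> edges, takes up exactly this surplus of
  two.\<close>

lemma euler_iff: "cyc fw E + cyc fb E + cyc s E = card E + 2 \<longleftrightarrow> cyc fw1 A + cyc fb A + cyc s1 A = card A + 2"
proof -
  have EU: "A \<union> U = E" using zE by auto
  have "A \<inter> U = {}" by auto
  note u = ncomp_Un[OF _ _ this, unfolded EU]
  have "cyc fw1 E = cyc fw1 A + cyc fw1 U" "cyc fb E = cyc fb A + cyc fb U" "cyc s1 E = cyc s1 A + cyc s1 U"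
    by (rule u; rule bijU)+
  moreover have "z \<noteq> []" using lz p2 by auto
  then have "cyc fw1 U = 1" "cyc fb U = 1" using nth_cycle_cyc[of z fw1] nth_cycle_cyc[of z fb] fw1z fbz lz by auto
  moreover have "cyc s1 U = p" using id_cyc[of U s1] s1z distinct_card[OF dz] lz by auto
  moreover have "card E = card A + p" using card_Un_disjoint[of A U] finU EU distinct_card[OF dz] lz by auto
  ultimately show ?thesis using cyc_fw1 cyc_s1 by linarith
qed

lemma zdn: "0 < k \<Longrightarrow> k < p \<Longrightarrow> dn fw t (z ! k)"
proof -
  assume k: "0 < k" "k < p"
  show ?thesis
  proof (cases "Suc k = p")
    case True
    then have "z ! k = d" by auto
    then show ?thesis using td tz[OF k] True unfolding dn_def by auto
  next
    case False
    then show ?thesis using fwz[of k] tz[of k] tz[of "Suc k"] k unfolding dn_def by auto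
  qed
qed

lemma z0_up: "\<not> dn fw t (z ! 0)" "t (fw (z ! 0)) + 1 = t (z ! 0) + p"
  using fwz[of 0] tz0 tz[of 1] p2 by (auto simp: dn_def)

lemma z_head: "Suc k < p \<Longrightarrow> 0 < t (fw (z ! k))"
  using fwz[of k] tz[of "Suc k"] by auto

lemma euler_conv: "cyc S.fwC A + cyc S.fbC A + cyc (sig S.fwC S.fbC) A = cyc fw1 A + cyc fb A + cyc s1 A"
  using S.cycC by simp

lemma lconst_remove:
  assumes "lconst E fw fb t p"
  shows "lconst A (res A fw1) (res A fb) (lres A 0 t) p"
proof -
  interpret L: lconst E fw fb t p by fact
  have cA: "c \<in> A" using cE cU by auto
  have all: "x \<in> reach {fw1, fb} c" if "x \<in> A" for x
  proof -
    have "reach {fw, fb} c \<subseteq> reach {fw1, fb} c \<union> U"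
    proof (rule reach_least)
      fix y f assume y: "y \<in> reach {fw1, fb} c \<union> U" and f: "f \<in> {fw, fb}"
      have w: "fw1 x \<in> reach {fw1, fb} c" "fb x \<in> reach {fw1, fb} c" if "x \<in> reach {fw1, fb} c" for x
        using that by (auto intro: reach_step)
      have cc: "fw1 c \<in> reach {fw1, fb} c" by (rule w) auto
      have "fw y \<in> reach {fw1, fb} c \<union> U"
        using y fw1_simps(1,2) fw1_simps(3)[of y] cc w(1)[of y] closed_U(1)[of y] fwc zU[of 0] p2 by (cases "y = c"; cases "y = d") auto
      moreover have "fb y \<in> reach {fw1, fb} c \<union> U" using y w closed_U by auto
      ultimately show "f y \<in> reach {fw1, fb} c \<union> U" using f by auto
    qed auto
    then show ?thesis using L.conn[OF cE, of x] that by auto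
  qed
  show ?thesis
  proof unfold_locales
    fix x assume x: "x \<in> A"
    then have xE: "x \<in> E" by auto
    have "(S.fbC ^^ k) x = (fb ^^ k) x \<and> (fb ^^ k) x \<in> A" for k
    proof (induction k)
      case (Suc k) then show ?case using closed_A(2)[of "(fb ^^ k) x"] by (simp add: res_def)
    qed (use x in auto)
    then show "(S.fbC ^^ p) x = x" using L.order[OF xE] by simp
    show "S.tC (S.fwC x) + 1 = S.tC x \<or> S.tC (S.fwC x) + 1 = S.tC x + p"
      using S.tC[OF x] S.tC_head[OF x] L.step[OF xE] head1 by auto
    show "y \<in> reach {S.fwC, S.fbC} x" if y: "y \<in> A" for y
    proof -
      have "c \<in> reach {fw1, fb} x" by (rule reach_sym[OF L1.bijs_wb cE all[OF x]])
      then have "y \<in> reach {fw1, fb} x" using all[OF y] by (rule reach_trans)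
      then show ?thesis using S.reachC_wb[OF x] by simp
    qed
    show "0 < S.tC (S.fwC x) \<Longrightarrow> \<exists>y\<in>reach {sig S.fwC S.fbC} x. dn S.fwC S.tC (S.fbC y)"
    proof -
      assume "0 < S.tC (S.fwC x)"
      then have "0 < t (fw x)" using S.tC_head[OF x] head1[of x] by simp
      then obtain y where y: "y \<in> reach {s} x" "dn fw t (fb y)" using L.down[OF xE] by blast
      \<comment> \<open>The witness survives the removal: \<open>d\<close> is excluded because its
        black successor is the up-step.\<close>
      have "fb d = z ! 0" using fbz[of "p - 1"] p2 by auto
      then have "y \<noteq> d" using y(2) z0_up by auto
      then have y1: "y \<in> reach {s1} x" using reach_s_s1[OF x y(1)] by simp
      then have yA: "y \<in> A" using S.reachC_s[OF x] reach_sub[OF S.C.bijs_s x] by auto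
      have "dn S.fwC S.tC (fb y)" using S.dnC[OF S.Cb[OF yA]] y dn1 by simp
      then show ?thesis using y1 S.reachC_s[OF x] yA by (auto simp: res_def)
    qed
    show "y \<in> reach {sig S.fwC S.fbC} x" if y: "y \<in> A" and h: "S.tC (S.fwC x) = 0" "S.tC (S.fwC y) = 0" for y
    proof -
      have "t (fw x) = 0" "t (fw y) = 0" using S.tC_head[OF x] S.tC_head[OF y] head1 h by auto
      then have "y \<in> reach {s} x" using L.uniq[OF xE] y by auto
      moreover have "y \<noteq> d" using y dU by blast
      ultimately have "y \<in> reach {s1} x" using reach_s_s1[OF x] by simp
      then show ?thesis using S.reachC_s[OF x] by simp
    qed
  next
    show "2 \<le> p" by (rule p2)
    show "cyc S.fwC A + cyc S.fbC A + cyc (sig S.fwC S.fbC) A = card A + 2"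
      using euler_iff L.euler euler_conv by simp
    obtain y where y: "y \<in> E" "t (fw y) = 0" using L.pt by blast
    show "\<exists>y\<in>A. S.tC (S.fwC y) = 0"
    proof (cases "y \<in> A")
      case True
      then show ?thesis using S.tC_head[OF True] head1[of y] y by auto
    next
      case False
      then obtain k where k: "k < p" "y = z ! k" using UE y by blast
      \<comment> \<open>Among the edges of \<open>z\<close> only the last can end at label
        \<open>0\<close>; its endpoint is the shared vertex, where \<open>c\<close> ends
        too.\<close>
      then have "k = p - 1" using z_head[of k] y by force
      then have "J = 0" using k y td by simp
      then show ?thesis using S.tC_head[OF cA] head1[of c] head_cd cA by auto
    qed
  qed (auto simp: lres_def)
qed

lemma lconst_insert:
  assumes "lconst A (res A fw1) (res A fb) (lres A 0 t) p"
  shows "lconst E fw fb t p"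
proof -
  interpret L: lconst A "res A fw1" "res A fb" "lres A 0 t" p by fact
  have cA: "c \<in> A" using cE cU by auto
  have zk: "z ! k \<in> reach {fw, fb} c" if "k < p" for k
    using that
  proof (induction k)
    case 0 then show ?case using fwc reach_step[of c "{fw, fb}" c fw] by auto
  next
    case (Suc k) then show ?case using fwz[of k] reach_step[of "z ! k" "{fw, fb}" c fw] by auto
  qed
  have UR: "x \<in> reach {fw, fb} c" if "x \<in> U" for x using zk UE[OF that] by auto
  have all: "x \<in> reach {fw, fb} c" if "x \<in> E" for x
  proof (cases "x \<in> U")
    case True then show ?thesis by (rule UR)
  next
    case False
    then have xA: "x \<in> A" using that by auto
    have "reach {fw1, fb} c \<subseteq> reach {fw, fb} c"
    proof (rule reach_least)
      fix y f assume y: "y \<in> reach {fw, fb} c" and f: "f \<in> {fw1, fb}"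
      have w: "fw x \<in> reach {fw, fb} c" "fb x \<in> reach {fw, fb} c" if "x \<in> reach {fw, fb} c" for x
        using that by (auto intro: reach_step)
      have "z ! 0 \<in> reach {fw, fb} c" using zk[of 0] p2 by simp
      then have "fw1 y \<in> reach {fw, fb} c"
        using w(1)[OF UR[OF dU]] w(1)[OF y] fw1_simps(1,2) fw1_simps(3)[of y] by (cases "y = c"; cases "y = d") simp_all
      then show "f y \<in> reach {fw, fb} c" using f w(2)[OF y] by auto
    qed auto
    then show ?thesis using L.conn[OF cA xA] S.reachC_wb[OF cA] by auto
  qed
  show ?thesis
  proof unfold_locales
    fix x assume x: "x \<in> E"
    have kU: "(fb ^^ n) (z ! k) = z ! ((k + n) mod p)" if "k < p" for k n
    proof (induction n)
      case (Suc n)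
      have "(k + n) mod p < p" using that by (intro mod_less_divisor) auto
      then show ?case using Suc fbz[of "(k + n) mod p"] by (simp add: mod_Suc_eq)
    qed (use that in auto)
    show "(fb ^^ p) x = x"
    proof (cases "x \<in> U")
      case True
      then show ?thesis using UE[OF True] kU[of _ p] by auto
    next
      case False
      then have xA: "x \<in> A" using x by auto
      have "(S.fbC ^^ k) x = (fb ^^ k) x \<and> (fb ^^ k) x \<in> A" for k
      proof (induction k)
        case (Suc k) then show ?case using closed_A(2)[of "(fb ^^ k) x"] by (simp add: res_def)
      qed (use xA in auto)
      then show ?thesis using L.order[OF xA] by simp
    qed
    show "t (fw x) + 1 = t x \<or> t (fw x) + 1 = t x + p"
    proof (cases "x \<in> U")
      case True
      then obtain k where "k < p" "x = z ! k" using UE by blast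
      then show ?thesis using zdn[of k] z0_up(2) by (cases "k = 0") (auto simp: dn_def)
    next
      case False
      then have xA: "x \<in> A" using x by auto
      then show ?thesis using L.step[OF xA] S.tC[OF xA] S.tC_head[OF xA] head1[of x] by auto
    qed
    show "y \<in> reach {fw, fb} x" if y: "y \<in> E" for y
      by (rule reach_trans[OF reach_sym[OF bijs_wb cE all[OF x]] all[OF y]])
    have Adown: "\<exists>y\<in>reach {s} x. dn fw t (fb y)" if xA: "x \<in> A" "0 < t (fw x)" for x
    proof -
      have "0 < S.tC (S.fwC x)" using S.tC_head[OF xA(1)] head1[of x] xA(2) by simp
      then obtain y where y: "y \<in> reach {s1} x" "dn S.fwC S.tC (S.fbC y)" using L.down[OF xA(1)] S.reachC_s[OF xA(1)] by auto
      then have yA: "y \<in> A" using S.reachC_s[OF xA(1)] reach_sub[OF S.C.bijs_s xA(1)] by auto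
      have "dn fw t (fb y)" using S.dnC[OF S.Cb[OF yA]] y dn1 yA by (simp add: res_def)
      then show ?thesis using reach_s1_s[OF xA(1)] y by auto
    qed
    show "\<exists>y\<in>reach {s} x. dn fw t (fb y)" if h: "0 < t (fw x)"
    proof (cases "x \<in> U")
      case True
      then obtain k where k: "k < p" "x = z ! k" using UE by blast
      show ?thesis
      proof (cases "Suc k = p")
        case True
        then have "x = d" using k by auto
        then have "0 < t (fw c)" using h head_cd by simp
        then obtain y where y: "y \<in> reach {s} c" "dn fw t (fb y)" using Adown[OF cA] by blast
        have "c \<in> reach {s} x" using \<open>x = d\<close> sd reach_step[of d "{s}" d s] by auto
        then have "y \<in> reach {s} x" using y(1) by (rule reach_trans)
        then show ?thesis using y(2) by blast
      next
        case False
        then have "fb x = z ! Suc k" using fbz k by simp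
        then show ?thesis using zdn[of "Suc k"] False k by (intro bexI[of _ x]) auto
      qed
    next
      case False then show ?thesis using Adown h x by auto
    qed
    show "y \<in> reach {s} x" if y: "y \<in> E" and h: "t (fw x) = 0" "t (fw y) = 0" for y
    proof -
      have AA: "v \<in> reach {s} u" if "u \<in> A" "v \<in> A" "t (fw u) = 0" "t (fw v) = 0" for u v
      proof -
        have "S.tC (S.fwC u) = 0" "S.tC (S.fwC v) = 0" using S.tC_head[OF that(1)] S.tC_head[OF that(2)] head1 that(3,4) by simp_all
        then have "v \<in> reach {s1} u" using L.uniq[OF that(1,2)] S.reachC_s[OF that(1)] by simp
        then show ?thesis by (rule subsetD[OF reach_s1_s[OF that(1)]])
      qed
      have "\<exists>v\<in>A. t (fw v) = 0 \<and> v \<in> reach {s} u \<and> u \<in> E" if u: "u \<in> E" "t (fw u) = 0" for u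
      proof (cases "u \<in> A")
        case False
        then obtain k where k: "k < p" "u = z ! k" using UE u by blast
        then have "k = p - 1" using z_head[of k] u by force
        then have ud: "u = d" using k by simp
        then have "c \<in> reach {s} u" using sd reach_step[of d "{s}" d s] by auto
        then show ?thesis using cA head_cd u ud by (intro bexI[of _ c]) auto
      qed (use u in auto)
      then obtain u v where "u \<in> A" "t (fw u) = 0" "u \<in> reach {s} x" "v \<in> A" "t (fw v) = 0" "v \<in> reach {s} y"
        using x y h by meson
      then show ?thesis
        by (intro reach_trans[OF reach_trans[OF _ AA[of u v]] reach_sym[OF bijs_s y]])
    qed
  next
    show "2 \<le> p" by (rule p2)
    show "cyc fw E + cyc fb E + cyc s E = card E + 2" using euler_iff L.euler euler_conv by simp
    obtain y where "y \<in> A" "S.tC (S.fwC y) = 0" using L.pt by blast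
    then show "\<exists>z\<in>E. t (fw z) = 0" using S.tC_head[of y] head1[of y] by (intro bexI[of _ y]) auto
  qed (rule out)
qed

lemma reach_root:
  assumes "r \<in> A" "c \<in> reach {fw1} r"
  shows "reach {fw1} r = reach {fw} r - U" "U \<subseteq> reach {fw} r"
proof -
  have sub: "reach {fw1} r \<subseteq> A" by (rule reach_least) (use assms(1) closed_A in auto)
  have "reach {fw} r \<subseteq> reach {fw1} r \<union> U"
  proof (rule reach_least)
    fix y f assume y: "y \<in> reach {fw1} r \<union> U" and f: "f \<in> {fw}"
    have w: "fw1 x \<in> reach {fw1} r" if "x \<in> reach {fw1} r" for x using that by (auto intro: reach_step)
    show "f y \<in> reach {fw1} r \<union> U"
      using y f fw1_simps(1,2) fw1_simps(3)[of y] w[OF assms(2)] w[of y] closed_U(1)[of y] fwc zU[of 0] p2 by (cases "y = c"; cases "y = d") auto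
  qed auto
  moreover have ss: "reach {fw1} x \<subseteq> reach {fw} x" if "x \<in> E" for x
  proof -
    have "k < p \<Longrightarrow> z ! k \<in> reach {fw} c" for k
    proof (induction k)
      case 0 then show ?case using fwc reach_step[of c "{fw}" c fw] by auto
    next
      case (Suc k) then show ?case using fwz[of k] reach_step[of "z ! k" "{fw}" c fw] by auto
    qed
    then have "d \<in> reach {fw} c" using p2 by auto
    from cyc_transpose_split(3)[OF fin permutes_imp_bij[OF fw] cE dE cd this, of fw1 x] that
    show ?thesis by (simp add: fw1_def)
  qed
  ultimately show "reach {fw1} r = reach {fw} r - U" using sub ss[of r] assms(1) by auto
  have cr: "c \<in> reach {fw} r" using assms ss[of r] by auto
  have zr: "k < p \<Longrightarrow> z ! k \<in> reach {fw} c" for k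
  proof (induction k)
    case 0 then show ?case using fwc reach_step[of c "{fw}" c fw] by auto
  next
    case (Suc k) then show ?case using fwz[of k] reach_step[of "z ! k" "{fw}" c fw] by auto
  qed
  show "U \<subseteq> reach {fw} r"
  proof
    fix x assume "x \<in> U"
    then obtain k where "k < p" "x = z ! k" using UE by blast
    then show "x \<in> reach {fw} r" using reach_trans[OF cr zr[of k]] by simp
  qed
qed

text \<open>The root face carries no weight and removing \<open>z\<close> changes no other white
  face, so the weight \<open>wF\<close> is preserved.\<close>

lemma faces:
  assumes r: "r \<in> A" "c \<in> reach {fw1} r"
  shows "reach {res A fw1} ` A - {reach {res A fw1} r} = reach {fw} ` E - {reach {fw} r}"
proof -
  note R = reach_root[OF r]
  have bw: "bijs {fw1} E" using L1.bijs_w .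
  have rE: "r \<in> E" using r by auto
  have same: "reach {fw1} x = reach {fw} x" if x: "x \<in> E" "x \<notin> reach {fw} r" for x
  proof -
    have n: "y \<notin> reach {fw} r" if "y \<in> reach {fw} x" for y
    proof
      assume "y \<in> reach {fw} r"
      then have "x \<in> reach {fw} r" using reach_sym[OF bijs_w x(1) that] by (rule reach_trans)
      then show False using x by simp
    qed
    have cd': "c \<in> reach {fw} r" "d \<in> reach {fw} r" using R r dU by auto
    show ?thesis
    proof (rule reach_cong1[of x "reach {fw} x", symmetric])
      fix y assume y: "y \<in> reach {fw} x"
      have "y \<noteq> c" "y \<noteq> d" using n[OF y] cd' by auto
      then show "fw y \<in> reach {fw} x \<and> fw y = fw1 y" using y fw1_simps(3) by (auto intro: reach_step)
    qed simp
  qed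
  have e1: "reach {fw} ` E - {reach {fw} r} = reach {fw} ` (E - reach {fw} r)"
  proof -
    have "reach {fw} x = reach {fw} r \<longleftrightarrow> x \<in> reach {fw} r" if "x \<in> E" for x
      using reach_eq[OF bijs_w rE, of x] reach_refl[of x "{fw}"] by blast
    then show ?thesis by auto
  qed
  have e2: "reach {fw1} ` A - {reach {fw1} r} = reach {fw1} ` (A - reach {fw1} r)"
  proof -
    have "reach {fw1} x = reach {fw1} r \<longleftrightarrow> x \<in> reach {fw1} r" if "x \<in> E" for x
      using reach_eq[OF bw rE, of x] reach_refl[of x "{fw1}"] by blast
    then show ?thesis by auto
  qed
  have e3: "A - reach {fw1} r = E - reach {fw} r" using R by auto
  have "reach {res A fw1} ` A = reach {fw1} ` A" by (intro image_cong refl S.reachC_w)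
  then have "reach {res A fw1} ` A - {reach {res A fw1} r} = reach {fw1} ` (E - reach {fw} r)"
    using S.reachC_w[OF r(1)] e2 e3 by simp
  also have "\<dots> = reach {fw} ` (E - reach {fw} r)" by (intro image_cong refl same) auto
  finally show ?thesis using e1 by simp
qed

text \<open>The contour of the root face of the two maps, read from the root: the shorter one is obtained
  by omitting the \<open>p\<close> edges of \<open>z\<close>, which occupy the positions from \<open>q\<close> on.\<close>

lemma contour_remove:
  assumes inj: "inj_on (\<lambda>k. (fw ^^ k) r) {..<N}" and q: "0 < q" "q + p \<le> N"
    and cq: "(fw ^^ (q - 1)) r = c" and zq: "\<And>l. l < p \<Longrightarrow> (fw ^^ (q + l)) r = z ! l"
  shows "k < q \<Longrightarrow> (fw1 ^^ k) r = (fw ^^ k) r" "q + p + k \<le> N \<Longrightarrow> (fw1 ^^ (q + k)) r = (fw ^^ (q + p + k)) r"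
proof -
  have ne: "(fw ^^ k) r \<noteq> c \<and> (fw ^^ k) r \<noteq> d" if "k < N" "k \<noteq> q - 1" "k \<noteq> q + p - 1" for k
  proof -
    have "(fw ^^ (q + p - 1)) r = d" using zq[of "p - 1"] p2 by simp
    moreover have "q - 1 \<in> {..<N}" "q + p - 1 \<in> {..<N}" "k \<in> {..<N}" using q p2 that by auto
    ultimately show ?thesis using inj_onD[OF inj, of k "q - 1"] inj_onD[OF inj, of k "q + p - 1"] that cq by metis
  qed
  show 1: "k < q \<Longrightarrow> (fw1 ^^ k) r = (fw ^^ k) r" for k
  proof (induction k)
    case (Suc k)
    have "(fw ^^ k) r \<noteq> c \<and> (fw ^^ k) r \<noteq> d" by (rule ne) (use Suc q p2 in auto)
    then show ?case using Suc fw1_simps(3) by simp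
  qed auto
  show "q + p + k \<le> N \<Longrightarrow> (fw1 ^^ (q + k)) r = (fw ^^ (q + p + k)) r"
  proof (induction k)
    case 0
    have "(fw1 ^^ q) r = fw1 ((fw1 ^^ (q - 1)) r)" using q by (cases q) auto
    also have "\<dots> = fw d" using 1[of "q - 1"] cq q fw1_simps(1) by simp
    also have "\<dots> = fw ((fw ^^ (q + (p - 1))) r)" using zq[of "p - 1"] p2 by simp
    also have "\<dots> = (fw ^^ (Suc (q + (p - 1)))) r" by simp
    also have "Suc (q + (p - 1)) = q + p" using p2 by simp
    finally show ?case by simp
  next
    case (Suc k)
    have "(fw ^^ (q + p + k)) r \<noteq> c \<and> (fw ^^ (q + p + k)) r \<noteq> d" by (rule ne) (use Suc q p2 in auto)
    then show ?case using Suc fw1_simps(3) by simp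
  qed
qed

lemma contour_insert:
  assumes inj: "inj_on (\<lambda>k. (fw1 ^^ k) r) {..<M}" and q: "0 < q" "q \<le> M" and r: "r \<in> A"
    and cq: "(fw1 ^^ (q - 1)) r = c"
  shows "k < q \<Longrightarrow> (fw ^^ k) r = (fw1 ^^ k) r" "l < p \<Longrightarrow> (fw ^^ (q + l)) r = z ! l"
    "q + k \<le> M \<Longrightarrow> (fw ^^ (q + p + k)) r = (fw1 ^^ (q + k)) r"
proof -
  have kA: "(fw1 ^^ k) r \<in> A" for k
  proof (induction k)
    case (Suc k) then show ?case using closed_A(1)[of "(fw1 ^^ k) r"] by simp
  qed (use r in simp)
  have ne: "(fw1 ^^ k) r \<noteq> c \<and> (fw1 ^^ k) r \<noteq> d" if "k < M" "k \<noteq> q - 1" for k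
  proof -
    have "q - 1 \<in> {..<M}" "k \<in> {..<M}" using q that by auto
    then show ?thesis using inj_onD[OF inj, of k "q - 1"] that cq kA[of k] dU by auto
  qed
  show 1: "k < q \<Longrightarrow> (fw ^^ k) r = (fw1 ^^ k) r" for k
  proof (induction k)
    case (Suc k)
    have "(fw1 ^^ k) r \<noteq> c \<and> (fw1 ^^ k) r \<noteq> d" by (rule ne) (use Suc q in auto)
    then show ?case using Suc fw1_simps(3) by simp
  qed auto
  show 2: "l < p \<Longrightarrow> (fw ^^ (q + l)) r = z ! l" for l
  proof (induction l)
    case 0
    have "(fw ^^ q) r = fw ((fw ^^ (q - 1)) r)" using q by (cases q) auto
    then show ?case using 1[of "q - 1"] cq q fwc by simp
  next
    case (Suc l) then show ?case using fwz[of l] by simp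
  qed
  show "q + k \<le> M \<Longrightarrow> (fw ^^ (q + p + k)) r = (fw1 ^^ (q + k)) r"
  proof (induction k)
    case 0
    have "(fw ^^ (q + (p - 1))) r = d" using 2[of "p - 1"] p2 by simp
    then have "(fw ^^ (Suc (q + (p - 1)))) r = fw d" by (simp only: funpow.simps o_apply)
    moreover have "Suc (q + (p - 1)) = q + p" using p2 by simp
    moreover have "fw d = fw1 ((fw1 ^^ (q - 1)) r)" using cq fw1_simps(1) by simp
    then have "fw d = (fw1 ^^ q) r" using q by (cases q) auto
    ultimately show ?case by simp
  next
    case (Suc k)
    have "(fw1 ^^ (q + k)) r \<noteq> c \<and> (fw1 ^^ (q + k)) r \<noteq> d" by (rule ne) (use Suc q in auto)
    then show ?case using Suc fw1_simps(3)[of "(fw1 ^^ (q + k)) r"] by simp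
  qed
qed

end

section \<open>Removal and insertion for maps with a given root word\<close>

lemma rmaps_labels:
  assumes p: "2 \<le> p" and m: "(fw, fb, t, r) \<in> rmaps p E (lastup p pre)"
  defines "q \<equiv> length pre" and "J \<equiv> wend p 0 pre"
  shows "t ((fw ^^ q) r) = J" "\<And>l. 0 < l \<Longrightarrow> l \<le> p + J \<Longrightarrow> t ((fw ^^ (q + l)) r) = J + p - l"
proof -
  have len: "length (lastup p pre) = q + p + J" using lastup_length[OF p] by (simp add: q_def J_def)
  have *: "k \<le> length (lastup p pre) \<Longrightarrow> t ((fw ^^ k) r) = wht p (lastup p pre) k" for k using m by (auto simp: rmaps_def)
  show "t ((fw ^^ q) r) = J" using *[of q] len wht_lastup_pre[of q pre p] by (simp add: q_def J_def wht_def)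
  show "t ((fw ^^ (q + l)) r) = J + p - l" if "0 < l" "l \<le> p + J" for l
    using *[of "q + l"] wht_lastup[of "l - 1" p pre] len that p by (simp add: q_def J_def)
qed

text \<open>The \<open>p - 1\<close> coincidences run through all edges of the black face, and
  \<open>order\<close> closes it after \<open>p\<close> steps. The prefix is nonempty so that the
  root face has an edge before position \<open>q\<close>.\<close>

lemma leaf_of_tmaps:
  assumes p: "2 \<le> p" and q0: "pre \<noteq> []" and m: "(fw, fb, t, r) \<in> tmaps p E (lastup p pre) (length pre) (p - 1)"
  defines "q \<equiv> length pre" and "J \<equiv> wend p 0 pre"
  defines "z \<equiv> map (\<lambda>l. (fw ^^ (q + l)) r) [0..<p]" and "c \<equiv> (fw ^^ (q - 1)) r"
  shows "leaf E fw fb t z c J p" "r \<in> E - set z" "inj_on (\<lambda>k. (fw ^^ k) r) {..<length (lastup p pre)}"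
    "(fw ^^ length (lastup p pre)) r = r"
proof -
  have rm: "(fw, fb, t, r) \<in> rmaps p E (lastup p pre)" using m by (simp add: tmaps_def)
  have lf: "\<And>l. l < p - 1 \<Longrightarrow> fb ((fw ^^ (q + l)) r) = (fw ^^ (q + l + 1)) r" using m by (simp add: tmaps_def q_def)
  interpret lconst E fw fb t p using rm by (simp add: rmaps_def)
  let ?N = "length (lastup p pre)"
  have len: "?N = q + p + J" using lastup_length[OF p] by (simp add: q_def J_def)
  have rE: "r \<in> E" and cN: "card (reach {fw} r) = ?N" using rm by (auto simp: rmaps_def)
  note P = orbit_period[OF fin permutes_imp_bij[OF fw] rE, unfolded cN]
  show inj: "inj_on (\<lambda>k. (fw ^^ k) r) {..<?N}" and "(fw ^^ ?N) r = r" using P by auto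
  note L = rmaps_labels[OF p rm, folded q_def J_def]
  have kE: "(fw ^^ k) r \<in> E" for k by (induction k) (use rE in auto)
  have zk: "l < p \<Longrightarrow> z ! l = (fw ^^ (q + l)) r" for l by (simp add: z_def)
  have qp: "0 < q" using q0 q_def by auto
  have nz: "(fw ^^ k) r \<notin> set z" if "k < q" for k
  proof
    assume "(fw ^^ k) r \<in> set z"
    then obtain l where "l < p" "(fw ^^ k) r = (fw ^^ (q + l)) r" by (auto simp: z_def)
    then show False using inj_onD[OF inj, of k "q + l"] that len by auto
  qed
  show "r \<in> E - set z" using rE nz[of 0] qp by simp
  have fbp: "l < p \<Longrightarrow> (fb ^^ l) ((fw ^^ q) r) = (fw ^^ (q + l)) r" for l
    by (induction l) (use lf in auto)
  show "leaf E fw fb t z c J p"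
  proof unfold_locales
    show "length z = p" "2 \<le> p" using p by (auto simp: z_def)
    show "distinct z"
      unfolding z_def distinct_map
    proof (intro conjI distinct_upt inj_onI)
      fix x y assume "x \<in> set [0..<p]" "y \<in> set [0..<p]" "(fw ^^ (q + x)) r = (fw ^^ (q + y)) r"
      then show "x = y" using inj_onD[OF inj, of "q + x" "q + y"] len by auto
    qed
    show "set z \<subseteq> E" using kE by (auto simp: z_def)
    show "c \<in> E" using kE by (simp add: c_def)
    show "c \<notin> set z" using nz[of "q - 1"] qp by (simp add: c_def)
    show "fb (z ! k) = z ! (Suc k mod p)" if k: "k < p" for k
    proof (cases "Suc k = p")
      case True
      have "(fb ^^ p) ((fw ^^ q) r) = (fw ^^ q) r" by (rule order[OF kE])
      then have "fb ((fb ^^ k) ((fw ^^ q) r)) = (fw ^^ q) r" using True by auto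
      then show ?thesis using fbp[OF k] zk[OF k] zk[of 0] p True by simp
    next
      case False
      then show ?thesis using lf[of k] zk[of k] zk[of "Suc k"] k by simp
    qed
    show "fw (z ! k) = z ! Suc k" if "Suc k < p" for k using zk[of k] zk[of "Suc k"] that by simp
    show "fw c = z ! 0" using zk[of 0] p qp unfolding c_def by (cases q) auto
    show "t (z ! 0) = J" using zk[of 0] p L(1) by simp
    show "t (z ! k) = J + p - k" if "0 < k" "k < p" for k using zk[of k] L(2)[of k] that by simp
    have "z ! (p - 1) = (fw ^^ (q + (p - 1))) r" by (rule zk) (use p in simp)
    then have "fw (z ! (p - 1)) = (fw ^^ Suc (q + (p - 1))) r" by (simp only: funpow.simps o_apply)
    also have "Suc (q + (p - 1)) = q + p" using p by simp
    finally show "t (fw (z ! (p - 1))) = J" using L(2)[of p] p by simp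
    show "t x = 0" if "x \<notin> E" for x by (rule out[OF that])
  qed
qed

lemma wht_short: 
  "k \<le> length pre \<Longrightarrow> wht p (pre @ replicate (wend p 0 pre) False) k = wht p pre k"
  "k \<le> wend p 0 pre \<Longrightarrow> wht p (pre @ replicate (wend p 0 pre) False) (length pre + k) = wend p 0 pre - k"
  by (simp_all add: wht_def wend_append wend_replicate min_def)

lemma remove_rmap:
  assumes p: "2 \<le> p" and q0: "pre \<noteq> []" and m: "(fw, fb, t, r) \<in> tmaps p E (lastup p pre) (length pre) (p - 1)"
  defines "q \<equiv> length pre" and "J \<equiv> wend p 0 pre"
  defines "z \<equiv> map (\<lambda>l. (fw ^^ (q + l)) r) [0..<p]" and "c \<equiv> (fw ^^ (q - 1)) r"
  defines "fw1 \<equiv> \<lambda>x. fw (transpose c (z ! (p - 1)) x)" and "A \<equiv> E - set z"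
  shows "(res A fw1, res A fb, lres A 0 t, r) \<in> rmaps p A (pre @ replicate J False)"
    "(res A fw1 ^^ (q - 1)) r = c" "c \<in> reach {fw1} r"
proof -
  note lf = leaf_of_tmaps[OF p q0 m, folded q_def J_def, folded z_def c_def]
  note f1_def = fw1_def
  interpret leaf E fw fb t z c J p by (rule lf)
  have f1: "leaf.fw1 fw z c p = fw1" unfolding f1_def by (rule leaf.fw1_def[OF lf(1)])
  note closed = closed_A[unfolded f1, folded A_def]
  have rm: "(fw, fb, t, r) \<in> rmaps p E (lastup p pre)" using m by (simp add: tmaps_def)
  then have L: "lconst E fw fb t p" by (simp add: rmaps_def)
  let ?N = "length (lastup p pre)"
  have len: "?N = q + p + J" using lastup_length[OF p] by (simp add: q_def J_def)
  have qp: "0 < q" "q + p \<le> ?N" using q0 len q_def by auto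
  have zq: "l < p \<Longrightarrow> (fw ^^ (q + l)) r = z ! l" for l by (simp add: z_def)
  have cq: "(fw ^^ (q - 1)) r = c" by (simp add: c_def)
  note C = contour_remove[OF lf(3) qp cq zq, unfolded f1]
  have pw: "(res A fw1 ^^ k) r = (fw1 ^^ k) r \<and> (fw1 ^^ k) r \<in> A" for k
    by (rule pow_res) (use closed lf(2) A_def in auto)
  have c1: "(fw1 ^^ (q - 1)) r = c" using C(1)[of "q - 1"] qp c_def by simp
  then show "(res A fw1 ^^ (q - 1)) r = c" using pw by simp
  show cr: "c \<in> reach {fw1} r" using c1 reach_power[of fw1 "{fw1}" "q - 1" r] by simp
  \<comment> \<open>Position on the long contour of the edge at position \<open>k\<close> of the
    short one: the \<open>p\<close> positions of \<open>z\<close> are skipped.\<close>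
  define \<phi> where "\<phi> = (\<lambda>k. if k < q then k else k + p)"
  have C': "(fw1 ^^ k) r = (fw ^^ \<phi> k) r" if "k \<le> q + J" for k
  proof (cases "k < q")
    case True then show ?thesis using C(1) by (simp add: \<phi>_def)
  next
    case False
    then obtain l where "k = q + l" using le_Suc_ex not_less by blast
    then show ?thesis using C(2)[of l] that len by (simp add: \<phi>_def ac_simps)
  qed
  have N1: "(fw1 ^^ (q + J)) r = r" using C'[of "q + J"] lf(4) len by (simp add: \<phi>_def ac_simps)
  have inj1: "inj_on (\<lambda>k. (fw1 ^^ k) r) {..<q + J}"
  proof (rule inj_onI)
    fix k l assume kl: "k \<in> {..<q + J}" "l \<in> {..<q + J}" "(fw1 ^^ k) r = (fw1 ^^ l) r"
    have "\<phi> k \<in> {..<?N}" "\<phi> l \<in> {..<?N}" using kl len by (auto simp: \<phi>_def)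
    moreover have "(fw ^^ \<phi> k) r = (fw ^^ \<phi> l) r" using kl C' by auto
    ultimately have "\<phi> k = \<phi> l" using inj_onD[OF lf(3)] by blast
    then show "k = l" by (auto simp: \<phi>_def split: if_splits)
  qed
  have card1: "card (reach {fw1} r) = q + J" by (rule orbit_periodI[OF N1 inj1]) (use qp in simp)
  have rch: "reach {res A fw1} r = reach {fw1} r" unfolding reach_single using pw by simp
  have lab1: "lres A 0 t ((res A fw1 ^^ k) r) = wht p (pre @ replicate J False) k" if k: "k \<le> q + J" for k
  proof -
    have 1: "lres A 0 t ((res A fw1 ^^ k) r) = t ((fw ^^ \<phi> k) r)" using pw[of k] C'[OF k] by (simp add: lres_def)
    have 2: "\<phi> k \<le> ?N" using len k by (auto simp: \<phi>_def)
    then have 3: "t ((fw ^^ \<phi> k) r) = wht p (lastup p pre) (\<phi> k)" using rm by (auto simp: rmaps_def)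
    show ?thesis
    proof (cases "k < q")
      case True
      then show ?thesis using 1 3 wht_lastup_pre[of k pre p] wht_short(1)[of k pre p] by (simp add: \<phi>_def q_def J_def)
    next
      case False
      then obtain l where l: "k = q + l" using le_Suc_ex not_less by blast
      have "t ((fw ^^ (q + (l + p))) r) = J + p - (l + p)"
        using rmaps_labels(2)[OF p rm, of "l + p"] l k p by (simp add: q_def J_def)
      then show ?thesis using 1 l k wht_short(2)[of l p pre] by (simp add: \<phi>_def q_def J_def ac_simps)
    qed
  qed
  show "(res A fw1, res A fb, lres A 0 t, r) \<in> rmaps p A (pre @ replicate J False)"
    unfolding rmaps_def using lconst_remove[OF L, unfolded f1, folded A_def] lf(2) rch card1 lab1 by (auto simp: A_def q_def)
qed

lemma insert_rmap:
  assumes p: "2 \<le> p" and q0: "pre \<noteq> []" and E: "finite E" and z: "distinct z" "length z = p" "set z \<subseteq> E"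
  defines "A \<equiv> E - set z" and "q \<equiv> length pre" and "J \<equiv> wend p 0 pre"
  assumes m: "(fwA, fbA, tA, r) \<in> rmaps p A (pre @ replicate J False)"
  obtains fw fb t where "(fw, fb, t, r) \<in> tmaps p E (lastup p pre) (length pre) (p - 1)"
     "z = map (\<lambda>l. (fw ^^ (q + l)) r) [0..<p]"
     "fwA = res A (\<lambda>x. fw (transpose ((fw ^^ (q - 1)) r) (z ! (p - 1)) x))" "fbA = res A fb" "tA = lres A 0 t"
proof -
  have LA: "lconst A fwA fbA tA p" and rA: "r \<in> A" and cN: "card (reach {fwA} r) = q + J"
     and labA: "\<And>k. k \<le> q + J \<Longrightarrow> tA ((fwA ^^ k) r) = wht p (pre @ replicate J False) k"
    using m by (auto simp: rmaps_def q_def)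
  interpret A: lconst A fwA fbA tA p by (rule LA)
  define c where "c = (fwA ^^ (q - 1)) r"
  define d where "d = z ! (p - 1)"
  define fw0 where "fw0 = (\<lambda>x. if x \<in> set z then cz z x else fwA x)"
  define fw where "fw = (\<lambda>x. fw0 (transpose c d x))"
  define fb where "fb = (\<lambda>x. if x \<in> set z then cz z x else fbA x)"
  define t where "t = (\<lambda>x. if x \<in> set z then lz J p z x else tA x)"
  have disj: "A \<inter> set z = {}" and AE: "A \<union> set z = E" using z A_def by auto
  have qp: "0 < q" using q0 q_def by auto
  have kA: "(fwA ^^ k) r \<in> A" for k by (induction k) (use rA A.inE(1) in auto)
  have cA: "c \<in> A" by (simp add: c_def kA)
  have dz: "d \<in> set z" unfolding d_def using z p by (intro nth_mem) auto
  have cd: "c \<noteq> d" using cA dz disj by auto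
  have fwAc: "fwA c = (fwA ^^ q) r" using qp unfolding c_def by (cases q) auto
  have tq: "tA ((fwA ^^ q) r) = J" using labA[of q] wht_short(2)[of 0 p pre] by (simp add: q_def J_def)
  have fw0_perm: "fw0 permutes E" unfolding fw0_def AE[symmetric]
    by (rule permutes_disjoint_union[OF A.fw cz_permutes[OF z(1)] disj])
  have fb_perm: "fb permutes E" unfolding fb_def AE[symmetric]
    by (rule permutes_disjoint_union[OF A.fb cz_permutes[OF z(1)] disj])
  have fw_perm: "fw permutes E"
    using permutes_compose[OF permutes_swap_id[of c E d] fw0_perm] cA dz AE by (auto simp: fw_def o_def)
  have zk: "k < p \<Longrightarrow> z ! k \<in> set z" for k using z by auto
  have czk: "k < p \<Longrightarrow> cz z (z ! k) = z ! (Suc k mod p)" for k using cz_nth[OF z(1), of k] z by simp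
  have zd: "k < p - 1 \<Longrightarrow> z ! k \<noteq> d" for k unfolding d_def using z by (auto simp: nth_eq_iff_index_eq)
  have fw_s: "fw c = z ! 0" "fw d = fwA c" "x \<noteq> c \<Longrightarrow> x \<noteq> d \<Longrightarrow> fw x = fw0 x" for x
  proof -
    have "cz z d = z ! 0" unfolding d_def using czk[of "p - 1"] p by simp
    then show "fw c = z ! 0" using dz by (simp add: fw_def fw0_def)
    show "fw d = fwA c" using cA disj by (auto simp: fw_def fw0_def)
    show "x \<noteq> c \<Longrightarrow> x \<noteq> d \<Longrightarrow> fw x = fw0 x" by (simp add: fw_def)
  qed
  have tzk: "k < p \<Longrightarrow> t (z ! k) = (if k = 0 then J else J + p - k)" for k
    using lz_nth[OF z(1), of k J p] z zk by (simp add: t_def)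
  have tA: "x \<in> A \<Longrightarrow> t x = tA x" for x using disj by (auto simp: t_def)
  have fwAcA: "fwA c \<in> A" using cA A.inE(1) by simp
  have tfd: "t (fw d) = J" using tA[OF fwAcA] fwAc tq fw_s by simp
  have lf: "leaf E fw fb t z c J p"
  proof unfold_locales
    show "finite E" "fw permutes E" "fb permutes E" by fact+
    show "distinct z" "length z = p" "2 \<le> p" "set z \<subseteq> E" using z p by auto
    show "c \<in> E" "c \<notin> set z" using cA disj AE by auto
    show "fb (z ! k) = z ! (Suc k mod p)" if "k < p" for k using czk zk that by (simp add: fb_def)
    show wz: "fw (z ! k) = z ! Suc k" if "Suc k < p" for k
    proof -
      have "z ! k \<noteq> c" using zk[of k] cA disj that by auto
      then show ?thesis using fw_s(3)[of "z ! k"] zd[of k] czk[of k] zk[of k] that by (simp add: fw0_def)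
    qed
    show "fw c = z ! 0" by (rule fw_s)
    show "t (z ! 0) = J" using tzk[of 0] p by simp
    show "t (z ! k) = J + p - k" if "0 < k" "k < p" for k using tzk[of k] that by simp
    show "t (fw (z ! (p - 1))) = J" using tfd by (simp add: d_def)
    show "t x = 0" if "x \<notin> E" for x using that z A.out[of x] by (auto simp: t_def A_def)
    show "t (fb x) = t (fw x)" if x: "x \<in> E" for x
    proof (cases "x \<in> set z")
      case True
      then obtain k where k: "k < p" "x = z ! k" using z by (metis in_set_conv_nth)
      show ?thesis
      proof (cases "Suc k = p")
        case True
        then have "x = d" "fb x = z ! 0" using k czk[of k] zk[of k] by (auto simp: d_def fb_def)
        then show ?thesis using tfd tzk[of 0] p by simp
      next
        case False
        then show ?thesis using wz[of k] czk[of k] zk[of k] k by (simp add: fb_def)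
      qed
    next
      case False
      then have xA: "x \<in> A" using x AE by auto
      then have xd: "x \<noteq> d" using dz disj by auto
      have fbx: "fb x = fbA x" "fbA x \<in> A" "fwA x \<in> A" using False xA A.inE by (auto simp: fb_def)
      show ?thesis
      proof (cases "x = c")
        case True
        then show ?thesis using fbx tA[of "fbA x"] A.lab[OF xA] fwAc tq fw_s(1) tzk[of 0] p by simp
      next
        case nc: False
        then have "fw x = fwA x" using fw_s(3) xd False by (simp add: fw0_def)
        then show ?thesis using fbx tA A.lab[OF xA] by simp
      qed
    qed
  qed
  interpret leaf E fw fb t z c J p by (rule lf)
  have f1: "leaf.fw1 fw z c p = fw0"
  proof
    fix x
    have "leaf.fw1 fw z c p x = fw (transpose c (z ! (p - 1)) x)" by (simp add: leaf.fw1_def[OF lf])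
    also have "\<dots> = fw0 x" by (simp add: fw_def d_def)
    finally show "leaf.fw1 fw z c p x = fw0 x" .
  qed
  have rA': "res A fw0 = fwA" "res A fb = fbA" unfolding fw0_def fb_def
    by (rule sublab_cong_res[OF A.fw disj], rule sublab_cong_res[OF A.fb disj])
  have lA: "lres A 0 t = tA" using tA A.out by (auto simp: lres_def fun_eq_iff)
  have L: "lconst E fw fb t p"
    by (rule lconst_insert) (use LA rA' lA f1 in \<open>simp add: A_def\<close>)
  have pw: "(res A fw0 ^^ k) r = (fw0 ^^ k) r \<and> (fw0 ^^ k) r \<in> A" for k
    by (rule pow_res) (use closed_A(1)[unfolded f1] rA A_def in auto)
  then have pwA: "(fw0 ^^ k) r = (fwA ^^ k) r" for k using rA' by simp
  have rch: "reach {fw0} r = reach {fwA} r" unfolding reach_single pwA by simp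
  have rEz: "r \<in> E - set z" using rA A_def by simp
  have PA: "(fwA ^^ (q + J)) r = r" "inj_on (\<lambda>k. (fwA ^^ k) r) {..<q + J}"
    using orbit_period(1,2)[OF A.fin permutes_imp_bij[OF A.fw] rA] cN by simp_all
  have C: "k < q \<Longrightarrow> (fw ^^ k) r = (fwA ^^ k) r" "l < p \<Longrightarrow> (fw ^^ (q + l)) r = z ! l"
    "q + k \<le> q + J \<Longrightarrow> (fw ^^ (q + p + k)) r = (fwA ^^ (q + k)) r" for k l
    using contour_insert[of r "q + J" q, unfolded f1 pwA] PA(2) qp rEz c_def by auto
  have cr: "c \<in> reach {fw0} r" using reach_power[of fwA "{fwA}" "q - 1" r] rch c_def by simp
  note RR = reach_root[OF rEz, unfolded f1, OF cr]
  have "finite (reach {fw} r)" using reach_sub[OF bijs_w, of r] rEz fin finite_subset by blast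
  then have "card (reach {fw} r) = card (reach {fw0} r) + card (set z)"
    using RR card_Diff_subset[of "set z" "reach {fw} r"] card_mono[of "reach {fw} r" "set z"] by simp
  then have cN': "card (reach {fw} r) = length (lastup p pre)"
    using rch cN distinct_card[OF z(1)] z(2) lastup_length[OF p, of pre] by (simp add: q_def J_def)
  have lab: "t ((fw ^^ k) r) = wht p (lastup p pre) k" if k: "k \<le> length (lastup p pre)" for k
  proof -
    have k': "k \<le> q + p + J" using k lastup_length[OF p] by (simp add: q_def J_def)
    consider "k < q" | l where "k = q + l" "l < p" | l where "k = q + p + l" "l \<le> J"
      using k' by (metis add_diff_inverse_nat add_le_cancel_left not_less group_cancel.add1 nat_add_left_cancel_less)
    then show ?thesis
    proof cases
      case 1
      then show ?thesis using C(1)[OF 1] labA[of k] tA[OF kA] wht_short(1)[of k pre p] wht_lastup_pre[of k pre p]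
        by (simp add: q_def J_def)
    next
      case 2
      then have "t ((fw ^^ k) r) = (if l = 0 then J else J + p - l)" using C(2) tzk by simp
      moreover have "wht p (lastup p pre) (q + l) = (if l = 0 then J else J + p - l)"
        using wht_lastup_pre[of q pre p] wht_lastup[of "l - 1" p pre] 2 p by (auto simp: q_def J_def wht_def)
      ultimately show ?thesis using 2 by simp
    next
      case 3
      have "t ((fw ^^ k) r) = J - l" using C(3)[of l] 3 labA[of "q + l"] tA[OF kA] wht_short(2)[of l p pre]
        by (simp add: q_def J_def)
      moreover have "wht p (lastup p pre) (q + 1 + (l + p - 1)) = J - l"
        using wht_lastup[of "l + p - 1" p pre] 3 p by (auto simp: q_def J_def)
      moreover have "q + 1 + (l + p - 1) = k" using 3 p by simp
      ultimately show ?thesis by simp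
    qed
  qed
  have tm: "(fw, fb, t, r) \<in> tmaps p E (lastup p pre) (length pre) (p - 1)"
    unfolding tmaps_def rmaps_def q_def[symmetric]
  proof (safe)
    show "lconst E fw fb t p" by (rule L)
    show "r \<in> E" using rEz by simp
    show "card (reach {fw} r) = length (lastup p pre)" by (rule cN')
    show "\<And>k. k \<le> length (lastup p pre) \<Longrightarrow> t ((fw ^^ k) r) = wht p (lastup p pre) k" by (rule lab)
    show "fb ((fw ^^ (q + l)) r) = (fw ^^ (q + l + 1)) r" if "l < p - 1" for l
      using C(2)[of l] C(2)[of "Suc l"] fbz[of l] that by simp
  qed
  show thesis
  proof (rule that[OF tm])
    show "z = map (\<lambda>l. (fw ^^ (q + l)) r) [0..<p]"
      by (rule nth_equalityI) (use z C(2) in auto)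
    have "(fw ^^ (q - 1)) r = c" using C(1)[of "q - 1"] qp c_def by simp
    moreover have "(\<lambda>x. fw (transpose c (z ! (p - 1)) x)) = fw0"
      unfolding fw_def d_def[symmetric] by (simp add: fun_eq_iff)
    ultimately show "fwA = res A (\<lambda>x. fw (transpose ((fw ^^ (q - 1)) r) (z ! (p - 1)) x))" using rA' by simp
    show "fbA = res A fb" "tA = lres A 0 t" using rA' lA by auto
  qed
qed

lemma sum_lists:
  fixes g :: "nat set \<Rightarrow> 'c::comm_ring_1"
  assumes "finite E"
  shows "(\<Sum>z\<in>{z. distinct z \<and> length z = p \<and> set z \<subseteq> E}. g (set z)) =
    (\<Sum>B\<in>Pow E. of_nat (if card B = p then fact p else 0) * g B)"
proof -
  let ?S = "{z. distinct z \<and> length z = p \<and> set z \<subseteq> E}"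
  have fS: "finite ?S" by (rule finite_subset[OF _ finite_lists_length_eq[OF assms, of p]]) auto
  have "(\<Sum>z\<in>?S. g (set z)) = (\<Sum>B\<in>Pow E. \<Sum>z\<in>{z \<in> ?S. set z = B}. g (set z))"
    by (rule sum.group[symmetric]) (use fS assms in auto)
  also have "\<dots> = (\<Sum>B\<in>Pow E. of_nat (if card B = p then fact p else 0) * g B)"
  proof (rule sum.cong[OF refl])
    fix B assume B: "B \<in> Pow E"
    have e: "{z \<in> ?S. set z = B} = (if card B = p then permutations_of_set B else {})"
      using B by (auto simp: permutations_of_set_def distinct_card)
    have "finite B" using B assms finite_subset by auto
    then have c: "card {z \<in> ?S. set z = B} = (if card B = p then fact p else 0)" unfolding e by auto
    have "(\<Sum>z\<in>{z \<in> ?S. set z = B}. g (set z)) = (\<Sum>z\<in>{z \<in> ?S. set z = B}. g B)" by (rule sum.cong) auto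
    also have "\<dots> = of_nat (card {z \<in> ?S. set z = B}) * g B" by (rule sum_constant)
    finally show "(\<Sum>z\<in>{z \<in> ?S. set z = B}. g (set z)) = of_nat (if card B = p then fact p else 0) * g B" by (simp only: c)
  qed
  finally show ?thesis .
qed

text \<open>The removed face leaves an ordered list of edges, hence \<open>fact p\<close> for each
  set \<open>B\<close>. The case in which the root itself is the last up-step is
  \<open>base_sum\<close>.\<close>

lemma remove_sum:
  fixes wg :: "nat \<Rightarrow> 'c::comm_ring_1" and pre :: "bool list"
  assumes E: "finite E" and p: "2 \<le> p" and q0: "pre \<noteq> []"
  shows "(\<Sum>x\<in>tmaps p E (lastup p pre) (length pre) (p - 1). wF wg E x) =
     (\<Sum>B\<in>Pow E. of_nat (if card B = p then fact p else 0) *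
        (\<Sum>x\<in>rmaps p (E - B) (pre @ replicate (wend p 0 pre) False). wF wg (E - B) x))"
proof -
  let ?q = "length pre" and ?J = "wend p 0 pre"
  let ?X = "tmaps p E (lastup p pre) ?q (p - 1)"
  let ?Z = "{z. distinct z \<and> length z = p \<and> set z \<subseteq> E}"
  let ?w = "pre @ replicate ?J False"
  let ?Y = "Sigma ?Z (\<lambda>z. rmaps p (E - set z) ?w)"
  define R where "R = (\<lambda>(fw, fb, t, r) (z, (fwA, fbA, tA, r')).
     r' = r \<and> z = map (\<lambda>l. (fw ^^ (?q + l)) r) [0..<p] \<and>
     fwA = res (E - set z) (\<lambda>x. fw (transpose ((fw ^^ (?q - 1)) r) (z ! (p - 1)) x)) \<and>
     fbA = res (E - set z) fb \<and> tA = lres (E - set z) 0 (t :: nat \<Rightarrow> nat))"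
  have fZ: "finite ?Z" by (rule finite_subset[OF _ finite_lists_length_eq[OF E, of p]]) auto
  have "(\<Sum>x\<in>?X. wF wg E x) = (\<Sum>(z, y)\<in>?Y. wF wg (E - set z) y)"
  proof (rule sum_bij_rel[where R=R])
    fix x assume x: "x \<in> ?X"
    obtain fw fb t r where xe: "x = (fw, fb, t, r)" by (cases x)
    let ?z = "map (\<lambda>l. (fw ^^ (?q + l)) r) [0..<p]"
    interpret leaf E fw fb t ?z "(fw ^^ (?q - 1)) r" ?J p
      by (rule leaf_of_tmaps(1)[OF p q0]) (use x xe in simp)
    show "\<exists>y\<in>?Y. R x y"
      using remove_rmap(1)[OF p q0, of fw fb t r E] x xe dz lz zE
      by (intro bexI[of _ "(?z, _)"]) (auto simp: R_def)
  next
    fix y assume y: "y \<in> ?Y"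
    obtain z fwA fbA tA r where ye: "y = (z, (fwA, fbA, tA, r))" by (metis prod_cases5)
    show "\<exists>x\<in>?X. R x y"
    proof (rule insert_rmap[OF p q0 E, of z fwA fbA tA r])
      fix fw fb t
      assume "(fw, fb, t, r) \<in> ?X" "z = map (\<lambda>l. (fw ^^ (?q + l)) r) [0..<p]"
        "fwA = res (E - set z) (\<lambda>x. fw (transpose ((fw ^^ (?q - 1)) r) (z ! (p - 1)) x))" "fbA = res (E - set z) fb" "tA = lres (E - set z) 0 t"
      then show ?thesis by (intro bexI[of _ "(fw, fb, t, r)"]) (simp_all add: R_def ye)
    qed (use y ye in auto)
  next
    fix x y z assume "R x y" "R x z" then show "y = z" by (auto simp: R_def split: prod.splits)
  next
    fix x x2 y assume X: "x \<in> ?X" "x2 \<in> ?X" and y: "y \<in> ?Y" and R: "R x y" "R x2 y"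
    obtain z fwA fbA tA r where ye: "y = (z, (fwA, fbA, tA, r))" by (metis prod_cases5)
    obtain fw fb t where xe: "x = (fw, fb, t, r)" using R(1) by (cases x) (auto simp: R_def ye)
    obtain fw2 fb2 t2 where xe2: "x2 = (fw2, fb2, t2, r)" using R(2) by (cases x2) (auto simp: R_def ye)
    define c where "c = (fw ^^ (?q - 1)) r"
    define c2 where "c2 = (fw2 ^^ (?q - 1)) r"
    let ?d = "z ! (p - 1)"
    have r1: "z = map (\<lambda>l. (fw ^^ (?q + l)) r) [0..<p]" "fwA = res (E - set z) (\<lambda>x. fw (transpose c ?d x))"
       "fbA = res (E - set z) fb" "tA = lres (E - set z) 0 t" using R(1) unfolding R_def ye xe prod.case c_def by blast+
    have r2: "z = map (\<lambda>l. (fw2 ^^ (?q + l)) r) [0..<p]" "fwA = res (E - set z) (\<lambda>x. fw2 (transpose c2 ?d x))"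
       "fbA = res (E - set z) fb2" "tA = lres (E - set z) 0 t2" using R(2) unfolding R_def ye xe2 prod.case c2_def by blast+
    interpret l1: leaf E fw fb t z c ?J p
      using leaf_of_tmaps(1)[OF p q0, of fw fb t r E] X xe r1(1) c_def by simp
    interpret l2: leaf E fw2 fb2 t2 z c2 ?J p
      using leaf_of_tmaps(1)[OF p q0, of fw2 fb2 t2 r E] X xe2 r2(1) c2_def by simp
    \<comment> \<open>The place of insertion is recovered from the small map, as the edge at
      position \<open>q - 1\<close> of its root face.\<close>
    have "(fwA ^^ (?q - 1)) r = c" using remove_rmap(2)[OF p q0, of fw fb t r E] X xe r1 c_def by simp
    moreover have "(fwA ^^ (?q - 1)) r = c2" using remove_rmap(2)[OF p q0, of fw2 fb2 t2 r E] X xe2 r2 c2_def by simp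
    ultimately have cc: "c = c2" by simp
    have cases: "u \<in> E - set z \<or> (\<exists>k<p. u = z ! k) \<or> u \<notin> E" for u using l1.UE by blast
    have w1: "l1.fw1 u = l2.fw1 u" for u
    proof -
      have "u \<in> E - set z \<Longrightarrow> l1.fw1 u = l2.fw1 u"
        using fun_cong[OF r1(2), of u] fun_cong[OF r2(2), of u] by (simp add: res_def l1.fw1_def l2.fw1_def)
      moreover have "u \<notin> E \<Longrightarrow> l1.fw1 u = l2.fw1 u"
        using permutes_not_in[OF l1.fw1_perm] permutes_not_in[OF l2.fw1_perm] by simp
      ultimately show ?thesis using cases[of u] l1.fw1z l2.fw1z by metis
    qed
    have "fw = fw2"
    proof
      fix u
      have "fw u = l1.fw1 (transpose c ?d u)" "fw2 u = l2.fw1 (transpose c2 ?d u)" by (simp_all add: l1.fw1_def l2.fw1_def)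
      then show "fw u = fw2 u" using w1 cc by simp
    qed
    moreover have "fb = fb2"
    proof
      fix u
      have "u \<in> E - set z \<Longrightarrow> fb u = fb2 u"
        using fun_cong[OF r1(3), of u] fun_cong[OF r2(3), of u] by (simp add: res_def)
      moreover have "u \<notin> E \<Longrightarrow> fb u = fb2 u"
        using permutes_not_in[OF l1.fb] permutes_not_in[OF l2.fb] by simp
      ultimately show "fb u = fb2 u" using cases[of u] l1.fbz l2.fbz by metis
    qed
    moreover have "t = t2"
    proof
      fix u
      have "u \<in> E - set z \<Longrightarrow> t u = t2 u"
        using fun_cong[OF r1(4), of u] fun_cong[OF r2(4), of u] by (simp add: lres_def)
      moreover have "t (z ! k) = t2 (z ! k)" if "k < p" for k
        using l1.tz0 l2.tz0 l1.tz[of k] l2.tz[of k] that by (cases "k = 0") auto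
      ultimately show "t u = t2 u" using cases[of u] l1.out l2.out by metis
    qed
    ultimately show "x = x2" by (simp add: xe xe2)
  next
    fix x y assume X: "x \<in> ?X" and y: "y \<in> ?Y" and R: "R x y"
    obtain z fwA fbA tA r where ye: "y = (z, (fwA, fbA, tA, r))" by (metis prod_cases5)
    obtain fw fb t where xe: "x = (fw, fb, t, r)" using R(1) by (cases x) (auto simp: R_def ye)
    define c where "c = (fw ^^ (?q - 1)) r"
    have r1: "z = map (\<lambda>l. (fw ^^ (?q + l)) r) [0..<p]" "fwA = res (E - set z) (\<lambda>x. fw (transpose c (z ! (p - 1)) x))"
      using R(1) unfolding R_def ye xe prod.case c_def by blast+
    interpret l1: leaf E fw fb t z c ?J p
      using leaf_of_tmaps(1)[OF p q0, of fw fb t r E] X xe r1(1) c_def by simp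
    have rA: "r \<in> E - set z" using leaf_of_tmaps(2)[OF p q0, of fw fb t r E] X xe r1(1) by simp
    have "c \<in> reach {l1.fw1} r"
      using remove_rmap(3)[OF p q0, of fw fb t r E, folded c_def r1(1)] X xe by (simp add: l1.fw1_def)
    from l1.faces[OF rA this] show "wF wg E x = (case y of (z, y) \<Rightarrow> wF wg (E - set z) y)"
      by (simp add: wF_def wtF_def xe ye r1(2) l1.fw1_def)
  qed
  also have "\<dots> = (\<Sum>z\<in>?Z. \<Sum>y\<in>rmaps p (E - set z) ?w. wF wg (E - set z) y)"
    by (rule sum.Sigma[symmetric]) (use fZ E maps_finite(1) in auto)
  also have "\<dots> = (\<Sum>B\<in>Pow E. of_nat (if card B = p then fact p else 0) * (\<Sum>x\<in>rmaps p (E - B) ?w. wF wg (E - B) x))"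
    by (rule sum_lists[OF E])
  finally show ?thesis .
qed

text \<open>The smallest constellation, a black polygon in the sphere. Both faces have the same
  contour, so the rotation around vertices is the identity.\<close>

lemma lconst_polygon:
  assumes z: "distinct z" "length z = p" and p: "2 \<le> p"
  shows "lconst (set z) (cz z) (cz z) (lz 0 p z) p"
proof -
  have zk: "k < p \<Longrightarrow> z ! k \<in> set z" for k using z by auto
  have ex: "x \<in> set z \<Longrightarrow> \<exists>k<p. x = z ! k" for x using z by (metis in_set_conv_nth)
  have czk: "k < p \<Longrightarrow> cz z (z ! k) = z ! (Suc k mod p)" for k using cz_nth[OF z(1), of k] z by simp
  have t: "k < p \<Longrightarrow> lz 0 p z (z ! k) = (if k = 0 then 0 else p - k)" for k
    using lz_nth[OF z(1), of k 0 p] z by simp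
  have perm: "cz z permutes set z" by (rule cz_permutes[OF z(1)])
  have sid: "sig (cz z) (cz z) x = x" for x using permutes_inverses[OF perm] by (simp add: sig_def)
  have h: "k < p \<Longrightarrow> lz 0 p z (cz z (z ! k)) = (if Suc k = p then 0 else p - Suc k)" for k
    using czk[of k] t[of "Suc k"] t[of 0] p by (cases "Suc k = p") auto
  show ?thesis
  proof unfold_locales
    show "finite (set z)" "cz z permutes set z" "2 \<le> p" using perm p by auto
    show "lz 0 p z x = 0" if "x \<notin> set z" for x using that by (simp add: lz_def)
    have "cyc (cz z) (set z) = 1" by (rule nth_cycle_cyc) (use czk z p in auto)
    moreover have "cyc (sig (cz z) (cz z)) (set z) = p" using id_cyc[of "set z" "sig (cz z) (cz z)"] sid distinct_card[OF z(1)] z by simp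
    ultimately show "cyc (cz z) (set z) + cyc (cz z) (set z) + cyc (sig (cz z) (cz z)) (set z) = card (set z) + 2"
      using distinct_card[OF z(1)] z by simp
    show "\<exists>x\<in>set z. lz 0 p z (cz z x) = 0" using h[of "p - 1"] zk[of "p - 1"] p by (intro bexI[of _ "z ! (p - 1)"]) auto
  next
    fix x assume "x \<in> set z"
    then obtain k where k: "k < p" "x = z ! k" using ex by blast
    show "(cz z ^^ p) x = x" using cz_pow[OF z(1), of k p] k z by simp
    show "lz 0 p z (cz z x) + 1 = lz 0 p z x \<or> lz 0 p z (cz z x) + 1 = lz 0 p z x + p"
      using h[OF k(1)] t[OF k(1)] k p by auto
    show "y \<in> reach {cz z, cz z} x" if "y \<in> set z" for y
      using nth_cycle_reach[of z "cz z" k] czk z k that by simp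
    show "0 < lz 0 p z (cz z x) \<Longrightarrow> \<exists>y\<in>reach {sig (cz z) (cz z)} x. dn (cz z) (lz 0 p z) (cz z y)"
    proof -
      assume pos: "0 < lz 0 p z (cz z x)"
      then have sk: "Suc k < p" using h[OF k(1)] k by (auto split: if_splits)
      have "dn (cz z) (lz 0 p z) (z ! Suc k)" unfolding dn_def using h[OF sk] t[OF sk] sk by auto
      then show ?thesis using czk[OF k(1)] k sk by (intro bexI[of _ x]) auto
    qed
    show "y \<in> reach {sig (cz z) (cz z)} x" if y: "y \<in> set z" "lz 0 p z (cz z x) = 0" "lz 0 p z (cz z y) = 0" for y
    proof -
      obtain l where l: "l < p" "y = z ! l" using ex y by blast
      have "Suc k = p" "Suc l = p" using h[OF k(1)] h[OF l(1)] y k l by (auto split: if_splits)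
      then show ?thesis using k l by auto
    qed
  qed simp
qed

text \<open>The root face follows one black face all the way round, so by connectedness these
  \<open>p\<close> edges are the whole map. Each order of the edges gives one map, and its weight is
  \<open>1\<close> because the root face is the only white face.\<close>

lemma base_sum:
  fixes wg :: "nat \<Rightarrow> 'c::comm_ring_1"
  assumes E: "finite E" and p: "2 \<le> p"
  shows "(\<Sum>x\<in>tmaps p E (lastup p []) 0 (p - 1). wF wg E x) = of_nat (if card E = p then fact p else 0)"
proof -
  let ?X = "tmaps p E (lastup p []) 0 (p - 1)"
  let ?Y = "{z. distinct z \<and> length z = p \<and> set z = E}"
  define R where "R = (\<lambda>(fw :: nat \<Rightarrow> nat, fb :: nat \<Rightarrow> nat, t :: nat \<Rightarrow> nat, r) z. z = map (\<lambda>l. (fw ^^ l) r) [0..<p])"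
  have len: "length (lastup p []) = p" using p by (simp add: lastup_def)
  have X: "distinct z \<and> length z = p \<and> set z = E \<and> fw permutes E \<and> fb permutes E \<and> (\<forall>x. x \<notin> E \<longrightarrow> t x = 0) \<and> r \<in> E \<and>
      (\<forall>k<p. fw (z ! k) = z ! (Suc k mod p) \<and> fb (z ! k) = z ! (Suc k mod p) \<and> t (z ! k) = (if k = 0 then 0 else p - k)) \<and> r = z ! 0"
    if x: "(fw, fb, t, r) \<in> ?X" and zd: "z = map (\<lambda>l. (fw ^^ l) r) [0..<p]" for fw fb t r z
  proof -
    have rm: "(fw, fb, t, r) \<in> rmaps p E (lastup p [])" using x by (simp add: tmaps_def)
    have lf: "\<And>l. l < p - 1 \<Longrightarrow> fb ((fw ^^ l) r) = (fw ^^ (l + 1)) r" using x by (simp add: tmaps_def)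
    interpret lconst E fw fb t p using rm by (simp add: rmaps_def)
    have rE: "r \<in> E" and cN: "card (reach {fw} r) = p" using rm len by (auto simp: rmaps_def)
    note P = orbit_period[OF fin permutes_imp_bij[OF fw] rE, unfolded cN]
    have zk: "l < p \<Longrightarrow> z ! l = (fw ^^ l) r" for l by (simp add: zd)
    have kE: "(fw ^^ k) r \<in> E" for k by (induction k) (use rE in auto)
    have dz: "distinct z" unfolding zd distinct_map using P(2) by (auto simp: atLeast0LessThan)
    have fwz: "fw (z ! k) = z ! (Suc k mod p)" if k: "k < p" for k
    proof (cases "Suc k = p")
      case True
      have "fw (z ! k) = (fw ^^ Suc k) r" using zk[OF k] by simp
      then show ?thesis using P(1) zk[of 0] p True by (simp only:) simp
    next
      case False then show ?thesis using zk[of k] zk[of "Suc k"] k by simp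
    qed
    have fbp: "l < p \<Longrightarrow> (fb ^^ l) r = (fw ^^ l) r" for l by (induction l) (use lf in auto)
    have fbz: "fb (z ! k) = z ! (Suc k mod p)" if k: "k < p" for k
    proof (cases "Suc k = p")
      case True
      have "fb (z ! k) = (fb ^^ Suc k) r" using zk[OF k] fbp[OF k] by simp
      then show ?thesis using order[OF rE] zk[of 0] p True by (simp only:) simp
    next
      case False then show ?thesis using zk[of k] zk[of "Suc k"] lf[of k] k by simp
    qed
    have lz: "length z = p" by (simp add: zd)
    have "reach {fw, fb} r \<subseteq> set z"
    proof (rule reach_least)
      show "r \<in> set z" using zk[of 0] p lz by (metis funpow_0 less_le_trans nth_mem zero_less_numeral)
      fix y f assume y: "y \<in> set z" and f: "f \<in> {fw, fb}"
      obtain k where "k < p" "y = z ! k" using y lz by (metis in_set_conv_nth)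
      then have "f y = z ! (Suc k mod p)" using f fwz fbz by auto
      then show "f y \<in> set z" using lz p by (auto intro!: nth_mem)
    qed
    then have "set z = E" using conn[OF rE] kE by (auto simp: zd)
    moreover have "t (z ! k) = (if k = 0 then 0 else p - k)" if "k < p" for k
      using rmaps_labels[OF p rm] zk[OF that] that by (cases "k = 0") auto
    ultimately show ?thesis using dz lz fw fb out rE fwz fbz zk[of 0] p by auto
  qed
  have one: "wF wg E x = 1" if x: "x \<in> ?X" for x
  proof -
    obtain fw fb t r where xe: "x = (fw, fb, t, r)" by (cases x)
    define z where "z = map (\<lambda>l. (fw ^^ l) r) [0..<p]"
    note F = X[OF x[unfolded xe] z_def]
    have "reach {fw} y = E" if y: "y \<in> E" for y
    proof -
      obtain k where "k < p" "y = z ! k" using y F by (metis in_set_conv_nth)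
      then show ?thesis using nth_cycle_reach[of z fw k] F by auto
    qed
    moreover have "r \<in> E" using F by blast
    ultimately have "reach {fw} ` E - {reach {fw} r} = {}" by auto
    then show ?thesis unfolding wF_def wtF_def xe prod.case by (simp only: prod.empty)
  qed
  have "(\<Sum>x\<in>?X. wF wg E x) = (\<Sum>z\<in>?Y. 1)"
  proof (rule sum_bij_rel[where R=R])
    fix x assume x: "x \<in> ?X"
    obtain fw fb t r where xe: "x = (fw, fb, t, r)" by (cases x)
    show "\<exists>y\<in>?Y. R x y" using X[OF x[unfolded xe] refl] by (auto simp: R_def xe)
  next
    fix z assume z: "z \<in> ?Y"
    then have z': "distinct z" "length z = p" "set z = E" by auto
    have pw: "(cz z ^^ k) (z ! 0) = z ! (k mod p)" for k using cz_pow[OF z'(1), of 0 k] z' p by auto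
    have L: "lconst E (cz z) (cz z) (lz 0 p z) p" using lconst_polygon[OF z'(1,2) p] z' by simp
    have zr: "z ! 0 \<in> E" using nth_mem[of 0 z] z' p by simp
    have "reach {cz z} (z ! 0) = set z"
      by (rule nth_cycle_reach) (use cz_nth[OF z'(1)] z' p in auto)
    then have c: "card (reach {cz z} (z ! 0)) = p" using distinct_card[OF z'(1)] z' by simp
    have "lz 0 p z ((cz z ^^ k) (z ! 0)) = wht p (lastup p []) k" if k: "k \<le> p" for k
    proof (cases "k = 0 \<or> k = p")
      case True
      then show ?thesis using pw[of k] lz_nth[OF z'(1), of 0 0 p] z' p wht_lastup[of "p - 1" p "[]"] by (auto simp: wht_def)
    next
      case False
      then show ?thesis using pw[of k] lz_nth[OF z'(1), of k 0 p] z' k wht_lastup[of "k - 1" p "[]"] by auto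
    qed
    then have "(cz z, cz z, lz 0 p z, z ! 0) \<in> rmaps p E (lastup p [])"
      using L zr c len by (simp add: rmaps_def)
    then have "(cz z, cz z, lz 0 p z, z ! 0) \<in> ?X" by (simp add: tmaps_def)
    moreover have "R (cz z, cz z, lz 0 p z, z ! 0) z"
      unfolding R_def prod.case by (rule nth_equalityI) (use pw z' in auto)
    ultimately show "\<exists>x\<in>?X. R x z" by blast
  next
    fix x y z assume "R x y" "R x z" then show "y = z" by (auto simp: R_def split: prod.splits)
  next
    fix x x2 z assume x: "x \<in> ?X" "x2 \<in> ?X" and R: "R x z" "R x2 z"
    obtain fw fb t r where xe: "x = (fw, fb, t, r)" by (cases x)
    obtain fw2 fb2 t2 r2 where xe2: "x2 = (fw2, fb2, t2, r2)" by (cases x2)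
    have z1: "z = map (\<lambda>l. (fw ^^ l) r) [0..<p]" and z2: "z = map (\<lambda>l. (fw2 ^^ l) r2) [0..<p]"
      using R unfolding R_def xe xe2 by auto
    note F1 = X[OF x(1)[unfolded xe] z1] and F2 = X[OF x(2)[unfolded xe2] z2]
    have c: "(\<exists>k<p. u = z ! k) \<or> u \<notin> E" for u using F1 by (metis in_set_conv_nth)
    have "fw = fw2" "fb = fb2" "t = t2"
      by (rule ext, use c F1 F2 permutes_not_in[of fw E] permutes_not_in[of fw2 E] permutes_not_in[of fb E] permutes_not_in[of fb2 E] in metis)+
    then show "x = x2" using F1 F2 by (simp add: xe xe2)
  qed (use one in auto)
  also have "\<dots> = of_nat (card ?Y)" by simp
  also have "?Y = (if card E = p then permutations_of_set E else {})"
    by (auto simp: permutations_of_set_def distinct_card)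
  finally show ?thesis using E by auto
qed

section \<open>Generating functions and the continued fraction\<close>

text \<open>The grading variable counts edges divided by \<open>p\<close>; \<open>gen\<close> is the exponential generating function of
  structures labelled by the edge set, so sums over subsets become products.\<close>

definition cf :: "nat \<Rightarrow> 'c::comm_ring_1 fps \<Rightarrow> nat \<Rightarrow> 'c" where
  "cf p S N = (if p dvd N then fps_nth S (N div p) else 0)"

definition gen :: "nat \<Rightarrow> (nat set \<Rightarrow> 'c::comm_ring_1) \<Rightarrow> 'c fps \<Rightarrow> bool" where
  "gen p a S \<longleftrightarrow> (\<forall>E. finite E \<longrightarrow> a E = of_nat (fact (card E)) * cf p S (card E))"

lemma gen_cong: "gen p a S \<Longrightarrow> (\<And>E. finite E \<Longrightarrow> b E = a E) \<Longrightarrow> gen p b S"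
  by (simp add: gen_def)

lemma gen_add: "gen p a S \<Longrightarrow> gen p b T \<Longrightarrow> gen p (\<lambda>E. a E + b E) (S + T)"
  by (auto simp: gen_def cf_def algebra_simps)

lemma gen_sum: "finite I \<Longrightarrow> (\<And>i. i \<in> I \<Longrightarrow> gen p (a i) (S i)) \<Longrightarrow> gen p (\<lambda>E. \<Sum>i\<in>I. a i E) (\<Sum>i\<in>I. S i)"
proof (induction I rule: finite_induct)
  case empty then show ?case by (simp add: gen_def cf_def)
next
  case (insert i I) then show ?case by (simp add: gen_add)
qed

lemma sum_Pow_card:
  fixes g :: "nat \<Rightarrow> 'c::comm_ring_1"
  assumes "finite E"
  shows "(\<Sum>B\<in>Pow E. g (card B)) = (\<Sum>k\<le>card E. of_nat (card E choose k) * g k)"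
proof -
  have "(\<Sum>B\<in>Pow E. g (card B)) = (\<Sum>k\<le>card E. \<Sum>B\<in>{B \<in> Pow E. card B = k}. g (card B))"
    by (rule sum.group[symmetric]) (use assms card_mono in auto)
  also have "\<dots> = (\<Sum>k\<le>card E. of_nat (card E choose k) * g k)"
    by (rule sum.cong[OF refl]) (simp add: n_subsets[OF assms])
  finally show ?thesis .
qed

lemma cf_mult:
  assumes "0 < p"
  shows "(\<Sum>k\<le>N. cf p S (N - k) * cf p T k) = cf p (S * T) N"
proof (cases "p dvd N")
  case True
  then obtain M where M: "N = p * M" by blast
  have "(\<Sum>k\<le>N. cf p S (N - k) * cf p T k) = (\<Sum>k\<in>(\<lambda>j. p * j) ` {..M}. cf p S (N - k) * cf p T k)"
  proof (rule sum.mono_neutral_right)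
    show "\<forall>k\<in>{..N} - (\<lambda>j. p * j) ` {..M}. cf p S (N - k) * cf p T k = 0"
    proof
      fix k assume k: "k \<in> {..N} - (\<lambda>j. p * j) ` {..M}"
      have "\<not> p dvd k"
      proof
        assume "p dvd k"
        then obtain j where "k = p * j" by blast
        then show False using k M assms by auto
      qed
      then show "cf p S (N - k) * cf p T k = 0" by (simp add: cf_def)
    qed
  qed (use M in auto)
  also have "\<dots> = (\<Sum>j\<le>M. cf p S (N - p * j) * cf p T (p * j))"
    by (rule sum.reindex_cong[of "\<lambda>j. p * j"]) (use assms in \<open>auto simp: inj_on_def\<close>)
  also have "\<dots> = (\<Sum>j\<le>M. fps_nth T j * fps_nth S (M - j))"
  proof (rule sum.cong[OF refl])
    fix j assume "j \<in> {..M}"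
    then have "N - p * j = p * (M - j)" by (simp add: M diff_mult_distrib2)
    then show "cf p S (N - p * j) * cf p T (p * j) = fps_nth T j * fps_nth S (M - j)" using assms by (simp add: cf_def mult.commute)
  qed
  also have "\<dots> = fps_nth (T * S) M" by (simp add: fps_mult_nth atLeast0AtMost)
  also have "\<dots> = cf p (S * T) N" using M assms by (simp add: cf_def mult.commute)
  finally show ?thesis .
next
  case False
  have "cf p S (N - k) * cf p T k = 0" if "k \<le> N" for k
  proof -
    have "\<not> (p dvd (N - k) \<and> p dvd k)" using False that by (metis dvd_add le_add_diff_inverse2)
    then show ?thesis by (auto simp: cf_def)
  qed
  then show ?thesis using False by (simp add: cf_def)
qed

text \<open>The binomial coefficient that counts the sets \<open>B\<close> of a given size cancels
  against the two factorials.\<close>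

lemma gen_mult:
  fixes S T :: "'c::comm_ring_1 fps"
  assumes "0 < p" "gen p a S" "gen p b T"
  shows "gen p (\<lambda>E. \<Sum>B\<in>Pow E. a (E - B) * b B) (S * T)"
  unfolding gen_def
proof (intro allI impI)
  fix E :: "nat set" assume E: "finite E"
  let ?N = "card E"
  let ?g = "\<lambda>k. of_nat (fact (?N - k) * fact k) * (cf p S (?N - k) * cf p T k)"
  have "(\<Sum>B\<in>Pow E. a (E - B) * b B) = (\<Sum>B\<in>Pow E. ?g (card B))"
  proof (rule sum.cong[OF refl])
    fix B assume "B \<in> Pow E"
    then have "finite B" using E finite_subset by auto
    then have B: "finite B" "finite (E - B)" "card (E - B) = ?N - card B"
      using E card_Diff_subset[of B E] \<open>B \<in> Pow E\<close> by auto
    have "a (E - B) = of_nat (fact (?N - card B)) * cf p S (?N - card B)" using assms(2) B by (simp add: gen_def)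
    moreover have "b B = of_nat (fact (card B)) * cf p T (card B)" using assms(3) B by (simp add: gen_def)
    ultimately show "a (E - B) * b B = ?g (card B)" by (simp add: mult_ac)
  qed
  also have "\<dots> = (\<Sum>k\<le>?N. of_nat (?N choose k) * ?g k)" by (rule sum_Pow_card[OF E])
  also have "\<dots> = (\<Sum>k\<le>?N. of_nat (fact ?N) * (cf p S (?N - k) * cf p T k))"
  proof (rule sum.cong[OF refl])
    fix k assume "k \<in> {..?N}"
    then have "(?N choose k) * (fact (?N - k) * fact k) = fact ?N"
      using binomial_fact_lemma[of k ?N] by (simp add: mult_ac)
    then have "of_nat (?N choose k) * (of_nat (fact (?N - k) * fact k) :: 'c) = of_nat (fact ?N)"
      by (metis of_nat_mult)
    then show "of_nat (?N choose k) * ?g k = of_nat (fact ?N) * (cf p S (?N - k) * cf p T k)"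
      by (metis mult.assoc)
  qed
  also have "\<dots> = of_nat (fact ?N) * cf p (S * T) ?N"
    by (simp only: sum_distrib_left[symmetric] cf_mult[OF assms(1)])
  finally show "(\<Sum>B\<in>Pow E. a (E - B) * b B) = of_nat (fact ?N) * cf p (S * T) ?N" .
qed

text \<open>The \<open>fact p\<close> orders of a set of \<open>p\<close> edges are exactly the
  number of its labellings, so adding a black face is multiplication by
  \<open>fps_X\<close>.\<close>

lemma gen_lists: assumes "0 < p" shows "gen p (\<lambda>B. of_nat (if card B = p then fact p else 0)) fps_X"
  unfolding gen_def
proof (intro allI impI)
  fix E :: "nat set"
  show "of_nat (if card E = p then fact p else 0) = of_nat (fact (card E)) * cf p (fps_X :: 'a fps) (card E)"
  proof (cases "p dvd card E")
    case True
    then obtain k where "card E = p * k" by blast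
    then show ?thesis using assms by (cases "k = 1") (auto simp: cf_def fps_X_def)
  next
    case False then show ?thesis by (auto simp: cf_def)
  qed
qed

section \<open>Excursion words and their weights\<close>

fun wok :: "nat \<Rightarrow> nat \<Rightarrow> bool list \<Rightarrow> bool" where
  "wok p h [] \<longleftrightarrow> h = 0"
| "wok p h (True # w) \<longleftrightarrow> wok p (h + (p - 1)) w"
| "wok p h (False # w) \<longleftrightarrow> 0 < h \<and> wok p (h - 1) w"

fun wwt :: "(nat \<Rightarrow> 'c::comm_ring_1) \<Rightarrow> nat \<Rightarrow> nat \<Rightarrow> bool list \<Rightarrow> 'c" where
  "wwt V p h [] = 1"
| "wwt V p h (True # w) = wwt V p (h + (p - 1)) w"
| "wwt V p h (False # w) = V h * wwt V p (h - 1) w"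

lemma wwt_append: "wwt V p h (u @ v) = wwt V p h u * wwt V p (wend p h u) v"
  by (induction V p h u rule: wwt.induct) (auto simp: mult.assoc)

lemma wwt_replicate: "wwt V p h (replicate n False) = (\<Prod>k<n. V (h - k))"
proof (induction n arbitrary: h)
  case (Suc n)
  have "(\<Prod>k<Suc n. V (h - k)) = V h * (\<Prod>k<n. V (h - Suc k))" by (subst prod.lessThan_Suc_shift) simp
  then show ?case using Suc by simp
qed auto

text \<open>Of the final descent the steps from the heights \<open>J + p - 1\<close> to
  \<open>J + 1\<close> belong to the last black face; the remaining \<open>J\<close> steps complete
  the word of the smaller map.\<close>

lemma wwt_lastup:
  assumes "2 \<le> p"
  shows "wwt V p 0 (lastup p pre) = wwt V p 0 (pre @ replicate (wend p 0 pre) False) * (\<Prod>j<p - 1. V (wend p 0 pre + (p - 1) - j))"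
proof -
  let ?J = "wend p 0 pre"
  have "(\<Prod>k<?J + (p - 1). V (?J + (p - 1) - k)) = (\<Prod>k<p - 1. V (?J + (p - 1) - k)) * (\<Prod>k<?J. V (?J - k))"
  proof -
    have "{..<?J + (p - 1)} = {..<p - 1} \<union> (\<lambda>k. (p - 1) + k) ` {..<?J}"
    proof (intro equalityI subsetI)
      fix x assume "x \<in> {..<?J + (p - 1)}"
      then show "x \<in> {..<p - 1} \<union> (\<lambda>k. (p - 1) + k) ` {..<?J}"
        by (cases "x < p - 1") (auto simp: image_iff intro!: bexI[of _ "x - (p - 1)"])
    qed auto
    then have "(\<Prod>k<?J + (p - 1). V (?J + (p - 1) - k)) = (\<Prod>k<p - 1. V (?J + (p - 1) - k)) * (\<Prod>k\<in>(\<lambda>k. (p - 1) + k) ` {..<?J}. V (?J + (p - 1) - k))"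
      by (simp only:) (rule prod.union_disjoint, auto)
    also have "(\<Prod>k\<in>(\<lambda>k. (p - 1) + k) ` {..<?J}. V (?J + (p - 1) - k)) = (\<Prod>k<?J. V (?J - k))"
      by (rule prod.reindex_cong[of "\<lambda>k. (p - 1) + k"]) (auto simp: inj_on_def)
    finally show ?thesis .
  qed
  then show ?thesis by (simp add: lastup_def wwt_append wwt_replicate mult_ac)
qed

lemma wok_append: "wok p h (u @ replicate n False) \<Longrightarrow> wend p h u = n"
proof (induction p h u rule: wend.induct)
  case (1 p h)
  have "wok p h (replicate n False) \<Longrightarrow> h = n" for h
  proof (induction n arbitrary: h)
    case (Suc n)
    then have "0 < h" "h - 1 = n" using Suc.IH[of "h - 1"] by auto
    then show ?case by simp
  qed simp
  then show ?case using 1 by simp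
qed auto

lemma wok_swap_tail: "wok p h (u @ v) \<Longrightarrow> wok p h (u @ replicate (wend p h u) False)"
proof (induction p h u rule: wend.induct)
  case (1 p h)
  have "wok p h (replicate h False)" by (induction h) auto
  then show ?case by simp
qed auto

lemma wok_decomp:
  assumes "wok p 0 w" "w \<noteq> []"
  obtains pre where "w = lastup p pre" "wok p 0 (pre @ replicate (wend p 0 pre) False)"
proof -
  have "True \<in> set w" using assms by (cases w) (auto split: bool.splits, metis (full_types) wok.simps(3) less_irrefl)
  then obtain pre ys where w: "w = pre @ True # ys" "True \<notin> set ys" by (metis split_list_last)
  have "y = False" if "y \<in> set ys" for y using w(2) that by (cases y) auto
  then have ys: "ys = replicate (length ys) False" by (intro replicate_eqI) auto
  have "wok p 0 ((pre @ [True]) @ replicate (length ys) False)" using assms(1) w ys by simp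
  then have "wend p 0 (pre @ [True]) = length ys" by (rule wok_append)
  then have "length ys = wend p 0 pre + (p - 1)" by (simp add: wend_append)
  then have "w = lastup p pre" using w ys by (simp add: lastup_def)
  moreover have "wok p 0 (pre @ replicate (wend p 0 pre) False)"
    using assms(1) unfolding w(1) by (rule wok_swap_tail)
  ultimately show thesis by (rule that)
qed

text \<open>Descends from \<open>p - 1\<close> coincidences to none. Each use of
  \<open>cut_sum\<close> adds the uncut maps and those with a region cut off, which turns a series
  \<open>P\<close> into \<open>P + P * (V - 1) = P * V\<close> for the height at hand.\<close>

lemma gen_tmaps:
  assumes p: "2 \<le> p" and V: "\<And>i. 0 < i \<Longrightarrow> gen p (\<lambda>E. \<Sum>x\<in>vmaps p E i. wV wg E x) (V i - 1)"
    and base: "gen p (\<lambda>E. \<Sum>x\<in>tmaps p E (lastup p pre) (length pre) (p - 1). wF wg E x) S"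
  shows "gen p (\<lambda>E. \<Sum>x\<in>rmaps p E (lastup p pre). wF wg E x) (S * (\<Prod>j<p - 1. V (wend p 0 pre + (p - 1) - j)))"
proof -
  let ?J = "wend p 0 pre" and ?w = "lastup p pre" and ?q = "length pre"
  have "gen p (\<lambda>E. \<Sum>x\<in>tmaps p E ?w ?q (p - 1 - n). wF wg E x) (S * (\<Prod>j\<in>{p - 1 - n..<p - 1}. V (?J + (p - 1) - j)))" if "n \<le> p - 1" for n
    using that
  proof (induction n)
    case 0 then show ?case using base by simp
  next
    case (Suc n)
    let ?j = "p - 1 - Suc n"
    have sj: "Suc ?j = p - 1 - n" "?j < p - 1" using Suc by auto
    let ?P = "S * (\<Prod>j\<in>{p - 1 - n..<p - 1}. V (?J + (p - 1) - j))"
    have IH: "gen p (\<lambda>E. \<Sum>x\<in>tmaps p E ?w ?q (Suc ?j). wF wg E x) ?P" unfolding sj(1) by (rule Suc.IH) (use Suc in simp)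
    have i0: "0 < ?J + (p - 1) - ?j" using sj(2) by linarith
    have "gen p (\<lambda>E. (\<Sum>x\<in>tmaps p E ?w ?q (Suc ?j). wF wg E x) +
        (\<Sum>B\<in>Pow E. (\<Sum>x\<in>tmaps p (E - B) ?w ?q (Suc ?j). wF wg (E - B) x) * (\<Sum>x\<in>vmaps p B (?J + (p - 1) - ?j). wV wg B x)))
       (?P + ?P * (V (?J + (p - 1) - ?j) - 1))"
      by (intro gen_add IH gen_mult V i0) (use p in simp)
    then have "gen p (\<lambda>E. \<Sum>x\<in>tmaps p E ?w ?q ?j. wF wg E x) (?P + ?P * (V (?J + (p - 1) - ?j) - 1))"
      by (rule gen_cong) (rule cut_sum[OF _ p sj(2)])
    moreover have "{?j..<p - 1} = insert ?j {p - 1 - n..<p - 1}" using sj by auto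
    then have "S * (\<Prod>j\<in>{?j..<p - 1}. V (?J + (p - 1) - j)) = ?P + ?P * (V (?J + (p - 1) - ?j) - 1)"
      using sj by (simp add: algebra_simps)
    ultimately show ?case by simp
  qed
  from this[of "p - 1"] show ?thesis by (simp add: tmaps_def atLeast0LessThan)
qed

text \<open>Induction on the number of up-steps, which is \<open>n\<close> for a word of length
  \<open>n * p\<close>. Removing the last one yields a factor \<open>fps_X\<close> for its black
  face and \<open>p - 1\<close> factors \<open>V\<close> for the cuts made before.\<close>

lemma gen_word:
  assumes p: "2 \<le> p" and V: "\<And>i. 0 < i \<Longrightarrow> gen p (\<lambda>E. \<Sum>x\<in>vmaps p E i. wV wg E x) (V i - 1)"
  shows "wok p 0 w \<Longrightarrow> length w = n * p \<Longrightarrow> 0 < n \<Longrightarrow> gen p (\<lambda>E. \<Sum>x\<in>rmaps p E w. wF wg E x) (fps_X ^ n * wwt V p 0 w)"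
proof (induction n arbitrary: w)
  case (Suc n)
  have "w \<noteq> []" using Suc.prems p by auto
  then obtain pre where w: "w = lastup p pre" "wok p 0 (pre @ replicate (wend p 0 pre) False)"
    by (rule wok_decomp[OF Suc.prems(1)])
  let ?w = "pre @ replicate (wend p 0 pre) False"
  have len: "length pre + wend p 0 pre = n * p" using Suc.prems(2) lastup_length[OF p, of pre] w by simp
  have "gen p (\<lambda>E. \<Sum>x\<in>tmaps p E (lastup p pre) (length pre) (p - 1). wF wg E x) (fps_X ^ Suc n * wwt V p 0 ?w)"
  proof (cases "pre = []")
    case True
    then have "n = 0" using len p by simp
    have "gen p (\<lambda>E. \<Sum>x\<in>tmaps p E (lastup p []) 0 (p - 1). wF wg E x) fps_X"
      by (rule gen_cong[OF gen_lists base_sum]) (use p in auto)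
    then show ?thesis using True \<open>n = 0\<close> by simp
  next
    case False
    then have n0: "0 < n" using len by (cases n) auto
    have IH: "gen p (\<lambda>E. \<Sum>x\<in>rmaps p E ?w. wF wg E x) (fps_X ^ n * wwt V p 0 ?w)"
      by (rule Suc.IH[OF w(2) _ n0]) (use len in simp)
    have "gen p (\<lambda>E. \<Sum>B\<in>Pow E. (\<Sum>x\<in>rmaps p (E - B) ?w. wF wg (E - B) x) * of_nat (if card B = p then fact p else 0))
       (fps_X ^ n * wwt V p 0 ?w * fps_X)"
      by (rule gen_mult[OF _ IH gen_lists]) (use p in auto)
    then have "gen p (\<lambda>E. \<Sum>x\<in>tmaps p E (lastup p pre) (length pre) (p - 1). wF wg E x) (fps_X ^ n * wwt V p 0 ?w * fps_X)"
      by (rule gen_cong) (subst remove_sum[OF _ p False], auto simp: mult.commute)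
    then show ?thesis by (simp add: mult_ac)
  qed
  from gen_tmaps[OF p V this] show ?case
    unfolding w(1) wwt_lastup[OF p] by (simp add: mult.assoc)
qed auto

text \<open>\<open>t r = 0\<close> places the pointed vertex at the origin of the root edge.
  Pointing then adds no choice, and these are the maps behind \<open>F_gf\<close>.\<close>

definition fmaps :: "nat \<Rightarrow> nat \<Rightarrow> nat set \<Rightarrow> lmap set" where
  "fmaps p n E = {(fw, fb, t, r). lconst E fw fb t p \<and> r \<in> E \<and> t r = 0 \<and> card (reach {fw} r) = n * p}"

definition words :: "nat \<Rightarrow> nat \<Rightarrow> nat \<Rightarrow> bool list set" where
  "words p h L = {w. length w = L \<and> wok p h w}"

lemma finite_words: "finite (words p h L)"
  by (rule finite_subset[OF _ finite_lists_length_eq[of "UNIV :: bool set" L]]) (auto simp: words_def)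

lemma wok_iff: "wok p h w \<longleftrightarrow> (\<forall>k<length w. \<not> w ! k \<longrightarrow> 0 < wend p h (take k w)) \<and> wend p h w = 0"
proof (induction p h w rule: wok.induct)
  case (2 p h w) then show ?case by (auto simp: nth_Cons All_less_Suc2 split: nat.splits)
next
  case (3 p h w) then show ?case by (auto simp: nth_Cons All_less_Suc2 split: nat.splits)
qed auto

lemma wht_Suc: "k < length w \<Longrightarrow> wht p w (Suc k) = (if w ! k then wht p w k + (p - 1) else wht p w k - 1)"
  by (cases "w ! k") (simp_all add: wht_def take_Suc_conv_app_nth wend_append)

lemma fmaps_words:
  assumes p: "2 \<le> p"
  shows "fmaps p n E = (\<Union>w\<in>words p 0 (n * p). rmaps p E w)"
proof (intro equalityI subsetI)
  fix x assume x: "x \<in> fmaps p n E"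
  obtain fw fb t r where xe: "x = (fw, fb, t, r)" by (cases x)
  interpret lconst E fw fb t p using x by (simp add: xe fmaps_def)
  have rE: "r \<in> E" "t r = 0" and cN: "card (reach {fw} r) = n * p" using x by (auto simp: xe fmaps_def)
  let ?w = "map (\<lambda>k. \<not> dn fw t ((fw ^^ k) r)) [0..<n * p]"
  have kE: "(fw ^^ k) r \<in> E" for k by (induction k) (use rE in auto)
  have lab: "k \<le> n * p \<Longrightarrow> t ((fw ^^ k) r) = wht p ?w k" for k
  proof (induction k)
    case 0 then show ?case using rE by (simp add: wht_def)
  next
    case (Suc k)
    then show ?case using wht_Suc[of k ?w p] step[OF kE[of k]] p by (auto simp: dn_def)
  qed
  have "wok p 0 ?w"
    unfolding wok_iff
  proof (intro conjI allI impI)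
    fix k assume k: "k < length ?w" "\<not> ?w ! k"
    then have "dn fw t ((fw ^^ k) r)" by auto
    then have "0 < t ((fw ^^ k) r)" by (auto simp: dn_def)
    then show "0 < wend p 0 (take k ?w)" using lab[of k] k by (simp add: wht_def)
  next
    have "(fw ^^ (n * p)) r = r" using orbit_period(1)[OF fin permutes_imp_bij[OF fw] rE(1)] cN by simp
    then show "wend p 0 ?w = 0" using lab[of "n * p"] rE by (simp add: wht_def)
  qed
  then have "?w \<in> words p 0 (n * p)" by (simp add: words_def)
  moreover have "x \<in> rmaps p E ?w" using lab rE cN lconst_axioms by (simp add: rmaps_def xe)
  ultimately show "x \<in> (\<Union>w\<in>words p 0 (n * p). rmaps p E w)" by blast
next
  fix x assume "x \<in> (\<Union>w\<in>words p 0 (n * p). rmaps p E w)"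
  then show "x \<in> fmaps p n E" by (auto simp: rmaps_def fmaps_def words_def wht_def dest: spec[of _ 0])
qed

lemma rmaps_disjoint:
  assumes p: "2 \<le> p" and x: "x \<in> rmaps p E w" "x \<in> rmaps p E w'"
  shows "w = w'"
proof -
  obtain fw fb t r where xe: "x = (fw, fb, t, r)" by (cases x)
  have len: "length w = length w'" and *: "\<And>k. k \<le> length w \<Longrightarrow> wht p w k = wht p w' k"
    using x by (auto simp: rmaps_def xe)
  show ?thesis
  proof (rule nth_equalityI[OF len])
    fix k assume k: "k < length w"
    have "wht p w (Suc k) = wht p w' (Suc k)" "wht p w k = wht p w' k" using * k by auto
    then show "w ! k = w' ! k" using wht_Suc[of k w p] wht_Suc[of k w' p] k len p by (auto split: if_splits)
  qed
qed

lemma gen_fmaps: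
  assumes p: "2 \<le> p" and V: "\<And>i. 0 < i \<Longrightarrow> gen p (\<lambda>E. \<Sum>x\<in>vmaps p E i. wV wg E x) (V i - 1)" and n: "0 < n"
  shows "gen p (\<lambda>E. \<Sum>x\<in>fmaps p n E. wF wg E x) (fps_X ^ n * (\<Sum>w\<in>words p 0 (n * p). wwt V p 0 w))"
proof -
  have "gen p (\<lambda>E. \<Sum>w\<in>words p 0 (n * p). \<Sum>x\<in>rmaps p E w. wF wg E x) (\<Sum>w\<in>words p 0 (n * p). fps_X ^ n * wwt V p 0 w)"
    by (rule gen_sum[OF finite_words gen_word[OF p V _ _ n]]) (auto simp: words_def)
  then have "gen p (\<lambda>E. \<Sum>x\<in>fmaps p n E. wF wg E x) (\<Sum>w\<in>words p 0 (n * p). fps_X ^ n * wwt V p 0 w)"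
  proof (rule gen_cong)
    fix E :: "nat set" assume "finite E"
    then show "(\<Sum>x\<in>fmaps p n E. wF wg E x) = (\<Sum>w\<in>words p 0 (n * p). \<Sum>x\<in>rmaps p E w. wF wg E x)"
      unfolding fmaps_words[OF p] using rmaps_disjoint[OF p]
      by (intro sum.UNION_disjoint finite_words) (auto intro: maps_finite)
  qed
  then show ?thesis by (simp add: sum_distrib_left)
qed

text \<open>The continued fraction is the fixed point of a contraction for the \<open>t\<close>-adic topology.\<close>

definition agree :: "nat \<Rightarrow> 'a::comm_ring_1 fps \<Rightarrow> 'a fps \<Rightarrow> bool" where
  "agree n f g \<longleftrightarrow> (\<forall>k<n. fps_nth f k = fps_nth g k)"

lemma agree_mult: "agree n f g \<Longrightarrow> agree n f' g' \<Longrightarrow> agree n (f * f') (g * g')"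
  by (auto simp: agree_def fps_mult_nth intro!: sum.cong)

lemma agree_prod: "(\<And>i. i \<in> I \<Longrightarrow> agree n (f i) (g i)) \<Longrightarrow> agree n (prod f I) (prod g I)"
proof (induction I rule: infinite_finite_induct)
  case (insert x F) then show ?case by (simp add: agree_mult)
qed (auto simp: agree_def)

lemma agree_refl: "agree n f f" by (simp add: agree_def)

text \<open>The defining equation of the continued fraction with its denominator multiplied out; the
  factor \<open>fps_X\<close> makes it contracting.\<close>

definition cfstep :: "nat \<Rightarrow> ((nat \<Rightarrow> 'a::comm_ring_1) \<Rightarrow> 'a fps) \<Rightarrow> (nat \<Rightarrow> 'a) \<Rightarrow> 'a fps" where
  "cfstep p G W = 1 + fps_X * ((\<Prod>i = 1..p - 1. fps_const (W i) * G (\<lambda>j. W (i + j))) * G W)"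

lemma cfstep_agree:
  assumes "\<And>W. agree n (G W) (H W)"
  shows "agree (Suc n) (cfstep p G W) (cfstep p H W)"
proof -
  have "agree n ((\<Prod>i = 1..p - 1. fps_const (W i) * G (\<lambda>j. W (i + j))) * G W)
     ((\<Prod>i = 1..p - 1. fps_const (W i) * H (\<lambda>j. W (i + j))) * H W)"
    by (intro agree_mult agree_prod agree_refl assms)
  then show ?thesis by (auto simp: agree_def cfstep_def less_Suc_eq_0_disj)
qed

lemma cfstep_iff: "G W * (1 - fps_X * (\<Prod>i = 1..p - 1. fps_const (W i) * G (\<lambda>j. W (i + j)))) = 1 \<longleftrightarrow> G W = cfstep p G W"
  by (simp add: cfstep_def algebra_simps)

lemma cfG_unique: "\<exists>!G :: (nat \<Rightarrow> 'a::comm_ring_1) \<Rightarrow> 'a fps. \<forall>W. G W = cfstep p G W"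
proof (rule ex_ex1I)
  define H where "H = (\<lambda>n. (cfstep p ^^ n) (\<lambda>_. 0 :: 'a fps))"
  have H: "H (Suc n) = cfstep p (H n)" for n by (simp add: H_def)
  have 1: "agree n (H n W) (H (n + k) W)" for n k W
  proof (induction n arbitrary: W)
    case 0 then show ?case by (simp add: agree_def)
  next
    case (Suc n) then show ?case using cfstep_agree[of n "H n" "H (n + k)"] by (simp add: H)
  qed
  \<comment> \<open>The coefficient of degree \<open>k\<close> is final from the iterate
    \<open>k + 1\<close> on.\<close>
  define G where "G = (\<lambda>W. Abs_fps (\<lambda>k. fps_nth (H (Suc k) W) k))"
  have 2: "agree n (H n W) (G W)" for n W
    unfolding agree_def
  proof (intro allI impI)
    fix k assume "k < n"
    then show "fps_nth (H n W) k = fps_nth (G W) k"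
      using 1[of "Suc k" W "n - Suc k"] by (simp add: agree_def G_def)
  qed
  have "G W = cfstep p G W" for W
  proof (rule fps_ext)
    fix k
    have "agree (Suc k) (cfstep p (H k) W) (cfstep p G W)" by (rule cfstep_agree) (rule 2)
    moreover have "agree (Suc k) (H (Suc k) W) (G W)" by (rule 2)
    ultimately show "fps_nth (G W) k = fps_nth (cfstep p G W) k" by (simp add: agree_def H)
  qed
  then show "\<exists>G :: (nat \<Rightarrow> 'a) \<Rightarrow> 'a fps. \<forall>W. G W = cfstep p G W" by blast
next
  fix G H :: "(nat \<Rightarrow> 'a) \<Rightarrow> 'a fps"
  assume G: "\<forall>W. G W = cfstep p G W" and H: "\<forall>W. H W = cfstep p H W"
  have "agree n (G W) (H W)" for n W
  proof (induction n arbitrary: W)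
    case (Suc n)
    then show ?case using cfstep_agree[of n G H p W] G H by metis
  qed (simp add: agree_def)
  then show "G = H" by (intro ext fps_ext) (metis agree_def lessI)
qed

lemma cfG_step: "cfG p W = cfstep p (cfG p) W"
proof -
  have "cfG p = (THE G :: (nat \<Rightarrow> 'a) \<Rightarrow> 'a fps. \<forall>W. G W = cfstep p G W)"
    unfolding cfG_def cfstep_iff ..
  then show ?thesis using theI'[OF cfG_unique[of p, where 'a='a]] by metis
qed

text \<open>Series of the words from height \<open>h\<close> down to \<open>0\<close> by first
  passage: an excursion above \<open>h\<close>, then the first step to \<open>h - 1\<close> with
  weight \<open>V h\<close>, then a word from there.\<close>

fun Rser :: "nat \<Rightarrow> (nat \<Rightarrow> 'a::comm_ring_1) \<Rightarrow> nat \<Rightarrow> 'a fps" where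
  "Rser p V 0 = cfG p V"
| "Rser p V (Suc h) = cfG p (\<lambda>j. V (Suc h + j)) * fps_const (V (Suc h)) * Rser p V h"

lemma Rser_add: "Rser p V (h + m) = (\<Prod>i = 1..m. fps_const (V (h + i)) * cfG p (\<lambda>j. V (h + i + j))) * Rser p V h"
  by (induction m) (simp_all add: mult_ac)

text \<open>Mirrors the first letter of a word: a down-step, or an up-step marked by
  \<open>fps_X\<close>. The product in \<open>cfG_step\<close> is the passage from height
  \<open>h + (p - 1)\<close> back to \<open>h\<close>, which \<open>Rser_add\<close>
  absorbs.\<close>

lemma Rser_step:
  assumes "2 \<le> p"
  shows "Rser p V h = (if h = 0 then 1 else fps_const (V h) * Rser p V (h - 1)) + fps_X * Rser p V (h + (p - 1))"
proof -
  let ?G = "\<lambda>h. cfG p (\<lambda>j. V (h + j))"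
  let ?P = "\<Prod>i = 1..p - 1. fps_const (V (h + i)) * ?G (h + i)"
  have G: "?G h = 1 + fps_X * (?P * ?G h)"
    using cfG_step[of p "\<lambda>j. V (h + j)"] by (simp add: cfstep_def add.assoc)
  have R: "Rser p V (h + (p - 1)) = ?P * Rser p V h" by (simp add: Rser_add add.assoc)
  show ?thesis
  proof (cases h)
    case 0
    then show ?thesis using G R by simp
  next
    case (Suc l)
    have "Rser p V h = ?G h * (fps_const (V h) * Rser p V l)" by (simp add: Suc mult_ac)
    also have "\<dots> = (1 + fps_X * (?P * ?G h)) * (fps_const (V h) * Rser p V l)" by (subst G) simp
    also have "\<dots> = fps_const (V h) * Rser p V l + fps_X * (?P * (?G h * (fps_const (V h) * Rser p V l)))"
      by (simp add: algebra_simps)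
    also have "?G h * (fps_const (V h) * Rser p V l) = Rser p V h" by (simp add: Suc mult_ac)
    finally show ?thesis using R Suc by simp
  qed
qed

lemma wok_length: "wok p h w \<Longrightarrow> h \<le> length w"
  by (induction p h w rule: wok.induct) auto

lemma words_Suc: "words p h (Suc L) = (#) True ` words p (h + (p - 1)) L \<union> (if 0 < h then (#) False ` words p (h - 1) L else {})"
proof (intro equalityI subsetI)
  fix w assume w: "w \<in> words p h (Suc L)"
  then obtain b v where "w = b # v" by (cases w) (auto simp: words_def)
  then show "w \<in> (#) True ` words p (h + (p - 1)) L \<union> (if 0 < h then (#) False ` words p (h - 1) L else {})"
    using w by (cases b) (auto simp: words_def)
qed (auto simp: words_def split: if_splits)

lemma sum_words_Suc:
  "(\<Sum>w\<in>words p h (Suc L). wwt V p h w) = (\<Sum>w\<in>words p (h + (p - 1)) L. wwt V p (h + (p - 1)) w) +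
     (if 0 < h then V h * (\<Sum>w\<in>words p (h - 1) L. wwt V p (h - 1) w) else 0)"
proof -
  have 1: "(\<Sum>w\<in>(#) b ` words p k L. wwt V p h w) = (\<Sum>w\<in>words p k L. wwt V p h (b # w))" for b k
    by (rule sum.reindex_cong[of "(#) b"]) auto
  have T: "(\<Sum>w\<in>(#) True ` words p (h + (p - 1)) L. wwt V p h w) = (\<Sum>w\<in>words p (h + (p - 1)) L. wwt V p (h + (p - 1)) w)"
    unfolding 1 by simp
  show ?thesis
  proof (cases "0 < h")
    case True
    have "(\<Sum>w\<in>words p h (Suc L). wwt V p h w) = (\<Sum>w\<in>(#) True ` words p (h + (p - 1)) L. wwt V p h w) +
        (\<Sum>w\<in>(#) False ` words p (h - 1) L. wwt V p h w)"
      unfolding words_Suc if_P[OF True] by (rule sum.union_disjoint) (auto simp: finite_words)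
    also have "(\<Sum>w\<in>(#) False ` words p (h - 1) L. wwt V p h w) = V h * (\<Sum>w\<in>words p (h - 1) L. wwt V p (h - 1) w)"
      unfolding 1 by (simp add: sum_distrib_left)
    finally show ?thesis unfolding T if_P[OF True] .
  next
    case False
    have "words p h (Suc L) = (#) True ` words p (h + (p - 1)) L" unfolding words_Suc if_not_P[OF False] by simp
    then show ?thesis using T False by simp
  qed
qed

text \<open>\<open>u\<close> up-steps from height \<open>h\<close> need
  \<open>h + u * (p - 1)\<close> down-steps to reach \<open>0\<close>, so the total length is
  \<open>h + p * u\<close>.\<close>

lemma Rser_words:
  assumes p: "2 \<le> p"
  shows "fps_nth (Rser p V h) u = (\<Sum>w\<in>words p h (h + p * u). wwt V p h w)"
proof (induction "h + p * u" arbitrary: h u)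
  case 0
  then have hu: "h = 0" "u = 0" using p by auto
  have "words p 0 0 = {[]}" by (auto simp: words_def)
  then show ?case using Rser_step[OF p, of V 0] hu by simp
next
  case (Suc L)
  have "fps_nth (Rser p V h) u = (if h = 0 then (if u = 0 then 1 else 0) else V h * fps_nth (Rser p V (h - 1)) u) +
     (if u = 0 then 0 else fps_nth (Rser p V (h + (p - 1))) (u - 1))"
    using arg_cong[OF Rser_step[OF p, of V h], of "\<lambda>f. fps_nth f u"] by auto
  also have "(if h = 0 then (if u = 0 then 1 else 0) else V h * fps_nth (Rser p V (h - 1)) u) =
     (if 0 < h then V h * (\<Sum>w\<in>words p (h - 1) L. wwt V p (h - 1) w) else 0)"
  proof (cases "h = 0")
    case True
    then have "u \<noteq> 0" using Suc(2) by (cases u) auto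
    then show ?thesis using True by simp
  next
    case False
    then have e: "h - 1 + p * u = L" using Suc by auto
    have "fps_nth (Rser p V (h - 1)) u = (\<Sum>w\<in>words p (h - 1) (h - 1 + p * u). wwt V p (h - 1) w)" by (rule Suc(1)) (use e in simp)
    then show ?thesis using False e by simp
  qed
  also have "(if u = 0 then 0 else fps_nth (Rser p V (h + (p - 1))) (u - 1)) = (\<Sum>w\<in>words p (h + (p - 1)) L. wwt V p (h + (p - 1)) w)"
  proof (cases "u = 0")
    case True
    then have "words p (h + (p - 1)) L = {}" using Suc(2) p by (auto simp: words_def dest: wok_length)
    then show ?thesis using True by simp
  next
    case False
    then obtain v where v: "u = Suc v" by (cases u) auto
    have e: "h + (p - 1) + p * v = L" using Suc(2) p v by simp
    have "fps_nth (Rser p V (h + (p - 1))) v = (\<Sum>w\<in>words p (h + (p - 1)) (h + (p - 1) + p * v). wwt V p (h + (p - 1)) w)" by (rule Suc(1)) (use e in simp)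
    then show ?thesis using v e by simp
  qed
  finally show ?case unfolding Suc(2)[symmetric] sum_words_Suc by simp
qed

lemma cfG_words: "2 \<le> p \<Longrightarrow> fps_nth (cfG p V) n = (\<Sum>w\<in>words p 0 (n * p). wwt V p 0 w)"
  using Rser_words[of p V 0 n] by (simp add: mult.commute)

section \<open>Existence of the labelling\<close>

text \<open>The constellation in terms of edges, before a vertex is pointed and labels exist. The
  face degrees are explicit here, whereas \<open>lconst\<close> encodes them in \<open>order\<close>
  and in the steps of the labels.\<close>

definition econst :: "nat \<Rightarrow> 'a set \<Rightarrow> ('a \<Rightarrow> 'a) \<Rightarrow> ('a \<Rightarrow> 'a) \<Rightarrow> bool" where
  "econst p E fw fb \<longleftrightarrow> finite E \<and> E \<noteq> {} \<and> fw permutes E \<and> fb permutes E \<and>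
     (\<forall>x\<in>E. \<forall>y\<in>E. y \<in> reach {fw, fb} x) \<and>
     cyc fw E + cyc fb E + cyc (sig fw fb) E = card E + 2 \<and>
     (\<forall>x\<in>E. card (reach {fb} x) = p) \<and> (\<forall>x\<in>E. p dvd card (reach {fw} x))"

lemma (in lconst) fb_mod: "x \<in> E \<Longrightarrow> (t ((fb ^^ j) x) + j) mod p = t x mod p"
proof (induction j)
  case (Suc j)
  have "(fb ^^ j) x \<in> E" by (rule fbk[OF Suc(2)])
  then have "t ((fb ^^ Suc j) x) + 1 = t ((fb ^^ j) x) \<or> t ((fb ^^ Suc j) x) + 1 = t ((fb ^^ j) x) + p"
    using step[of "(fb ^^ j) x"] lab[of "(fb ^^ j) x"] by simp
  then have "t ((fb ^^ Suc j) x) + Suc j = t ((fb ^^ j) x) + j \<or> t ((fb ^^ Suc j) x) + Suc j = t ((fb ^^ j) x) + j + p" by linarith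
  then have m: "(t ((fb ^^ Suc j) x) + Suc j) mod p = (t ((fb ^^ j) x) + j) mod p"
    by (rule disjE) (simp_all only: mod_add_self2)
  then show ?case using Suc.IH[OF Suc.prems] by (simp only:)
qed simp

lemma (in lconst) fw_mod: "x \<in> E \<Longrightarrow> (t ((fw ^^ j) x) + j) mod p = t x mod p \<and> (fw ^^ j) x \<in> E"
proof (induction j)
  case (Suc j)
  then have IH: "(t ((fw ^^ j) x) + j) mod p = t x mod p" "(fw ^^ j) x \<in> E" by auto
  have "t ((fw ^^ Suc j) x) + 1 = t ((fw ^^ j) x) \<or> t ((fw ^^ Suc j) x) + 1 = t ((fw ^^ j) x) + p"
    using step[OF IH(2)] by simp
  then have "t ((fw ^^ Suc j) x) + Suc j = t ((fw ^^ j) x) + j \<or> t ((fw ^^ Suc j) x) + Suc j = t ((fw ^^ j) x) + j + p" by linarith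
  then have m: "(t ((fw ^^ Suc j) x) + Suc j) mod p = (t ((fw ^^ j) x) + j) mod p"
    by (rule disjE) (simp_all only: mod_add_self2)
  moreover have "(fw ^^ Suc j) x \<in> E" using IH(2) by simp
  ultimately show ?case using IH(1) by (simp only:)
qed simp

lemma mod_same_dvd: "((a::nat) + j) mod p = a mod p \<Longrightarrow> p dvd j"
  by (metis add_diff_cancel_left' le_add1 mod_eq_dvd_iff_nat)

text \<open>Along every edge the label falls by one modulo \<open>p\<close>, so every face degree is
  a multiple of \<open>p\<close>; \<open>order\<close> bounds the black ones by
  \<open>p\<close>.\<close>

lemma (in lconst) econst: "econst p E fw fb"
  unfolding econst_def
proof (intro conjI ballI)
  show "E \<noteq> {}" using pt by auto
  fix x assume x: "x \<in> E"
  note P = orbit_period[OF fin permutes_imp_bij[OF fb] x]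
  have 1: "p dvd card (reach {fb} x)"
    by (rule mod_same_dvd[of "t x"]) (use fb_mod[OF x, of "card (reach {fb} x)"] P(1) in simp)
  have "\<not> p < card (reach {fb} x)"
  proof
    assume "p < card (reach {fb} x)"
    then show False using inj_onD[OF P(2), of p 0] order[OF x] p2 P(4) by auto
  qed
  then show "card (reach {fb} x) = p" using dvd_imp_le[OF 1 P(4)] by simp
  show "p dvd card (reach {fw} x)"
    by (rule mod_same_dvd[of "t x"])
      (use fw_mod[OF x, of "card (reach {fw} x)"] orbit_period(1)[OF fin permutes_imp_bij[OF fw] x] in simp)
qed (use fin fw fb conn euler in auto)

text \<open>Each cycle receives total weight one from its points. So numbers of cycles follow from
  their lengths, which is how the cycles of the cover are counted.\<close>

lemma cyc_sum:
  assumes "finite E" "bij_betw f E E"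
  shows "real (cyc f E) = (\<Sum>x\<in>E. 1 / real (card (reach {f} x)))"
proof -
  have F: "bijs {f} E" using assms by (simp add: bijs_def)
  have "(\<Sum>x\<in>E. 1 / real (card (reach {f} x))) = (\<Sum>U\<in>reach {f} ` E. \<Sum>x\<in>{x \<in> E. reach {f} x = U}. 1 / real (card (reach {f} x)))"
    by (rule sum.group[symmetric]) (use assms in auto)
  also have "\<dots> = (\<Sum>U\<in>reach {f} ` E. 1)"
  proof (rule sum.cong[OF refl])
    fix U assume "U \<in> reach {f} ` E"
    then obtain y where y: "y \<in> E" "U = reach {f} y" by auto
    have UE: "U \<subseteq> E" using reach_sub[OF F y(1)] y by simp
    have e: "{x \<in> E. reach {f} x = U} = U"
    proof (intro equalityI subsetI)
      fix x assume "x \<in> {x \<in> E. reach {f} x = U}" then show "x \<in> U" using reach_refl[of x "{f}"] by auto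
    next
      fix x assume x: "x \<in> U"
      then have "reach {f} x = U" using reach_eq[OF F y(1), of x] y by simp
      then show "x \<in> {x \<in> E. reach {f} x = U}" using UE x by auto
    qed
    have "finite U" "U \<noteq> {}" using UE assms(1) finite_subset y reach_refl[of y "{f}"] by auto
    then have c: "real (card U) \<noteq> 0" by simp
    have "(\<Sum>x\<in>{x \<in> E. reach {f} x = U}. 1 / real (card (reach {f} x))) = (\<Sum>x\<in>{x \<in> E. reach {f} x = U}. 1 / real (card U))"
      by (rule sum.cong) auto
    also have "\<dots> = real (card U) * (1 / real (card U))" unfolding e by simp
    finally show "(\<Sum>x\<in>{x \<in> E. reach {f} x = U}. 1 / real (card (reach {f} x))) = 1" using c by simp
  qed
  finally show ?thesis by (simp add: ncomp_def)
qed

text \<open>A planar map all of whose face degrees are multiples of \<open>p\<close> has a potential modulo \<open>p\<close>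
  that decreases by one along each edge: all faces and vertices lift to the \<open>p\<close>-fold cyclic cover,
  so by nonnegativity of the genus the cover is disconnected into \<open>p\<close> sheets.\<close>

locale cover =
  fixes E :: "'a set" and fw fb :: "'a \<Rightarrow> 'a" and p :: nat
  assumes ec: "econst p E fw fb" and p2: "2 \<le> p"
begin

definition lift :: "('a \<Rightarrow> 'a) \<Rightarrow> 'a \<times> nat \<Rightarrow> 'a \<times> nat" where
  "lift f = (\<lambda>(x, c). (f x, Suc c mod p))"

text \<open>For the rotation around vertices: it is \<open>inv fw\<close> after \<open>fb\<close>,
  and the two changes of sheet cancel.\<close>

definition lift0 :: "('a \<Rightarrow> 'a) \<Rightarrow> 'a \<times> nat \<Rightarrow> 'a \<times> nat" where
  "lift0 f = (\<lambda>(x, c). (f x, c))"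

abbreviation "EE \<equiv> E \<times> {..<p}"
abbreviation "lreach \<equiv> reach {lift fw, lift fb}"

lemma props: "finite E" "fw permutes E" "fb permutes E" "\<And>x y. x \<in> E \<Longrightarrow> y \<in> E \<Longrightarrow> y \<in> reach {fw, fb} x"
  "cyc fw E + cyc fb E + cyc (sig fw fb) E = card E + 2"
  "\<And>x. x \<in> E \<Longrightarrow> p dvd card (reach {fb} x)" "\<And>x. x \<in> E \<Longrightarrow> p dvd card (reach {fw} x)"
  using ec by (auto simp: econst_def)

lemma Suc_mod_inj: "c < p \<Longrightarrow> c' < p \<Longrightarrow> Suc c mod p = Suc c' mod p \<Longrightarrow> c = c'"
  by (cases "Suc c = p"; cases "Suc c' = p") auto

lemma lift_bij: assumes "f permutes E" shows "bij_betw (lift f) EE EE"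
proof -
  have i: "inj_on (lift f) EE"
  proof (rule inj_onI)
    fix u v assume uv: "u \<in> EE" "v \<in> EE" "lift f u = lift f v"
    obtain x c y d where e: "u = (x, c)" "v = (y, d)" by (cases u, cases v)
    have "x = y" using uv injD[OF permutes_inj[OF assms], of x y] by (simp add: e lift_def)
    moreover have "c = d" using uv Suc_mod_inj[of c d] by (simp add: e lift_def)
    ultimately show "u = v" by (simp add: e)
  qed
  have "lift f ` EE \<subseteq> EE" using permutes_in_image[OF assms] p2 by (auto simp: lift_def)
  then have "lift f ` EE = EE" using i props(1) by (intro endo_inj_surj) auto
  then show ?thesis using i by (simp add: bij_betw_def)
qed

lemma lift0_bij: assumes "f permutes E" shows "bij_betw (lift0 f) EE EE"
proof -
  have i: "inj_on (lift0 f) EE" using injD[OF permutes_inj[OF assms]] by (auto simp: inj_on_def lift0_def)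
  have "lift0 f ` EE \<subseteq> EE" using permutes_in_image[OF assms] by (auto simp: lift0_def)
  then have "lift0 f ` EE = EE" using i props(1) by (intro endo_inj_surj) auto
  then show ?thesis using i by (simp add: bij_betw_def)
qed

lemma fEE: "finite EE" using props(1) by simp

lemma lift_app: "lift f (x, c) = (f x, Suc c mod p)" "lift0 f (x, c) = (f x, c)"
  by (simp_all add: lift_def lift0_def)

lemma lift_pow: "c < p \<Longrightarrow> (lift f ^^ k) (x, c) = ((f ^^ k) x, (c + k) mod p)"
  by (induction k) (simp_all add: lift_app mod_Suc_eq)

lemma lift0_pow: "(lift0 f ^^ k) (x, c) = ((f ^^ k) x, c)"
  by (induction k) (simp_all add: lift_app)

text \<open>As \<open>p\<close> divides the cycle length, one turn returns to the starting sheet; a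
  lifted cycle is as long as the original one.\<close>

lemma lift_cyc:
  assumes f: "f permutes E" and d: "\<And>x. x \<in> E \<Longrightarrow> p dvd card (reach {f} x)"
  shows "cyc (lift f) EE = p * cyc f E"
proof -
  have c: "card (reach {lift f} (x, c)) = card (reach {f} x)" if x: "x \<in> E" "c < p" for x c
  proof -
    let ?N = "card (reach {f} x)"
    note P = orbit_period[OF props(1) permutes_imp_bij[OF f] x(1)]
    obtain M where M: "?N = p * M" using d[OF x(1)] by blast
    show ?thesis
    proof (rule orbit_periodI)
      show "(lift f ^^ ?N) (x, c) = (x, c)" unfolding lift_pow[OF x(2)] P(1) using M x by simp
      show "inj_on (\<lambda>k. (lift f ^^ k) (x, c)) {..<?N}"
      proof (rule inj_onI)
        fix k l assume kl: "k \<in> {..<?N}" "l \<in> {..<?N}" "(lift f ^^ k) (x, c) = (lift f ^^ l) (x, c)"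
        then have "(f ^^ k) x = (f ^^ l) x" by (simp add: lift_pow[OF x(2)])
        then show "k = l" using inj_onD[OF P(2)] kl by auto
      qed
    qed (rule P(4))
  qed
  have "real (cyc (lift f) EE) = (\<Sum>(x, c)\<in>EE. 1 / real (card (reach {f} x)))"
    unfolding cyc_sum[OF fEE lift_bij[OF f]] by (rule sum.cong) (use c in auto)
  also have "\<dots> = (\<Sum>x\<in>E. \<Sum>c<p. 1 / real (card (reach {f} x)))" by (rule sum.cartesian_product[symmetric])
  also have "\<dots> = real p * real (cyc f E)"
    unfolding cyc_sum[OF props(1) permutes_imp_bij[OF f]] by (simp add: sum_distrib_left)
  finally show ?thesis by (metis of_nat_eq_iff of_nat_mult)
qed

lemma lift0_cyc:
  assumes f: "f permutes E"
  shows "cyc (lift0 f) EE = p * cyc f E"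
proof -
  have c: "card (reach {lift0 f} (x, c)) = card (reach {f} x)" for x c
  proof -
    have "reach {lift0 f} (x, c) = (\<lambda>y. (y, c)) ` reach {f} x" unfolding reach_single lift0_pow by auto
    then show ?thesis by (simp add: card_image inj_on_def)
  qed
  have "real (cyc (lift0 f) EE) = (\<Sum>(x, c)\<in>EE. 1 / real (card (reach {f} x)))"
    unfolding cyc_sum[OF fEE lift0_bij[OF f]] by (rule sum.cong) (use c in auto)
  also have "\<dots> = (\<Sum>x\<in>E. \<Sum>c<p. 1 / real (card (reach {f} x)))" by (rule sum.cartesian_product[symmetric])
  also have "\<dots> = real p * real (cyc f E)"
    unfolding cyc_sum[OF props(1) permutes_imp_bij[OF f]] by (simp add: sum_distrib_left)
  finally show ?thesis by (metis of_nat_eq_iff of_nat_mult)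
qed

lemma bijsL: "bijs {lift fw, lift fb} EE"
  using lift_bij props by (simp add: bijs_def)

text \<open>All terms of Euler's formula are multiplied by \<open>p\<close>, so the cover has total
  \<open>p * (card E + 2)\<close>, which the genus inequality permits only with at least
  \<open>p\<close> components.\<close>

lemma sheets: "p \<le> ncomp {lift fw, lift fb} EE"
proof -
  have sp: "sig fw fb permutes E" unfolding sig_def by (rule permutes_compose[OF props(3) permutes_inv[OF props(2)]])
  have "cyc (lift fw) EE + cyc (lift fb) EE + cyc (lift0 (sig fw fb)) EE \<le> card EE + 2 * ncomp {lift fw, lift fb} EE"
  proof (rule genus_nonneg)
    show "finite EE" using props(1) by simp
    show "lift fw (lift0 (sig fw fb) z) = lift fb z" if "z \<in> EE" for z
      using permutes_inverses[OF props(2)] by (auto simp: lift_def lift0_def sig_def split: prod.splits)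
  qed (use lift_bij lift0_bij props sp in auto)
  then have "p * (cyc fw E + cyc fb E + cyc (sig fw fb) E) \<le> card E * p + 2 * ncomp {lift fw, lift fb} EE"
    using lift_cyc[OF props(2) props(7)] lift_cyc[OF props(3) props(6)] lift0_cyc[OF sp]
    by (simp add: algebra_simps card_cartesian_product)
  then have "p * (card E + 2) \<le> card E * p + 2 * ncomp {lift fw, lift fb} EE" by (simp only: props(5))
  then show ?thesis by (simp add: algebra_simps)
qed

lemma lift_path: assumes "y \<in> reach {fw, fb} x" "c < p" shows "\<exists>c'<p. (y, c') \<in> lreach (x, c)"
  using assms
proof induction
  case (reach_step y f)
  then obtain c' where c': "c' < p" "(y, c') \<in> lreach (x, c)" by auto
  have "lift f \<in> {lift fw, lift fb}" using reach_step(2) by auto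
  then have "lift f (y, c') \<in> lreach (x, c)" by (rule reach.reach_step[OF c'(2)])
  then show ?case using p2 by (intro exI[of _ "Suc c' mod p"]) (auto simp: lift_def)
qed auto

lemma lift_shift: assumes "(y, k) \<in> lreach (x, c)" "k < p" "c < p" shows "(y, (k + j) mod p) \<in> lreach (x, (c + j) mod p)"
proof -
  have "\<exists>y' k'. u = (y', k') \<and> (y', (k' + j) mod p) \<in> lreach (x, (c + j) mod p)" if "u \<in> lreach (x, c)" for u
    using that
  proof induction
    case (reach_step u f)
    then obtain y' k' where u: "u = (y', k')" "(y', (k' + j) mod p) \<in> lreach (x, (c + j) mod p)" by auto
    obtain g where g: "f = lift g" using reach_step(2) by auto
    have "f (y', (k' + j) mod p) \<in> lreach (x, (c + j) mod p)" by (rule reach.reach_step[OF u(2) reach_step(2)])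
    moreover have "f (y', (k' + j) mod p) = (g y', (Suc k' mod p + j) mod p)"
      by (simp add: g lift_def mod_Suc_eq mod_add_left_eq)
    ultimately show ?case using u by (simp add: g lift_def)
  qed auto
  then show ?thesis using assms(1) by blast
qed

text \<open>Every component contains one of the \<open>p\<close> points above \<open>x\<close>;
  since there are at least \<open>p\<close> components, these points lie in pairwise different
  ones.\<close>

lemma sheet_inj:
  assumes x: "x \<in> E" and k: "k < p" "l < p" and e: "lreach (x, k) = lreach (x, l)"
  shows "k = l"
proof -
  let ?F = "\<lambda>c. lreach (x, c)"
  have "lreach ` EE \<subseteq> ?F ` {..<p}"
  proof
    fix U assume "U \<in> lreach ` EE"
    then obtain y c where y: "y \<in> E" "c < p" "U = lreach (y, c)" by auto
    obtain c' where "c' < p" "(x, c') \<in> lreach (y, c)" using lift_path[OF props(4)[OF y(1) x] y(2)] by blast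
    have yE: "(y, c) \<in> EE" using y by simp
    have "lreach (x, c') = U" unfolding y(3) by (rule reach_eq[OF bijsL yE \<open>(x, c') \<in> lreach (y, c)\<close>])
    then show "U \<in> ?F ` {..<p}" using \<open>c' < p\<close> by blast
  qed
  then have "card (lreach ` EE) \<le> card (?F ` {..<p})" by (rule card_mono[rotated]) simp
  then have "p \<le> card (?F ` {..<p})" using sheets unfolding ncomp_def by (rule order_trans[rotated])
  then have "card (?F ` {..<p}) = card {..<p}" using card_image_le[of "{..<p}" ?F] by simp
  then have "inj_on ?F {..<p}" by (intro eq_card_imp_inj_on) auto
  then show ?thesis using e k by (auto dest: inj_onD)
qed

text \<open>The value at \<open>x\<close> is the sheet above the base point \<open>x0\<close> that
  is connected with \<open>(x, 0)\<close>; it is unique by \<open>sheet_inj\<close>, and a step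
  along an edge shifts it by one.\<close>

lemma potential: "\<exists>c. \<forall>x\<in>E. c x < p \<and> c x = Suc (c (fw x)) mod p \<and> c x = Suc (c (fb x)) mod p"
proof -
  obtain x0 where x0: "x0 \<in> E" using ec by (auto simp: econst_def)
  define c where "c = (\<lambda>x. SOME k. k < p \<and> (x0, k) \<in> lreach (x, 0))"
  have c: "c x < p \<and> (x0, c x) \<in> lreach (x, 0)" if "x \<in> E" for x
    unfolding c_def by (rule someI_ex) (use lift_path[OF props(4)[OF that x0], of 0] p2 in auto)
  have key: "c x = Suc (c (f x)) mod p" if x: "x \<in> E" and f: "f \<in> {fw, fb}" for x f
  proof -
    have fx: "f x \<in> E" using f x permutes_in_image[OF props(2)] permutes_in_image[OF props(3)] by auto
    have 1: "lift f (x, 0) = (f x, 1)" using p2 by (simp add: lift_def)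
    have "lift f (x, 0) \<in> lreach (x, 0)" by (rule reach_step) (use f in auto)
    then have e1: "lreach (f x, 1) = lreach (x, 0)"
      unfolding 1 by (rule reach_eq[OF bijsL, rotated]) (use x p2 in auto)
    have "(x0, Suc (c (f x)) mod p) \<in> lreach (f x, 1)"
      using lift_shift[of x0 "c (f x)" "f x" 0 1] c[OF fx] p2 by auto
    then have "(x0, Suc (c (f x)) mod p) \<in> lreach (x, 0)" using e1 by simp
    then have "lreach (x0, Suc (c (f x)) mod p) = lreach (x, 0)"
      by (rule reach_eq[OF bijsL, rotated]) (use x p2 in auto)
    moreover have "(x0, c x) \<in> lreach (x, 0)" using c[OF x] by simp
    then have "lreach (x0, c x) = lreach (x, 0)" by (rule reach_eq[OF bijsL, rotated]) (use x p2 in auto)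
    ultimately show ?thesis using sheet_inj[OF x0, of "c x" "Suc (c (f x)) mod p"] c[OF x] p2 by simp
  qed
  show ?thesis using c key by (intro exI[of _ c]) auto
qed

end

text \<open>\<open>H\<close> is the distance from the endpoint of an edge to the vertex of
  \<open>z\<close>, and \<open>inv fw\<close> transfers it to origins. Along an edge it falls by at
  most one and rises by at most \<open>p - 1\<close>; the potential modulo \<open>p\<close> leaves
  only these two extremes.\<close>

theorem econst_label:
  assumes ec: "econst p E fw fb" and p2: "2 \<le> p" and zE: "z \<in> E"
  shows "\<exists>t. lconst E fw fb t p \<and> (\<forall>x\<in>E. t (fw x) = 0 \<longleftrightarrow> x \<in> reach {sig fw fb} z)"
proof -
  interpret cover E fw fb p by unfold_locales (use ec p2 in auto)
  let ?s = "sig fw fb"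
  note [simp] = permutes_in_image[OF props(2)] permutes_in_image[OF props(3)] permutes_inverses[OF props(2)] permutes_inverses[OF props(3)]
    permutes_in_image[OF permutes_inv[OF props(2)]]
  have sp: "?s permutes E" unfolding sig_def by (rule permutes_compose[OF props(3) permutes_inv[OF props(2)]])
  have fws: "fw (?s x) = fb x" for x by (simp add: sig_def)
  have bs: "bijs {?s} E" using props(1) permutes_imp_bij[OF sp] by (simp add: bijs_def)
  have sE: "?s x \<in> E \<longleftrightarrow> x \<in> E" for x using permutes_in_image[OF sp] .
  have rE: "x \<in> E \<Longrightarrow> y \<in> reach {?s} x \<Longrightarrow> y \<in> E" for x y using reach_sub[OF bs] by auto
  \<comment> \<open>\<open>B k\<close> holds the edges from whose endpoint a walk of
    \<open>k\<close> edges leads to the vertex of \<open>z\<close>: as \<open>y\<close> runs through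
    the orbit of \<open>x\<close>, \<open>fb y\<close> runs through the edges leaving the endpoint
    of \<open>x\<close>.\<close>
  define B where "B = rec_nat (reach {?s} z) (\<lambda>_ S. {x \<in> E. \<exists>y\<in>reach {?s} x. fb y \<in> S})"
  have B0: "B 0 = reach {?s} z" and BS: "B (Suc k) = {x \<in> E. \<exists>y\<in>reach {?s} x. fb y \<in> B k}" for k
    by (simp_all add: B_def)
  have BE: "B k \<subseteq> E" for k by (cases k) (use BS B0 rE[OF zE] in auto)
  have Binv: "y \<in> B k" if "x \<in> B k" "y \<in> reach {?s} x" for x y k
  proof (cases k)
    case 0 then show ?thesis using that B0 reach_trans[of x "{?s}" z y] by auto
  next
    case (Suc l)
    have x: "x \<in> E" using that BE by auto
    then have "reach {?s} y = reach {?s} x" by (rule reach_eq[OF bs _ that(2)])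
    then show ?thesis using that Suc BS rE[OF x that(2)] by auto
  qed
  have fwfb: "\<exists>y\<in>reach {?s} x. fw x = fb y" if x: "x \<in> E" for x
  proof -
    have "?s (inv ?s x) = x" using permutes_inverses[OF sp] by auto
    then have "fw x = fb (inv ?s x)" using fws[of "inv ?s x"] by simp
    moreover have "inv ?s x \<in> reach {?s} x"
      by (rule reach_back[OF bs, of ?s x]) (use x \<open>?s (inv ?s x) = x\<close> permutes_in_image[OF permutes_inv[OF sp]] in auto)
    ultimately show ?thesis by blast
  qed
  have ex: "\<exists>k. x \<in> B k" if x: "x \<in> E" for x
  proof (rule ccontr)
    assume n: "\<nexists>k. x \<in> B k"
    have "reach {fw, fb} x \<subseteq> {y \<in> E. \<nexists>k. y \<in> B k}"
    proof (rule reach_least)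
      fix y f assume y: "y \<in> {y \<in> E. \<nexists>k. y \<in> B k}" and f: "f \<in> {fw, fb}"
      have "\<exists>y'\<in>reach {?s} y. f y = fb y'" using f fwfb[of y] y by auto
      then have "f y \<in> B k \<Longrightarrow> y \<in> B (Suc k)" for k using y BS by auto
      then show "f y \<in> {y \<in> E. \<nexists>k. y \<in> B k}" using y f by auto
    qed (use x n in auto)
    then have "z \<notin> B 0" using props(4)[OF x zE] by blast
    then show False using B0 by simp
  qed
  define H where "H = (\<lambda>x. LEAST k. x \<in> B k)"
  have HB: "x \<in> B (H x)" if "x \<in> E" for x unfolding H_def by (rule LeastI_ex[OF ex[OF that]])
  have Hle: "x \<in> B k \<Longrightarrow> H x \<le> k" for x k unfolding H_def by (rule Least_le)
  have Hs: "H y = H x" if "x \<in> E" "y \<in> reach {?s} x" for x y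
  proof -
    have "y \<in> B k \<longleftrightarrow> x \<in> B k" for k using Binv that(2) reach_sym[OF bs that] by blast
    then show ?thesis by (simp add: H_def)
  qed
  have H1: "H x \<le> H (fb y) + 1" if "x \<in> E" "y \<in> reach {?s} x" for x y
    using Hle[of x "Suc (H (fb y))"] BS HB[of "fb y"] rE[OF that] that by auto
  have H2: "\<exists>y\<in>reach {?s} x. H (fb y) + 1 = H x" if x: "x \<in> E" "0 < H x" for x
  proof -
    obtain l where l: "H x = Suc l" using x by (cases "H x") auto
    then obtain y where y: "y \<in> reach {?s} x" "fb y \<in> B l" using HB[OF x(1)] BS by auto
    then have "H (fb y) \<le> l" using Hle by simp
    then show ?thesis using H1[OF x(1) y(1)] l y by (intro bexI[of _ y]) auto
  qed
  have fbk: "(fb ^^ k) x \<in> E" if "x \<in> E" for x k by (induction k) (use that in auto)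
  have order: "(fb ^^ p) x = x" if x: "x \<in> E" for x
    using orbit_period(1)[OF props(1) permutes_imp_bij[OF props(3)] x] ec x by (simp add: econst_def)
  \<comment> \<open>The way back around the black face: its other \<open>p - 1\<close> edges lead
    from the endpoint of \<open>fb x\<close> to that of \<open>x\<close>.\<close>
  have H3: "H (fb x) \<le> H x + (p - 1)" if x: "x \<in> E" for x
  proof -
    have "H (fb x) \<le> H ((fb ^^ Suc k) x) + k" for k
    proof (induction k)
      case (Suc k)
      then show ?case using H1[OF fbk[OF x, of "Suc k"], of "(fb ^^ Suc k) x"] by simp
    qed simp
    from this[of "p - 1"] show ?thesis using order[OF x] p2 by simp
  qed
  obtain c where c: "\<And>x. x \<in> E \<Longrightarrow> c x < p \<and> c x = Suc (c (fw x)) mod p \<and> c x = Suc (c (fb x)) mod p"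
    using potential by blast
  have cs: "c y = c x" if "x \<in> E" "y \<in> reach {?s} x" for x y
    using that(2)
  proof induction
    case (reach_step y f)
    have yE: "y \<in> E" using rE[OF that(1) reach_step(1)] .
    have "c (?s y) = Suc (c (fw (?s y))) mod p" using c[of "?s y"] sE yE by simp
    also have "\<dots> = c y" using c[OF yE] fws by simp
    finally show ?case using reach_step by simp
  qed simp
  have cB: "x \<in> B k \<Longrightarrow> c x = (c z + k) mod p" for x k
  proof (induction k arbitrary: x)
    case 0 then show ?case using B0 cs[OF zE] c[OF zE] by simp
  next
    case (Suc k)
    then obtain y where y: "x \<in> E" "y \<in> reach {?s} x" "fb y \<in> B k" using BS by auto
    have "c x = c y" using cs[OF y(1,2)] by simp
    also have "\<dots> = Suc (c (fb y)) mod p" using c[OF rE[OF y(1,2)]] by simp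
    also have "\<dots> = (c z + Suc k) mod p" using Suc.IH[OF y(3)] by (simp add: mod_Suc_eq)
    finally show ?case .
  qed
  have Hstep: "H (fw x) + 1 = H x \<or> H (fw x) + 1 = H x + p" if x: "x \<in> E" for x
  proof -
    obtain y where y: "y \<in> reach {?s} x" "fw x = fb y" using fwfb[OF x] by blast
    have yE: "y \<in> E" by (rule rE[OF x y(1)])
    have a: "H x \<le> H (fw x) + 1" using H1[OF x y(1)] y by simp
    have b: "H (fw x) \<le> H x + (p - 1)" using H3[OF yE] Hs[OF x y(1)] y by simp
    have "(c z + H x) mod p = Suc ((c z + H (fw x)) mod p) mod p"
      using cB[OF HB[OF x]] cB[OF HB, of "fw x"] c[OF x] x by simp
    then have "(c z + (H (fw x) + 1)) mod p = (c z + H x) mod p" by (simp add: mod_Suc_eq)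
    then have "p dvd (c z + (H (fw x) + 1)) - (c z + H x)" using a by (metis add_le_cancel_left mod_eq_dvd_iff_nat)
    then have "p dvd H (fw x) + 1 - H x" by simp
    then obtain q where q: "H (fw x) + 1 - H x = p * q" by blast
    then have "p * q \<le> p" using b p2 by linarith
    then have "q = 0 \<or> q = 1" using p2 by (cases q) auto
    then show ?thesis using q a by auto
  qed
  define t where "t = (\<lambda>x. if x \<in> E then H (inv fw x) else 0)"
  have tfw: "t (fw x) = H x" if "x \<in> E" for x using that by (simp add: t_def)
  have H0: "H x = 0 \<longleftrightarrow> x \<in> reach {?s} z" if x: "x \<in> E" for x
  proof
    assume "H x = 0"
    then show "x \<in> reach {?s} z" using HB[OF x] by (simp only: B0)
  next
    assume "x \<in> reach {?s} z"
    then have "x \<in> B 0" by (simp only: B0)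
    then show "H x = 0" using Hle[of x 0] by simp
  qed
  have dnt: "dn fw t x \<longleftrightarrow> H x + 1 = H (inv fw x)" if "x \<in> E" for x
    using that tfw[OF that] by (simp add: dn_def t_def)
  have "lconst E fw fb t p"
  proof unfold_locales
    show "finite E" "fw permutes E" "fb permutes E" "2 \<le> p" using props p2 by auto
    show "cyc fw E + cyc fb E + cyc ?s E = card E + 2" by (rule props)
    show "\<exists>z\<in>E. t (fw z) = 0" using zE tfw[OF zE] H0[OF zE] by auto
    fix x assume x: "x \<in> E"
    show "t (fb x) = t (fw x)"
      using x tfw[OF x] Hs[OF x, of "?s x"] reach_step[of x "{?s}" x ?s] by (simp add: t_def sig_def)
    show "(fb ^^ p) x = x" by (rule order[OF x])
    show "t (fw x) + 1 = t x \<or> t (fw x) + 1 = t x + p"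
      using Hstep[of "inv fw x"] x tfw[OF x] by (simp add: t_def)
    show "y \<in> reach {fw, fb} x" if "y \<in> E" for y by (rule props(4)[OF x that])
    show "\<exists>y\<in>reach {?s} x. dn fw t (fb y)" if pos: "0 < t (fw x)"
    proof -
      obtain y where y: "y \<in> reach {?s} x" "H (fb y) + 1 = H x" using H2[OF x] pos tfw[OF x] by auto
      have yE: "y \<in> E" by (rule rE[OF x y(1)])
      have "H (inv fw (fb y)) = H x"
        using Hs[OF yE, of "?s y"] Hs[OF x y(1)] reach_step[of y "{?s}" y ?s] by (simp add: sig_def)
      then have "dn fw t (fb y)" using dnt[of "fb y"] yE y by simp
      then show ?thesis using y by blast
    qed
    show "y \<in> reach {?s} x" if y: "y \<in> E" "t (fw x) = 0" "t (fw y) = 0" for y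
    proof -
      have "x \<in> reach {?s} z" "y \<in> reach {?s} z" using y H0 tfw x by auto
      then show ?thesis using reach_eq[OF bs zE, of x] by auto
    qed
  next
    show "t x = 0" if "x \<notin> E" for x using that by (simp add: t_def)
  qed
  then show ?thesis using tfw H0 by (intro exI[of _ t]) auto
qed

section \<open>Relabelling of edges by conjugation\<close>

definition conjp :: "('a \<Rightarrow> 'a) \<Rightarrow> ('a \<Rightarrow> 'a) \<Rightarrow> 'a \<Rightarrow> 'a" where
  "conjp g f = g \<circ> f \<circ> inv g"

lemma conj_perm: assumes "bij g" "f permutes E" shows "conjp g f permutes g ` E"
proof (rule bij_imp_permutes)
  have b: "bij_betw (inv g) (g ` E) E" using assms(1)
    by (metis bij_betw_imageI bij_is_inj image_inv_f_f inj_on_inv_into inj_on_subset surj_imp_inj_inv bij_is_surj subset_UNIV)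
  have "bij_betw g E (g ` E)" using assms(1) by (meson bij_betw_imageI bij_is_inj inj_on_subset subset_UNIV)
  then show "bij_betw (conjp g f) (g ` E) (g ` E)" unfolding conjp_def
    using b permutes_imp_bij[OF assms(2)] by (metis bij_betw_trans)
  show "conjp g f x = x" if "x \<notin> g ` E" for x
  proof -
    have "inv g x \<notin> E" using that assms(1) by (metis bij_inv_eq_iff imageI)
    then show ?thesis using permutes_not_in[OF assms(2)] assms(1) by (simp add: conjp_def bij_is_surj surj_f_inv_f)
  qed
qed

lemma conj_sig: assumes "bij g" "bij fw" shows "sig (conjp g fw) (conjp g fb) = conjp g (sig fw fb)"
proof -
  have "inv (conjp g fw) = g \<circ> inv fw \<circ> inv g"
  proof (rule inv_unique_comp)
    show "conjp g fw \<circ> (g \<circ> inv fw \<circ> inv g) = id" "g \<circ> inv fw \<circ> inv g \<circ> conjp g fw = id"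
      using assms by (auto simp: conjp_def fun_eq_iff bij_is_inj bij_is_surj surj_f_inv_f)
  qed
  then show ?thesis using assms by (auto simp: sig_def conjp_def fun_eq_iff bij_is_inj)
qed

lemma conj_app: "bij g \<Longrightarrow> conjp g f (g x) = g (f x)"
  by (simp add: conjp_def bij_is_inj)

lemma reach_conj1: "bij g \<Longrightarrow> reach {conjp g f} (g x) = g ` reach {f} x"
  using reach_conj[of g "{f}" x] by (simp add: conjp_def)

lemma reach_conj2: "bij g \<Longrightarrow> reach {conjp g f, conjp g f'} (g x) = g ` reach {f, f'} x"
  using reach_conj[of g "{f, f'}" x] by (simp add: conjp_def)

lemma lconst_conj:
  assumes L: "lconst E fw fb t p" and g: "bij g"
  shows "lconst (g ` E) (conjp g fw) (conjp g fb) (t \<circ> inv g) p"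
proof -
  interpret lconst E fw fb t p by (rule L)
  have gi: "inv g (g x) = x" for x using g by (simp add: bij_is_inj)
  have gj: "inj g" using g by (rule bij_is_inj)
  have S: "sig (conjp g fw) (conjp g fb) = conjp g s" by (rule conj_sig[OF g permutes_bij[OF fw]])
  have d: "dn (conjp g fw) (t \<circ> inv g) (g x) = dn fw t x" for x by (simp add: dn_def conj_app[OF g] gi)
  have cy: "cyc (conjp g f) (g ` E) = cyc f E" for f using cyc_conj[OF g, of f E] by (simp add: conjp_def)
  show ?thesis
  proof unfold_locales
    show "finite (g ` E)" using fin by simp
    show "conjp g fw permutes g ` E" "conjp g fb permutes g ` E" using conj_perm[OF g] fw fb by auto
    show "2 \<le> p" by (rule p2)
    show "cyc (conjp g fw) (g ` E) + cyc (conjp g fb) (g ` E) + cyc (sig (conjp g fw) (conjp g fb)) (g ` E) = card (g ` E) + 2"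
      unfolding S cy using euler card_image[of g E] gj by (simp add: inj_on_subset)
    show "\<exists>z\<in>g ` E. (t \<circ> inv g) (conjp g fw z) = 0" using pt by (auto simp: conj_app[OF g] gi)
    show "(t \<circ> inv g) x = 0" if "x \<notin> g ` E" for x
    proof -
      have "inv g x \<notin> E" using that g by (metis bij_inv_eq_iff imageI)
      then show ?thesis using out by simp
    qed
    fix x' assume "x' \<in> g ` E"
    then obtain x where x: "x' = g x" "x \<in> E" by auto
    show "(t \<circ> inv g) (conjp g fb x') = (t \<circ> inv g) (conjp g fw x')" using lab x by (simp add: conj_app[OF g] gi)
    have "(conjp g fb ^^ k) (g x) = g ((fb ^^ k) x)" for k by (induction k) (simp_all add: conj_app[OF g])
    then show "(conjp g fb ^^ p) x' = x'" using order x by simp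
    show "(t \<circ> inv g) (conjp g fw x') + 1 = (t \<circ> inv g) x' \<or> (t \<circ> inv g) (conjp g fw x') + 1 = (t \<circ> inv g) x' + p"
      using step[OF x(2)] x by (simp add: conj_app[OF g] gi)
    show "y \<in> reach {conjp g fw, conjp g fb} x'" if "y \<in> g ` E" for y
      using that conn[OF x(2)] unfolding x(1) reach_conj2[OF g] by auto
    show "\<exists>y\<in>reach {sig (conjp g fw) (conjp g fb)} x'. dn (conjp g fw) (t \<circ> inv g) (conjp g fb y)" if "0 < (t \<circ> inv g) (conjp g fw x')"
    proof -
      have "0 < t (fw x)" using that x by (simp add: conj_app[OF g] gi)
      then obtain y where "y \<in> reach {s} x" "dn fw t (fb y)" using down[OF x(2)] by blast
      then show ?thesis unfolding S x(1) reach_conj1[OF g] by (intro bexI[of _ "g y"]) (auto simp: conj_app[OF g] d)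
    qed
    show "y \<in> reach {sig (conjp g fw) (conjp g fb)} x'" if y: "y \<in> g ` E" "(t \<circ> inv g) (conjp g fw x') = 0" "(t \<circ> inv g) (conjp g fw y) = 0" for y
      using y uniq[OF x(2)] x unfolding S x(1) reach_conj1[OF g] by (auto simp: conj_app[OF g] gi)
  qed
qed

definition act :: "(nat \<Rightarrow> nat) \<Rightarrow> lmap \<Rightarrow> lmap" where
  "act g = (\<lambda>(fw, fb, t, r). (conjp g fw, conjp g fb, t \<circ> inv g, g r))"

lemma act_vmaps: "bij g \<Longrightarrow> x \<in> vmaps p E i \<Longrightarrow> act g x \<in> vmaps p (g ` E) i"
  by (auto simp: vmaps_def act_def dn_def conj_app bij_is_inj intro: lconst_conj)

lemma card_reach_conj: "bij g \<Longrightarrow> card (reach {conjp g f} (g x)) = card (reach {f} x)"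
  by (simp add: reach_conj1 card_image inj_on_subset[OF bij_is_inj])

lemma act_fmaps: "bij g \<Longrightarrow> x \<in> fmaps p n E \<Longrightarrow> act g x \<in> fmaps p n (g ` E)"
  by (auto simp: fmaps_def act_def bij_is_inj card_reach_conj intro: lconst_conj)

lemma conj_conj: "bij g \<Longrightarrow> bij h \<Longrightarrow> conjp g (conjp h f) = conjp (g \<circ> h) f"
  by (auto simp: conjp_def fun_eq_iff o_inv_distrib)

lemma act_act: "bij g \<Longrightarrow> bij h \<Longrightarrow> act g (act h x) = act (g \<circ> h) x"
  by (cases x) (auto simp: act_def conj_conj o_inv_distrib fun_eq_iff)

lemma act_id: "act id x = x"
  by (cases x) (auto simp: act_def conjp_def fun_eq_iff)

lemma act_inv: assumes "bij g" shows "act (inv g) (act g x) = x"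
  using act_act[OF bij_imp_bij_inv[OF assms] assms, of x] assms by (simp add: bij_is_inj act_id)

lemma wV_act: assumes "bij g" shows "wV wg (g ` E) (act g x) = wV wg E x"
proof -
  obtain fw fb t r where x: "x = (fw, fb, t, r)" by (cases x)
  have gi: "inj g" using assms by (rule bij_is_inj)
  have "reach {conjp g fw} ` g ` E = (`) g ` (reach {fw} ` E)" by (simp add: image_image reach_conj1[OF assms])
  moreover have "inj_on ((`) g) (reach {fw} ` E)" by (rule inj_onI) (simp add: inj_image_eq_iff[OF gi])
  ultimately show ?thesis
    by (simp add: wV_def wtV_def act_def x prod.reindex card_image inj_on_subset[OF gi])
qed

text \<open>\<open>gen\<close> speaks about arbitrary edge sets, the comparison with isomorphism
  classes only about \<open>{0..<K}\<close>.\<close>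

lemma vmaps_transport:
  assumes "finite E" "finite E'" "card E = card E'"
  shows "(\<Sum>x\<in>vmaps p E i. wV wg E x) = (\<Sum>x\<in>vmaps p E' i. wV wg E' x)"
proof -
  have "\<exists>g. bij g \<and> g ` E = E'"
  proof -
    have c: "card (E' - E) = card (E - E')"
      using assms card_Diff_subset_Int[of E' E] card_Diff_subset_Int[of E E'] by (simp add: Int_commute)
    obtain h where h: "bij_betw h (E - E') (E' - E)" using c assms finite_same_card_bij by (metis finite_Diff)
    \<comment> \<open>An involution that exchanges the two differences, hence a bijection of all of
      \<open>nat\<close>, as \<open>act\<close> requires.\<close>
    define g where "g = (\<lambda>x. if x \<in> E - E' then h x else if x \<in> E' - E then inv_into (E - E') h x else x)"
    have h1: "h x \<in> E' - E" if "x \<in> E - E'" for x using h that by (auto simp: bij_betw_def)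
    have h2: "inv_into (E - E') h x \<in> E - E'" if "x \<in> E' - E" for x using h that by (metis bij_betw_def inv_into_into)
    have gg: "g (g x) = x" for x
      using h1[of x] h2[of x] bij_betw_inv_into_left[OF h, of x] bij_betw_inv_into_right[OF h, of x] by (auto simp: g_def)
    have "bij g" by (rule o_bij[of g]) (auto simp: fun_eq_iff gg)
    moreover have sub: "g x \<in> E'" if "x \<in> E" for x using h1[of x] that by (auto simp: g_def)
    moreover have "g x \<in> E" if "x \<in> E'" for x using h2[of x] that by (auto simp: g_def)
    then have "g ` E = E'" using sub gg by (metis (no_types, lifting) imageI image_subsetI subset_antisym subsetI)
    ultimately show ?thesis by blast
  qed
  then obtain g where g: "bij g" "g ` E = E'" by blast
  have gE: "inv g ` E' = E" using g by (metis bij_is_inj image_inv_f_f)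
  have gi: "bij (inv g)" using g by (simp add: bij_imp_bij_inv)
  show ?thesis
  proof (rule sum.reindex_bij_witness[of _ "act (inv g)" "act g"])
    show "act (inv g) x \<in> vmaps p E i" if "x \<in> vmaps p E' i" for x using act_vmaps[OF gi that] gE by simp
    show "act g x \<in> vmaps p E' i" if "x \<in> vmaps p E i" for x using act_vmaps[OF g(1) that] g(2) by simp
    show "act (inv g) (act g x) = x" for x by (rule act_inv[OF g(1)])
    show "act g (act (inv g) x) = x" for x using act_inv[OF gi, of x] by (simp add: inv_inv_eq[OF g(1)])
    show "wV wg E' (act g x) = wV wg E x" for x
      unfolding g(2)[symmetric] by (rule wV_act[OF g(1)])
  qed
qed

text \<open>Relabellings with the same result agree at the root, hence along \<open>fw\<close> and
  \<open>fb\<close>, and these reach every edge: a rooted map has no nontrivial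
  automorphism.\<close>

lemma act_inj:
  assumes L: "lconst E fw fb t p" and r: "r \<in> E" and g: "g permutes E" "h permutes E"
    and e: "act g (fw, fb, t, r) = act h (fw, fb, t, r)"
  shows "g = h"
proof -
  interpret lconst E fw fb t p by (rule L)
  have b: "bij g" "bij h" using g permutes_bij by auto
  have e': "conjp g fw = conjp h fw" "conjp g fb = conjp h fb" "g r = h r" using e by (auto simp: act_def)
  have "reach {fw, fb} r \<subseteq> {x. g x = h x}"
  proof (rule reach_least)
    fix x f assume x: "x \<in> {x. g x = h x}" and f: "f \<in> {fw, fb}"
    have "conjp g f = conjp h f" using f e' by auto
    then show "f x \<in> {x. g x = h x}" using conj_app[OF b(1), of f x] conj_app[OF b(2), of f x] x by simp
  qed (use e' in simp)
  then have "g x = h x" if "x \<in> E" for x using conn[OF r that] by auto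
  then show ?thesis using permutes_not_in[OF g(1)] permutes_not_in[OF g(2)] by (metis ext)
qed

section \<open>Rooted maps on darts\<close>

text \<open>Edge \<open>x\<close> becomes the white dart \<open>x\<close> and the black dart \<open>x + K\<close>.\<close>

definition dsig :: "nat \<Rightarrow> (nat \<Rightarrow> nat) \<Rightarrow> (nat \<Rightarrow> nat) \<Rightarrow> nat \<Rightarrow> nat" where
  "dsig K fw fb d = (if d < K then inv fb d + K else if d < 2 * K then fw (d - K) else d)"

definition dalp :: "nat \<Rightarrow> nat \<Rightarrow> nat" where
  "dalp K d = (if d < K then d + K else if d < 2 * K then d - K else d)"

definition dwh :: "nat \<Rightarrow> nat \<Rightarrow> bool" where
  "dwh K d \<longleftrightarrow> d < K"

locale darts = labelled "{0..<K}" fw fb "\<lambda>_. 0" for K :: nat and fw fb :: "nat \<Rightarrow> nat"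
begin

abbreviation "E \<equiv> {0..<K}"
abbreviation "D \<equiv> {0..<2 * K}"
abbreviation "\<sigma> \<equiv> dsig K fw fb"
abbreviation "\<alpha> \<equiv> dalp K"

lemma K_simps [simp]: "x < K \<Longrightarrow> fw x < K" "x < K \<Longrightarrow> inv fb x < K" "x < K \<Longrightarrow> fb x < K" "x < K \<Longrightarrow> inv fw x < K" "x < K \<Longrightarrow> s x < K"
  using inE(1)[of x] inE(2)[of x] inE(3)[of x] inE(4)[of x] inE(5)[of x] by auto

lemma \<sigma>_simps: "x < K \<Longrightarrow> \<sigma> x = inv fb x + K" "x < K \<Longrightarrow> \<sigma> (x + K) = fw x"
  by (auto simp: dsig_def)

lemma \<alpha>_simps: "x < K \<Longrightarrow> \<alpha> x = x + K" "x < K \<Longrightarrow> \<alpha> (x + K) = x"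
  by (auto simp: dalp_def)

lemma dart_cases: assumes "d \<in> D" obtains "d < K" | x where "d = x + K" "x < K"
  using assms by (metis add.commute add_diff_inverse_nat atLeastLessThan_iff mult_2 nat_add_left_cancel_less not_less)

lemma \<alpha>_perm: "\<alpha> permutes D"
  by (rule bij_imp_permutes[OF bij_betw_byWitness[where f'=\<alpha>]]) (auto simp: dalp_def)

lemma \<sigma>_perm: "\<sigma> permutes D"
proof (rule bij_imp_permutes)
  let ?g = "\<lambda>d. if d < K then inv fw d + K else fb (d - K)"
  show "bij_betw \<sigma> D D"
  proof (rule bij_betw_byWitness[where f'="?g"])
    show "\<forall>a\<in>D. ?g (\<sigma> a) = a" by (auto elim!: dart_cases simp: \<sigma>_simps)
    show "\<forall>a\<in>D. \<sigma> (?g a) = a" by (auto elim!: dart_cases simp: \<sigma>_simps)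
    show "\<sigma> ` D \<subseteq> D"
    proof (rule image_subsetI)
      fix d assume "d \<in> D" then show "\<sigma> d \<in> D"
      proof (cases rule: dart_cases)
        case 1
        show ?thesis unfolding \<sigma>_simps(1)[OF 1] atLeastLessThan_iff using K_simps(2)[OF 1] by linarith
      next
        case (2 x)
        show ?thesis unfolding 2(1) \<sigma>_simps(2)[OF 2(2)] atLeastLessThan_iff using K_simps(1)[OF 2(2)] by linarith
      qed
    qed
    show "?g ` D \<subseteq> D"
    proof (rule image_subsetI)
      fix d assume "d \<in> D" then show "?g d \<in> D"
      proof (cases rule: dart_cases)
        case 1
        show ?thesis unfolding atLeastLessThan_iff if_P[OF 1] using K_simps(4)[OF 1] by linarith
      next
        case (2 x)
        have "\<not> d < K" "d - K = x" using 2 by auto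
        then show ?thesis using K_simps(3)[OF 2(2)] by (simp del: K_simps)
      qed
    qed
  qed
qed (simp add: dsig_def)

lemma bijs_D: "bijs {\<sigma>} D" "bijs {\<sigma>, \<alpha>} D"
  using permutes_imp_bij[OF \<sigma>_perm] permutes_imp_bij[OF \<alpha>_perm] by (auto simp: bijs_def)

text \<open>A black dart runs against the orientation of its edge, so the darts of a black face
  follow each other by \<open>inv fb\<close>.\<close>

lemma \<phi>_simps: "x < K \<Longrightarrow> (\<sigma> \<circ> \<alpha>) x = fw x" "x < K \<Longrightarrow> (\<sigma> \<circ> \<alpha>) (x + K) = inv fb x + K"
  by (simp_all add: \<sigma>_simps \<alpha>_simps)

lemma face_white: "x < K \<Longrightarrow> orb (\<sigma> \<circ> \<alpha>) x = reach {fw} x"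
  unfolding orb_eq_reach by (rule reach_cong1[of x E]) (use \<phi>_simps(1) in auto)

lemma reach_inv_fb: "x < K \<Longrightarrow> reach {inv fb} x = reach {fb} x"
  using reach_inverse[OF fin permutes_imp_bij[OF fb] permutes_imp_bij[OF permutes_inv[OF fb]], of x] by simp

lemma face_black: "x < K \<Longrightarrow> orb (\<sigma> \<circ> \<alpha>) (x + K) = (\<lambda>y. y + K) ` reach {fb} x"
proof -
  assume x: "x < K"
  have "((\<sigma> \<circ> \<alpha>) ^^ k) (x + K) = (inv fb ^^ k) x + K \<and> (inv fb ^^ k) x < K" for k
  proof (induction k)
    case (Suc k) then show ?case using \<phi>_simps(2)[of "(inv fb ^^ k) x"] by simp
  qed (use x in auto)
  then have "orb (\<sigma> \<circ> \<alpha>) (x + K) = (\<lambda>y. y + K) ` reach {inv fb} x"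
    unfolding orb_def reach_single by (auto simp: image_iff)
  then show ?thesis using reach_inv_fb[OF x] by simp
qed

text \<open>The edges in the \<open>s\<close>-orbit arrive at the vertex and contribute their black
  darts; their white successors leave it and contribute white darts.\<close>

definition vert :: "nat \<Rightarrow> nat set" where
  "vert x = (\<lambda>y. y + K) ` reach {s} x \<union> fw ` reach {s} x"

lemma reach_s_K: "x < K \<Longrightarrow> y \<in> reach {s} x \<Longrightarrow> y < K"
  using reach_sub[OF bijs_s, of x] by auto

text \<open>Around a vertex arriving and leaving edges alternate: two steps of \<sigma> lead from
  the black dart of \<open>y\<close> over the white dart of \<open>fw y\<close> to the black dart of
  the \<open>s\<close>-predecessor of \<open>y\<close>.\<close>

lemma orb_black: assumes x: "x < K" shows "orb \<sigma> (x + K) = vert x"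
proof
  show "orb \<sigma> (x + K) \<subseteq> vert x"
    unfolding orb_eq_reach
  proof (rule reach_least)
    show "x + K \<in> vert x" by (auto simp: vert_def)
    fix d f assume d: "d \<in> vert x" and f: "f \<in> {\<sigma>}"
    then consider y where "y \<in> reach {s} x" "d = y + K" | y where "y \<in> reach {s} x" "d = fw y" by (auto simp: vert_def)
    then show "f d \<in> vert x"
    proof cases
      case 1
      then show ?thesis using f reach_s_K[OF x] by (auto simp: \<sigma>_simps vert_def)
    next
      case 2
      have y: "y < K" using reach_s_K[OF x] 2 by auto
      have "s (inv fb (fw y)) = y" by (simp add: sig_def)
      then have "inv fb (fw y) \<in> reach {s} x"
        using reach_back[OF bijs_s, of s x "inv fb (fw y)"] 2 x y by simp
      moreover have "f d = inv fb (fw y) + K" using f 2 y by (simp add: \<sigma>_simps)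
      ultimately show ?thesis by (auto simp: vert_def)
    qed
  qed
  have xD: "x + K \<in> D" using x by simp
  have "reach {s} x \<subseteq> {y. y < K \<and> y + K \<in> reach {\<sigma>} (x + K)}"
  proof (rule reach_least)
    fix y f assume y: "y \<in> {y. y < K \<and> y + K \<in> reach {\<sigma>} (x + K)}" and f: "f \<in> {s}"
    have sy: "s y < K" using y by simp
    have e1: "\<sigma> (s y + K) = fw (s y)" by (rule \<sigma>_simps(2)[OF sy])
    have e2: "\<sigma> (fw (s y)) = y + K" using y sy by (simp add: \<sigma>_simps fw_s)
    have fD: "fw (s y) \<in> D" using order.strict_trans2[OF K_simps(1)[OF sy], of "2 * K"] by simp
    have "fw (s y) \<in> reach {\<sigma>} (x + K)"
      by (rule reach_back[OF bijs_D(1) _ xD fD, of \<sigma>]) (use e2 y in simp_all)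
    then have e3: "\<sigma> (s y + K) \<in> reach {\<sigma>} (x + K)" unfolding e1 .
    have sD: "s y + K \<in> D" using sy by simp
    have "s y + K \<in> reach {\<sigma>} (x + K)"
      by (rule reach_back[OF bijs_D(1), of \<sigma> "x + K" "s y + K"]) (use xD sD e3 in simp_all)
    then show "f y \<in> {y. y < K \<and> y + K \<in> reach {\<sigma>} (x + K)}" using f sy by auto
  qed (use x in auto)
  then have 1: "y \<in> reach {s} x \<Longrightarrow> y < K \<and> y + K \<in> reach {\<sigma>} (x + K)" for y by auto
  moreover have "fw y \<in> reach {\<sigma>} (x + K)" if "y \<in> reach {s} x" for y
  proof -
    have "\<sigma> (y + K) \<in> reach {\<sigma>} (x + K)" by (rule reach_step[OF conjunct2[OF 1[OF that]]]) simp
    then show ?thesis using 1[OF that] by (simp add: \<sigma>_simps)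
  qed
  ultimately show "vert x \<subseteq> orb \<sigma> (x + K)" unfolding orb_eq_reach vert_def by auto
qed

lemma orb_white: assumes d: "d < K" shows "orb \<sigma> d = vert (inv fw d)"
proof -
  have i: "inv fw d < K" using d by simp
  have e: "\<sigma> (inv fw d + K) = d" using i by (simp add: \<sigma>_simps)
  have "\<sigma> (inv fw d + K) \<in> reach {\<sigma>} (inv fw d + K)" by (rule reach_step) auto
  then have "reach {\<sigma>} d = reach {\<sigma>} (inv fw d + K)"
    unfolding e by (intro reach_eq[OF bijs_D(1)]) (use i in auto)
  then show ?thesis using orb_black[OF i] by (simp add: orb_eq_reach)
qed

lemma vert_inj: assumes "x < K" "y < K" "vert x = vert y" shows "reach {s} x = reach {s} y"
proof -
  have "x + K \<in> vert y" unfolding assms(3)[symmetric] by (auto simp: vert_def)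
  moreover have "x + K \<noteq> fw u" if "u \<in> reach {s} y" for u
    using K_simps(1)[OF reach_s_K[OF assms(2) that]] by auto
  ultimately have "x \<in> reach {s} y" by (auto simp: vert_def)
  then show ?thesis by (intro reach_eq[OF bijs_s]) (use assms in auto)
qed

lemma orbs_\<sigma>: "orb \<sigma> ` D = vert ` E"
proof (intro equalityI subsetI)
  fix U assume "U \<in> orb \<sigma> ` D"
  then obtain d where d: "d \<in> D" "U = orb \<sigma> d" by auto
  from d(1) show "U \<in> vert ` E"
  proof (cases rule: dart_cases)
    case 1 then show ?thesis using d orb_white[OF 1] K_simps(4)[OF 1] by auto
  next
    case (2 x) then show ?thesis using d orb_black by auto
  qed
next
  fix U assume "U \<in> vert ` E"
  then obtain x where "x < K" "U = vert x" by auto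
  then show "U \<in> orb \<sigma> ` D" using orb_black[of x] by (intro image_eqI[of _ _ "x + K"]) auto
qed

lemma card_orbs_\<sigma>: "card (orb \<sigma> ` D) = cyc s E"
proof -
  have "vert x = (\<lambda>U. (\<lambda>y. y + K) ` U \<union> fw ` U) (reach {s} x)" for x by (simp add: vert_def)
  then have "vert ` E = (\<lambda>U. (\<lambda>y. y + K) ` U \<union> fw ` U) ` (reach {s} ` E)" by (simp add: image_image)
  moreover have "inj_on (\<lambda>U. (\<lambda>y. y + K) ` U \<union> fw ` U) (reach {s} ` E)"
    using vert_inj by (auto simp: inj_on_def vert_def)
  ultimately show ?thesis unfolding orbs_\<sigma> by (simp add: card_image ncomp_def)
qed

lemma card_orbs_\<phi>: "card (orb (\<sigma> \<circ> \<alpha>) ` D) = cyc fw E + cyc fb E"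
proof -
  have D: "D = E \<union> (\<lambda>x. x + K) ` E" by (auto elim!: dart_cases)
  have "orb (\<sigma> \<circ> \<alpha>) ` D = reach {fw} ` E \<union> (`) (\<lambda>y. y + K) ` (reach {fb} ` E)"
    unfolding D image_Un image_image using face_white face_black by (intro arg_cong2[of _ _ _ _ "(\<union>)"] image_cong) auto
  moreover have "U \<noteq> (\<lambda>y. y + K) ` V" if U: "U \<in> reach {fw} ` E" for U V
  proof -
    obtain x where "x < K" "U = reach {fw} x" using U by auto
    then have "x \<in> U" "x \<notin> (\<lambda>y. y + K) ` V" by auto
    then show ?thesis by auto
  qed
  then have "reach {fw} ` E \<inter> (`) (\<lambda>y. y + K) ` (reach {fb} ` E) = {}" by blast
  moreover have "card ((`) (\<lambda>y. y + K) ` (reach {fb} ` E)) = cyc fb E"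
    unfolding ncomp_def by (intro card_image) (auto simp: inj_on_def inj_image_eq_iff)
  ultimately show ?thesis by (simp add: card_Un_disjoint ncomp_def)
qed

lemma reach_dart: "x < K \<Longrightarrow> y \<in> reach {fw, fb} x \<Longrightarrow> y < K \<and> y \<in> reach {\<sigma>, \<alpha>} x"
proof -
  assume x: "x < K"
  have "reach {fw, fb} x \<subseteq> {y. y < K \<and> y \<in> reach {\<sigma>, \<alpha>} x}"
  proof (rule reach_least)
    fix y f assume y: "y \<in> {y. y < K \<and> y \<in> reach {\<sigma>, \<alpha>} x}" and f: "f \<in> {fw, fb}"
    have st: "d \<in> reach {\<sigma>, \<alpha>} x \<Longrightarrow> \<sigma> d \<in> reach {\<sigma>, \<alpha>} x \<and> \<alpha> d \<in> reach {\<sigma>, \<alpha>} x" for d by (auto intro: reach_step)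
    have a: "y + K \<in> reach {\<sigma>, \<alpha>} x" using st[of y] y \<alpha>_simps(1)[of y] by auto
    have w: "fw y \<in> reach {\<sigma>, \<alpha>} x" using st[OF a] y \<sigma>_simps(2)[of y] by auto
    have fbK: "fb y < K" using y by simp
    have "\<sigma> (fb y) = y + K" using \<sigma>_simps(1)[OF fbK] by simp
    then have sr: "\<sigma> (fb y) \<in> reach {\<sigma>, \<alpha>} x" using a by simp
    have "fb y \<in> reach {\<sigma>, \<alpha>} x"
      by (rule reach_back[OF bijs_D(2), of \<sigma> x "fb y"]) (use sr x fbK in simp_all)
    then show "f y \<in> {y. y < K \<and> y \<in> reach {\<sigma>, \<alpha>} x}" using f w y by auto
  qed (use x in auto)
  then show "y \<in> reach {fw, fb} x \<Longrightarrow> y < K \<and> y \<in> reach {\<sigma>, \<alpha>} x" by auto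
qed

lemma reach_dart_back: "x < K \<Longrightarrow> d \<in> reach {\<sigma>, \<alpha>} x \<Longrightarrow> \<exists>y\<in>reach {fw, fb} x. d = y \<or> d = y + K"
proof -
  assume x: "x < K"
  have "reach {\<sigma>, \<alpha>} x \<subseteq> {d. \<exists>y\<in>reach {fw, fb} x. d = y \<or> d = y + K}"
  proof (rule reach_least)
    fix d f assume d: "d \<in> {d. \<exists>y\<in>reach {fw, fb} x. d = y \<or> d = y + K}" and f: "f \<in> {\<sigma>, \<alpha>}"
    then obtain y where y: "y \<in> reach {fw, fb} x" "d = y \<or> d = y + K" by blast
    have yK: "y < K" using reach_sub[OF bijs_wb, of x] x y(1) by auto
    have w: "fw y \<in> reach {fw, fb} x" using y by (auto intro: reach_step)
    have b: "inv fb y \<in> reach {fw, fb} x"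
      by (rule reach_back[OF bijs_wb, of fb]) (use x y yK K_simps(2)[OF yK] in auto)
    show "f d \<in> {d. \<exists>y\<in>reach {fw, fb} x. d = y \<or> d = y + K}"
      using f y w b \<sigma>_simps[OF yK] \<alpha>_simps[OF yK] by auto
  qed (auto intro: bexI[of _ x])
  then show "d \<in> reach {\<sigma>, \<alpha>} x \<Longrightarrow> \<exists>y\<in>reach {fw, fb} x. d = y \<or> d = y + K" by auto
qed

lemma conn_iff: "(\<forall>d\<in>D. \<forall>e\<in>D. (d, e) \<in> ({(x, \<sigma> x) | x. x \<in> D} \<union> {(x, \<alpha> x) | x. x \<in> D})\<^sup>*) \<longleftrightarrow>
   (\<forall>x\<in>E. \<forall>y\<in>E. y \<in> reach {fw, fb} x)"
proof -
  let ?R = "({(x, \<sigma> x) | x. x \<in> D} \<union> {(x, \<alpha> x) | x. x \<in> D})"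
  have R: "(d, e) \<in> ?R\<^sup>* \<longleftrightarrow> e \<in> reach {\<sigma>, \<alpha>} d" if d: "d \<in> D" for d e
  proof
    assume "(d, e) \<in> ?R\<^sup>*"
    then show "e \<in> reach {\<sigma>, \<alpha>} d" by induction (auto intro: reach_step)
  next
    assume "e \<in> reach {\<sigma>, \<alpha>} d"
    then show "(d, e) \<in> ?R\<^sup>*"
    proof induction
      case (reach_step y f)
      have "y \<in> D" using reach_sub[OF bijs_D(2) d] reach_step(1) by auto
      then have "(y, f y) \<in> ?R" using reach_step(2) by auto
      then show ?case using reach_step(3) by (rule rtrancl_into_rtrancl[rotated])
    qed simp
  qed
  have EW: "x \<in> D" if "x < K" for x using that by auto
  show ?thesis
  proof
    assume *: "\<forall>d\<in>D. \<forall>e\<in>D. (d, e) \<in> ?R\<^sup>*"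
    show "\<forall>x\<in>E. \<forall>y\<in>E. y \<in> reach {fw, fb} x"
    proof (intro ballI)
      fix x y assume xy: "x \<in> E" "y \<in> E"
      then have "y \<in> reach {\<sigma>, \<alpha>} x" using * R[of x y] EW by auto
      then obtain u where "u \<in> reach {fw, fb} x" "y = u \<or> y = u + K" using reach_dart_back[of x y] xy by auto
      then show "y \<in> reach {fw, fb} x" using xy by auto
    qed
  next
    assume *: "\<forall>x\<in>E. \<forall>y\<in>E. y \<in> reach {fw, fb} x"
    have r1: "\<exists>x<K. reach {\<sigma>, \<alpha>} d = reach {\<sigma>, \<alpha>} x" if "d \<in> D" for d
      using that
    proof (cases rule: dart_cases)
      case (2 x)
      have "\<alpha> x \<in> reach {\<sigma>, \<alpha>} x" by (rule reach_step) auto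
      then have "reach {\<sigma>, \<alpha>} d = reach {\<sigma>, \<alpha>} x"
        unfolding \<alpha>_simps(1)[OF 2(2)] 2(1) by (intro reach_eq[OF bijs_D(2)]) (use 2 in auto)
      then show ?thesis using 2 by auto
    qed auto
    show "\<forall>d\<in>D. \<forall>e\<in>D. (d, e) \<in> ?R\<^sup>*"
    proof (intro ballI)
      fix d e assume d: "d \<in> D" and e: "e \<in> D"
      obtain x where x: "x < K" "reach {\<sigma>, \<alpha>} d = reach {\<sigma>, \<alpha>} x" using r1[OF d] by blast
      obtain y where y: "y < K" "reach {\<sigma>, \<alpha>} e = reach {\<sigma>, \<alpha>} y" using r1[OF e] by blast
      have "y \<in> reach {fw, fb} x" using * x(1) y(1) by simp
      then have "y \<in> reach {\<sigma>, \<alpha>} x" using reach_dart[OF x(1), of y] by simp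
      then have "reach {\<sigma>, \<alpha>} y = reach {\<sigma>, \<alpha>} x" by (intro reach_eq[OF bijs_D(2)]) (use x in auto)
      then have "e \<in> reach {\<sigma>, \<alpha>} d" using x y reach_refl[of e "{\<sigma>, \<alpha>}"] by simp
      then show "(d, e) \<in> ?R\<^sup>*" using R[OF d] by simp
    qed
  qed
qed

lemma dart_iff: "is_constellation p D \<sigma> \<alpha> (dwh K) \<longleftrightarrow> econst p E fw fb"
proof -
  have planar: "is_planar_map D \<sigma> \<alpha> \<longleftrightarrow> (\<forall>x\<in>E. \<forall>y\<in>E. y \<in> reach {fw, fb} x) \<and> cyc fw E + cyc fb E + cyc s E = card E + 2"
  proof -
    have "\<alpha> d \<noteq> d \<and> \<alpha> (\<alpha> d) = d" if "d \<in> D" for d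
      using that by (cases rule: dart_cases) (auto simp: \<alpha>_simps)
    then show ?thesis unfolding is_planar_map_def conn_iff card_orbs_\<sigma> card_orbs_\<phi>
      using \<sigma>_perm \<alpha>_perm by (auto simp: add_ac)
  qed
  have c1: "dwh K ((\<sigma> \<circ> \<alpha>) d) = dwh K d" if "d \<in> D" for d
    using that by (cases rule: dart_cases) (auto simp: \<phi>_simps dwh_def simp del: o_apply)
  have c2: "dwh K (\<alpha> d) \<longleftrightarrow> \<not> dwh K d" if "d \<in> D" for d
    using that by (cases rule: dart_cases) (auto simp: \<alpha>_simps dwh_def)
  have b: "(\<forall>d\<in>D. \<not> dwh K d \<longrightarrow> card (orb (\<sigma> \<circ> \<alpha>) d) = p) \<longleftrightarrow> (\<forall>x\<in>E. card (reach {fb} x) = p)"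
  proof -
    have cb: "card (orb (\<sigma> \<circ> \<alpha>) (x + K)) = card (reach {fb} x)" if "x < K" for x
      unfolding face_black[OF that] by (simp add: card_image inj_on_def)
    show ?thesis
    proof
      assume *: "\<forall>d\<in>D. \<not> dwh K d \<longrightarrow> card (orb (\<sigma> \<circ> \<alpha>) d) = p"
      show "\<forall>x\<in>E. card (reach {fb} x) = p"
      proof
        fix x assume "x \<in> E"
        then show "card (reach {fb} x) = p" using *[rule_format, of "x + K"] cb[of x] by (simp add: dwh_def)
      qed
    next
      assume *: "\<forall>x\<in>E. card (reach {fb} x) = p"
      show "\<forall>d\<in>D. \<not> dwh K d \<longrightarrow> card (orb (\<sigma> \<circ> \<alpha>) d) = p"
      proof (intro ballI impI)
        fix d assume "d \<in> D" "\<not> dwh K d"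
        then have "d = (d - K) + K" "d - K < K" by (auto simp: dwh_def)
        then obtain x where "d = x + K" "x < K" by blast
        then show "card (orb (\<sigma> \<circ> \<alpha>) d) = p" using * cb by auto
      qed
    qed
  qed
  have w: "(\<forall>d\<in>D. dwh K d \<longrightarrow> p dvd card (orb (\<sigma> \<circ> \<alpha>) d)) \<longleftrightarrow> (\<forall>x\<in>E. p dvd card (reach {fw} x))"
    using face_white by (auto simp: dwh_def)
  have w0: "\<forall>d. dwh K d \<longrightarrow> d \<in> D" by (auto simp: dwh_def)
  have ne: "cyc fw E + cyc fb E + cyc s E = card E + 2 \<Longrightarrow> E \<noteq> {}" by (cases "K = 0") (auto simp: ncomp_def)
  show ?thesis
    unfolding is_constellation_def planar econst_def b w using c1 c2 w0 ne fw fb by blast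
qed

lemma white_faces_eq: "white_faces (2 * K) \<sigma> \<alpha> (dwh K) = reach {fw} ` E"
proof -
  have "white_faces (2 * K) \<sigma> \<alpha> (dwh K) = orb (\<sigma> \<circ> \<alpha>) ` E" by (auto simp: white_faces_def dwh_def)
  also have "\<dots> = reach {fw} ` E" by (rule image_cong) (use face_white in auto)
  finally show ?thesis .
qed

end

text \<open>A white dart sits at the origin of its edge, a black one at the endpoint, so this is the
  label of the vertex that carries the dart.\<close>

definition dlab :: "nat \<Rightarrow> (nat \<Rightarrow> nat) \<Rightarrow> (nat \<Rightarrow> nat) \<Rightarrow> nat \<Rightarrow> nat" where
  "dlab K fw t d = (if d < K then t d else t (fw (d - K)))"

definition dpt :: "nat \<Rightarrow> (nat \<Rightarrow> nat) \<Rightarrow> (nat \<Rightarrow> nat) \<Rightarrow> nat set" where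
  "dpt K fw t = {d. d < 2 * K \<and> dlab K fw t d = 0}"

locale ldarts = lconst "{0..<K}" fw fb t p for K :: nat and fw fb t p
begin

sublocale N: darts K fw fb
  by unfold_locales (use fw fb in auto)

abbreviation "D \<equiv> {0..<2 * K}"
abbreviation "\<sigma> \<equiv> dsig K fw fb"
abbreviation "\<alpha> \<equiv> dalp K"
abbreviation "P \<equiv> dpt K fw t"

lemma dlab_simps: "x < K \<Longrightarrow> dlab K fw t x = t x" "dlab K fw t (x + K) = t (fw x)"
  by (auto simp: dlab_def)

lemma dlab_\<sigma>: assumes "d \<in> D" shows "dlab K fw t (\<sigma> d) = dlab K fw t d"
  using assms
proof (cases rule: N.dart_cases)
  case 1
  then show ?thesis using lab[of "inv fb d"] N.K_simps(2)[OF 1] by (simp add: N.\<sigma>_simps dlab_simps)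
next
  case (2 x)
  then show ?thesis by (simp add: N.\<sigma>_simps dlab_simps)
qed

lemma dlab_orb: "d \<in> D \<Longrightarrow> e \<in> orb \<sigma> d \<Longrightarrow> dlab K fw t e = dlab K fw t d"
proof -
  assume d: "d \<in> D" and e: "e \<in> orb \<sigma> d"
  have "reach {\<sigma>} d \<subseteq> {e \<in> D. dlab K fw t e = dlab K fw t d}"
    by (rule reach_least) (use d dlab_\<sigma> permutes_in_image[OF N.\<sigma>_perm] in auto)
  then show ?thesis using e by (auto simp: orb_eq_reach)
qed

lemma orb_sub: "d \<in> D \<Longrightarrow> orb \<sigma> d \<subseteq> D"
  unfolding orb_eq_reach by (rule reach_sub[OF N.bijs_D(1)])

lemma orb_refl: "d \<in> orb \<sigma> d" by (simp add: orb_eq_reach)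

lemma orb_eq: "d \<in> D \<Longrightarrow> e \<in> orb \<sigma> d \<Longrightarrow> orb \<sigma> e = orb \<sigma> d"
  unfolding orb_eq_reach by (rule reach_eq[OF N.bijs_D(1)])

lemma dpt_orb: assumes d: "d \<in> D" "dlab K fw t d = 0" shows "orb \<sigma> d = P"
proof
  show "orb \<sigma> d \<subseteq> P" using dlab_orb[OF d(1)] d orb_sub[OF d(1)] by (auto simp: dpt_def)
  show "P \<subseteq> orb \<sigma> d"
  proof
    fix e assume e: "e \<in> P"
    have hd: "\<exists>x<K. t (fw x) = 0 \<and> orb \<sigma> u = N.vert x" if u: "u \<in> D" "dlab K fw t u = 0" for u
      using u(1)
    proof (cases rule: N.dart_cases)
      case 1
      then show ?thesis using N.orb_white[OF 1] u dlab_simps(1)[OF 1] by (intro exI[of _ "inv fw u"]) auto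
    next
      case (2 x)
      then show ?thesis using N.orb_black[OF 2(2)] u dlab_simps(2)[of x] by (intro exI[of _ x]) auto
    qed
    obtain x where x: "x < K" "t (fw x) = 0" "orb \<sigma> d = N.vert x" using hd[OF d] by blast
    obtain y where y: "y < K" "t (fw y) = 0" "orb \<sigma> e = N.vert y" using hd[of e] e by (auto simp: dpt_def)
    have "y \<in> reach {s} x" using uniq[of x y] x y by auto
    then have "reach {s} y = reach {s} x" by (intro reach_eq[OF bijs_s]) (use x in auto)
    then have "N.vert y = N.vert x" by (simp add: N.vert_def)
    then show "e \<in> orb \<sigma> d" using x y orb_refl[of e] by simp
  qed
qed

lemma dpt_in: "P \<in> orb \<sigma> ` D"
proof -
  obtain z where z: "z < K" "t (fw z) = 0" using pt by auto
  then have "orb \<sigma> (z + K) = P" by (intro dpt_orb) (auto simp: dlab_simps)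
  then show ?thesis using z by (intro image_eqI[of _ _ "z + K"]) auto
qed

lemma walk_lab:
  assumes "(v, P) \<in> oriented_edges (2 * K) \<sigma> \<alpha> (dwh K) ^^ k" "v = orb \<sigma> d" "d \<in> D"
  shows "dlab K fw t d \<le> k"
  using assms
proof (induction k arbitrary: v d)
  case 0
  then have "d \<in> P" using orb_refl[of d] by simp
  then show ?case by (simp add: dpt_def)
next
  case (Suc k)
  obtain u where u: "(v, u) \<in> oriented_edges (2 * K) \<sigma> \<alpha> (dwh K)" "(u, P) \<in> oriented_edges (2 * K) \<sigma> \<alpha> (dwh K) ^^ k"
    using Suc.prems(1) by (metis relpow_Suc_D2)
  obtain e where e: "v = orb \<sigma> e" "u = orb \<sigma> (\<alpha> e)" "e < K" using u(1) by (auto simp: oriented_edges_def dwh_def)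
  have "e \<in> orb \<sigma> d" using e Suc.prems orb_refl[of e] by simp
  then have "dlab K fw t e = dlab K fw t d" using dlab_orb Suc.prems by blast
  then have 1: "dlab K fw t d = t e" using e dlab_simps by simp
  have ae: "\<alpha> e \<in> D" using e by (simp add: N.\<alpha>_simps)
  have "dlab K fw t (\<alpha> e) \<le> k" by (rule Suc.IH[OF u(2) e(2) ae])
  then have "t (fw e) \<le> k" using e by (simp add: N.\<alpha>_simps dlab_simps)
  then show ?case using 1 step[of e] e p2 by auto
qed

lemma walk_exists:
  assumes "d \<in> D"
  shows "(orb \<sigma> d, P) \<in> oriented_edges (2 * K) \<sigma> \<alpha> (dwh K) ^^ dlab K fw t d"
  using assms
proof (induction "dlab K fw t d" arbitrary: d)
  case 0
  then have "orb \<sigma> d = P" using dpt_orb[of d] by simp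
  then show ?case using 0 by simp
next
  case (Suc l)
  obtain x where x: "x < K" "orb \<sigma> d = orb \<sigma> (x + K)" "t (fw x) = Suc l"
    using Suc(3)
  proof (cases rule: N.dart_cases)
    case 1
    show ?thesis
      by (rule that[of "inv fw d"]) (use 1 Suc(2) N.orb_white[OF 1] N.orb_black[of "inv fw d"] dlab_simps(1)[OF 1] in auto)
  next
    case (2 y)
    then show ?thesis using that[of y] Suc(2) dlab_simps(2)[of y] by auto
  qed
  obtain y where y: "y \<in> reach {s} x" "dn fw t (fb y)" using down[of x] x by auto
  have yK: "y < K" using N.reach_s_K[OF x(1) y(1)] .
  have fyK: "fb y < K" using yK N.K_simps(3) by blast
  have "reach {s} y = reach {s} x" by (rule reach_eq[OF bijs_s _ y(1)]) (use x in auto)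
  then have v: "orb \<sigma> (y + K) = orb \<sigma> (x + K)" using N.orb_black[OF x(1)] N.orb_black[OF yK] by (simp add: N.vert_def)
  have "\<sigma> (fb y) = y + K" using N.\<sigma>_simps(1)[OF fyK] by simp
  then have "y + K \<in> orb \<sigma> (fb y)" unfolding orb_eq_reach using reach_step[of "fb y" "{\<sigma>}" "fb y" \<sigma>] by simp
  then have o: "orb \<sigma> (fb y) = orb \<sigma> d" using orb_eq[of "fb y" "y + K"] v x fyK by simp
  have E: "(orb \<sigma> (fb y), orb \<sigma> (\<alpha> (fb y))) \<in> oriented_edges (2 * K) \<sigma> \<alpha> (dwh K)"
    using fyK by (force simp: oriented_edges_def dwh_def)
  have "t (fb y) = Suc l" using lab[of y] head_reach[OF _ y(1)] x yK by simp
  then have tl: "t (fw (fb y)) = l" using y by (simp add: dn_def)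
  have aD: "\<alpha> (fb y) \<in> D" using fyK by (simp add: N.\<alpha>_simps)
  have dl: "dlab K fw t (\<alpha> (fb y)) = l" using tl fyK by (simp add: N.\<alpha>_simps dlab_simps)
  have "(orb \<sigma> (\<alpha> (fb y)), P) \<in> oriented_edges (2 * K) \<sigma> \<alpha> (dwh K) ^^ l"
    using Suc(1)[OF dl[symmetric] aD] dl by simp
  then show ?case using E o relpow_Suc_I2 Suc(2) by metis
qed

text \<open>Labels fall by at most one per edge and so bound the length of a walk from below;
  following down-edges attains the bound.\<close>

lemma vtype_eq: "d \<in> D \<Longrightarrow> vtype (2 * K) \<sigma> \<alpha> (dwh K) P (orb \<sigma> d) = dlab K fw t d"
  unfolding vtype_def by (rule Least_equality) (use walk_exists walk_lab in blast)+

lemma is_const: "is_constellation p D \<sigma> \<alpha> (dwh K)"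
  using N.dart_iff econst by simp

end

section \<open>Isomorphism of constellations as conjugation\<close>

definition rconj :: "(nat \<Rightarrow> nat) \<Rightarrow> rmap \<Rightarrow> rmap" where
  "rconj \<pi> = (\<lambda>(\<sigma>, \<alpha>, w, r). (conjp \<pi> \<sigma>, conjp \<pi> \<alpha>, w \<circ> inv \<pi>, \<pi> r))"

definition pconj :: "(nat \<Rightarrow> nat) \<Rightarrow> pmap \<Rightarrow> pmap" where
  "pconj \<pi> = (\<lambda>(s, P). (rconj \<pi> s, \<pi> ` P))"

lemma conj_id: "conjp id f = f" by (auto simp: conjp_def fun_eq_iff)

lemma rconj_id: "rconj id s = s" by (cases s) (auto simp: rconj_def conj_id)
lemma pconj_id: "pconj id s = s" by (cases s) (auto simp: pconj_def rconj_id)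

lemma rconj_comp: "bij \<pi> \<Longrightarrow> bij \<rho> \<Longrightarrow> rconj \<pi> (rconj \<rho> s) = rconj (\<pi> \<circ> \<rho>) s"
  by (cases s) (auto simp: rconj_def conj_conj o_inv_distrib fun_eq_iff)

lemma pconj_comp: "bij \<pi> \<Longrightarrow> bij \<rho> \<Longrightarrow> pconj \<pi> (pconj \<rho> s) = pconj (\<pi> \<circ> \<rho>) s"
  by (cases s) (auto simp: pconj_def rconj_comp image_comp)

lemma inv_comp_id: "bij \<pi> \<Longrightarrow> inv \<pi> \<circ> \<pi> = id" by (simp add: bij_is_inj)

lemma orb_conj: "bij \<pi> \<Longrightarrow> orb (conjp \<pi> f) (\<pi> x) = \<pi> ` orb f x"
  by (simp add: orb_eq_reach reach_conj1)

lemma conj_o: "bij \<pi> \<Longrightarrow> conjp \<pi> f \<circ> conjp \<pi> g = conjp \<pi> (f \<circ> g)"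
  by (auto simp: conjp_def fun_eq_iff bij_is_inj)

lemma card_orbs_conj: assumes "bij \<pi>" shows "card (orb (conjp \<pi> f) ` \<pi> ` D) = card (orb f ` D)"
proof -
  have "orb (conjp \<pi> f) ` \<pi> ` D = (`) \<pi> ` (orb f ` D)" by (simp add: image_image orb_conj[OF assms])
  moreover have "inj_on ((`) \<pi>) (orb f ` D)" by (rule inj_onI) (simp add: inj_image_eq_iff[OF bij_is_inj[OF assms]])
  ultimately show ?thesis by (simp add: card_image)
qed

lemma is_constellation_conj:
  assumes C: "is_constellation p D \<sigma> \<alpha> w" and \<pi>: "bij \<pi>"
  shows "is_constellation p (\<pi> ` D) (conjp \<pi> \<sigma>) (conjp \<pi> \<alpha>) (w \<circ> inv \<pi>)"
proof -
  have gi: "inv \<pi> (\<pi> x) = x" for x using \<pi> by (simp add: bij_is_inj)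
  have M: "finite D" "\<sigma> permutes D" "\<alpha> permutes D" "\<And>d. d \<in> D \<Longrightarrow> \<alpha> d \<noteq> d \<and> \<alpha> (\<alpha> d) = d"
     "\<And>d e. d \<in> D \<Longrightarrow> e \<in> D \<Longrightarrow> (d, e) \<in> ({(x, \<sigma> x) | x. x \<in> D} \<union> {(x, \<alpha> x) | x. x \<in> D})\<^sup>*"
     "card (orb \<sigma> ` D) + card (orb (\<sigma> \<circ> \<alpha>) ` D) = card D div 2 + 2"
    using C by (auto simp: is_constellation_def is_planar_map_def)
  have W: "\<And>d. w d \<Longrightarrow> d \<in> D" "\<And>d. d \<in> D \<Longrightarrow> w ((\<sigma> \<circ> \<alpha>) d) = w d" "\<And>d. d \<in> D \<Longrightarrow> w (\<alpha> d) \<longleftrightarrow> \<not> w d"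
     "\<And>d. d \<in> D \<Longrightarrow> \<not> w d \<Longrightarrow> card (orb (\<sigma> \<circ> \<alpha>) d) = p" "\<And>d. d \<in> D \<Longrightarrow> w d \<Longrightarrow> p dvd card (orb (\<sigma> \<circ> \<alpha>) d)"
    using C unfolding is_constellation_def by blast+
  have co: "card (orb (conjp \<pi> f) (\<pi> d)) = card (orb f d)" for f d
    unfolding orb_conj[OF \<pi>] by (rule card_image) (rule inj_on_subset[OF bij_is_inj[OF \<pi>]], simp)
  let ?R = "{(x, \<sigma> x) | x. x \<in> D} \<union> {(x, \<alpha> x) | x. x \<in> D}"
  let ?R' = "{(x, conjp \<pi> \<sigma> x) | x. x \<in> \<pi> ` D} \<union> {(x, conjp \<pi> \<alpha> x) | x. x \<in> \<pi> ` D}"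
  have path: "(\<pi> d, \<pi> e) \<in> ?R'\<^sup>*" if "(d, e) \<in> ?R\<^sup>*" for d e
    using that
  proof induction
    case (step y z)
    have "(\<pi> y, \<pi> z) \<in> ?R'"
    proof -
      consider "y \<in> D" "z = \<sigma> y" | "y \<in> D" "z = \<alpha> y" using step(2) by auto
      then show ?thesis by cases (force simp: conj_app[OF \<pi>])+
    qed
    then show ?case using step(3) by (rule rtrancl_into_rtrancl[rotated])
  qed simp
  have "is_planar_map (\<pi> ` D) (conjp \<pi> \<sigma>) (conjp \<pi> \<alpha>)"
    unfolding is_planar_map_def
  proof (intro conjI ballI)
    show "finite (\<pi> ` D)" using M(1) by simp
    show "conjp \<pi> \<sigma> permutes \<pi> ` D" "conjp \<pi> \<alpha> permutes \<pi> ` D" using conj_perm[OF \<pi>] M by auto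
    show "conjp \<pi> \<alpha> d \<noteq> d" if d: "d \<in> \<pi> ` D" for d
    proof -
      obtain x where x: "x \<in> D" "d = \<pi> x" using d by blast
      then have "\<alpha> x \<noteq> x" using M(4) by blast
      then show ?thesis using x(2) bij_is_inj[OF \<pi>] by (simp add: conj_app[OF \<pi>] inj_eq)
    qed
    show "conjp \<pi> \<alpha> (conjp \<pi> \<alpha> d) = d" if d: "d \<in> \<pi> ` D" for d
      using d M(4) by (auto simp: conj_app[OF \<pi>])
    show "(d, e) \<in> ?R'\<^sup>*" if de: "d \<in> \<pi> ` D" "e \<in> \<pi> ` D" for d e
    proof -
      obtain d0 e0 where "d0 \<in> D" "d = \<pi> d0" "e0 \<in> D" "e = \<pi> e0" using de by blast
      then show ?thesis using path[OF M(5)[of d0 e0]] by simp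
    qed
    have "card (\<pi> ` D) = card D" by (rule card_image) (rule inj_on_subset[OF bij_is_inj[OF \<pi>]], simp)
    then show "card (orb (conjp \<pi> \<sigma>) ` \<pi> ` D) + card (orb (conjp \<pi> \<sigma> \<circ> conjp \<pi> \<alpha>) ` \<pi> ` D) = card (\<pi> ` D) div 2 + 2"
      unfolding conj_o[OF \<pi>] card_orbs_conj[OF \<pi>] using M(6) by simp
  qed
  moreover have "d \<in> \<pi> ` D" if "(w \<circ> inv \<pi>) d" for d
    using W(1)[of "inv \<pi> d"] that \<pi> by (metis bij_inv_eq_iff comp_apply imageI)
  moreover have "(w \<circ> inv \<pi>) ((conjp \<pi> \<sigma> \<circ> conjp \<pi> \<alpha>) d) = (w \<circ> inv \<pi>) d" if "d \<in> \<pi> ` D" for d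
    using that W(2) unfolding conj_o[OF \<pi>] by (auto simp: conj_app[OF \<pi>] gi)
  moreover have "(w \<circ> inv \<pi>) (conjp \<pi> \<alpha> d) \<longleftrightarrow> \<not> (w \<circ> inv \<pi>) d" if "d \<in> \<pi> ` D" for d
    using that W(3) by (auto simp: conj_app[OF \<pi>] gi)
  moreover have "card (orb (conjp \<pi> \<sigma> \<circ> conjp \<pi> \<alpha>) d) = p" if "d \<in> \<pi> ` D" "\<not> (w \<circ> inv \<pi>) d" for d
    using that W(4) unfolding conj_o[OF \<pi>] by (auto simp: co gi)
  moreover have "p dvd card (orb (conjp \<pi> \<sigma> \<circ> conjp \<pi> \<alpha>) d)" if "d \<in> \<pi> ` D" "(w \<circ> inv \<pi>) d" for d
    using that W(5) unfolding conj_o[OF \<pi>] by (auto simp: co gi)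
  ultimately show ?thesis unfolding is_constellation_def by blast
qed

text \<open>Everything is trivial outside \<open>{0..<N}\<close>, so the pointwise conditions of an
  isomorphism become equations between functions, and isomorphism becomes an orbit relation.\<close>

lemma iso_conj:
  assumes \<pi>: "\<pi> permutes {0..<N}" and C: "is_constellation p {0..<N} \<sigma> \<alpha> w" "is_constellation p {0..<N} \<sigma>' \<alpha>' w'"
  shows "(\<forall>d<N. \<pi> (\<sigma> d) = \<sigma>' (\<pi> d) \<and> \<pi> (\<alpha> d) = \<alpha>' (\<pi> d) \<and> w' (\<pi> d) = w d) \<longleftrightarrow>
    \<sigma>' = conjp \<pi> \<sigma> \<and> \<alpha>' = conjp \<pi> \<alpha> \<and> w' = w \<circ> inv \<pi>"
proof -
  have b: "bij \<pi>" using \<pi> by (rule permutes_bij)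
  have P: "\<sigma> permutes {0..<N}" "\<alpha> permutes {0..<N}" "\<sigma>' permutes {0..<N}" "\<alpha>' permutes {0..<N}"
    and W: "\<And>d. w d \<Longrightarrow> d < N" "\<And>d. w' d \<Longrightarrow> d < N"
    using C by (auto simp: is_constellation_def is_planar_map_def)
  have gi: "inv \<pi> (\<pi> x) = x" for x using b by (simp add: bij_is_inj)
  have *: "f' = conjp \<pi> f" if "f permutes {0..<N}" "f' permutes {0..<N}" "\<And>d. d < N \<Longrightarrow> \<pi> (f d) = f' (\<pi> d)" for f f'
  proof
    fix e
    obtain d where d: "e = \<pi> d" using b by (metis bij_pointE)
    show "f' e = conjp \<pi> f e"
    proof (cases "d < N")
      case True then show ?thesis using that d by (simp add: conj_app[OF b])
    next
      case False
      then have "\<pi> d = d" "f d = d" using permutes_not_in[OF \<pi>, of d] permutes_not_in[OF that(1), of d] by auto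
      moreover have "f' d = d" using permutes_not_in[OF that(2), of d] False by auto
      ultimately show ?thesis using d conj_app[OF b, of f d] by simp
    qed
  qed
  show ?thesis
  proof
    assume H: "\<forall>d<N. \<pi> (\<sigma> d) = \<sigma>' (\<pi> d) \<and> \<pi> (\<alpha> d) = \<alpha>' (\<pi> d) \<and> w' (\<pi> d) = w d"
    have "w' e = (w \<circ> inv \<pi>) e" for e
    proof -
      obtain d where d: "e = \<pi> d" using b by (metis bij_pointE)
      show ?thesis
      proof (cases "d < N")
        case True then show ?thesis using H d gi by simp
      next
        case False
        then have "\<pi> d = d" using permutes_not_in[OF \<pi>, of d] by auto
        then show ?thesis using W[of d] False d gi[of d] by auto
      qed
    qed
    then show "\<sigma>' = conjp \<pi> \<sigma> \<and> \<alpha>' = conjp \<pi> \<alpha> \<and> w' = w \<circ> inv \<pi>" using * P H by auto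
  next
    assume "\<sigma>' = conjp \<pi> \<sigma> \<and> \<alpha>' = conjp \<pi> \<alpha> \<and> w' = w \<circ> inv \<pi>"
    then show "\<forall>d<N. \<pi> (\<sigma> d) = \<sigma>' (\<pi> d) \<and> \<pi> (\<alpha> d) = \<alpha>' (\<pi> d) \<and> w' (\<pi> d) = w d"
      by (simp add: conj_app[OF b] gi)
  qed
qed

lemma rmap_iso_conj:
  assumes "s \<in> rooted_constellations p n N" "s' \<in> rooted_constellations p n N"
  shows "rmap_iso N s s' \<longleftrightarrow> (\<exists>\<pi>. \<pi> permutes {0..<N} \<and> s' = rconj \<pi> s)"
proof -
  obtain \<sigma> \<alpha> w r \<sigma>' \<alpha>' w' r' where s: "s = (\<sigma>, \<alpha>, w, r)" "s' = (\<sigma>', \<alpha>', w', r')" by (metis prod_cases4)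
  have C: "is_constellation p {0..<N} \<sigma> \<alpha> w" "is_constellation p {0..<N} \<sigma>' \<alpha>' w'"
    using assms s by (auto simp: rooted_constellations_def)
  show ?thesis unfolding s rmap_iso_def rconj_def prod.case using iso_conj[OF _ C] by auto
qed

lemma pmap_iso_conj:
  assumes "s \<in> pointed_constellations p N" "s' \<in> pointed_constellations p N"
  shows "pmap_iso N s s' \<longleftrightarrow> (\<exists>\<pi>. \<pi> permutes {0..<N} \<and> s' = pconj \<pi> s)"
proof -
  obtain \<sigma> \<alpha> w r P \<sigma>' \<alpha>' w' r' P' where s: "s = ((\<sigma>, \<alpha>, w, r), P)" "s' = ((\<sigma>', \<alpha>', w', r'), P')" by (metis prod_cases4 prod.exhaust)
  have C: "is_constellation p {0..<N} \<sigma> \<alpha> w" "is_constellation p {0..<N} \<sigma>' \<alpha>' w'"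
    using assms s by (auto simp: pointed_constellations_def)
  show ?thesis unfolding s pmap_iso_def pconj_def rconj_def prod.case using iso_conj[OF _ C] by auto
qed

lemma equiv_action:
  assumes iso: "\<And>s s'. s \<in> S \<Longrightarrow> s' \<in> S \<Longrightarrow> isom s s' \<longleftrightarrow> (\<exists>\<pi>. \<pi> permutes {0..<N::nat} \<and> s' = A \<pi> s)"
    and A: "\<And>s. A id s = s" "\<And>\<pi> \<rho> s. bij \<pi> \<Longrightarrow> bij \<rho> \<Longrightarrow> A \<pi> (A \<rho> s) = A (\<pi> \<circ> \<rho>) s"
  shows "equiv S ({(s, s'). isom s s'} \<inter> S \<times> S)"
proof (rule equivI)
  show "refl_on S ({(s, s'). isom s s'} \<inter> S \<times> S)"
  proof (rule refl_onI)
    fix s assume "s \<in> S"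
    moreover have "\<exists>\<pi>. \<pi> permutes {0..<N} \<and> s = A \<pi> s" using A(1)[of s] permutes_id by metis
    ultimately show "(s, s) \<in> {(s, s'). isom s s'} \<inter> S \<times> S" using iso by auto
  qed
  show "sym ({(s, s'). isom s s'} \<inter> S \<times> S)"
  proof (rule symI)
    fix s s' assume "(s, s') \<in> {(s, s'). isom s s'} \<inter> S \<times> S"
    then have s: "s \<in> S" "s' \<in> S" "isom s s'" by auto
    then obtain \<pi> where \<pi>: "\<pi> permutes {0..<N}" "s' = A \<pi> s" using iso by auto
    have "bij \<pi>" by (rule permutes_bij[OF \<pi>(1)])
    then have "A (inv \<pi>) s' = s" using A(2)[of "inv \<pi>" \<pi> s] \<pi> by (simp add: bij_imp_bij_inv inv_comp_id A(1))
    then have "isom s' s" using iso[OF s(2,1)] permutes_inv[OF \<pi>(1)] by metis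
    then show "(s', s) \<in> {(s, s'). isom s s'} \<inter> S \<times> S" using s by auto
  qed
  show "trans ({(s, s'). isom s s'} \<inter> S \<times> S)"
  proof (rule transI)
    fix s s' s'' assume "(s, s') \<in> {(s, s'). isom s s'} \<inter> S \<times> S" "(s', s'') \<in> {(s, s'). isom s s'} \<inter> S \<times> S"
    then have s: "s \<in> S" "s' \<in> S" "s'' \<in> S" "isom s s'" "isom s' s''" by auto
    obtain \<pi> where \<pi>: "\<pi> permutes {0..<N}" "s' = A \<pi> s" using iso s by auto
    obtain \<rho> where \<rho>: "\<rho> permutes {0..<N}" "s'' = A \<rho> s'" using iso s by auto
    have "s'' = A (\<rho> \<circ> \<pi>) s" using A(2)[OF permutes_bij[OF \<rho>(1)] permutes_bij[OF \<pi>(1)]] \<pi> \<rho> by simp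
    moreover have "\<rho> \<circ> \<pi> permutes {0..<N}" by (rule permutes_compose[OF \<pi>(1) \<rho>(1)])
    ultimately have "isom s s''" using iso[OF s(1,3)] by auto
    then show "(s, s'') \<in> {(s, s'). isom s s'} \<inter> S \<times> S" using s by auto
  qed
qed auto

text \<open>Rooted maps have no automorphisms, so each isomorphism class is represented by exactly
  \<open>K!\<close> labelled maps with \<open>K\<close> edges.\<close>

lemma class_sum:
  fixes wt :: "'s \<Rightarrow> 'c::comm_ring_1"
  assumes eq: "equiv S R" and X: "finite X" "\<And>x. x \<in> X \<Longrightarrow> \<Psi> x \<in> S" "\<And>s. s \<in> S \<Longrightarrow> \<exists>x\<in>X. (s, \<Psi> x) \<in> R"
    and iso: "\<And>x y. x \<in> X \<Longrightarrow> y \<in> X \<Longrightarrow> (\<Psi> x, \<Psi> y) \<in> R \<longleftrightarrow> (\<exists>g. g permutes {0..<K::nat} \<and> y = a g x)"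
    and act: "\<And>x g. x \<in> X \<Longrightarrow> g permutes {0..<K} \<Longrightarrow> a g x \<in> X"
    and inj: "\<And>x. x \<in> X \<Longrightarrow> inj_on (\<lambda>g. a g x) {g. g permutes {0..<K}}"
    and wt: "\<And>s s'. (s, s') \<in> R \<Longrightarrow> wt s = wt s'"
  shows "(\<Sum>x\<in>X. wt (\<Psi> x)) = of_nat (fact K) * (\<Sum>c\<in>S // R. the_elem (wt ` c))"
proof -
  let ?Q = "(\<lambda>x. R `` {\<Psi> x}) ` X"
  have Q: "S // R = ?Q"
  proof
    show "?Q \<subseteq> S // R" using X(2) by (auto intro: quotientI)
    show "S // R \<subseteq> ?Q"
    proof
      fix c assume "c \<in> S // R"
      then obtain s where s: "c = R `` {s}" "s \<in> S" by (rule quotientE)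
      then obtain x where "x \<in> X" "(s, \<Psi> x) \<in> R" using X(3) by blast
      then show "c \<in> ?Q" using s equiv_class_eq[OF eq, of s "\<Psi> x"] by auto
    qed
  qed
  have "(\<Sum>x\<in>X. wt (\<Psi> x)) = (\<Sum>c\<in>?Q. \<Sum>x\<in>{x \<in> X. R `` {\<Psi> x} = c}. wt (\<Psi> x))"
    by (rule sum.group[symmetric]) (use X(1) in auto)
  also have "\<dots> = (\<Sum>c\<in>?Q. of_nat (fact K) * the_elem (wt ` c))"
  proof (rule sum.cong[OF refl])
    fix c assume "c \<in> ?Q"
    then obtain x where x: "x \<in> X" "c = R `` {\<Psi> x}" by auto
    have cl: "R `` {\<Psi> y} = c \<longleftrightarrow> (\<Psi> x, \<Psi> y) \<in> R" if "y \<in> X" for y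
      using eq_equiv_class_iff[OF eq X(2)[OF x(1)] X(2)[OF that]] x(2) by auto
    have e: "{y \<in> X. R `` {\<Psi> y} = c} = (\<lambda>g. a g x) ` {g. g permutes {0..<K}}"
      using cl iso[OF x(1)] act[OF x(1)] by auto
    have cd: "card {y \<in> X. R `` {\<Psi> y} = c} = fact K"
      unfolding e card_image[OF inj[OF x(1)]] using card_permutations[of "{0..<K}" K] by simp
    have "\<Psi> x \<in> c" using x X(2) equiv_class_self[OF eq] by auto
    moreover have "wt s = wt (\<Psi> x)" if "s \<in> c" for s using wt[of "\<Psi> x" s] that x by auto
    ultimately have "wt ` c = {wt (\<Psi> x)}" by blast
    then have te: "the_elem (wt ` c) = wt (\<Psi> x)" by simp
    have "(\<Sum>y\<in>{y \<in> X. R `` {\<Psi> y} = c}. wt (\<Psi> y)) = (\<Sum>y\<in>{y \<in> X. R `` {\<Psi> y} = c}. wt (\<Psi> x))"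
      using wt cl by (intro sum.cong refl) fastforce
    also have "\<dots> = of_nat (fact K) * wt (\<Psi> x)" by (simp only: sum_constant cd)
    finally show "(\<Sum>y\<in>{y \<in> X. R `` {\<Psi> y} = c}. wt (\<Psi> y)) = of_nat (fact K) * the_elem (wt ` c)" by (simp only: te)
  qed
  finally show ?thesis unfolding Q by (simp only: sum_distrib_left)
qed

lemma white_faces_conj:
  assumes \<pi>: "\<pi> permutes {0..<N}"
  shows "white_faces N (conjp \<pi> \<sigma>) (conjp \<pi> \<alpha>) (w \<circ> inv \<pi>) = (`) \<pi> ` white_faces N \<sigma> \<alpha> w"
proof -
  have b: "bij \<pi>" using \<pi> by (rule permutes_bij)
  have gi: "inv \<pi> (\<pi> x) = x" for x using b by (simp add: bij_is_inj)
  have lt: "\<pi> d < N \<longleftrightarrow> d < N" for d using permutes_in_image[OF \<pi>, of d] by simp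
  have "U \<in> white_faces N (conjp \<pi> \<sigma>) (conjp \<pi> \<alpha>) (w \<circ> inv \<pi>) \<longleftrightarrow> U \<in> (`) \<pi> ` white_faces N \<sigma> \<alpha> w" for U
  proof
    assume "U \<in> white_faces N (conjp \<pi> \<sigma>) (conjp \<pi> \<alpha>) (w \<circ> inv \<pi>)"
    then obtain e where e: "U = orb (conjp \<pi> \<sigma> \<circ> conjp \<pi> \<alpha>) e" "e < N" "w (inv \<pi> e)" by (auto simp: white_faces_def)
    obtain d where d: "e = \<pi> d" using b by (metis bij_pointE)
    have "U = \<pi> ` orb (\<sigma> \<circ> \<alpha>) d" unfolding e(1) d conj_o[OF b] orb_conj[OF b] ..
    moreover have "orb (\<sigma> \<circ> \<alpha>) d \<in> white_faces N \<sigma> \<alpha> w" using e d gi lt by (auto simp: white_faces_def)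
    ultimately show "U \<in> (`) \<pi> ` white_faces N \<sigma> \<alpha> w" by blast
  next
    assume "U \<in> (`) \<pi> ` white_faces N \<sigma> \<alpha> w"
    then obtain d where d: "U = \<pi> ` orb (\<sigma> \<circ> \<alpha>) d" "d < N" "w d" by (auto simp: white_faces_def)
    have "U = orb (conjp \<pi> \<sigma> \<circ> conjp \<pi> \<alpha>) (\<pi> d)" unfolding conj_o[OF b] orb_conj[OF b] by (rule d(1))
    then show "U \<in> white_faces N (conjp \<pi> \<sigma>) (conjp \<pi> \<alpha>) (w \<circ> inv \<pi>)" using d lt gi unfolding white_faces_def by (auto intro!: exI[of _ "\<pi> d"])
  qed
  then show ?thesis by blast
qed

lemma weights_conj:
  assumes \<pi>: "\<pi> permutes {0..<N}"
  shows "V_weight p N (pconj \<pi> s) = V_weight p N s" "F_weight p N (rconj \<pi> s') = F_weight p N s'"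
proof -
  have b: "bij \<pi>" using \<pi> by (rule permutes_bij)
  have inj: "inj_on ((`) \<pi>) Z" for Z by (rule inj_onI) (simp add: inj_image_eq_iff[OF bij_is_inj[OF b]])
  have ci: "card (\<pi> ` U) = card U" for U by (rule card_image) (rule inj_on_subset[OF bij_is_inj[OF b]], simp)
  have *: "(\<Prod>f\<in>(`) \<pi> ` Z. xmon (card f div p)) = (\<Prod>f\<in>Z. xmon (card f div p))" for Z
    by (simp add: prod.reindex[OF inj] ci)
  show "V_weight p N (pconj \<pi> s) = V_weight p N s"
    by (cases s) (auto simp: V_weight_def pconj_def rconj_def white_faces_conj[OF \<pi>] *)
  obtain \<sigma> \<alpha> w r where s: "s' = (\<sigma>, \<alpha>, w, r)" by (metis prod_cases4)
  have "(`) \<pi> ` white_faces N \<sigma> \<alpha> w - {\<pi> ` orb (\<sigma> \<circ> \<alpha>) r} = (`) \<pi> ` (white_faces N \<sigma> \<alpha> w - {orb (\<sigma> \<circ> \<alpha>) r})"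
    using inj_image_eq_iff[OF bij_is_inj[OF b]] by auto
  then show "F_weight p N (rconj \<pi> s') = F_weight p N s'"
    unfolding s F_weight_def rconj_def prod.case white_faces_conj[OF \<pi>] conj_o[OF b] orb_conj[OF b] by (simp only: *)
qed

lemma oriented_edges_conj:
  assumes \<pi>: "\<pi> permutes {0..<N}" and "(v, u) \<in> oriented_edges N \<sigma> \<alpha> w ^^ k"
  shows "(\<pi> ` v, \<pi> ` u) \<in> oriented_edges N (conjp \<pi> \<sigma>) (conjp \<pi> \<alpha>) (w \<circ> inv \<pi>) ^^ k"
  using assms(2)
proof (induction k arbitrary: u)
  case (Suc k)
  have b: "bij \<pi>" using \<pi> by (rule permutes_bij)
  obtain x where x: "(v, x) \<in> oriented_edges N \<sigma> \<alpha> w ^^ k" "(x, u) \<in> oriented_edges N \<sigma> \<alpha> w" using Suc.prems by auto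
  obtain d where d: "x = orb \<sigma> d" "u = orb \<sigma> (\<alpha> d)" "d < N" "w d" using x(2) by (auto simp: oriented_edges_def)
  have "\<pi> d < N" using permutes_in_image[OF \<pi>, of d] d by simp
  moreover have "(w \<circ> inv \<pi>) (\<pi> d)" using d b by (simp add: bij_is_inj)
  moreover have "\<pi> ` x = orb (conjp \<pi> \<sigma>) (\<pi> d)" "\<pi> ` u = orb (conjp \<pi> \<sigma>) (conjp \<pi> \<alpha> (\<pi> d))"
    unfolding d conj_app[OF b] orb_conj[OF b] by auto
  ultimately have "(\<pi> ` x, \<pi> ` u) \<in> oriented_edges N (conjp \<pi> \<sigma>) (conjp \<pi> \<alpha>) (w \<circ> inv \<pi>)"
    unfolding oriented_edges_def by blast
  then show ?case by (rule relpow_Suc_I[OF Suc.IH[OF x(1)]])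
qed simp

lemma vtype_conj:
  assumes \<pi>: "\<pi> permutes {0..<N}"
  shows "vtype N (conjp \<pi> \<sigma>) (conjp \<pi> \<alpha>) (w \<circ> inv \<pi>) (\<pi> ` P) (\<pi> ` v) = vtype N \<sigma> \<alpha> w P v"
proof -
  have b: "bij \<pi>" using \<pi> by (rule permutes_bij)
  have bi: "bij (inv \<pi>)" using b by (rule bij_imp_bij_inv)
  have c: "conjp (inv \<pi>) (conjp \<pi> f) = f" for f using conj_conj[OF bi b] by (simp add: inv_comp_id[OF b] conj_id)
  have i: "inv \<pi> ` \<pi> ` U = U" for U using b by (simp add: image_comp inv_comp_id)
  have w: "(w \<circ> inv \<pi>) \<circ> inv (inv \<pi>) = w" using b by (simp add: inv_inv_eq o_assoc[symmetric] inv_comp_id)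
  have "(\<pi> ` v, \<pi> ` P) \<in> oriented_edges N (conjp \<pi> \<sigma>) (conjp \<pi> \<alpha>) (w \<circ> inv \<pi>) ^^ k \<longleftrightarrow> (v, P) \<in> oriented_edges N \<sigma> \<alpha> w ^^ k" for k
    using oriented_edges_conj[OF \<pi>, where v=v and u=P and \<sigma>=\<sigma> and \<alpha>=\<alpha> and w=w and k=k]
      oriented_edges_conj[OF permutes_inv[OF \<pi>], where v="\<pi> ` v" and u="\<pi> ` P" and \<sigma>="conjp \<pi> \<sigma>" and \<alpha>="conjp \<pi> \<alpha>" and w="w \<circ> inv \<pi>" and k=k]
    unfolding c i w by blast
  then show ?thesis by (simp add: vtype_def)
qed

lemma pointed_conj:
  assumes "s \<in> pointed_constellations p N" "\<pi> permutes {0..<N}"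
  shows "pconj \<pi> s \<in> pointed_constellations p N"
proof -
  obtain \<sigma> \<alpha> w r P where s: "s = ((\<sigma>, \<alpha>, w, r), P)" by (metis prod_cases4 prod.exhaust)
  have b: "bij \<pi>" using assms(2) by (rule permutes_bij)
  have D: "\<pi> ` {0..<N} = {0..<N}" by (rule permutes_image[OF assms(2)])
  have C: "is_constellation p {0..<N} \<sigma> \<alpha> w" "r < N" "w r" "P \<in> orb \<sigma> ` {0..<N}" using assms(1) s by (auto simp: pointed_constellations_def)
  have "is_constellation p {0..<N} (conjp \<pi> \<sigma>) (conjp \<pi> \<alpha>) (w \<circ> inv \<pi>)"
    using is_constellation_conj[OF C(1) b] D by simp
  moreover have "\<pi> r < N" using permutes_in_image[OF assms(2), of r] C by simp
  moreover have "(w \<circ> inv \<pi>) (\<pi> r)" using C b by (simp add: bij_is_inj)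
  moreover have "\<pi> ` P \<in> orb (conjp \<pi> \<sigma>) ` {0..<N}"
  proof -
    obtain d where "d < N" "P = orb \<sigma> d" using C by auto
    then show ?thesis using orb_conj[OF b, of \<sigma> d] permutes_in_image[OF assms(2), of d]
      by (intro image_eqI[of _ _ "\<pi> d"]) auto
  qed
  ultimately show ?thesis by (simp add: s pconj_def rconj_def pointed_constellations_def)
qed

lemma V_structs_conj:
  assumes "s \<in> V_structs p i N" "\<pi> permutes {0..<N}"
  shows "pconj \<pi> s \<in> V_structs p i N"
proof -
  obtain \<sigma> \<alpha> w r P where s: "s = ((\<sigma>, \<alpha>, w, r), P)" by (metis prod_cases4 prod.exhaust)
  have b: "bij \<pi>" using assms(2) by (rule permutes_bij)
  have "s \<in> pointed_constellations p N" using assms(1) by (auto simp: V_structs_def)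
  then have "pconj \<pi> s \<in> pointed_constellations p N" using assms(2) by (rule pointed_conj)
  then show ?thesis using assms(1) vtype_conj[OF assms(2), of \<sigma> \<alpha> w P]
    by (simp add: V_structs_def s pconj_def rconj_def orb_conj[OF b] conj_app[OF b])
qed

text \<open>The white darts are numbered first, and each black dart gets the number of its partner
  plus \<open>K\<close>. The rotation then changes the colour of a dart, so it splits into two
  permutations of the edges.\<close>

lemma normalize:
  assumes C: "is_constellation p {0..<N} \<sigma> \<alpha> w"
  shows "\<exists>\<pi> K fw fb. N = 2 * K \<and> \<pi> permutes {0..<N} \<and> fw permutes {0..<K} \<and> fb permutes {0..<K} \<and>
     conjp \<pi> \<sigma> = dsig K fw fb \<and> conjp \<pi> \<alpha> = dalp K \<and> w \<circ> inv \<pi> = dwh K"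
proof -
  have \<alpha>: "\<alpha> permutes {0..<N}" "\<And>d. d < N \<Longrightarrow> \<alpha> (\<alpha> d) = d" and W: "\<And>d. w d \<Longrightarrow> d < N"
    and wa: "\<And>d. d < N \<Longrightarrow> w (\<alpha> d) \<longleftrightarrow> \<not> w d"
    using C by (auto simp: is_constellation_def is_planar_map_def)
  have aN: "\<alpha> d < N \<longleftrightarrow> d < N" for d using permutes_in_image[OF \<alpha>(1), of d] by simp
  let ?W = "{d. w d}" and ?B = "{d. d < N \<and> \<not> w d}"
  have finW: "finite ?W" by (rule finite_subset[of _ "{0..<N}"]) (use W in auto)
  define K where "K = card ?W"
  have "bij_betw \<alpha> ?W ?B"
    by (rule bij_betw_byWitness[where f'=\<alpha>]) (use \<alpha>(2) W wa aN in auto)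
  then have "card ?B = K" by (simp add: K_def bij_betw_same_card)
  moreover have "{0..<N} = ?W \<union> ?B" using W by auto
  then have "N = card ?W + card ?B" using card_Un_disjoint[of ?W ?B] finW by (metis (no_types, lifting) card_atLeastLessThan diff_zero disjoint_iff finite_Un finite_atLeastLessThan mem_Collect_eq)
  ultimately have N: "N = 2 * K" by (simp add: K_def)
  obtain \<beta> where \<beta>: "bij_betw \<beta> ?W {0..<K}" using ex_bij_betw_finite_nat[OF finW] K_def by blast
  have \<beta>K: "w d \<Longrightarrow> \<beta> d < K" for d using \<beta> by (auto simp: bij_betw_def)
  have \<beta>i: "w d \<Longrightarrow> w e \<Longrightarrow> \<beta> d = \<beta> e \<Longrightarrow> d = e" for d e using \<beta> by (auto simp: bij_betw_def inj_on_def)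
  define \<pi> where "\<pi> = (\<lambda>d. if w d then \<beta> d else if d < N then \<beta> (\<alpha> d) + K else d)"
  have \<pi>1: "w d \<Longrightarrow> \<pi> d = \<beta> d" and \<pi>2: "\<not> w d \<Longrightarrow> d < N \<Longrightarrow> \<pi> d = \<beta> (\<alpha> d) + K" for d by (auto simp: \<pi>_def)
  have \<pi>N: "\<pi> d < N" if "d < N" for d
  proof (cases "w d")
    case True then show ?thesis using \<pi>1 \<beta>K[OF True] N by simp
  next
    case False
    then have "\<beta> (\<alpha> d) < K" using \<beta>K[of "\<alpha> d"] wa that by blast
    then show ?thesis using \<pi>2[OF False that] N by simp
  qed
  have lt: "\<pi> d < K \<longleftrightarrow> w d" if "d < N" for d
    using \<pi>1[of d] \<pi>2[of d] \<beta>K[of d] that by (cases "w d") auto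
  have inj: "inj_on \<pi> {0..<N}"
  proof (rule inj_onI)
    fix d e assume de: "d \<in> {0..<N}" "e \<in> {0..<N}" "\<pi> d = \<pi> e"
    then have ww: "w d = w e" using lt by (metis atLeastLessThan_iff)
    show "d = e"
    proof (cases "w d")
      case True then show ?thesis using \<beta>i ww de \<pi>1 by auto
    next
      case False
      then have "\<beta> (\<alpha> d) = \<beta> (\<alpha> e)" using de ww \<pi>2 by auto
      moreover have "w (\<alpha> d)" "w (\<alpha> e)" using wa[of d] wa[of e] de False ww by auto
      ultimately have "\<alpha> d = \<alpha> e" using \<beta>i by blast
      then show ?thesis using \<alpha>(2)[of d] \<alpha>(2)[of e] de by (metis atLeastLessThan_iff)
    qed
  qed
  have "\<pi> ` {0..<N} = {0..<N}" by (rule endo_inj_surj[OF _ _ inj]) (use \<pi>N in auto)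
  then have \<pi>: "\<pi> permutes {0..<N}"
    by (intro bij_imp_permutes) (use inj W in \<open>auto simp: bij_betw_def \<pi>_def\<close>)
  have b: "bij \<pi>" by (rule permutes_bij[OF \<pi>])
  have D: "\<pi> ` {0..<N} = {0..<N}" by (rule permutes_image[OF \<pi>])
  have pre: "\<exists>d. e = \<pi> d \<and> (e < N \<longleftrightarrow> d < N)" for e
  proof -
    obtain d where "e = \<pi> d" using b by (metis bij_pointE)
    then show ?thesis using permutes_in_image[OF \<pi>, of d] by auto
  qed
  have w': "w \<circ> inv \<pi> = dwh K"
  proof
    fix e
    obtain d where d: "e = \<pi> d" "e < N \<longleftrightarrow> d < N" using pre by blast
    have "inv \<pi> e = d" using d b by (simp add: bij_is_inj)
    then show "(w \<circ> inv \<pi>) e = dwh K e" using lt[of d] d W[of d] N by (cases "d < N") (auto simp: dwh_def)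
  qed
  have \<alpha>': "conjp \<pi> \<alpha> = dalp K"
  proof
    fix e
    obtain d where d: "e = \<pi> d" "e < N \<longleftrightarrow> d < N" using pre by blast
    have c: "conjp \<pi> \<alpha> e = \<pi> (\<alpha> d)" using d conj_app[OF b] by simp
    show "conjp \<pi> \<alpha> e = dalp K e"
    proof (cases "d < N")
      case False
      then have "\<alpha> d = d" "\<pi> d = d" using permutes_not_in[OF \<alpha>(1), of d] permutes_not_in[OF \<pi>, of d] by auto
      then show ?thesis using c d False N by (simp add: dalp_def)
    next
      case True
      show ?thesis
      proof (cases "w d")
        case w: True
        then have "\<pi> (\<alpha> d) = \<beta> d + K" using \<pi>2[of "\<alpha> d"] wa True aN \<alpha>(2) by auto
        then show ?thesis using c d \<pi>1[OF w] \<beta>K[OF w] by (simp add: dalp_def)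
      next
        case w: False
        then have w2: "w (\<alpha> d)" using wa True by auto
        then show ?thesis using c d \<pi>1[OF w2] \<pi>2[OF w True] \<beta>K[OF w2] by (simp add: dalp_def)
      qed
    qed
  qed
  define \<sigma>' where "\<sigma>' = conjp \<pi> \<sigma>"
  have C': "is_constellation p {0..<N} \<sigma>' (dalp K) (dwh K)"
    using is_constellation_conj[OF C b] unfolding D \<alpha>' w' \<sigma>'_def .
  have s': "\<sigma>' permutes {0..<N}" and col: "\<And>d. d < N \<Longrightarrow> dwh K (\<sigma>' (dalp K d)) = dwh K d"
    using C' by (auto simp: is_constellation_def is_planar_map_def)
  have sN: "\<sigma>' d < N \<longleftrightarrow> d < N" for d using permutes_in_image[OF s', of d] by simp
  have si: "\<sigma>' d = \<sigma>' e \<Longrightarrow> d = e" for d e using permutes_inj[OF s'] by (auto dest: injD)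
  have s1: "K \<le> \<sigma>' x \<and> \<sigma>' x < 2 * K" if "x < K" for x
    using col[of "x + K"] sN[of x] that N by (auto simp: dwh_def dalp_def)
  have s2: "\<sigma>' (x + K) < K" if "x < K" for x
    using col[of x] that N by (auto simp: dwh_def dalp_def)
  define fw where "fw = (\<lambda>x. if x < K then \<sigma>' (x + K) else x)"
  \<comment> \<open>This will be the inverse of the black successor, in accordance with
    \<open>inv fb\<close> in \<open>dsig\<close>.\<close>
  define f where "f = (\<lambda>x. if x < K then \<sigma>' x - K else x)"
  have perm: "g permutes {0..<K}" if "inj_on g {0..<K}" "\<And>x. x < K \<Longrightarrow> g x < K" "\<And>x. \<not> x < K \<Longrightarrow> g x = x" for g :: "nat \<Rightarrow> nat"
  proof (rule bij_imp_permutes)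
    have "g ` {0..<K} = {0..<K}" by (rule endo_inj_surj[OF _ _ that(1)]) (use that in auto)
    then show "bij_betw g {0..<K} {0..<K}" using that(1) by (simp add: bij_betw_def)
  qed (use that in auto)
  have pw: "fw permutes {0..<K}"
  proof (rule perm)
    show "inj_on fw {0..<K}"
    proof (rule inj_onI)
      fix x y assume "x \<in> {0..<K}" "y \<in> {0..<K}" "fw x = fw y"
      then show "x = y" using si[of "x + K" "y + K"] by (simp add: fw_def)
    qed
  qed (use s2 in \<open>auto simp: fw_def\<close>)
  have pf: "f permutes {0..<K}"
  proof (rule perm)
    show "inj_on f {0..<K}"
    proof (rule inj_onI)
      fix x y assume xy: "x \<in> {0..<K}" "y \<in> {0..<K}" "f x = f y"
      then have "\<sigma>' x = \<sigma>' y" using s1[of x] s1[of y] by (simp add: f_def) linarith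
      then show "x = y" by (rule si)
    qed
    show "f x < K" if "x < K" for x using s1[OF that] that by (auto simp: f_def)
  qed (auto simp: f_def)
  have "dsig K fw (inv f) = \<sigma>'"
  proof
    fix d
    have i: "inv (inv f) = f" using permutes_bij[OF pf] by (rule inv_inv_eq)
    consider "d < K" | "K \<le> d" "d < 2 * K" | "2 * K \<le> d" by linarith
    then show "dsig K fw (inv f) d = \<sigma>' d"
    proof cases
      case 1
      have "f d = \<sigma>' d - K" using 1 by (simp add: f_def)
      then show ?thesis using 1 s1[OF 1] by (simp add: dsig_def i)
    next
      case 2
      then have "d - K < K" "d - K + K = d" by auto
      then show ?thesis using 2 by (simp add: dsig_def fw_def)
    next
      case 3
      then show ?thesis using permutes_not_in[OF s', of d] N by (simp add: dsig_def)
    qed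
  qed
  then show ?thesis using N \<pi> pw permutes_inv[OF pf] \<alpha>' w' \<sigma>'_def
    by (intro exI[of _ \<pi>] exI[of _ K] exI[of _ fw] exI[of _ "inv f"]) simp
qed

text \<open>Of the labels only the zero set survives, as the pointed vertex. By
  \<open>lconst_unique\<close> the others can be recovered from it.\<close>

definition psi :: "nat \<Rightarrow> lmap \<Rightarrow> pmap" where
  "psi K = (\<lambda>(fw, fb, t, r). ((dsig K fw fb, dalp K, dwh K, r), dpt K fw t))"

lemma psi_in: assumes "x \<in> lmaps p {0..<K}" shows "psi K x \<in> pointed_constellations p (2 * K)"
proof -
  obtain fw fb t r where x: "x = (fw, fb, t, r)" by (cases x)
  have L: "lconst {0..<K} fw fb t p" "r < K" using assms by (auto simp: lmaps_def x)
  interpret ldarts K fw fb t p using L(1) by (simp add: ldarts_def)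
  show ?thesis using is_const dpt_in L(2) by (auto simp: psi_def x pointed_constellations_def dwh_def)
qed

lemma psi_vtype:
  assumes "lconst {0..<K} fw fb t p" "r < K"
  shows "vtype (2 * K) (dsig K fw fb) (dalp K) (dwh K) (dpt K fw t) (orb (dsig K fw fb) r) = t r"
    "vtype (2 * K) (dsig K fw fb) (dalp K) (dwh K) (dpt K fw t) (orb (dsig K fw fb) (dalp K r)) = t (fw r)"
proof -
  interpret ldarts K fw fb t p using assms(1) by (simp add: ldarts_def)
  show "vtype (2 * K) \<sigma> \<alpha> (dwh K) P (orb \<sigma> r) = t r" using vtype_eq[of r] assms(2) dlab_simps by simp
  show "vtype (2 * K) \<sigma> \<alpha> (dwh K) P (orb \<sigma> (\<alpha> r)) = t (fw r)" using vtype_eq[of "\<alpha> r"] assms(2) dlab_simps(2)[of r] by (simp add: N.\<alpha>_simps)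
qed

lemma psi_V: assumes "x \<in> lmaps p {0..<K}" shows "psi K x \<in> V_structs p i (2 * K) \<longleftrightarrow> x \<in> vmaps p {0..<K} i"
proof -
  obtain fw fb t r where x: "x = (fw, fb, t, r)" by (cases x)
  have L: "lconst {0..<K} fw fb t p" "r < K" using assms by (auto simp: lmaps_def x)
  have "(\<exists>j. 1 \<le> j \<and> j \<le> i \<and> t r = j \<and> t (fw r) = j - 1) \<longleftrightarrow> dn fw t r \<and> t r \<le> i" by (auto simp: dn_def)
  then show ?thesis using psi_in[OF assms] L psi_vtype[OF L]
    by (simp add: V_structs_def psi_def x vmaps_def)
qed

text \<open>Along a path on which \<open>t'\<close> falls to \<open>0\<close> in unit steps,
  \<open>t\<close> loses at most one per step and reaches \<open>0\<close> at the same place, so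
  \<open>t\<close> is no larger than \<open>t'\<close>; the situation is symmetric.\<close>

lemma lconst_unique:
  assumes L: "lconst E fw fb t p" "lconst E fw fb t' p" and z: "\<And>x. x \<in> E \<Longrightarrow> t (fw x) = 0 \<longleftrightarrow> t' (fw x) = 0"
  shows "t = t'"
proof -
  have le: "t (fw x) \<le> t' (fw x)" if "lconst E fw fb t p" "lconst E fw fb t' p" "\<And>x. x \<in> E \<Longrightarrow> t (fw x) = 0 \<longleftrightarrow> t' (fw x) = 0" "x \<in> E" for t t' x
    using that(4)
  proof (induction "t' (fw x)" arbitrary: x)
    case 0 then show ?case using that(3)[of x] by simp
  next
    case (Suc l)
    interpret A: lconst E fw fb t p by fact
    interpret B: lconst E fw fb t' p by fact
    obtain y where y: "y \<in> reach {sig fw fb} x" "dn fw t' (fb y)" using B.down[OF Suc(3)] Suc(2) by auto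
    have yE: "y \<in> E" using reach_sub[OF A.bijs_s Suc(3)] y by auto
    have "t' (fb y) = Suc l" using B.lab[OF yE] B.head_reach[OF Suc(3) y(1)] Suc by simp
    then have l: "t' (fw (fb y)) = l" using y by (simp add: dn_def)
    then have "t (fw (fb y)) \<le> l" using Suc(1)[of "fb y"] yE by simp
    moreover have "t (fw x) = t (fb y)" using A.lab[OF yE] A.head_reach[OF Suc(3) y(1)] by simp
    moreover have "t (fb y) \<le> t (fw (fb y)) + 1" using A.step[of "fb y"] yE A.p2 by auto
    ultimately show ?case using Suc(2) by simp
  qed
  interpret A: lconst E fw fb t p by fact
  interpret B: lconst E fw fb t' p by fact
  show ?thesis
  proof
    fix x
    show "t x = t' x"
    proof (cases "x \<in> E")
      case True
      then have "t (fw (inv fw x)) = t' (fw (inv fw x))"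
        using le[OF L z, of "inv fw x"] le[OF L(2,1), of "inv fw x"] z by (simp add: le_antisym)
      then show ?thesis by simp
    next
      case False then show ?thesis using A.out B.out by simp
    qed
  qed
qed

text \<open>The constellation is brought into the normal form of \<open>normalize\<close>, and
  \<open>econst_label\<close> supplies the labels that vanish at its pointed vertex.\<close>

lemma psi_surj:
  assumes s: "s \<in> pointed_constellations p N" and p: "2 \<le> p"
  obtains \<pi> x K where "N = 2 * K" "\<pi> permutes {0..<N}" "x \<in> lmaps p {0..<K}" "psi K x = pconj \<pi> s"
proof -
  obtain \<sigma> \<alpha> w r P where se: "s = ((\<sigma>, \<alpha>, w, r), P)" by (metis prod_cases4 prod.exhaust)
  have C: "is_constellation p {0..<N} \<sigma> \<alpha> w" using s by (simp add: se pointed_constellations_def)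
  obtain \<pi> K fw fb where n: "N = 2 * K" "\<pi> permutes {0..<N}" "fw permutes {0..<K}" "fb permutes {0..<K}"
     "conjp \<pi> \<sigma> = dsig K fw fb" "conjp \<pi> \<alpha> = dalp K" "w \<circ> inv \<pi> = dwh K"
    using normalize[OF C] by blast
  have pc: "pconj \<pi> s = ((dsig K fw fb, dalp K, dwh K, \<pi> r), \<pi> ` P)" using n by (simp add: pconj_def rconj_def se)
  then have "((dsig K fw fb, dalp K, dwh K, \<pi> r), \<pi> ` P) \<in> pointed_constellations p N" using pointed_conj[OF s n(2)] by simp
  then have c: "is_constellation p {0..<2 * K} (dsig K fw fb) (dalp K) (dwh K)" "\<pi> r < K" "\<pi> ` P \<in> orb (dsig K fw fb) ` {0..<2 * K}"
    using n(1) by (auto simp: pointed_constellations_def dwh_def)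
  interpret d: darts K fw fb by unfold_locales (use n in auto)
  have ec: "econst p {0..<K} fw fb" using c(1) d.dart_iff by simp
  obtain z where z: "z < K" "\<pi> ` P = d.vert z" using c(3) unfolding d.orbs_\<sigma> by auto
  obtain t where t: "lconst {0..<K} fw fb t p" "\<And>x. x < K \<Longrightarrow> t (fw x) = 0 \<longleftrightarrow> x \<in> reach {sig fw fb} z"
    using econst_label[OF ec p, of z] z by auto
  interpret l: ldarts K fw fb t p using t(1) by (simp add: ldarts_def)
  have "orb (dsig K fw fb) (z + K) = dpt K fw t"
    by (rule l.dpt_orb) (use z t(2)[OF z(1)] l.dlab_simps(2)[of z] in auto)
  then have "dpt K fw t = \<pi> ` P" using d.orb_black[OF z(1)] z(2) by simp
  then have "psi K (fw, fb, t, \<pi> r) = pconj \<pi> s" by (simp add: psi_def pc)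
  moreover have "(fw, fb, t, \<pi> r) \<in> lmaps p {0..<K}" using t(1) c(2) by (simp add: lmaps_def)
  ultimately show thesis using that n(1,2) by blast
qed

lemma psi_iso:
  assumes x: "x \<in> lmaps p {0..<K}" and y: "y \<in> lmaps p {0..<K}"
  shows "(\<exists>\<pi>. \<pi> permutes {0..<2 * K} \<and> psi K y = pconj \<pi> (psi K x)) \<longleftrightarrow> (\<exists>g. g permutes {0..<K} \<and> y = act g x)"
proof -
  obtain fw fb t r where xe: "x = (fw, fb, t, r)" by (cases x)
  obtain fw' fb' t' r' where ye: "y = (fw', fb', t', r')" by (cases y)
  have Lx: "lconst {0..<K} fw fb t p" "r < K" using x by (auto simp: lmaps_def xe)
  have Ly: "lconst {0..<K} fw' fb' t' p" "r' < K" using y by (auto simp: lmaps_def ye)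
  interpret X: ldarts K fw fb t p using Lx(1) by (simp add: ldarts_def)
  interpret Y: ldarts K fw' fb' t' p using Ly(1) by (simp add: ldarts_def)
  show ?thesis
  proof
    assume "\<exists>\<pi>. \<pi> permutes {0..<2 * K} \<and> psi K y = pconj \<pi> (psi K x)"
    then obtain \<pi> where \<pi>: "\<pi> permutes {0..<2 * K}" and e: "dsig K fw' fb' = conjp \<pi> (dsig K fw fb)" "dalp K = conjp \<pi> (dalp K)"
      "dwh K = dwh K \<circ> inv \<pi>" "r' = \<pi> r" "dpt K fw' t' = \<pi> ` dpt K fw t"
      by (auto simp: psi_def pconj_def rconj_def xe ye)
    have b: "bij \<pi>" by (rule permutes_bij[OF \<pi>])
    have lt: "\<pi> d < K \<longleftrightarrow> d < K" for d
      using fun_cong[OF e(3), of "\<pi> d"] b by (simp add: dwh_def bij_is_inj)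
    \<comment> \<open>The relabelling of edges is read off from the white darts; on the black ones
      \<pi> acts in parallel, because it commutes with the edge involution.\<close>
    define g where "g = (\<lambda>d. if d < K then \<pi> d else d)"
    have g1: "d < K \<Longrightarrow> g d = \<pi> d" for d by (simp add: g_def)
    have gp: "g permutes {0..<K}"
    proof (rule bij_imp_permutes)
      have i: "inj_on g {0..<K}" using injD[OF bij_is_inj[OF b]] by (auto simp: inj_on_def g_def)
      have "g ` {0..<K} = {0..<K}" 
      proof (rule endo_inj_surj[OF finite_atLeastLessThan _ i])
        show "g ` {0..<K} \<subseteq> {0..<K}"
        proof (rule image_subsetI)
          fix d assume "d \<in> {0..<K}"
          then have "d < K" by simp
          then show "g d \<in> {0..<K}" using lt[of d] by (simp add: g_def)
        qed
      qed
      then show "bij_betw g {0..<K} {0..<K}" using i by (simp add: bij_betw_def)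
    qed (simp add: g_def)
    have gb: "bij g" by (rule permutes_bij[OF gp])
    have gE: "g ` {0..<K} = {0..<K}" by (rule permutes_image[OF gp])
    have pK: "\<pi> (d + K) = \<pi> d + K" if "d < K" for d
    proof -
      have "dalp K (\<pi> d) = \<pi> (dalp K d)" by (subst e(2)) (rule conj_app[OF b])
      moreover have "\<pi> d < K" using lt that by simp
      ultimately show ?thesis using that by (simp add: dalp_def)
    qed
    have fwg: "fw' (g d) = g (fw d)" if d: "d < K" for d
    proof -
      have "dsig K fw' fb' (\<pi> (d + K)) = \<pi> (dsig K fw fb (d + K))" using e(1) conj_app[OF b] by simp
      then show ?thesis using X.N.\<sigma>_simps(2)[OF d] Y.N.\<sigma>_simps(2)[of "\<pi> d"] lt[of d] d pK[OF d] X.N.K_simps(1)[OF d] by (simp add: g1)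
    qed
    have fbg0: "inv fb' (g d) = g (inv fb d)" if d: "d < K" for d
    proof -
      have "dsig K fw' fb' (\<pi> d) = \<pi> (dsig K fw fb d)" using e(1) conj_app[OF b] by simp
      then show ?thesis using X.N.\<sigma>_simps(1)[OF d] Y.N.\<sigma>_simps(1)[of "\<pi> d"] lt[of d] d pK[OF X.N.K_simps(2)[OF d]] X.N.K_simps(2)[OF d] by (simp add: g1)
    qed
    have fbg: "fb' (g d) = g (fb d)" if d: "d < K" for d
      using fbg0[OF X.N.K_simps(3)[OF d]] Y.inv_inv(1)[of "g (fb d)"] by simp
    have ext: "f' = conjp g f" if "f permutes {0..<K}" "f' permutes {0..<K}" "\<And>d. d < K \<Longrightarrow> f' (g d) = g (f d)" for f f'
    proof
      fix e
      obtain d where d: "e = g d" using gb by (metis bij_pointE)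
      show "f' e = conjp g f e"
      proof (cases "d < K")
        case True then show ?thesis using that d by (simp add: conj_app[OF gb])
      next
        case False
        then have "g d = d" "f d = d" "f' d = d"
          using permutes_not_in[OF gp, of d] permutes_not_in[OF that(1), of d] permutes_not_in[OF that(2), of d] by auto
        then show ?thesis using d conj_app[OF gb, of f d] by simp
      qed
    qed
    have f: "fw' = conjp g fw" "fb' = conjp g fb" using ext X.fw X.fb Y.fw Y.fb fwg fbg by auto
    have L2: "lconst {0..<K} fw' fb' (t \<circ> inv g) p" using lconst_conj[OF Lx(1) gb] unfolding gE f .
    have "t' = t \<circ> inv g"
    proof (rule lconst_unique[OF Ly(1) L2])
      fix u assume "u \<in> {0..<K}"
      then obtain d where d: "u = g d" "d < K" using gE by (metis atLeastLessThan_iff imageE)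
      have gK: "g d < K" using d g1 lt by simp
      have "t' (fw' u) = 0 \<longleftrightarrow> g d + K \<in> dpt K fw' t'"
        using d gK Y.dlab_simps(2)[of "g d"] by (simp add: dpt_def)
      also have "\<dots> \<longleftrightarrow> \<pi> (d + K) \<in> \<pi> ` dpt K fw t" using e(5) pK[OF d(2)] g1[OF d(2)] by simp
      also have "\<dots> \<longleftrightarrow> d + K \<in> dpt K fw t" using b by (auto simp: bij_is_inj inj_image_mem_iff)
      also have "\<dots> \<longleftrightarrow> t (fw d) = 0" using d X.dlab_simps(2)[of d] by (simp add: dpt_def)
      also have "t (fw d) = (t \<circ> inv g) (fw' u)" using fwg[OF d(2)] d gb by (simp add: bij_is_inj)
      finally show "t' (fw' u) = 0 \<longleftrightarrow> (t \<circ> inv g) (fw' u) = 0" .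
    qed
    then have "y = act g x" using f e(4) g1[OF Lx(2)] by (simp add: xe ye act_def)
    then show "\<exists>g. g permutes {0..<K} \<and> y = act g x" using gp by blast
  next
    assume "\<exists>g. g permutes {0..<K} \<and> y = act g x"
    then obtain g where g: "g permutes {0..<K}" and f: "fw' = conjp g fw" "fb' = conjp g fb" "t' = t \<circ> inv g" "r' = g r"
      by (auto simp: act_def xe ye)
    have gb: "bij g" by (rule permutes_bij[OF g])
    have gK: "g d < K \<longleftrightarrow> d < K" for d using permutes_in_image[OF g, of d] by simp
    define \<pi> where "\<pi> = (\<lambda>d. if d < K then g d else if d < 2 * K then g (d - K) + K else d)"
    have p1: "d < K \<Longrightarrow> \<pi> d = g d" and p2: "d < K \<Longrightarrow> \<pi> (d + K) = g d + K" for d by (auto simp: \<pi>_def)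
    have pl: "\<pi> d < 2 * K" if "d < 2 * K" for d
    proof (cases "d < K")
      case True then show ?thesis using gK[of d] by (simp add: \<pi>_def)
    next
      case False then show ?thesis using gK[of "d - K"] that by (simp add: \<pi>_def)
    qed
    have inj: "inj_on \<pi> {0..<2 * K}"
    proof (rule inj_onI)
      fix d e assume de: "d \<in> {0..<2 * K}" "e \<in> {0..<2 * K}" "\<pi> d = \<pi> e"
      have gi: "g a = g c \<Longrightarrow> a = c" for a c using bij_is_inj[OF gb] by (auto dest: injD)
      show "d = e"
      proof (cases "d < K")
        case d: True
        show ?thesis
        proof (cases "e < K")
          case True then show ?thesis using de(3) p1 gi d by simp
        next
          case False
          then have "\<pi> e = g (e - K) + K" using de(2) by (simp add: \<pi>_def)
          then show ?thesis using de(3) p1[OF d] gK[of d] d by simp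
        qed
      next
        case d: False
        then have \<pi>d: "\<pi> d = g (d - K) + K" using de(1) by (simp add: \<pi>_def)
        show ?thesis
        proof (cases "e < K")
          case True then show ?thesis using de(3) p1[OF True] gK[of e] \<pi>d by simp
        next
          case False
          then have "\<pi> e = g (e - K) + K" using de(2) by (simp add: \<pi>_def)
          then have "d - K = e - K" using de(3) \<pi>d gi by simp
          then show ?thesis using d False by simp
        qed
      qed
    qed
    have \<pi>: "\<pi> permutes {0..<2 * K}"
    proof (rule bij_imp_permutes)
      have "\<pi> ` {0..<2 * K} = {0..<2 * K}" 
      proof (rule endo_inj_surj[OF finite_atLeastLessThan _ inj])
        show "\<pi> ` {0..<2 * K} \<subseteq> {0..<2 * K}" by (rule image_subsetI) (simp add: pl)
      qed
      then show "bij_betw \<pi> {0..<2 * K} {0..<2 * K}" using inj by (simp add: bij_betw_def)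
    qed (simp add: \<pi>_def)
    have b: "bij \<pi>" by (rule permutes_bij[OF \<pi>])
    have gi: "inv g (g d) = d" for d using gb by (simp add: bij_is_inj)
    have fwg: "fw' (g d) = g (fw d)" for d unfolding f by (rule conj_app[OF gb])
    have fbg: "inv fb' (g d) = g (inv fb d)" for d
    proof -
      have "fb' (g (inv fb d)) = g d" unfolding f using conj_app[OF gb, of fb "inv fb d"] by simp
      then show ?thesis using Y.inv_inv(2) by metis
    qed
    have lab: "dlab K fw' t' (\<pi> d) = dlab K fw t d" if "d < 2 * K" for d
    proof (rule X.N.dart_cases[of d])
      show "d < K \<Longrightarrow> ?thesis" using gK[of d] by (simp add: p1 dlab_def f gi)
      show "d = u + K \<Longrightarrow> u < K \<Longrightarrow> ?thesis" for u using fwg[of u] gi[of "fw u"] by (simp add: p2 dlab_def f)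
    qed (use that in simp)
    have "\<pi> (dsig K fw fb d) = dsig K fw' fb' (\<pi> d) \<and> \<pi> (dalp K d) = dalp K (\<pi> d) \<and> dwh K (\<pi> d) = dwh K d" if "d < 2 * K" for d
    proof (rule X.N.dart_cases[of d])
      assume d: "d < K"
      have "\<pi> (dsig K fw fb d) = g (inv fb d) + K" using X.N.\<sigma>_simps(1)[OF d] p2[OF X.N.K_simps(2)[OF d]] by simp
      moreover have "dsig K fw' fb' (\<pi> d) = inv fb' (g d) + K" using p1[OF d] Y.N.\<sigma>_simps(1)[of "g d"] gK[of d] d by simp
      ultimately show ?thesis using fbg[of d] p1[OF d] p2[OF d] d gK[of d] by (simp add: dalp_def dwh_def)
    next
      fix u assume u: "d = u + K" "u < K"
      have "\<pi> (dsig K fw fb d) = g (fw u)" using X.N.\<sigma>_simps(2)[OF u(2)] p1[OF X.N.K_simps(1)[OF u(2)]] u by simp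
      moreover have "dsig K fw' fb' (\<pi> d) = fw' (g u)" using p2[OF u(2)] Y.N.\<sigma>_simps(2)[of "g u"] gK[of u] u by simp
      ultimately show ?thesis using fwg[of u] p1[OF u(2)] p2[OF u(2)] u gK[of u] by (simp add: dalp_def dwh_def)
    qed (use that in simp)
    then have c: "dsig K fw' fb' = conjp \<pi> (dsig K fw fb) \<and> dalp K = conjp \<pi> (dalp K) \<and> dwh K = dwh K \<circ> inv \<pi>"
      using iso_conj[OF \<pi> X.is_const Y.is_const] by blast
    have "dpt K fw' t' = \<pi> ` dpt K fw t"
    proof (intro equalityI subsetI)
      fix u assume u: "u \<in> dpt K fw' t'"
      then have "u \<in> \<pi> ` {0..<2 * K}" using permutes_image[OF \<pi>] by (auto simp: dpt_def)
      then obtain d where "d < 2 * K" "u = \<pi> d" by auto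
      then show "u \<in> \<pi> ` dpt K fw t" using u lab[of d] by (auto simp: dpt_def)
    next
      fix u assume "u \<in> \<pi> ` dpt K fw t"
      then show "u \<in> dpt K fw' t'" using lab pl by (auto simp: dpt_def)
    qed
    moreover have "r' = \<pi> r" using f p1 Lx by simp
    ultimately have "psi K y = pconj \<pi> (psi K x)" using c by (simp add: psi_def pconj_def rconj_def xe ye)
    then show "\<exists>\<pi>. \<pi> permutes {0..<2 * K} \<and> psi K y = pconj \<pi> (psi K x)" using \<pi> by blast
  qed
qed

lemma act_inj_on: assumes "x \<in> lmaps p {0..<K}" shows "inj_on (\<lambda>g. act g x) {g. g permutes {0..<K}}"
proof (rule inj_onI)
  fix g h assume gh: "g \<in> {g. g permutes {0..<K}}" "h \<in> {g. g permutes {0..<K}}" "act g x = act h x"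
  obtain fw fb t r where x: "x = (fw, fb, t, r)" by (cases x)
  show "g = h" by (rule act_inj[of "{0..<K}" fw fb t p r]) (use assms gh x in \<open>auto simp: lmaps_def\<close>)
qed

section \<open>Labelled maps and isomorphism classes\<close>

abbreviation "wx p \<equiv> \<lambda>k. xmon (k div p)"

lemma V_class_sum:
  assumes p: "2 \<le> p"
  shows "(\<Sum>x\<in>vmaps p {0..<K} i. wV (wx p) {0..<K} x) =
    of_nat (fact K) * (\<Sum>c\<in>V_classes p i (2 * K). the_elem (V_weight p (2 * K) ` c))"
proof -
  let ?S = "V_structs p i (2 * K)"
  let ?R = "{(s, s'). pmap_iso (2 * K) s s'} \<inter> ?S \<times> ?S"
  have SP: "s \<in> pointed_constellations p (2 * K)" if "s \<in> ?S" for s using that by (auto simp: V_structs_def)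
  have XL: "x \<in> lmaps p {0..<K}" if "x \<in> vmaps p {0..<K} i" for x using that by (auto simp: vmaps_def lmaps_def)
  have iso: "pmap_iso (2 * K) s s' \<longleftrightarrow> (\<exists>\<pi>. \<pi> permutes {0..<2 * K} \<and> s' = pconj \<pi> s)" if "s \<in> ?S" "s' \<in> ?S" for s s'
    by (rule pmap_iso_conj[OF SP[OF that(1)] SP[OF that(2)]])
  have eq: "equiv ?S ?R" by (rule equiv_action[OF iso pconj_id pconj_comp])
  have w: "V_weight p (2 * K) (psi K x) = wV (wx p) {0..<K} x" if "x \<in> vmaps p {0..<K} i" for x
  proof -
    obtain fw fb t r where x: "x = (fw, fb, t, r)" by (cases x)
    interpret ldarts K fw fb t p using XL[OF that] by (simp add: lmaps_def x ldarts_def)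
    show ?thesis by (simp add: x psi_def V_weight_def wV_def wtV_def N.white_faces_eq)
  qed
  have "(\<Sum>x\<in>vmaps p {0..<K} i. V_weight p (2 * K) (psi K x)) =
    of_nat (fact K) * (\<Sum>c\<in>?S // ?R. the_elem (V_weight p (2 * K) ` c))"
  proof (rule class_sum[OF eq, where a=act])
    show "finite (vmaps p {0..<K} i)" by (simp add: maps_finite)
    show in_S: "psi K x \<in> ?S" if "x \<in> vmaps p {0..<K} i" for x using psi_V[OF XL[OF that]] that by simp
    show "\<exists>x\<in>vmaps p {0..<K} i. (s, psi K x) \<in> ?R" if s: "s \<in> ?S" for s
    proof -
      obtain \<pi> x K' where x: "2 * K = 2 * K'" "\<pi> permutes {0..<2 * K}" "x \<in> lmaps p {0..<K'}" "psi K' x = pconj \<pi> s"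
        by (rule psi_surj[OF SP[OF s] p])
      have KK: "K' = K" using x by simp
      note x = x(2-4)[unfolded KK]
      have S: "psi K x \<in> ?S" unfolding x(3) by (rule V_structs_conj[OF s x(1)])
      then have "x \<in> vmaps p {0..<K} i" using psi_V[of x p K i] x(2) by simp
      moreover have "pmap_iso (2 * K) s (psi K x)" unfolding iso[OF s S] using x(1,3) by blast
      then have "(s, psi K x) \<in> ?R" using s S by simp
      ultimately show ?thesis by blast
    qed
    show "(psi K x, psi K y) \<in> ?R \<longleftrightarrow> (\<exists>g. g permutes {0..<K} \<and> y = act g x)"
      if "x \<in> vmaps p {0..<K} i" "y \<in> vmaps p {0..<K} i" for x y
    proof -
      have "(psi K x, psi K y) \<in> ?R \<longleftrightarrow> pmap_iso (2 * K) (psi K x) (psi K y)"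
        using in_S[OF that(1)] in_S[OF that(2)] by simp
      then show ?thesis unfolding iso[OF in_S[OF that(1)] in_S[OF that(2)]] psi_iso[OF XL[OF that(1)] XL[OF that(2)]] .
    qed
    show "act g x \<in> vmaps p {0..<K} i" if "x \<in> vmaps p {0..<K} i" "g permutes {0..<K}" for x g
      using act_vmaps[OF permutes_bij[OF that(2)] that(1)] permutes_image[OF that(2)] by simp
    show "inj_on (\<lambda>g. act g x) {g. g permutes {0..<K}}" if "x \<in> vmaps p {0..<K} i" for x by (rule act_inj_on[OF XL[OF that]])
    show "V_weight p (2 * K) s = V_weight p (2 * K) s'" if ss: "(s, s') \<in> ?R" for s s'
    proof -
      obtain \<pi> where "\<pi> permutes {0..<2 * K}" "s' = pconj \<pi> s" using ss iso[of s s'] by auto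
      then show ?thesis using weights_conj(1) by simp
    qed
  qed
  then show ?thesis unfolding V_classes_def using w by (simp cong: sum.cong)
qed

lemma rooted_pointed: 
  assumes "(\<sigma>, \<alpha>, w, r) \<in> rooted_constellations p n N"
  shows "((\<sigma>, \<alpha>, w, r), orb \<sigma> r) \<in> pointed_constellations p N"
  using assms by (auto simp: rooted_constellations_def pointed_constellations_def)

text \<open>A rooted constellation is treated as one pointed at the origin of its root edge. This
  vertex is determined by the rooted map, so rooted and pointed isomorphisms correspond, which is
  the content of \<open>rp\<close>.\<close>

lemma F_class_sum:
  assumes p: "2 \<le> p"
  shows "(\<Sum>x\<in>fmaps p n {0..<K}. wF (wx p) {0..<K} x) =
    of_nat (fact K) * (\<Sum>c\<in>F_classes p n (2 * K). the_elem (F_weight p (2 * K) ` c))"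
proof -
  let ?S = "rooted_constellations p n (2 * K)"
  let ?R = "{(s, s'). rmap_iso (2 * K) s s'} \<inter> ?S \<times> ?S"
  let ?\<Psi> = "\<lambda>x. fst (psi K x)"
  have XL: "x \<in> lmaps p {0..<K}" if "x \<in> fmaps p n {0..<K}" for x using that by (auto simp: fmaps_def lmaps_def)
  have iso: "rmap_iso (2 * K) s s' \<longleftrightarrow> (\<exists>\<pi>. \<pi> permutes {0..<2 * K} \<and> s' = rconj \<pi> s)" if "s \<in> ?S" "s' \<in> ?S" for s s'
    by (rule rmap_iso_conj[OF that])
  have eq: "equiv ?S ?R" by (rule equiv_action[OF iso rconj_id rconj_comp])
  have props: "F_weight p (2 * K) (?\<Psi> x) = wF (wx p) {0..<K} x" "?\<Psi> x \<in> ?S"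
     "psi K x = (?\<Psi> x, orb (fst (?\<Psi> x)) (snd (snd (snd (?\<Psi> x)))))" if "x \<in> fmaps p n {0..<K}" for x
  proof -
    obtain fw fb t r where x: "x = (fw, fb, t, r)" by (cases x)
    interpret ldarts K fw fb t p using XL[OF that] by (simp add: lmaps_def x ldarts_def)
    have r: "r < K" "t r = 0" "card (reach {fw} r) = n * p" using that by (auto simp: fmaps_def x)
    show "F_weight p (2 * K) (?\<Psi> x) = wF (wx p) {0..<K} x"
      by (simp add: x psi_def F_weight_def wF_def wtF_def N.white_faces_eq N.face_white[OF r(1), unfolded o_def] N.face_white[OF r(1)])
    show "?\<Psi> x \<in> ?S" using is_const r N.face_white[OF r(1)] by (simp add: x psi_def rooted_constellations_def dwh_def)
    show "psi K x = (?\<Psi> x, orb (fst (?\<Psi> x)) (snd (snd (snd (?\<Psi> x)))))"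
      using dpt_orb[of r] r dlab_simps(1)[OF r(1)] by (simp add: x psi_def)
  qed
  have rp: "rconj \<pi> (?\<Psi> x) = ?\<Psi> y \<longleftrightarrow> pconj \<pi> (psi K x) = psi K y"
    if xy: "x \<in> fmaps p n {0..<K}" "y \<in> fmaps p n {0..<K}" and \<pi>: "\<pi> permutes {0..<2 * K}" for x y \<pi>
  proof
    assume e: "rconj \<pi> (?\<Psi> x) = ?\<Psi> y"
    obtain \<sigma> \<alpha> w r where s: "?\<Psi> x = (\<sigma>, \<alpha>, w, r)" by (metis prod_cases4)
    have 1: "psi K x = (?\<Psi> x, orb \<sigma> r)" using props(3)[OF xy(1)] unfolding s by simp
    have y: "?\<Psi> y = (conjp \<pi> \<sigma>, conjp \<pi> \<alpha>, w \<circ> inv \<pi>, \<pi> r)" using e unfolding s by (simp add: rconj_def)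
    have 2: "psi K y = (?\<Psi> y, orb (conjp \<pi> \<sigma>) (\<pi> r))" using props(3)[OF xy(2)] unfolding y by simp
    have "pconj \<pi> (psi K x) = pconj \<pi> (?\<Psi> x, orb \<sigma> r)" by (rule arg_cong[OF 1])
    also have "\<dots> = (?\<Psi> y, orb (conjp \<pi> \<sigma>) (\<pi> r))" using e orb_conj[OF permutes_bij[OF \<pi>]] by (simp add: pconj_def)
    finally show "pconj \<pi> (psi K x) = psi K y" unfolding 2[symmetric] .
  next
    assume "pconj \<pi> (psi K x) = psi K y"
    then show "rconj \<pi> (?\<Psi> x) = ?\<Psi> y" by (cases "psi K x"; cases "psi K y") (simp add: pconj_def)
  qed
  have "(\<Sum>x\<in>fmaps p n {0..<K}. F_weight p (2 * K) (?\<Psi> x)) =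
    of_nat (fact K) * (\<Sum>c\<in>?S // ?R. the_elem (F_weight p (2 * K) ` c))"
  proof (rule class_sum[OF eq, where a=act])
    show "finite (fmaps p n {0..<K})" by (rule finite_subset[OF _ finite_lmaps[of "{0..<K}" p]]) (use XL in auto)
    show in_S: "?\<Psi> x \<in> ?S" if "x \<in> fmaps p n {0..<K}" for x using props(2)[OF that] .
    show "\<exists>x\<in>fmaps p n {0..<K}. (s, ?\<Psi> x) \<in> ?R" if s: "s \<in> ?S" for s
    proof -
      obtain \<sigma> \<alpha> w r where se: "s = (\<sigma>, \<alpha>, w, r)" by (metis prod_cases4)
      obtain \<pi> x K' where x: "2 * K = 2 * K'" "\<pi> permutes {0..<2 * K}" "x \<in> lmaps p {0..<K'}" "psi K' x = pconj \<pi> (s, orb \<sigma> r)"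
        using psi_surj[OF rooted_pointed p, of \<sigma> \<alpha> w r n "2 * K"] s se by metis
      have KK: "K' = K" using x by simp
      note x = x(2-4)[unfolded KK]
      have b: "bij \<pi>" by (rule permutes_bij[OF x(1)])
      obtain fw fb t r' where xe: "x = (fw, fb, t, r')" by (cases x)
      interpret ldarts K fw fb t p using x(2) by (simp add: lmaps_def xe ldarts_def)
      have e: "dsig K fw fb = conjp \<pi> \<sigma>" "dalp K = conjp \<pi> \<alpha>" "dwh K = w \<circ> inv \<pi>" "r' = \<pi> r" "dpt K fw t = \<pi> ` orb \<sigma> r"
        using x(3) by (auto simp: psi_def xe pconj_def rconj_def se)
      have r': "r' < K" using x(2) by (simp add: lmaps_def xe)
      have "r' \<in> dpt K fw t" using e by (simp add: orb_eq_reach)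
      then have t0: "t r' = 0" using r' by (simp add: dpt_def dlab_def)
      have "card (orb (\<sigma> \<circ> \<alpha>) r) = n * p" using s se by (simp add: rooted_constellations_def)
      moreover have "reach {fw} r' = \<pi> ` orb (\<sigma> \<circ> \<alpha>) r"
        using N.face_white[OF r'] e conj_o[OF b, of \<sigma> \<alpha>] orb_conj[OF b, of "\<sigma> \<circ> \<alpha>" r] by metis
      ultimately have "card (reach {fw} r') = n * p" by (simp add: card_image inj_on_subset[OF bij_is_inj[OF b]])
      then have xf: "x \<in> fmaps p n {0..<K}" using r' t0 lconst_axioms by (simp add: fmaps_def xe)
      have "?\<Psi> x = rconj \<pi> s" using x(3) by (simp add: pconj_def)
      then have "rmap_iso (2 * K) s (?\<Psi> x)" unfolding iso[OF s in_S[OF xf]] using x(1) by blast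
      then have "(s, ?\<Psi> x) \<in> ?R" using s in_S[OF xf] by simp
      then show ?thesis using xf by blast
    qed
    show "(?\<Psi> x, ?\<Psi> y) \<in> ?R \<longleftrightarrow> (\<exists>g. g permutes {0..<K} \<and> y = act g x)"
      if xy: "x \<in> fmaps p n {0..<K}" "y \<in> fmaps p n {0..<K}" for x y
    proof -
      have "(?\<Psi> x, ?\<Psi> y) \<in> ?R \<longleftrightarrow> (\<exists>\<pi>. \<pi> permutes {0..<2 * K} \<and> ?\<Psi> y = rconj \<pi> (?\<Psi> x))"
        unfolding iso[OF in_S[OF xy(1)] in_S[OF xy(2)], symmetric] using in_S[OF xy(1)] in_S[OF xy(2)] by simp
      also have "\<dots> \<longleftrightarrow> (\<exists>\<pi>. \<pi> permutes {0..<2 * K} \<and> psi K y = pconj \<pi> (psi K x))"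
        using rp[OF xy] by metis
      finally show ?thesis unfolding psi_iso[OF XL[OF xy(1)] XL[OF xy(2)]] .
    qed
    show "act g x \<in> fmaps p n {0..<K}" if "x \<in> fmaps p n {0..<K}" "g permutes {0..<K}" for x g
      using act_fmaps[OF permutes_bij[OF that(2)] that(1)] permutes_image[OF that(2)] by simp
    show "inj_on (\<lambda>g. act g x) {g. g permutes {0..<K}}" if "x \<in> fmaps p n {0..<K}" for x by (rule act_inj_on[OF XL[OF that]])
    show "F_weight p (2 * K) s = F_weight p (2 * K) s'" if ss: "(s, s') \<in> ?R" for s s'
    proof -
      obtain \<pi> where "\<pi> permutes {0..<2 * K}" "s' = rconj \<pi> s" using ss iso[of s s'] by auto
      then show ?thesis using weights_conj(2) by simp
    qed
  qed
  then show ?thesis unfolding F_classes_def using props(1) by (simp cong: sum.cong)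
qed

text \<open>The black faces partition the edges into sets of size \<open>p\<close>.\<close>

lemma vmaps_dvd: assumes "x \<in> vmaps p E i" shows "p dvd card E"
proof -
  obtain fw fb t r where x: "x = (fw, fb, t, r)" by (cases x)
  interpret lconst E fw fb t p using assms by (simp add: vmaps_def x)
  have "real (cyc fb E) = (\<Sum>x\<in>E. 1 / real p)"
    unfolding cyc_sum[OF fin permutes_imp_bij[OF fb]] using econst by (intro sum.cong) (auto simp: econst_def)
  then have "real (card E) = real (p * cyc fb E)" using p2 by (simp add: field_simps)
  then show ?thesis by (metis dvd_triv_left of_nat_eq_iff)
qed

lemma gen_V:
  assumes p: "2 \<le> p"
  shows "gen p (\<lambda>E. \<Sum>x\<in>vmaps p E i. wV (wx p) E x) (V_gf p i - 1)"
  unfolding gen_def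
proof (intro allI impI)
  fix E :: "nat set" assume E: "finite E"
  let ?K = "card E"
  show "(\<Sum>x\<in>vmaps p E i. wV (wx p) E x) = of_nat (fact ?K) * cf p (V_gf p i - 1) ?K"
  proof (cases "p dvd ?K")
    case True
    then obtain d where d: "?K = p * d" by blast
    have "(\<Sum>x\<in>vmaps p E i. wV (wx p) E x) = (\<Sum>x\<in>vmaps p {0..<?K} i. wV (wx p) {0..<?K} x)"
      by (rule vmaps_transport) (use E in auto)
    moreover have "cf p (V_gf p i - 1) ?K = (\<Sum>c\<in>V_classes p i (2 * ?K). the_elem (V_weight p (2 * ?K) ` c))"
      using p d by (simp add: cf_def V_gf_def mult.assoc)
    ultimately show ?thesis using V_class_sum[OF p] by simp
  next
    case False
    then have "vmaps p E i = {}" using vmaps_dvd by blast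
    then show ?thesis using False by (simp add: cf_def)
  qed
qed

theorem theorem1:
  fixes p :: nat
  assumes "p \<ge> 2"
  shows "Abs_fps (\<lambda>n. F_gf p n) = cfG p (\<lambda>i. V_gf p i)"
proof (rule fps_ext)
  fix n
  let ?S = "\<Sum>w\<in>words p 0 (n * p). wwt (\<lambda>i. V_gf p i) p 0 w"
  have "F_gf p n = ?S"
  proof (cases "n = 0")
    case True
    have "words p 0 0 = {[]}" by (auto simp: words_def)
    then show ?thesis using True by (simp add: F_gf_def)
  next
    case False
    show ?thesis
    proof (rule fps_ext)
      fix d
      \<comment> \<open>Each edge borders one white face, so this is the number of edges when the
        root degree is \<open>n * p\<close> and the other white faces have weighted degree
        \<open>d\<close>; there are twice as many darts.\<close>
      let ?K = "p * (n + d)"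
      have "of_nat (fact ?K) * (\<Sum>c\<in>F_classes p n (2 * ?K). the_elem (F_weight p (2 * ?K) ` c)) = of_nat (fact ?K) * cf p (fps_X ^ n * ?S) ?K"
        using gen_fmaps[OF assms gen_V[OF assms], of n] False F_class_sum[OF assms, where n=n and K="?K"] by (simp add: gen_def)
      \<comment> \<open>Both sides count labelled maps; the coefficient ring has characteristic zero
        and no zero divisors, so the number of labellings cancels.\<close>
      moreover have "of_nat (fact ?K) \<noteq> (0 :: xpoly)" by simp
      ultimately have "(\<Sum>c\<in>F_classes p n (2 * ?K). the_elem (F_weight p (2 * ?K) ` c)) = cf p (fps_X ^ n * ?S) ?K"
        by (simp only: mult_cancel_left) blast
      also have "\<dots> = fps_nth ?S d" using assms by (simp add: cf_def fps_X_power_mult_nth)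
      finally show "fps_nth (F_gf p n) d = fps_nth ?S d" using False by (simp add: F_gf_def mult.assoc)
    qed
  qed
  then show "fps_nth (Abs_fps (\<lambda>n. F_gf p n)) n = fps_nth (cfG p (\<lambda>i. V_gf p i)) n"
    by (simp add: cfG_words[OF assms])
qed

end
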